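(* Let $k$ be an algebraically closed field, $R=k[x_0,x_1,x_2]$, $r\geq2$, $\lambda=[d_1,\dots,d_r]$ with $d_1\geq\cdots\geq d_r\geq1$, $d=\sum d_i$, $N=\binom{d+2}{2}-1$. Let $s=d_2+\cdots+d_r$ and $p=\sum_{2\leq i<j\leq r}d_id_j$ (so $p=0$ if $r=2$). Then the secant line variety $\sigma_2(\mathbb{X}_{2,\lambda})$ is defective if and only if $d_1\geq s$ and $2p-3s>0$.
   Context: $\mathbb{X}_{2,\lambda}\subset\mathbb{P}^N=\mathbb{P}(R_d)$ is the variety of classes $[F]$ of forms $F=F_1\cdots F_r$ with $F_i\in R_{d_i}$. $\sigma_2(\mathbb{X})$ is the Zariski closure of the union of lines joining two distinct points of $\mathbb{X}$; its expected dimension is $\min\{N,2\dim\mathbb{X}+1\}$, and it is defective if its actual dimension is smaller than the expected dimension. *)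

theory Defs
  imports "HOL-Computational_Algebra.Polynomial" "HOL-Library.Poly_Mapping" "HOL-Library.Extended_Nat"
begin

text \<open>A monomial x0^a x1^b x2^c is encoded by its exponent triple (a,b,c).
  An element of R is encoded by its coefficient function; a form of degree e
  is a coefficient function supported on monomials of total degree e.\<close>

type_synonym mon = "nat \<times> nat \<times> nat"

definition mdeg :: "mon \<Rightarrow> nat" where
  "mdeg m = (case m of (a, b, c) \<Rightarrow> a + b + c)"

definition is_form :: "nat \<Rightarrow> (mon \<Rightarrow> 'k::field) \<Rightarrow> bool" where
  "is_form e F \<longleftrightarrow> (\<forall>m. mdeg m \<noteq> e \<longrightarrow> F m = 0)"

definition fmul :: "(mon \<Rightarrow> 'k::field) \<Rightarrow> (mon \<Rightarrow> 'k) \<Rightarrow> (mon \<Rightarrow> 'k)" where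
  "fmul F G = (\<lambda>(a, b, c). \<Sum>(i, j, l) \<in> {0..a} \<times> {0..b} \<times> {0..c}.
                   F (i, j, l) * G (a - i, b - j, c - l))"

definition fone :: "mon \<Rightarrow> 'k::field" where
  "fone = (\<lambda>m. if m = (0, 0, 0) then 1 else 0)"

definition fprod :: "(mon \<Rightarrow> 'k::field) list \<Rightarrow> (mon \<Rightarrow> 'k)" where
  "fprod Fs = foldr fmul Fs fone"

text \<open>A point of P(R_d) is represented by a nonzero form F of degree d
  (any nonzero scalar multiple represents the same point); subsets of P(R_d)
  are represented by scaling-invariant sets of nonzero degree-d forms.
  Polynomial functions on R_d are polynomials in the coordinates F m
  (m a monomial), encoded with Poly_Mapping.\<close>

type_synonym 'k coordpoly = "(mon \<Rightarrow>\<^sub>0 nat) \<Rightarrow>\<^sub>0 'k"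

definition peval :: "'k::field coordpoly \<Rightarrow> (mon \<Rightarrow> 'k) \<Rightarrow> 'k" where
  "peval P F = (\<Sum>\<alpha>\<in>Poly_Mapping.keys P. Poly_Mapping.lookup P \<alpha> *
      (\<Prod>m\<in>Poly_Mapping.keys (\<alpha> :: mon \<Rightarrow>\<^sub>0 nat). F m ^ Poly_Mapping.lookup \<alpha> m))"

definition homogeneous_cp :: "'k::field coordpoly \<Rightarrow> bool" where
  "homogeneous_cp P \<longleftrightarrow> (\<exists>t. \<forall>\<alpha>\<in>Poly_Mapping.keys P. (\<Sum>m\<in>Poly_Mapping.keys (\<alpha> :: mon \<Rightarrow>\<^sub>0 nat). Poly_Mapping.lookup \<alpha> m) = t)"

definition zclosed :: "nat \<Rightarrow> (mon \<Rightarrow> 'k::field) set \<Rightarrow> bool" where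
  "zclosed d Z \<longleftrightarrow> (\<exists>S :: 'k coordpoly set. (\<forall>P\<in>S. homogeneous_cp P) \<and>
      Z = {F. is_form d F \<and> F \<noteq> (\<lambda>_. 0) \<and> (\<forall>P\<in>S. peval P F = 0)})"

definition zclosure :: "nat \<Rightarrow> (mon \<Rightarrow> 'k::field) set \<Rightarrow> (mon \<Rightarrow> 'k) set" where
  "zclosure d A = \<Inter>{Z. zclosed d Z \<and> A \<subseteq> Z}"

definition zirreducible :: "nat \<Rightarrow> (mon \<Rightarrow> 'k::field) set \<Rightarrow> bool" where
  "zirreducible d Z \<longleftrightarrow> zclosed d Z \<and> Z \<noteq> {} \<and>
     (\<forall>Z1 Z2. zclosed d Z1 \<longrightarrow> zclosed d Z2 \<longrightarrow> Z \<subseteq> Z1 \<union> Z2 \<longrightarrow> Z \<subseteq> Z1 \<or> Z \<subseteq> Z2)"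

definition pdim :: "nat \<Rightarrow> (mon \<Rightarrow> 'k::field) set \<Rightarrow> enat" where
  "pdim d A = (SUP n \<in> {n. \<exists>Z :: nat \<Rightarrow> (mon \<Rightarrow> 'k) set.
                   (\<forall>i\<le>n. zirreducible d (Z i) \<and> Z i \<subseteq> zclosure d A) \<and>
                   (\<forall>i<n. Z i \<subset> Z (Suc i))}. enat n)"

definition Xlam :: "'k itself \<Rightarrow> nat list \<Rightarrow> (mon \<Rightarrow> 'k::field) set" where
  "Xlam _ ds = {G. \<exists>Fs. length Fs = length ds \<and>
        (\<forall>i<length ds. is_form (ds ! i) (Fs ! i) \<and> Fs ! i \<noteq> (\<lambda>_. 0)) \<and> G = fprod Fs}"

definition secant_lines :: "nat \<Rightarrow> (mon \<Rightarrow> 'k::field) set \<Rightarrow> (mon \<Rightarrow> 'k) set" where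
  "secant_lines d X = {H. \<exists>F G a b. F \<in> X \<and> G \<in> X \<and> \<not> (\<exists>c. G = (\<lambda>m. c * F m)) \<and>
        (a, b) \<noteq> (0, 0) \<and> H = (\<lambda>m. a * F m + b * G m)}"
  
definition sigma2 :: "nat \<Rightarrow> (mon \<Rightarrow> 'k::field) set \<Rightarrow> (mon \<Rightarrow> 'k) set" where
  "sigma2 d X = zclosure d (secant_lines d X)"

definition sigma2_defective :: "'k::field itself \<Rightarrow> nat list \<Rightarrow> bool" where
  "sigma2_defective T ds \<longleftrightarrow>
     (let d = sum_list ds; N = ((d + 2) choose 2) - 1; X = Xlam T ds in
       pdim d (sigma2 d X) < min (enat N) (2 * pdim d X + 1))"

end

theory Submission
  imports Defs "HOL-Library.FuncSet"
begin

text \<open>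
  The tangent space of the cone over \<open>X\<close> at \<open>F = F\<^sub>1\<cdots>F\<^sub>r\<close> is \<open>T\<^sub>F = \<Sum>\<^sub>i (F/F\<^sub>i) R\<^bsub>d\<^sub>i\<^esub>\<close>, and a parametrised
  cone has at least the dimension of the span of its tangent vectors (Terracini's lemma; this direction
  holds in every characteristic). So non-defectivity follows once \<open>T\<^sub>F + T\<^sub>G\<close> has the expected dimension
  for some \<open>F\<close>, \<open>G\<close> that are products of lines. This is shown by induction on \<open>d\<close>, adding one line to the
  largest block of both products: if \<open>l\<close> is added to \<open>F\<close> and \<open>l + \<epsilon>\<mu>\<close> to \<open>G\<close>, then the limit for
  \<open>\<epsilon> \<rightarrow> 0\<close> contains \<open>l (T\<^sub>F + T\<^sub>G)\<close> together with \<open>\<mu> K\<close> for all \<open>K\<close> in the intersection of \<open>T\<^sub>F\<close> and \<open>T\<^sub>G\<close>, and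
  the remaining contributions are counted by restricting them to the line \<open>l\<close>.

  If \<open>d\<^sub>1 \<ge> s\<close>, a general sum \<open>F\<^sub>1F' + G\<^sub>1G'\<close> of two products can be rewritten as
  \<open>(F\<^sub>1 - AG')F' + (G\<^sub>1 + AF')G'\<close>, so that \<open>F\<^sub>1\<close> may be reduced modulo \<open>G'\<close>. This saves
  \<open>(d\<^sub>1 - s + 2) choose 2\<close> parameters, and the secant variety is defective as soon as the number of remaining
  parameters is smaller than \<open>N + 1\<close>, which amounts to \<open>2p > 3s\<close>.

  Dimensions of closed cones are compared with the maximal number of algebraically independent
  polynomial functions on them.
\<close>

section \<open>Linear algebra of functions\<close>

text \<open>Why one or two elements \<open>K\<close> are enough: let the enlarged block have degree
  \<open>M\<close> and its cofactors degree \<open>S\<close>. Filling the whole space requires a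
  gain of \<open>M + S + 1\<close> dimensions, but on the new line the two blocks only contribute
  traces of dimensions \<open>M + 1\<close> and \<open>min S (M + 1)\<close>. The shortfall
  \<open>S - M - 1\<close> has to come from the products \<open>\<mu> K\<close>. Since the line
  always goes to a largest block, the sum of the squared block degrees is at most \<open>M\<close>
  times the total degree, and then the sign condition of the induction forces the shortfall to be at
  most 2. There are two targets, according to the sign of the expected surplus: the span is
  everything (\<open>rank_fill\<close>), or the two tangent spaces are independent
  (\<open>rank_inject\<close>). The second induction falls back on the first where the parameter
  count reaches the dimension of the space. The dimension is defined by chains of irreducible closed
  sets. Lower bounds therefore exhibit a chain, obtained by releasing the parameters of a family one
  at a time; upper bounds turn a chain into independent functions and count monomials in the
  parameters.\<close>

lemma infinite_alg_closed_field: "infinite (UNIV :: 'k::alg_closed_field set)"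
proof
  assume fin: "finite (UNIV :: 'k set)"
  define p :: "'k poly" where "p = (\<Prod>a\<in>UNIV. [:- a, 1:]) + 1"
  have nz: "poly p x = 1" for x
    using fin by (auto simp: p_def poly_prod prod_zero_iff)
  have "degree (\<Prod>a\<in>(UNIV::'k set). [:- a, 1:]) = card (UNIV :: 'k set)"
    by (subst degree_prod_eq_sum_degree) auto
  moreover have "card (UNIV :: 'k set) > 0" using fin by (simp add: card_gt_0_iff)
  ultimately have "degree p > 0" unfolding p_def by (subst degree_add_eq_left) auto
  then obtain x where "poly p x = 0" using alg_closed_imp_poly_has_root by blast
  with nz show False by simp
qed

lemma cofinite_poly_nonzero: "p \<noteq> 0 \<Longrightarrow> \<forall>\<^sub>F t in cofinite. poly p (t::'k::field) \<noteq> 0"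
  by (simp add: eventually_cofinite poly_roots_finite)

lemma cofinite_exists:
  assumes "\<forall>\<^sub>F t::'k::alg_closed_field in cofinite. P t"
  shows "\<exists>t. P t"
proof -
  have "cofinite \<noteq> (bot :: 'k filter)" by (simp add: infinite_alg_closed_field)
  thus ?thesis using assms eventually_happens by blast
qed

lemma poly_zero_cofinite:
  assumes "\<forall>\<^sub>F t::'k::alg_closed_field in cofinite. poly p t = 0"
  shows "p = 0"
proof (rule ccontr)
  assume "p \<noteq> 0"
  hence "\<forall>\<^sub>F t in cofinite. poly p t \<noteq> 0" by (rule cofinite_poly_nonzero)
  hence "\<forall>\<^sub>F t::'k in cofinite. False" using assms by eventually_elim simp
  thus False using cofinite_exists by blast
qed

text \<open>A family tested on a set of arguments, rather than a set of vectors: index sets may be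
  disjoint sums of several kinds of vectors, and \<open>X\<close> consists of points for forms and
  of monomials for coefficient vectors.\<close>

definition indep :: "'i set \<Rightarrow> ('i \<Rightarrow> 'a \<Rightarrow> 'k::field) \<Rightarrow> 'a set \<Rightarrow> bool" where
  "indep I b X \<longleftrightarrow> (\<forall>c. (\<forall>x\<in>X. (\<Sum>i\<in>I. c i * b i x) = 0) \<longrightarrow> (\<forall>i\<in>I. c i = 0))"

lemma indepI:
  "(\<And>c i. (\<And>x. x \<in> X \<Longrightarrow> (\<Sum>i\<in>I. c i * b i x) = 0) \<Longrightarrow> i \<in> I \<Longrightarrow> c i = 0) \<Longrightarrow> indep I b X"
  by (auto simp: indep_def)

lemma indepD:
  "indep I b X \<Longrightarrow> (\<And>x. x \<in> X \<Longrightarrow> (\<Sum>i\<in>I. c i * b i x) = 0) \<Longrightarrow> i \<in> I \<Longrightarrow> c i = 0"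
  by (auto simp: indep_def)

lemma indep_cong:
  assumes "\<And>i x. i \<in> I \<Longrightarrow> x \<in> X \<Longrightarrow> b i x = b' i x"
  shows "indep I b X \<longleftrightarrow> indep I b' X"
proof -
  have "(\<Sum>i\<in>I. c i * b i x) = (\<Sum>i\<in>I. c i * b' i x)" if "x \<in> X" for c x
    using assms that by (intro sum.cong) auto
  thus ?thesis unfolding indep_def by simp
qed

lemma indep_reindex:
  assumes "inj_on h J"
  shows "indep (h ` J) b X \<longleftrightarrow> indep J (\<lambda>j. b (h j)) X"
proof
  assume L: "indep (h ` J) b X"
  show "indep J (\<lambda>j. b (h j)) X"
  proof (rule indepI)
    fix c j assume z: "\<And>x. x \<in> X \<Longrightarrow> (\<Sum>i\<in>J. c i * b (h i) x) = 0" and j: "j \<in> J"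
    have "(c \<circ> the_inv_into J h) (h j) = 0"
    proof (rule indepD[OF L])
      show "(\<Sum>i\<in>h ` J. (c \<circ> the_inv_into J h) i * b i x) = 0" if "x \<in> X" for x
        using z[OF that] by (simp add: sum.reindex[OF assms] the_inv_into_f_f[OF assms])
    qed (use j in auto)
    thus "c j = 0" using j by (simp add: the_inv_into_f_f[OF assms])
  qed
next
  assume R: "indep J (\<lambda>j. b (h j)) X"
  show "indep (h ` J) b X"
  proof (rule indepI)
    fix c i assume z: "\<And>x. x \<in> X \<Longrightarrow> (\<Sum>i\<in>h ` J. c i * b i x) = 0" and i: "i \<in> h ` J"
    then obtain j where j: "j \<in> J" "i = h j" by auto
    have "(c \<circ> h) j = 0"
      by (rule indepD[OF R _ j(1)]) (use z in \<open>auto simp: sum.reindex[OF assms]\<close>)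
    thus "c i = 0" using j by simp
  qed
qed

lemma indep_subset:
  assumes "indep I b X" "J \<subseteq> I" "finite I"
  shows "indep J b X"
proof (rule indepI)
  fix c j assume z: "\<And>x. x \<in> X \<Longrightarrow> (\<Sum>i\<in>J. c i * b i x) = 0" and j: "j \<in> J"
  define c' where "c' i = (if i \<in> J then c i else 0)" for i
  have "c' j = 0"
  proof (rule indepD[OF assms(1), of c'])
    fix x assume x: "x \<in> X"
    have "(\<Sum>i\<in>I. c' i * b i x) = (\<Sum>i\<in>J. c i * b i x)"
      using assms by (intro sum.mono_neutral_cong_right) (auto simp: c'_def)
    thus "(\<Sum>i\<in>I. c' i * b i x) = 0" using z[OF x] by simp
  qed (use j assms in auto)
  thus "c j = 0" using j by (simp add: c'_def)
qed

lemma homogeneous_system_solvable: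
  fixes M :: "'i \<Rightarrow> 'j \<Rightarrow> 'k::field"
  assumes "finite J" "finite I" "card J < card I"
  shows "\<exists>c. (\<exists>i\<in>I. c i \<noteq> 0) \<and> (\<forall>j\<in>J. (\<Sum>i\<in>I. c i * M i j) = 0)"
  using assms
proof (induction J arbitrary: I M rule: finite_induct)
  case empty
  hence "I \<noteq> {}" by auto
  thus ?case by (intro exI[of _ "\<lambda>_. 1"]) auto
next
  case (insert j J)
  show ?case
  proof (cases "\<forall>i\<in>I. M i j = 0")
    case True
    have "card J < card I" using insert by simp
    then obtain c where "\<exists>i\<in>I. c i \<noteq> 0" "\<forall>j\<in>J. (\<Sum>i\<in>I. c i * M i j) = 0"
      using insert.IH[OF \<open>finite I\<close>] by blast
    thus ?thesis using True by (intro exI[of _ c]) auto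
  next
    case False
    then obtain k where k: "k \<in> I" "M k j \<noteq> 0" by auto
    define I' where "I' = I - {k}"
    have I': "finite I'" "card J < card I'" using insert k by (auto simp: I'_def)
    obtain c where c: "\<exists>i\<in>I'. c i \<noteq> 0"
      "\<forall>l\<in>J. (\<Sum>i\<in>I'. c i * (M i l - M i j / M k j * M k l)) = 0"
      using insert.IH[OF I', of "\<lambda>i l. M i l - M i j / M k j * M k l"] by blast
    define c' where "c' = c(k := - (\<Sum>i\<in>I'. c i * M i j) / M k j)"
    have split: "(\<Sum>i\<in>I. c' i * M i l) = c' k * M k l + (\<Sum>i\<in>I'. c i * M i l)" for l
    proof -
      have "(\<Sum>i\<in>I. c' i * M i l) = c' k * M k l + (\<Sum>i\<in>I'. c' i * M i l)"
        unfolding I'_def using k insert.prems by (intro sum.remove) auto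
      thus ?thesis by (simp add: c'_def I'_def cong: sum.cong_simp)
    qed
    have "(\<Sum>i\<in>I. c' i * M i j) = 0" using k(2) unfolding split by (simp add: c'_def)
    moreover have "(\<Sum>i\<in>I. c' i * M i l) = 0" if "l \<in> J" for l
    proof -
      have "0 = (\<Sum>i\<in>I'. c i * (M i l - M i j / M k j * M k l))" using c(2) that by simp
      also have "\<dots> = (\<Sum>i\<in>I'. c i * M i l) - (\<Sum>i\<in>I'. c i * M i j) / M k j * M k l"
        by (simp add: algebra_simps sum_subtractf sum_distrib_left sum_distrib_right sum_divide_distrib)
      finally show ?thesis unfolding split by (simp add: c'_def)
    qed
    moreover have "\<exists>i\<in>I. c' i \<noteq> 0" using c(1) by (auto simp: c'_def I'_def)
    ultimately show ?thesis by (intro exI[of _ c']) auto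
  qed
qed

lemma not_indep_span:
  assumes "finite J" "finite I" "card J < card I"
    and "\<And>i x. i \<in> I \<Longrightarrow> x \<in> X \<Longrightarrow> b i x = (\<Sum>j\<in>J. M i j * e j x)"
  shows "\<not> indep I b X"
proof
  assume ind: "indep I b X"
  obtain c where c: "\<exists>i\<in>I. c i \<noteq> 0" "\<forall>j\<in>J. (\<Sum>i\<in>I. c i * M i j) = 0"
    using homogeneous_system_solvable[OF assms(1-3)] by blast
  have "(\<Sum>i\<in>I. c i * b i x) = 0" if "x \<in> X" for x
  proof -
    have "(\<Sum>i\<in>I. c i * b i x) = (\<Sum>i\<in>I. \<Sum>j\<in>J. c i * M i j * e j x)"
      using that by (intro sum.cong) (auto simp: assms(4) sum_distrib_left mult.assoc)
    also have "\<dots> = (\<Sum>j\<in>J. (\<Sum>i\<in>I. c i * M i j) * e j x)"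
      by (subst sum.swap) (simp add: sum_distrib_right)
    also have "\<dots> = 0" using c(2) by simp
    finally show ?thesis .
  qed
  thus False using indepD[OF ind, of c] c(1) by blast
qed

text \<open>Steinitz exchange for a single vector. It is needed to make the point of the cone itself
  one of the independent tangent vectors.\<close>

lemma indep_exchange:
  assumes "finite I" "indep I b X" "x0 \<in> X" "w x0 \<noteq> 0" "I \<noteq> {}"
  shows "\<exists>k\<in>I. indep I (b(k := w)) X"
proof (cases "\<exists>a. \<forall>x\<in>X. w x = (\<Sum>i\<in>I. a i * b i x)")
  case True
  then obtain a where a: "\<And>x. x \<in> X \<Longrightarrow> w x = (\<Sum>i\<in>I. a i * b i x)" by blast
  have "\<exists>k\<in>I. a k \<noteq> 0"
  proof (rule ccontr)
    assume "\<not> ?thesis"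
    hence "w x0 = 0" using a[OF assms(3)] by simp
    with assms(4) show False by simp
  qed
  then obtain k where k: "k \<in> I" "a k \<noteq> 0" by blast
  have "indep I (b(k := w)) X"
  proof (rule indepI)
    fix c i assume z: "\<And>x. x \<in> X \<Longrightarrow> (\<Sum>i\<in>I. c i * (b(k := w)) i x) = 0" and i: "i \<in> I"
    have z': "(\<Sum>i\<in>I. (c k * a i + (if i = k then 0 else c i)) * b i x) = 0" if "x \<in> X" for x
    proof -
      have "(\<Sum>i\<in>I. c i * (b(k := w)) i x) = c k * w x + (\<Sum>i\<in>I-{k}. c i * b i x)"
        using k assms(1) by (subst sum.remove[of _ k]) auto
      also have "(\<Sum>i\<in>I-{k}. c i * b i x) = (\<Sum>i\<in>I. (if i = k then 0 else c i) * b i x)"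
        using assms(1) by (intro sum.mono_neutral_cong_left) auto
      finally have "c k * w x + (\<Sum>i\<in>I. (if i = k then 0 else c i) * b i x) = 0"
        using z[OF that] by simp
      moreover have "c k * w x = (\<Sum>i\<in>I. c k * a i * b i x)"
        unfolding a[OF that] sum_distrib_left by (simp add: mult.assoc)
      ultimately show ?thesis by (simp only: distrib_right sum.distrib)
    qed
    have 1: "c k * a j + (if j = k then 0 else c j) = 0" if "j \<in> I" for j
      using indepD[OF assms(2), of "\<lambda>i. c k * a i + (if i = k then 0 else c i)", OF z' that] .
    have "c k = 0" using 1[OF k(1)] k(2) by simp
    thus "c i = 0" using 1[OF i] by (auto split: if_splits)
  qed
  thus ?thesis using k by blast
next
  case False
  obtain k where k: "k \<in> I" using assms by auto
  have "indep I (b(k := w)) X"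
  proof (rule indepI)
    fix c i assume z: "\<And>x. x \<in> X \<Longrightarrow> (\<Sum>i\<in>I. c i * (b(k := w)) i x) = 0" and i: "i \<in> I"
    have z': "c k * w x + (\<Sum>i\<in>I. (if i = k then 0 else c i) * b i x) = 0" if "x \<in> X" for x
    proof -
      have "(\<Sum>i\<in>I. c i * (b(k := w)) i x) = c k * w x + (\<Sum>i\<in>I-{k}. c i * b i x)"
        using k assms(1) by (subst sum.remove[of _ k]) auto
      also have "(\<Sum>i\<in>I-{k}. c i * b i x) = (\<Sum>i\<in>I. (if i = k then 0 else c i) * b i x)"
        using assms(1) by (intro sum.mono_neutral_cong_left) auto
      finally show ?thesis using z[OF that] by simp
    qed
    have ck: "c k = 0"
    proof (rule ccontr)
      assume n: "c k \<noteq> 0"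
      have "w x = (\<Sum>i\<in>I. (- (if i = k then 0 else c i) / c k) * b i x)" if "x \<in> X" for x
      proof -
        have "w x = - (\<Sum>i\<in>I. (if i = k then 0 else c i) * b i x) / c k"
        proof -
          have "c k * w x = - (\<Sum>i\<in>I. (if i = k then 0 else c i) * b i x)"
            using z'[OF that] by (simp only: eq_neg_iff_add_eq_0)
          thus ?thesis using n by (metis nonzero_mult_div_cancel_left)
        qed
        also have "\<dots> = (\<Sum>i\<in>I. (- (if i = k then 0 else c i) / c k) * b i x)"
          by (simp only: sum_divide_distrib sum_negf[symmetric] mult_minus_left times_divide_eq_left)
        finally show ?thesis .
      qed
      hence "\<exists>a. \<forall>x\<in>X. w x = (\<Sum>i\<in>I. a i * b i x)"
        by (intro exI[of _ "\<lambda>i. - (if i = k then 0 else c i) / c k"]) simp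
      with False show False by contradiction
    qed
    have "(if i = k then 0 else c i) = 0"
    proof (rule indepD[OF assms(2), of "\<lambda>i. if i = k then 0 else c i", OF _ i])
      show "(\<Sum>i\<in>I. (if i = k then 0 else c i) * b i x) = 0" if "x \<in> X" for x
        using z'[OF that] ck by simp
    qed
    thus "c i = 0" using ck by (auto split: if_splits)
  qed
  thus ?thesis using k by blast
qed

text \<open>The dual basis is built from evaluations at points of \<open>X\<close>. For coefficient
  vectors these evaluations are coordinates, so the dual basis consists of linear polynomial
  functions.\<close>

lemma indep_dual_functionals:
  assumes "finite X" "finite I" "indep I w X"
  shows "\<exists>L. \<forall>i\<in>I. \<forall>k\<in>I. (\<Sum>x\<in>X. L i x * w k x) = (if i = k then 1 else (0::'k::field))"
  using assms(2,3)
proof (induction I rule: finite_induct)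
  case empty
  thus ?case by auto
next
  case (insert n I)
  have "indep I w X" by (rule indep_subset[OF insert.prems]) (use insert in auto)
  then obtain L where L: "\<And>i k. i \<in> I \<Longrightarrow> k \<in> I \<Longrightarrow> (\<Sum>x\<in>X. L i x * w k x) = (if i = k then 1 else 0)"
    using insert.IH by blast
  define ap where "ap i f = (\<Sum>x\<in>X. L i x * f x)" for i f
  define a where "a i = ap i (w n)" for i
  have "\<exists>x0\<in>X. w n x0 - (\<Sum>i\<in>I. a i * w i x0) \<noteq> 0"
  proof (rule ccontr)
    assume "\<not> ?thesis"
    hence z: "w n x = (\<Sum>i\<in>I. a i * w i x)" if "x \<in> X" for x using that by auto
    have "(\<Sum>i\<in>insert n I. (if i = n then 1 else - a i) * w i x) = 0" if "x \<in> X" for x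
    proof -
      have "(\<Sum>i\<in>I. (if i = n then 1 else - a i) * w i x) = (\<Sum>i\<in>I. - (a i * w i x))"
        using insert.hyps by (intro sum.cong) auto
      thus ?thesis using z[OF that] insert.hyps by (simp add: sum_negf)
    qed
    from indepD[OF insert.prems this, of n] show False by simp
  qed
  then obtain x0 where x0: "x0 \<in> X" and ne: "w n x0 - (\<Sum>i\<in>I. a i * w i x0) \<noteq> 0" by blast
  define D where "D = w n x0 - (\<Sum>i\<in>I. a i * w i x0)"
  \<comment> \<open>Evaluation at \<open>x0\<close>, corrected so as to vanish on the earlier
    vectors and divided by its value \<open>D\<close> on the new one.\<close>
  define \<nu> where "\<nu> x = ((if x = x0 then 1 else 0) - (\<Sum>i\<in>I. w i x0 * L i x)) / D" for x
  define L' where "L' i x = (if i = n then \<nu> x else L i x - a i * \<nu> x)" for i x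
  have nu: "(\<Sum>x\<in>X. \<nu> x * f x) = (f x0 - (\<Sum>i\<in>I. w i x0 * ap i f)) / D" for f
  proof -
    have "(\<Sum>x\<in>X. \<nu> x * f x) = (\<Sum>x\<in>X. (if x = x0 then f x else 0) - (\<Sum>i\<in>I. w i x0 * L i x) * f x) / D"
      unfolding sum_divide_distrib by (rule sum.cong) (simp_all add: \<nu>_def left_diff_distrib)
    also have "(\<Sum>x\<in>X. (if x = x0 then f x else 0) - (\<Sum>i\<in>I. w i x0 * L i x) * f x)
       = f x0 - (\<Sum>x\<in>X. \<Sum>i\<in>I. w i x0 * L i x * f x)"
      using x0 assms(1) by (simp add: sum_subtractf sum_distrib_right)
    also have "(\<Sum>x\<in>X. \<Sum>i\<in>I. w i x0 * L i x * f x) = (\<Sum>i\<in>I. w i x0 * ap i f)"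
      by (subst sum.swap) (simp add: ap_def sum_distrib_left mult.assoc)
    finally show ?thesis .
  qed
  have nuI: "(\<Sum>x\<in>X. \<nu> x * w k x) = 0" if "k \<in> I" for k
  proof -
    have "(\<Sum>i\<in>I. w i x0 * ap i (w k)) = (\<Sum>i\<in>I. if i = k then w k x0 else 0)"
      using that L unfolding ap_def by (intro sum.cong) auto
    also have "\<dots> = w k x0" using that insert.hyps by simp
    finally show ?thesis by (simp add: nu)
  qed
  have nun: "(\<Sum>x\<in>X. \<nu> x * w n x) = 1"
  proof -
    have "(\<Sum>i\<in>I. w i x0 * ap i (w n)) = (\<Sum>i\<in>I. a i * w i x0)"
      by (simp add: a_def mult.commute)
    thus ?thesis using ne by (simp add: nu D_def)
  qed
  have "(\<Sum>x\<in>X. L' i x * w k x) = (if i = k then 1 else 0)" if "i \<in> insert n I" "k \<in> insert n I" for i k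
  proof (cases "i = n")
    case True
    thus ?thesis using that nuI nun by (auto simp: L'_def)
  next
    case False
    hence "(\<Sum>x\<in>X. L' i x * w k x) = (\<Sum>x\<in>X. L i x * w k x) - a i * (\<Sum>x\<in>X. \<nu> x * w k x)"
      by (simp add: L'_def algebra_simps sum_subtractf sum_distrib_left)
    moreover have "(\<Sum>x\<in>X. L i x * w n x) = a i" by (simp add: a_def ap_def)
    ultimately show ?thesis using False that L nuI nun by auto
  qed
  thus ?case by blast
qed

text \<open>Linear independence is an open condition; the induction step is one step of
  fraction-free elimination with pivot \<open>b n t p\<close>.\<close>

lemma indep_cofinite:
  fixes b :: "'i \<Rightarrow> 'k::alg_closed_field \<Rightarrow> 'a \<Rightarrow> 'k"
  assumes "finite I" "indep I (\<lambda>i. b i t0) X" "\<And>i x. i \<in> I \<Longrightarrow> \<exists>p. \<forall>t. b i t x = poly p t"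
  shows "\<forall>\<^sub>F t in cofinite. indep I (\<lambda>i. b i t) X"
  using assms
proof (induction I arbitrary: b rule: finite_induct)
  case empty
  thus ?case by (simp add: indep_def)
next
  case (insert n I)
  have "\<exists>p\<in>X. b n t0 p \<noteq> 0"
  proof (rule ccontr)
    assume "\<not> ?thesis"
    hence z: "b n t0 x = 0" if "x \<in> X" for x using that by auto
    have "(\<Sum>i\<in>insert n I. (if i = n then 1 else 0) * b i t0 x) = 0" if "x \<in> X" for x
    proof -
      have "(\<Sum>i\<in>I. (if i = n then 1 else 0) * b i t0 x) = 0"
        using insert.hyps by (intro sum.neutral) auto
      thus ?thesis using z[OF that] insert.hyps by simp
    qed
    from indepD[OF insert.prems(1) this, of n] show False by simp
  qed
  then obtain p where p: "p \<in> X" "b n t0 p \<noteq> 0" by blast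
  define b' where "b' i t x = b n t p * b i t x - b i t p * b n t x" for i t x
  have "indep I (\<lambda>i. b' i t0) X"
  proof (rule indepI)
    fix c i assume z: "\<And>x. x \<in> X \<Longrightarrow> (\<Sum>i\<in>I. c i * b' i t0 x) = 0" and i: "i \<in> I"
    \<comment> \<open>A relation between the reduced functions is rewritten as one between the
      original functions.\<close>
    define c' where "c' i = (if i = n then - (\<Sum>i\<in>I. c i * b i t0 p) else c i * b n t0 p)" for i
    have "(\<Sum>i\<in>insert n I. c' i * b i t0 x) = 0" if "x \<in> X" for x
    proof -
      have "(\<Sum>i\<in>I. c' i * b i t0 x) = (\<Sum>i\<in>I. c i * b n t0 p * b i t0 x)"
        using insert.hyps by (intro sum.cong) (auto simp: c'_def)
      hence "(\<Sum>i\<in>insert n I. c' i * b i t0 x) = (\<Sum>i\<in>I. c i * b' i t0 x)"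
        using insert.hyps
        by (simp add: c'_def b'_def algebra_simps sum_subtractf sum_distrib_left sum_distrib_right)
      thus ?thesis using z[OF that] by simp
    qed
    from indepD[OF insert.prems(1) this, of i] have "c' i = 0" using i by simp
    thus "c i = 0" using i insert.hyps p by (auto simp: c'_def split: if_splits)
  qed
  moreover have "\<exists>q. \<forall>t. b' i t x = poly q t" if hi: "i \<in> I" for i x
  proof -
    obtain p1 p2 p3 p4 where "\<And>t. b n t p = poly p1 t" "\<And>t. b i t x = poly p2 t"
       "\<And>t. b i t p = poly p3 t" "\<And>t. b n t x = poly p4 t"
      using insert.prems(2)[of n p] insert.prems(2)[of i x] insert.prems(2)[of i p]
        insert.prems(2)[of n x] hi by blast
    hence "b' i t x = poly (p1 * p2 - p3 * p4) t" for t by (simp add: b'_def)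
    thus ?thesis by blast
  qed
  ultimately have 1: "\<forall>\<^sub>F t in cofinite. indep I (\<lambda>i. b' i t) X" by (rule insert.IH)
  obtain q where q: "\<And>t. b n t p = poly q t" using insert.prems(2)[of n] by blast
  have "q \<noteq> 0" using p(2) q by auto
  hence 2: "\<forall>\<^sub>F t in cofinite. b n t p \<noteq> 0" using cofinite_poly_nonzero[of q] by (simp add: q)
  show ?case using 1 2
  proof eventually_elim
    case (elim t)
    show ?case
    proof (rule indepI)
      fix c i assume z: "\<And>x. x \<in> X \<Longrightarrow> (\<Sum>i\<in>insert n I. c i * b i t x) = 0" and i: "i \<in> insert n I"
      have zz: "c n * b n t x + (\<Sum>i\<in>I. c i * b i t x) = 0" if "x \<in> X" for x
        using z[OF that] insert.hyps by simp
      have "(\<Sum>i\<in>I. c i * b' i t x) = 0" if "x \<in> X" for x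
      proof -
        have "(\<Sum>i\<in>I. c i * b' i t x) = b n t p * (\<Sum>i\<in>I. c i * b i t x) - (\<Sum>i\<in>I. c i * b i t p) * b n t x"
          by (simp add: b'_def algebra_simps sum_subtractf sum_distrib_left sum_distrib_right)
        also have "\<dots> = b n t p * (- (c n * b n t x)) - (- (c n * b n t p)) * b n t x"
        proof -
          have "(\<Sum>i\<in>I. c i * b i t x) = - (c n * b n t x)"
            using zz[OF that] by (simp add: eq_neg_iff_add_eq_0 add.commute)
          moreover have "(\<Sum>i\<in>I. c i * b i t p) = - (c n * b n t p)"
            using zz[OF p(1)] by (simp add: eq_neg_iff_add_eq_0 add.commute)
          ultimately show ?thesis by simp
        qed
        finally show ?thesis by simp
      qed
      hence ci: "c j = 0" if "j \<in> I" for j using indepD[OF elim(1), of c] that by simp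
      have "c n = 0" using zz[OF p(1)] ci elim(2) by simp
      thus "c i = 0" using ci i by auto
    qed
  qed
qed

text \<open>Adding one multiple at a time makes rule induction available where finite linear
  combinations would have to be chosen. The same closure serves for forms, for polynomial functions
  of the coefficients and for polynomials in parameters.\<close>

inductive_set lspan :: "('a \<Rightarrow> 'k::field) set \<Rightarrow> ('a \<Rightarrow> 'k) set" for B where
  lspan_zero: "(\<lambda>x. 0) \<in> lspan B"
| lspan_step: "g \<in> lspan B \<Longrightarrow> b \<in> B \<Longrightarrow> (\<lambda>x. g x + c * b x) \<in> lspan B"

lemma lspan_base: "b \<in> B \<Longrightarrow> b \<in> lspan B"
  using lspan_step[OF lspan_zero, of b B 1] by simp

lemma lspan_add: "f \<in> lspan B \<Longrightarrow> g \<in> lspan B \<Longrightarrow> (\<lambda>x. f x + g x) \<in> lspan B"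
proof (induction rule: lspan.induct)
  case (lspan_step h b c)
  from lspan.lspan_step[OF lspan_step.IH[OF lspan_step.prems] lspan_step.hyps(2), of c]
  show ?case by (simp add: algebra_simps)
qed simp

lemma lspan_scale: "f \<in> lspan B \<Longrightarrow> (\<lambda>x. a * f x) \<in> lspan B"
proof (induction rule: lspan.induct)
  case (lspan_step h b c)
  from lspan.lspan_step[OF lspan_step.IH lspan_step.hyps(2), of "a * c"]
  show ?case by (simp add: algebra_simps)
qed (simp add: lspan_zero)

lemma lspan_sum: "(\<And>i. i \<in> I \<Longrightarrow> f i \<in> lspan B) \<Longrightarrow> (\<lambda>x. \<Sum>i\<in>I. f i x) \<in> lspan B"
  by (induction I rule: infinite_finite_induct) (auto intro: lspan_add lspan_zero)

lemma lspan_lincomb: "(\<And>i. i \<in> I \<Longrightarrow> f i \<in> lspan B) \<Longrightarrow> (\<lambda>x. \<Sum>i\<in>I. c i * f i x) \<in> lspan B"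
  by (intro lspan_sum lspan_scale)

lemma lspan_mult:
  assumes "f \<in> lspan B" "g \<in> lspan C" "\<And>b c. b \<in> B \<Longrightarrow> c \<in> C \<Longrightarrow> (\<lambda>x. b x * c x) \<in> lspan D"
  shows "(\<lambda>x. f x * g x) \<in> lspan D"
  using assms(1)
proof (induction rule: lspan.induct)
  case lspan_zero
  thus ?case by (simp add: lspan.lspan_zero)
next
  case (lspan_step h b a)
  have "(\<lambda>x. b x * g x) \<in> lspan D" using assms(2)
  proof (induction rule: lspan.induct)
    case lspan_zero
    thus ?case by (simp add: lspan.lspan_zero)
  next
    case (lspan_step k c a')
    have "(\<lambda>x. b x * k x + a' * (b x * c x)) \<in> lspan D"
      by (intro lspan_add lspan_scale lspan_step.IH assms(3) \<open>b \<in> B\<close> lspan_step.hyps)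
    thus ?case by (simp add: algebra_simps)
  qed
  hence "(\<lambda>x. h x * g x + a * (b x * g x)) \<in> lspan D"
    by (intro lspan_add lspan_scale lspan_step.IH)
  thus ?case by (simp add: algebra_simps)
qed

lemma lspan_mono: "f \<in> lspan B \<Longrightarrow> B \<subseteq> lspan C \<Longrightarrow> f \<in> lspan C"
proof (induction rule: lspan.induct)
  case (lspan_step g b c)
  thus ?case by (intro lspan_add lspan_scale) auto
qed (rule lspan_zero)

lemma lspan_finite_image:
  assumes "f \<in> lspan (e ` J)" "finite J"
  shows "\<exists>c. \<forall>x. f x = (\<Sum>j\<in>J. c j * e j x)"
  using assms(1)
proof (induction rule: lspan.induct)
  case lspan_zero
  show ?case by (intro exI[of _ "\<lambda>_. 0"]) simp
next
  case (lspan_step g b a)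
  then obtain c j where c: "\<forall>x. g x = (\<Sum>j\<in>J. c j * e j x)" and j: "j \<in> J" "b = e j" by auto
  have "(\<Sum>i\<in>J. (c(j := c j + a)) i * e i x) = (\<Sum>i\<in>J. c i * e i x) + a * e j x" for x
  proof -
    have "(\<Sum>i\<in>J. (c(j := c j + a)) i * e i x) = (\<Sum>i\<in>J. c i * e i x + (if i = j then a * e j x else 0))"
      by (intro sum.cong) (auto simp: algebra_simps)
    also have "\<dots> = (\<Sum>i\<in>J. c i * e i x) + a * e j x"
      using j(1) assms(2) by (simp add: sum.distrib)
    finally show ?thesis .
  qed
  thus ?case using c j by (intro exI[of _ "c(j := c j + a)"]) simp
qed

section \<open>Ternary forms as functions\<close>

text \<open>Induction on the variables, comparing coefficients in one of them. The last hypothesis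
  only asks that an exponent in \<open>S\<close> be determined by its values on \<open>V\<close>,
  which also covers extensional exponent functions.\<close>

lemma indep_monomials:
  fixes V :: "'v set"
  assumes "finite V" "finite S" "\<And>\<alpha> \<beta>. \<alpha> \<in> S \<Longrightarrow> \<beta> \<in> S \<Longrightarrow> \<forall>v\<in>V. \<alpha> v = \<beta> v \<Longrightarrow> \<alpha> = \<beta>"
  shows "indep S (\<lambda>\<alpha> (u :: 'v \<Rightarrow> 'k::alg_closed_field). \<Prod>v\<in>V. u v ^ \<alpha> v) UNIV"
  using assms
proof (induction V arbitrary: S rule: finite_induct)
  case empty
  show ?case
  proof (rule indepI)
    fix c :: "('v \<Rightarrow> nat) \<Rightarrow> 'k" and \<alpha>
    assume z: "\<And>u::'v \<Rightarrow> 'k. u \<in> UNIV \<Longrightarrow> (\<Sum>\<alpha>\<in>S. c \<alpha> * (\<Prod>v\<in>{}. u v ^ \<alpha> v)) = 0" and \<alpha>: "\<alpha> \<in> S"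
    have "S = {\<alpha>}" using empty.prems \<alpha> by auto
    thus "c \<alpha> = 0" using z[of "\<lambda>_. 0"] by simp
  qed
next
  case (insert v V)
  show ?case
  proof (rule indepI)
    fix c :: "('v \<Rightarrow> nat) \<Rightarrow> 'k" and \<alpha>
    assume z: "\<And>u::'v \<Rightarrow> 'k. u \<in> UNIV \<Longrightarrow> (\<Sum>\<alpha>\<in>S. c \<alpha> * (\<Prod>v\<in>insert v V. u v ^ \<alpha> v)) = 0" and \<alpha>: "\<alpha> \<in> S"
    define S' where "S' = {\<beta> \<in> S. \<beta> v = \<alpha> v}"
    have ind: "indep S' (\<lambda>\<alpha> (u :: 'v \<Rightarrow> 'k). \<Prod>v\<in>V. u v ^ \<alpha> v) UNIV"
    proof (rule insert.IH)
      show "finite S'" using insert.prems by (simp add: S'_def)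
      show "\<beta> = \<gamma>" if "\<beta> \<in> S'" "\<gamma> \<in> S'" "\<forall>v\<in>V. \<beta> v = \<gamma> v" for \<beta> \<gamma>
        using that by (intro insert.prems(2)) (auto simp: S'_def)
    qed
    have "(\<Sum>\<beta>\<in>S'. c \<beta> * (\<Prod>v\<in>V. u v ^ \<beta> v)) = 0" for u :: "'v \<Rightarrow> 'k"
    proof -
      \<comment> \<open>All variables but \<open>v\<close> are frozen; the coefficient in degree
        \<open>\<alpha> v\<close> isolates the terms with index in \<open>S'\<close>.\<close>
      define q where "q = (\<Sum>\<beta>\<in>S. monom (c \<beta> * (\<Prod>w\<in>V. u w ^ \<beta> w)) (\<beta> v))"
      have "poly q t = 0" for t
      proof -
        have "(\<Prod>w\<in>V. (u(v := t)) w ^ \<beta> w) = (\<Prod>w\<in>V. u w ^ \<beta> w)" for \<beta>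
          using insert.hyps by (intro prod.cong) auto
        hence "poly q t = (\<Sum>\<beta>\<in>S. c \<beta> * (\<Prod>w\<in>insert v V. (u(v := t)) w ^ \<beta> w))"
          using insert.hyps by (simp add: q_def poly_sum poly_monom mult_ac)
        thus ?thesis using z[of "u(v := t)"] by simp
      qed
      hence "q = 0" by (intro poly_zero_cofinite) simp
      hence "0 = coeff q (\<alpha> v)" by simp
      also have "\<dots> = (\<Sum>\<beta>\<in>S. if \<beta> v = \<alpha> v then c \<beta> * (\<Prod>w\<in>V. u w ^ \<beta> w) else 0)"
        by (simp add: q_def coeff_sum)
      also have "\<dots> = (\<Sum>\<beta>\<in>S'. c \<beta> * (\<Prod>v\<in>V. u v ^ \<beta> v))"
        unfolding S'_def using insert.prems by (intro sum.mono_neutral_cong_right) auto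
      finally show ?thesis by simp
    qed
    thus "c \<alpha> = 0" using indepD[OF ind, of c \<alpha>] \<alpha> by (simp add: S'_def)
  qed
qed

type_synonym 'k pt = "'k \<times> 'k \<times> 'k"

definition mons :: "nat \<Rightarrow> mon set" where
  "mons e = {m. mdeg m = e}"

fun mono3 :: "mon \<Rightarrow> 'k::field pt \<Rightarrow> 'k" where
  "mono3 (a, b, c) (x, y, z) = x ^ a * y ^ b * z ^ c"

text \<open>Forms are functions here, so that products are pointwise and restriction to a line is
  evaluation. By \<open>indep_mono3\<close> no information is lost; coefficient vectors return with
  \<open>ev\<close>.\<close>

definition forms :: "nat \<Rightarrow> ('k::field pt \<Rightarrow> 'k) set" where
  "forms e = lspan (mono3 ` mons e)"

lemma in_mons [simp]: "(a, b, c) \<in> mons e \<longleftrightarrow> a + b + c = e"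
  by (simp add: mons_def mdeg_def)

lemma mons_Suc: "mons (Suc e) = (\<lambda>(a, b, c). (Suc a, b, c)) ` mons e \<union> (\<lambda>b. (0, b, Suc e - b)) ` {..Suc e}"
proof (intro equalityI subsetI)
  fix m assume m: "m \<in> mons (Suc e)"
  obtain a b c where abc: "m = (a, b, c)" by (cases m) auto
  show "m \<in> (\<lambda>(a, b, c). (Suc a, b, c)) ` mons e \<union> (\<lambda>b. (0, b, Suc e - b)) ` {..Suc e}"
  proof (cases a)
    case 0
    thus ?thesis using m abc by (intro UnI2) (auto intro!: image_eqI[of _ _ b])
  next
    case (Suc a')
    thus ?thesis using m abc by (intro UnI1 image_eqI[of _ _ "(a', b, c)"]) auto
  qed
qed auto

lemma finite_mons [simp]: "finite (mons e)"
proof (induction e)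
  case 0
  have "mons 0 = {(0, 0, 0)}" by (auto simp: mons_def mdeg_def)
  thus ?case by simp
qed (simp add: mons_Suc)

lemma card_mons: "card (mons e) = (e + 2) choose 2"
proof (induction e)
  case 0
  have "mons 0 = {(0, 0, 0)}" by (auto simp: mons_def mdeg_def)
  thus ?case by (simp add: numeral_2_eq_2)
next
  case (Suc e)
  have "card (mons (Suc e)) = card ((\<lambda>(a, b, c). (Suc a, b, c)) ` mons e) + card ((\<lambda>b. (0::nat, b, Suc e - b)) ` {..Suc e})"
    unfolding mons_Suc by (intro card_Un_disjoint) auto
  also have "card ((\<lambda>(a, b, c). (Suc a, b, c)) ` mons e) = card (mons e)"
    by (intro card_image) (auto simp: inj_on_def)
  also have "card ((\<lambda>b. (0::nat, b, Suc e - b)) ` {..Suc e}) = e + 2"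
    by (subst card_image) (auto simp: inj_on_def)
  finally show ?case using Suc by (simp add: numeral_2_eq_2)
qed

lemma indep_mono3: "indep (mons e) (mono3 :: mon \<Rightarrow> 'k::alg_closed_field pt \<Rightarrow> 'k) UNIV"
proof (rule indepI)
  fix c :: "mon \<Rightarrow> 'k" and m
  assume z: "\<And>p. p \<in> UNIV \<Longrightarrow> (\<Sum>m\<in>mons e. c m * mono3 m p) = 0" and m: "m \<in> mons e"
  define h :: "mon \<Rightarrow> nat \<Rightarrow> nat" where "h = (\<lambda>(a, b, c) i. if i = 0 then a else if i = 1 then b else c)"
  have inj: "inj_on h (mons e)"
  proof (rule inj_onI)
    fix x y :: mon assume "h x = h y"
    hence "h x 0 = h y 0" "h x 1 = h y 1" "h x 2 = h y 2" by auto
    thus "x = y" by (cases x; cases y) (auto simp: h_def)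
  qed
  have "indep (h ` mons e) (\<lambda>\<alpha> (u :: nat \<Rightarrow> 'k). \<Prod>v\<in>{0,1,2}. u v ^ \<alpha> v) UNIV"
  proof (rule indep_monomials)
    fix \<alpha> \<beta> assume "\<alpha> \<in> h ` mons e" "\<beta> \<in> h ` mons e" "\<forall>v\<in>{0, 1, 2}. \<alpha> v = \<beta> v"
    thus "\<alpha> = \<beta>" by (auto simp: h_def)
  qed auto
  hence I: "indep (mons e) (\<lambda>m (u :: nat \<Rightarrow> 'k). \<Prod>v\<in>{0,1,2}. u v ^ h m v) UNIV"
    by (simp only: indep_reindex[OF inj])
  show "c m = 0"
  proof (rule indepD[OF I _ m])
    fix u :: "nat \<Rightarrow> 'k"
    have "(\<Prod>v\<in>{0,1,2}. u v ^ h m v) = mono3 m (u 0, u 1, u 2)" for m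
      by (cases m) (simp add: h_def mult.assoc)
    thus "(\<Sum>m\<in>mons e. c m * (\<Prod>v\<in>{0,1,2}. u v ^ h m v)) = 0" using z[of "(u 0, u 1, u 2)"] by simp
  qed
qed

lemma forms_coeffs: "f \<in> forms e \<Longrightarrow> \<exists>c. \<forall>x. f x = (\<Sum>m\<in>mons e. c m * mono3 m x)"
  unfolding forms_def by (rule lspan_finite_image) auto

lemma forms_zero [simp]: "(\<lambda>x. 0) \<in> forms e" by (simp add: forms_def lspan_zero)
lemma forms_add: "f \<in> forms e \<Longrightarrow> g \<in> forms e \<Longrightarrow> (\<lambda>x. f x + g x) \<in> forms e"
  unfolding forms_def by (rule lspan_add)
lemma forms_scale: "f \<in> forms e \<Longrightarrow> (\<lambda>x. a * f x) \<in> forms e"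
  unfolding forms_def by (rule lspan_scale)
lemma forms_sum: "(\<And>i. i \<in> I \<Longrightarrow> f i \<in> forms e) \<Longrightarrow> (\<lambda>x. \<Sum>i\<in>I. f i x) \<in> forms e"
  unfolding forms_def by (rule lspan_sum)
lemma forms_mono3: "m \<in> mons e \<Longrightarrow> mono3 m \<in> forms e"
  unfolding forms_def by (rule lspan_base) auto

lemma forms_mult:
  assumes "f \<in> forms a" "g \<in> forms b"
  shows "(\<lambda>x. f x * g x) \<in> forms (a + b)"
  unfolding forms_def
proof (rule lspan_mult[OF assms[unfolded forms_def]])
  fix f g :: "'a pt \<Rightarrow> 'a" assume "f \<in> mono3 ` mons a" "g \<in> mono3 ` mons b"
  then obtain x y z x' y' z' where f: "f = mono3 (x, y, z)" "x + y + z = a"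
    and g: "g = mono3 (x', y', z')" "x' + y' + z' = b" by force
  have "(\<lambda>p. f p * g p) = mono3 (x + x', y + y', z + z')"
    using f g by (auto simp: fun_eq_iff power_add mult_ac)
  also have "\<dots> \<in> lspan (mono3 ` mons (a + b))"
    using f g by (intro lspan_base) auto
  finally show "(\<lambda>p. f p * g p) \<in> lspan (mono3 ` mons (a + b))" .
qed

lemma forms_const: "(\<lambda>x. a) \<in> forms 0"
proof -
  have "(\<lambda>x::'a pt. a * mono3 (0, 0, 0) x) \<in> forms 0" by (intro forms_scale forms_mono3) simp
  moreover have "(\<lambda>x::'a pt. a * mono3 (0, 0, 0) x) = (\<lambda>x. a)" by (auto simp: fun_eq_iff)
  ultimately show ?thesis by simp
qed

lemma forms_0_const:
  assumes "f \<in> forms 0" shows "f x = f y"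
proof -
  have 0: "mons 0 = {(0, 0, 0)}" by (auto simp: mons_def mdeg_def)
  obtain c where "\<And>x. f x = (\<Sum>m\<in>mons 0. c m * mono3 m x)" using forms_coeffs[OF assms] by blast
  thus ?thesis by (cases x; cases y) (simp add: 0)
qed

lemma forms_prod:
  assumes "finite I" "\<And>i. i \<in> I \<Longrightarrow> f i \<in> forms (e i)"
  shows "(\<lambda>x. \<Prod>i\<in>I. f i x) \<in> forms (\<Sum>i\<in>I. e i)"
  using assms by (induction I rule: finite_induct) (auto intro: forms_const forms_mult)

lemma forms_power:
  assumes "f \<in> forms e" shows "(\<lambda>x. f x ^ k) \<in> forms (k * e)"
  using forms_prod[of "{..<k}" "\<lambda>_. f" "\<lambda>_. e"] assms by simp

text \<open>The source of the genericity arguments for forms: along a polynomial curve a form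
  vanishes identically or at finitely many parameters only.\<close>

lemma forms_path:
  assumes "f \<in> forms e"
  shows "\<exists>p. \<forall>t. f (poly a t, poly b t, poly c t) = poly p t"
  using assms unfolding forms_def
proof (induction rule: lspan.induct)
  case lspan_zero
  show ?case by (rule exI[of _ 0]) simp
next
  case (lspan_step g h k)
  then obtain p i j l where "\<forall>t. g (poly a t, poly b t, poly c t) = poly p t" "h = mono3 (i, j, l)" by force
  thus ?case by (intro exI[of _ "p + smult k (a ^ i * b ^ j * c ^ l)"]) simp
qed

text \<open>On the line through \<open>x\<close> and \<open>y\<close> both restrictions are nonzero
  polynomials in one variable, and only finitely many roots are to be avoided.\<close>

lemma forms_nonzero_both:
  fixes f :: "'k::alg_closed_field pt \<Rightarrow> 'k"
  assumes "f \<in> forms a" "g \<in> forms b" "f x \<noteq> 0" "g y \<noteq> 0"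
  shows "\<exists>z. f z \<noteq> 0 \<and> g z \<noteq> 0"
proof -
  obtain x1 x2 x3 y1 y2 y3 where xy: "x = (x1, x2, x3)" "y = (y1, y2, y3)" by (cases x; cases y) auto
  define w where "w t = (poly [:x1, y1 - x1:] t, poly [:x2, y2 - x2:] t, poly [:x3, y3 - x3:] t)" for t
  obtain p q where p: "\<And>t. f (w t) = poly p t" and q: "\<And>t. g (w t) = poly q t"
    using forms_path[OF assms(1)] forms_path[OF assms(2)] unfolding w_def by meson
  have "poly p 0 \<noteq> 0" "poly q 1 \<noteq> 0"
    using assms p[of 0, symmetric] q[of 1, symmetric] by (simp_all add: w_def xy)
  hence "p \<noteq> 0" "q \<noteq> 0" by auto
  hence "\<forall>\<^sub>F t in cofinite. poly p t \<noteq> 0 \<and> poly q t \<noteq> 0"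
    by (intro eventually_conj cofinite_poly_nonzero)
  from cofinite_exists[OF this] show ?thesis using p q by metis
qed

subsection \<open>Lines\<close>

text \<open>One type serves for points and for coefficient vectors of lines. \<open>lin\<close> is
  the incidence pairing, \<open>cross\<close> is both the join of two points and the meet of two
  lines, and \<open>det3\<close> vanishes on concurrent lines.\<close>

fun lin :: "'k::field pt \<Rightarrow> 'k pt \<Rightarrow> 'k" where
  "lin (a, b, c) (x, y, z) = a * x + b * y + c * z"

fun cross :: "'k::field pt \<Rightarrow> 'k pt \<Rightarrow> 'k pt" where
  "cross (a, b, c) (x, y, z) = (b * z - c * y, c * x - a * z, a * y - b * x)"

definition det3 :: "'k::field pt \<Rightarrow> 'k pt \<Rightarrow> 'k pt \<Rightarrow> 'k" where
  "det3 u v w = lin u (cross v w)"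

fun comb :: "'k::field \<Rightarrow> 'k pt \<Rightarrow> 'k \<Rightarrow> 'k pt \<Rightarrow> 'k pt" where
  "comb s (a, b, c) t (x, y, z) = (s * a + t * x, s * b + t * y, s * c + t * z)"

abbreviation e1 :: "'k::field pt" where "e1 \<equiv> (1, 0, 0)"
abbreviation e2 :: "'k::field pt" where "e2 \<equiv> (0, 1, 0)"
abbreviation e3 :: "'k::field pt" where "e3 \<equiv> (0, 0, 1)"
abbreviation z3 :: "'k::field pt" where "z3 \<equiv> (0, 0, 0)"

lemma lin_comb_left: "lin (comb s u t v) p = s * lin u p + t * lin v p"
  by (cases u; cases v; cases p) (simp add: algebra_simps)

lemma lin_comb_right: "lin p (comb s u t v) = s * lin p u + t * lin p v"
  by (cases u; cases v; cases p) (simp add: algebra_simps)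

lemma lin_commute: "lin u v = lin v u"
  by (cases u; cases v) (simp add: mult.commute)

lemma lin_cross_self: "lin u (cross u v) = 0" "lin v (cross u v) = 0"
  by (cases u; cases v; simp add: algebra_simps)+

lemma lin_cross_rotate: "lin u (cross v w) = lin w (cross u v)"
  by (cases u; cases v; cases w) (simp add: algebra_simps)

lemma lin_forms: "lin v \<in> forms 1"
proof -
  obtain a b c where v: "v = (a, b, c)" by (cases v) auto
  have "lin v = (\<lambda>p. a * mono3 (1, 0, 0) p + b * mono3 (0, 1, 0) p + c * mono3 (0, 0, 1) p)"
    by (auto simp: v fun_eq_iff)
  also have "\<dots> \<in> forms 1" by (intro forms_add forms_scale forms_mono3) auto
  finally show ?thesis .
qed

lemma forms_lin_mult: "f \<in> forms e \<Longrightarrow> (\<lambda>x. lin v x * f x) \<in> forms (Suc e)"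
  using forms_mult[OF lin_forms, of f e v] by simp

lemma nonzero_witness: "u \<noteq> z3 \<Longrightarrow> \<exists>w. lin w u \<noteq> (0::'k::field)"
proof -
  assume u: "u \<noteq> z3"
  have "lin e1 u \<noteq> 0 \<or> lin e2 u \<noteq> 0 \<or> lin e3 u \<noteq> 0" using u by (cases u) auto
  thus ?thesis by blast
qed

section \<open>Coordinates along a line, and divisibility by a line\<close>

lemma frame_exists:
  assumes "v \<noteq> z3"
  shows "\<exists>\<beta> \<gamma>. det3 v \<beta> \<gamma> \<noteq> (0::'k::field)"
proof -
  have "det3 v e2 e3 \<noteq> 0 \<or> det3 v e3 e1 \<noteq> 0 \<or> det3 v e1 e2 \<noteq> 0"
    using assms by (cases v) (auto simp: det3_def)
  thus ?thesis by blast
qed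

lemma cramer:
  assumes "det3 v \<beta> \<gamma> \<noteq> (0::'k::field)"
  shows "\<exists>a b c. \<forall>p. lin w p = a * lin v p + b * lin \<beta> p + c * lin \<gamma> p"
proof -
  let ?D = "det3 v \<beta> \<gamma>"
  have "?D * lin w p = det3 w \<beta> \<gamma> * lin v p + det3 v w \<gamma> * lin \<beta> p + det3 v \<beta> w * lin \<gamma> p" for p
    by (cases v; cases \<beta>; cases \<gamma>; cases w; cases p; hypsubst)
      (simp add: det3_def algebra_simps)
  hence "lin w p = (det3 w \<beta> \<gamma> / ?D) * lin v p + (det3 v w \<gamma> / ?D) * lin \<beta> p + (det3 v \<beta> w / ?D) * lin \<gamma> p" for p
    using assms by (simp add: add_divide_distrib[symmetric] eq_divide_eq mult.commute)
  thus ?thesis by blast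
qed

text \<open>\<open>lin \<beta>\<close> and \<open>lin \<gamma>\<close> are homogeneous coordinates
  on the line \<open>v\<close>, so distinct points of it receive pairs that are not
  proportional.\<close>

lemma frame_separates:
  assumes "det3 v \<beta> \<gamma> \<noteq> (0::'k::field)" "lin v p = 0" "lin v q = 0" "cross p q \<noteq> z3"
  shows "lin \<beta> p * lin \<gamma> q \<noteq> lin \<beta> q * lin \<gamma> p"
proof
  assume eq: "lin \<beta> p * lin \<gamma> q = lin \<beta> q * lin \<gamma> p"
  have "det3 v \<beta> \<gamma> * lin w (cross p q) = 0" for w
  proof -
    \<comment> \<open>The product of two determinants is the determinant of the matrix of pairings,
      expanded here along the row of \<open>v\<close>.\<close>
    have "det3 v \<beta> \<gamma> * lin w (cross p q) =
       lin v w * (lin \<beta> p * lin \<gamma> q - lin \<beta> q * lin \<gamma> p)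
       + lin v p * (lin \<beta> q * lin \<gamma> w - lin \<beta> w * lin \<gamma> q)
       + lin v q * (lin \<beta> w * lin \<gamma> p - lin \<beta> p * lin \<gamma> w)"
      by (cases v; cases \<beta>; cases \<gamma>; cases w; cases p; cases q; hypsubst)
        (simp add: det3_def algebra_simps)
    thus ?thesis using assms eq by simp
  qed
  hence "lin w (cross p q) = 0" for w using assms(1) by simp
  thus False using nonzero_witness[OF assms(4)] by blast
qed

text \<open>A nonzero binary form of degree \<open>e\<close> has at most \<open>e\<close> projective
  roots. Dehomogenising loses the root at infinity, so points with second coordinate 0 need a
  separate argument.\<close>

lemma binary_form_zero:
  fixes c :: "nat \<Rightarrow> 'k::field"
  assumes "finite S" "e < card S"
    and van: "\<And>b g. (b, g) \<in> S \<Longrightarrow> (\<Sum>i\<le>e. c i * (b ^ i * g ^ (e - i))) = 0"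
    and sep: "\<And>s t. s \<in> S \<Longrightarrow> t \<in> S \<Longrightarrow> s \<noteq> t \<Longrightarrow> fst s * snd t \<noteq> fst t * snd s"
    and "i \<le> e"
  shows "c i = 0"
proof -
  define q where "q = (\<Sum>i\<le>e. monom (c i) i)"
  have cq: "coeff q i = (if i \<le> e then c i else 0)" for i
    by (simp add: q_def coeff_sum)
  have dq: "degree q \<le> e" by (rule degree_le) (simp add: cq)
  define S1 where "S1 = {s \<in> S. snd s \<noteq> 0}"
  have fin: "finite S1" using assms(1) by (simp add: S1_def)
  have root: "poly q (fst s / snd s) = 0" if "s \<in> S1" for s
  proof -
    obtain b g where s: "s = (b, g)" by (cases s)
    have g: "g \<noteq> 0" "(b, g) \<in> S" using that s by (auto simp: S1_def)
    have "poly q (b / g) * g ^ e = (\<Sum>i\<le>e. c i * (b / g) ^ i * g ^ e)"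
      by (simp add: q_def poly_sum poly_monom sum_distrib_right)
    also have "\<dots> = (\<Sum>i\<le>e. c i * (b ^ i * g ^ (e - i)))"
      using g by (intro sum.cong) (auto simp: power_divide power_diff)
    also have "\<dots> = 0" by (rule van[OF g(2)])
    finally show ?thesis using g s by simp
  qed
  have inj: "inj_on (\<lambda>s. fst s / snd s) S1"
    by (rule inj_onI) (use sep in \<open>auto simp: S1_def field_simps\<close>)
  have "q = 0"
  proof (rule ccontr)
    assume "q \<noteq> 0"
    have "card S1 = card ((\<lambda>s. fst s / snd s) ` S1)" by (simp add: card_image[OF inj])
    also have "\<dots> \<le> card {x. poly q x = 0}"
      by (intro card_mono poly_roots_finite \<open>q \<noteq> 0\<close>) (use root in auto)
    also have "\<dots> \<le> degree q" by (rule card_poly_roots_bound[OF \<open>q \<noteq> 0\<close>])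
    finally have le: "card S1 \<le> degree q" .
    \<comment> \<open>If all points were affine, \<open>q\<close> would have more than
      \<open>e\<close> roots. So there is a point at infinity, and only one by \<open>sep\<close>;
      there only the top coefficient survives, and its vanishing contradicts the \<open>e\<close>
      affine roots.\<close>
    hence "S1 \<noteq> S" using dq assms(2) by auto
    then obtain s where s: "s \<in> S" "snd s = 0" by (auto simp: S1_def)
    have "t = s" if t: "t \<in> S" "snd t = 0" for t
    proof (rule ccontr)
      assume "t \<noteq> s"
      from sep[OF t(1) s(1) this] show False using s t by simp
    qed
    hence "S \<subseteq> insert s S1" unfolding S1_def by blast
    hence "card S \<le> card (insert s S1)" using fin by (intro card_mono) auto
    also have "\<dots> \<le> Suc (card S1)" using fin by (simp add: card_insert_if)
    finally have "card S \<le> Suc (card S1)" .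
    hence ce: "e \<le> card S1" using assms(2) by simp
    have "(\<Sum>i\<le>e. c i * (fst s ^ i * snd s ^ (e - i))) = 0" using van[of "fst s" "snd s"] s(1) by simp
    moreover have "(\<Sum>i\<le>e. c i * (fst s ^ i * snd s ^ (e - i))) = (\<Sum>i\<in>{e}. c i * (fst s ^ i * snd s ^ (e - i)))"
      by (rule sum.mono_neutral_right) (auto simp: s)
    ultimately have ces: "c e * fst s ^ e = 0" by simp
    have "c e = 0"
    proof (cases "e = 0")
      case False
      hence "S1 \<noteq> {}" using ce by auto
      then obtain t where "t \<in> S" "snd t \<noteq> 0" by (auto simp: S1_def)
      hence "fst s \<noteq> 0" using sep[of s t] s by force
      thus ?thesis using ces by simp
    qed (use ces in simp)
    hence "coeff q e = 0" by (simp add: cq)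
    moreover have "degree q = e" using dq le ce by simp
    ultimately show False using \<open>q \<noteq> 0\<close> by (metis leading_coeff_0_iff)
  qed
  thus ?thesis using cq[of i] assms(5) by simp
qed

text \<open>The nonvanishing cross products say that the members are distinct as projective
  points.\<close>

definition gen_pts :: "'k::field pt \<Rightarrow> 'k pt set \<Rightarrow> bool" where
  "gen_pts v P \<longleftrightarrow> finite P \<and> (\<forall>p\<in>P. lin v p = 0) \<and> (\<forall>p\<in>P. \<forall>q\<in>P. p \<noteq> q \<longrightarrow> cross p q \<noteq> z3)"

lemma binary_form_zero_on_line:
  assumes "det3 v \<beta> \<gamma> \<noteq> (0::'k::field)" "gen_pts v P" "e < card P"
    and "\<And>p. p \<in> P \<Longrightarrow> (\<Sum>i\<le>e. c i * (lin \<beta> p ^ i * lin \<gamma> p ^ (e - i))) = 0" "i \<le> e"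
  shows "c i = 0"
proof -
  define h where "h p = (lin \<beta> p, lin \<gamma> p)" for p
  have sep: "fst (h p) * snd (h q) \<noteq> fst (h q) * snd (h p)" if "p \<in> P" "q \<in> P" "p \<noteq> q" for p q
    using frame_separates[OF assms(1), of p q] that assms(2) by (simp add: h_def gen_pts_def)
  hence inj: "inj_on h P" by (intro inj_onI) (metis mult.commute)
  show ?thesis
  proof (rule binary_form_zero[of "h ` P" e c])
    show "finite (h ` P)" "e < card (h ` P)"
      using assms(2,3) by (auto simp: gen_pts_def card_image[OF inj])
    show "(\<Sum>i\<le>e. c i * (b ^ i * g ^ (e - i))) = 0" if "(b, g) \<in> h ` P" for b g
      using that assms(4) by (auto simp: h_def)
    show "fst s * snd t \<noteq> fst t * snd s" if st: "s \<in> h ` P" "t \<in> h ` P" "s \<noteq> t" for s t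
    proof -
      obtain p q where "p \<in> P" "q \<in> P" "s = h p" "t = h q" using st by blast
      thus ?thesis using sep[of p q] st(3) by blast
    qed
  qed fact
qed

text \<open>Forms of degree \<open>e - 1\<close>, with degree -1 giving only zero; truncated
  subtraction would produce constants for \<open>e = 0\<close>.\<close>

definition pforms :: "nat \<Rightarrow> ('k::field pt \<Rightarrow> 'k) set" where
  "pforms e = (if e = 0 then {\<lambda>_. 0} else forms (e - 1))"

lemma pforms_lin_mult: "g \<in> pforms e \<Longrightarrow> (\<lambda>x. lin v x * g x) \<in> forms e"
  by (cases e) (auto simp: pforms_def forms_lin_mult)

lemma binary_forms: "(\<lambda>p. lin \<beta> p ^ i * lin \<gamma> p ^ j) \<in> forms (i + j)"
  using forms_mult[OF forms_power[OF lin_forms, of \<beta> i] forms_power[OF lin_forms, of \<gamma> j]] by simp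

text \<open>The binary part is the trace of the form on the line \<open>v\<close>. One linear factor
  is split off a monomial and expanded in the frame by \<open>cramer\<close>; the rest is known by
  induction on the degree.\<close>

lemma forms_decompose:
  assumes "det3 v \<beta> \<gamma> \<noteq> (0::'k::field)" "f \<in> forms e"
  shows "\<exists>g c. g \<in> pforms e \<and> (\<forall>p. f p = lin v p * g p + (\<Sum>i\<le>e. c i * (lin \<beta> p ^ i * lin \<gamma> p ^ (e - i))))"
  using assms(2)
proof (induction e arbitrary: f)
  case 0
  obtain a where a: "\<And>p. f p = a" using forms_0_const[OF 0] by metis
  show ?case by (rule exI[of _ "\<lambda>_. 0"], rule exI[of _ "\<lambda>_. a"]) (simp add: pforms_def a)
next
  case (Suc e)
  show ?case using Suc.prems unfolding forms_def
  proof (induction rule: lspan.induct)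
    case lspan_zero
    show ?case
      by (rule exI[of _ "\<lambda>_. 0"], rule exI[of _ "\<lambda>_. 0"]) (simp add: pforms_def)
  next
    case (lspan_step g b a)
    then obtain g1 c1 where g1: "g1 \<in> pforms (Suc e)"
      "\<And>p. g p = lin v p * g1 p + (\<Sum>i\<le>Suc e. c1 i * (lin \<beta> p ^ i * lin \<gamma> p ^ (Suc e - i)))" by blast
    obtain x y z where b: "b = mono3 (x, y, z)" "x + y + z = Suc e" using lspan_step.hyps(2) by force
    have "\<exists>w m. m \<in> mons e \<and> (\<forall>p. b p = lin w p * mono3 m p)"
    proof -
      consider "x > 0" | "y > 0" | "z > 0" using b by linarith
      thus ?thesis
      proof cases
        case 1
        have "b p = lin e1 p * mono3 (x - 1, y, z) p" for p
          unfolding b(1) using 1 by (cases p; cases x) (auto simp: mult_ac)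
        thus ?thesis using b 1 by (intro exI[of _ e1] exI[of _ "(x - 1, y, z)"]) auto
      next
        case 2
        have "b p = lin e2 p * mono3 (x, y - 1, z) p" for p
          unfolding b(1) using 2 by (cases p; cases y) (auto simp: mult_ac)
        thus ?thesis using b 2 by (intro exI[of _ e2] exI[of _ "(x, y - 1, z)"]) auto
      next
        case 3
        have "b p = lin e3 p * mono3 (x, y, z - 1) p" for p
          unfolding b(1) using 3 by (cases p; cases z) (auto simp: mult_ac)
        thus ?thesis using b 3 by (intro exI[of _ e3] exI[of _ "(x, y, z - 1)"]) auto
      qed
    qed
    then obtain w m where m: "m \<in> mons e" "\<And>p. b p = lin w p * mono3 m p" by blast
    obtain g2 c2 where g2: "g2 \<in> pforms e"
      "\<And>p. mono3 m p = lin v p * g2 p + (\<Sum>i\<le>e. c2 i * (lin \<beta> p ^ i * lin \<gamma> p ^ (e - i)))"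
      using Suc.IH[OF forms_mono3[OF m(1)]] by blast
    obtain k1 k2 k3 where w: "\<And>p. lin w p = k1 * lin v p + k2 * lin \<beta> p + k3 * lin \<gamma> p"
      using cramer[OF assms(1)] by blast
    define B where "B p = (\<Sum>i\<le>e. c2 i * (lin \<beta> p ^ i * lin \<gamma> p ^ (e - i)))" for p
    have "B \<in> forms e" unfolding B_def
    proof (intro forms_sum forms_scale)
      fix i assume "i \<in> {..e}"
      thus "(\<lambda>p. lin \<beta> p ^ i * lin \<gamma> p ^ (e - i)) \<in> forms e" using binary_forms[of \<beta> i \<gamma> "e - i"] by simp
    qed
    define G where "G p = g1 p + a * (lin w p * g2 p + k1 * B p)" for p
    define C where "C i = c1 i + a * ((if i = 0 then 0 else k2 * c2 (i - 1)) + (if i = Suc e then 0 else k3 * c2 i))" for i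
    have G: "G \<in> pforms (Suc e)"
      unfolding G_def using g1(1) pforms_lin_mult[OF g2(1), of w] \<open>B \<in> forms e\<close>
      by (auto simp: pforms_def intro!: forms_add forms_scale)
    have shift: "lin \<beta> p * B p = (\<Sum>i\<le>Suc e. (if i = 0 then 0 else c2 (i - 1)) * (lin \<beta> p ^ i * lin \<gamma> p ^ (Suc e - i)))" for p
      unfolding B_def by (subst sum.atMost_Suc_shift) (simp add: sum_distrib_left mult_ac)
    have shift': "lin \<gamma> p * B p = (\<Sum>i\<le>Suc e. (if i = Suc e then 0 else c2 i) * (lin \<beta> p ^ i * lin \<gamma> p ^ (Suc e - i)))" for p
    proof -
      have "lin \<gamma> p * B p = (\<Sum>i\<le>e. c2 i * (lin \<beta> p ^ i * lin \<gamma> p ^ (Suc e - i)))"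
        unfolding B_def sum_distrib_left by (intro sum.cong) (auto simp: Suc_diff_le mult_ac)
      thus ?thesis by simp
    qed
    have "g p + a * b p = lin v p * G p + (\<Sum>i\<le>Suc e. C i * (lin \<beta> p ^ i * lin \<gamma> p ^ (Suc e - i)))" for p
    proof -
      have "b p = lin v p * (lin w p * g2 p + k1 * B p) + (k2 * (lin \<beta> p * B p) + k3 * (lin \<gamma> p * B p))"
        unfolding m(2) g2(2) B_def[symmetric] by (simp add: algebra_simps) (simp add: w algebra_simps)
      moreover have "(\<Sum>i\<le>Suc e. C i * (lin \<beta> p ^ i * lin \<gamma> p ^ (Suc e - i)))
        = (\<Sum>i\<le>Suc e. c1 i * (lin \<beta> p ^ i * lin \<gamma> p ^ (Suc e - i))) + a * (k2 * (lin \<beta> p * B p) + k3 * (lin \<gamma> p * B p))"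
        unfolding shift shift' sum_distrib_left sum.distrib[symmetric]
        by (intro sum.cong) (auto simp: C_def algebra_simps)
      ultimately show ?thesis unfolding g1(2) G_def by (simp only: distrib_left) (simp only: ac_simps)
    qed
    thus ?case using G by blast
  qed
qed

text \<open>With more than \<open>e\<close> zeros on the line, the binary part of the decomposition
  vanishes.\<close>

lemma forms_divisible_by_line:
  assumes "v \<noteq> z3" "f \<in> forms e" "gen_pts v P" "e < card P" "\<And>p. p \<in> P \<Longrightarrow> f p = (0::'k::field)"
  shows "\<exists>g \<in> pforms e. \<forall>p. f p = lin v p * g p"
proof -
  obtain \<beta> \<gamma> where fr: "det3 v \<beta> \<gamma> \<noteq> 0" using frame_exists[OF assms(1)] by blast
  obtain g c where g: "g \<in> pforms e"
    "\<And>p. f p = lin v p * g p + (\<Sum>i\<le>e. c i * (lin \<beta> p ^ i * lin \<gamma> p ^ (e - i)))"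
    using forms_decompose[OF fr assms(2)] by blast
  have "c i = 0" if "i \<le> e" for i
  proof (rule binary_form_zero_on_line[OF fr assms(3,4) _ that])
    fix p assume p: "p \<in> P"
    hence "lin v p = 0" using assms(3) by (simp add: gen_pts_def)
    thus "(\<Sum>i\<le>e. c i * (lin \<beta> p ^ i * lin \<gamma> p ^ (e - i))) = 0" using g(2)[of p] assms(5)[OF p] by simp
  qed
  thus ?thesis using g by (intro bexI[of _ g]) auto
qed

text \<open>With a second point \<open>b\<close> of the line, the points \<open>q + t b\<close> are
  pairwise distinct, and \<open>f\<close> is a polynomial in \<open>t\<close> that does not vanish
  at \<open>t = 0\<close>.\<close>

lemma gen_pts_avoiding:
  fixes v :: "'k::alg_closed_field pt"
  assumes "v \<noteq> z3" "f \<in> forms a" "lin v q = 0" "q \<noteq> z3" "f q \<noteq> 0"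
  shows "\<exists>P. gen_pts v P \<and> card P = n \<and> (\<forall>p\<in>P. f p \<noteq> 0)"
proof -
  obtain w where w: "lin w q \<noteq> 0" using nonzero_witness[OF assms(4)] by blast
  define b where "b = cross v w"
  have vb: "lin v b = 0" by (simp add: b_def lin_cross_self)
  obtain q1 q2 q3 b1 b2 b3 where qb: "q = (q1, q2, q3)" "b = (b1, b2, b3)" by (cases q; cases b) auto
  have qb0: "cross q b \<noteq> z3"
  proof -
    \<comment> \<open>Triple product expansion; as \<open>q\<close> lies on \<open>v\<close>, only
      the multiple of \<open>v\<close> remains.\<close>
    have "cross q b = comb (lin w q) v (- lin v q) w"
      unfolding b_def by (cases v; cases w; cases q) (simp add: algebra_simps)
    thus ?thesis using w assms(1,3) by (cases v; cases w) auto
  qed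
  define P where "P t = (poly [:q1, b1:] t, poly [:q2, b2:] t, poly [:q3, b3:] t)" for t
  have Pc: "P t = comb 1 q t b" for t by (simp add: P_def qb mult.commute)
  obtain p where p: "\<And>t. f (P t) = poly p t" using forms_path[OF assms(2)] unfolding P_def by blast
  have "poly p 0 \<noteq> 0" using p[of 0, symmetric] assms(5) by (simp add: P_def qb)
  hence "finite {t. poly p t = 0}" by (intro poly_roots_finite) auto
  hence "infinite (UNIV - {t. poly p t = 0})" using infinite_alg_closed_field by (simp add: Diff_infinite_finite)
  then obtain T where T: "T \<subseteq> UNIV - {t. poly p t = 0}" "finite T" "card T = n"
    by (meson infinite_arbitrarily_large)
  have cr: "cross (P s) (P t) = comb (t - s) (cross q b) 0 z3" for s t
    by (simp add: Pc qb algebra_simps)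
  have ne: "cross (P s) (P t) \<noteq> z3" if "s \<noteq> t" for s t
    using that qb0 unfolding cr by (cases "cross q b") auto
  have inj: "inj_on P T"
  proof (rule inj_onI, rule ccontr)
    fix s t assume "P s = P t" "s \<noteq> t"
    hence "cross (P s) (P t) = z3" by (cases "P t") (simp add: algebra_simps)
    thus False using ne[OF \<open>s \<noteq> t\<close>] by simp
  qed
  have "lin v (P t) = 0" for t
    unfolding Pc lin_comb_right using assms(3) vb by simp
  moreover have "cross x y \<noteq> z3" if xy: "x \<in> P ` T" "y \<in> P ` T" "x \<noteq> y" for x y
  proof -
    obtain s t where "x = P s" "y = P t" using xy by blast
    thus ?thesis using ne[of s t] xy(3) by blast
  qed
  ultimately have "gen_pts v (P ` T)"
    using T unfolding gen_pts_def by blast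
  moreover have "card (P ` T) = n" using T by (simp add: card_image[OF inj])
  moreover have "\<forall>x\<in>P ` T. f x \<noteq> 0" using T p by auto
  ultimately show ?thesis by blast
qed

text \<open>Each line is a factor, and dividing it off lowers the degree by one; there are more
  lines than the degree can accommodate.\<close>

lemma forms_zero_of_many_lines:
  fixes v :: "'j \<Rightarrow> 'k::alg_closed_field pt"
  assumes "finite J" "K \<in> forms e" "e < card J"
    and "\<And>i j. i \<in> J \<Longrightarrow> j \<in> J \<Longrightarrow> i \<noteq> j \<Longrightarrow> cross (v i) (v j) \<noteq> z3"
    and "\<And>j. j \<in> J \<Longrightarrow> v j \<noteq> z3"
    and "\<And>j p. j \<in> J \<Longrightarrow> lin (v j) p = 0 \<Longrightarrow> K p = 0"
  shows "K p = 0"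
  using assms
proof (induction e arbitrary: J K p)
  case 0
  then obtain j where "j \<in> J" by fastforce
  hence "K z3 = 0" using 0(6)[of j z3] by (cases "v j") simp
  thus ?case using forms_0_const[OF 0(2), of p z3] by simp
next
  case (Suc e)
  then obtain j where j: "j \<in> J" by fastforce
  have pt: "\<exists>q. lin (v i) q = 0 \<and> q \<noteq> z3" if "i \<in> J" for i
  proof -
    obtain \<beta> \<gamma> where "det3 (v i) \<beta> \<gamma> \<noteq> 0" using frame_exists Suc.prems(5)[OF \<open>i \<in> J\<close>] by blast
    hence "cross (v i) \<beta> \<noteq> z3" unfolding det3_def using lin_cross_rotate[of "v i" \<beta> \<gamma>] by (cases \<gamma>) auto
    thus ?thesis using lin_cross_self(1) by blast
  qed
  obtain q where q: "lin (v j) q = 0" "q \<noteq> z3" using pt[OF j] by blast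
  obtain P where P: "gen_pts (v j) P" "card P = Suc (Suc e)"
    using gen_pts_avoiding[OF Suc.prems(5)[OF j] forms_const[of 1] q, of "Suc (Suc e)"] by auto
  obtain g where g: "g \<in> pforms (Suc e)" "\<And>p. K p = lin (v j) p * g p"
    using forms_divisible_by_line[OF Suc.prems(5)[OF j] Suc.prems(2) P(1)] P(2)
      Suc.prems(6)[OF j] P(1) by (auto simp: gen_pts_def)
  have gz: "g p = 0" for p
  proof (rule Suc.IH[of "J - {j}"])
    show "finite (J - {j})" "e < card (J - {j})" using Suc.prems j by auto
    show "g \<in> forms e" using g(1) by (simp add: pforms_def)
    show "cross (v i) (v i') \<noteq> z3" if "i \<in> J - {j}" "i' \<in> J - {j}" "i \<noteq> i'" for i i'
      using that Suc.prems(4) by auto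
    show "v i \<noteq> z3" if "i \<in> J - {j}" for i using that Suc.prems(5) by auto
    \<comment> \<open>On the line \<open>v i\<close> the quotient is known to vanish only off
      \<open>v j\<close>. Enough points of this kind exist to make \<open>v i\<close> a factor, and
      then the quotient vanishes on the whole line.\<close>
    show "g p = 0" if i: "i \<in> J - {j}" and pi: "lin (v i) p = 0" for i p
    proof -
      have vi: "v i \<noteq> z3" using i Suc.prems(5) by auto
      have "cross (v i) (v j) \<noteq> z3" using i j Suc.prems(4) by auto
      then obtain w where "lin w (cross (v i) (v j)) \<noteq> 0" using nonzero_witness by blast
      hence w: "lin (v j) (cross w (v i)) \<noteq> 0" using lin_cross_rotate by metis
      hence "cross w (v i) \<noteq> z3" by (cases "v j") auto
      then obtain Q where Q: "gen_pts (v i) Q" "card Q = Suc e" "\<forall>p\<in>Q. lin (v j) p \<noteq> 0"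
        using gen_pts_avoiding[OF vi lin_forms lin_cross_self(2) _ w] by blast
      have "g p = 0" if "p \<in> Q" for p
        using that Q Suc.prems(6)[of i p] i g(2)[of p] by (auto simp: gen_pts_def)
      then obtain h where "\<And>p. g p = lin (v i) p * h p"
        using forms_divisible_by_line[OF vi \<open>g \<in> forms e\<close> Q(1)] Q(2) by auto
      from this[of p] show ?thesis using pi by simp
    qed
  qed
  thus ?case by (simp add: g(2))
qed

section \<open>Tangent spaces at products of lines\<close>

text \<open>The Boolean distinguishes the two products, the numbers are block and position.
  Configurations are total functions and do not depend on the degrees, so adding a line just
  overwrites one entry.\<close>

type_synonym 'k config = "bool \<Rightarrow> nat \<Rightarrow> nat \<Rightarrow> 'k pt"

definition blk :: "(nat \<Rightarrow> nat \<Rightarrow> 'k::field pt) \<Rightarrow> (nat \<Rightarrow> nat) \<Rightarrow> nat \<Rightarrow> 'k pt \<Rightarrow> 'k" where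
  "blk c n i p = (\<Prod>j<n i. lin (c i j) p)"

definition cof :: "nat \<Rightarrow> (nat \<Rightarrow> nat) \<Rightarrow> (nat \<Rightarrow> nat \<Rightarrow> 'k::field pt) \<Rightarrow> nat \<Rightarrow> 'k pt \<Rightarrow> 'k" where
  "cof r n c i p = (\<Prod>j\<in>{..<r} - {i}. blk c n j p)"

text \<open>The coefficients \<open>a\<close> are kept apart from the lines: for fixed
  \<open>a\<close> the value is polynomial in the configuration, which lets independence spread from
  one configuration to general ones.\<close>

definition tval :: "bool set \<Rightarrow> nat \<Rightarrow> (nat \<Rightarrow> nat) \<Rightarrow> 'k::field config \<Rightarrow> (bool \<Rightarrow> nat \<Rightarrow> 'k pt \<Rightarrow> 'k) \<Rightarrow> 'k pt \<Rightarrow> 'k" where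
  "tval S r n u a p = (\<Sum>s\<in>S. \<Sum>i<r. a s i p * cof r n (u s) i p)"

definition tcoef :: "nat \<Rightarrow> (nat \<Rightarrow> nat) \<Rightarrow> (bool \<Rightarrow> nat \<Rightarrow> 'k::field pt \<Rightarrow> 'k) \<Rightarrow> bool" where
  "tcoef r n a \<longleftrightarrow> (\<forall>s. \<forall>i<r. a s i \<in> forms (n i))"

text \<open>The tangent space at the product of lines given by \<open>u True\<close> for \<open>S = {True}\<close>,
  and the span of the tangent spaces at the two products for \<open>S = UNIV\<close>.\<close>

definition tsp :: "bool set \<Rightarrow> nat \<Rightarrow> (nat \<Rightarrow> nat) \<Rightarrow> 'k::field config \<Rightarrow> ('k pt \<Rightarrow> 'k) set" where
  "tsp S r n u = {tval S r n u a | a. tcoef r n a}"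

definition rank_ge :: "'k::field itself \<Rightarrow> bool set \<Rightarrow> nat \<Rightarrow> (nat \<Rightarrow> nat) \<Rightarrow> nat \<Rightarrow> bool" where
  "rank_ge _ S r n N \<longleftrightarrow> (\<exists>u b. (\<forall>k<N. b k \<in> tsp S r n u) \<and> indep {..<N} b (UNIV :: 'k pt set))"

lemma blk_forms: "blk c n i \<in> forms (n i)"
proof -
  have "(\<lambda>p. \<Prod>j<n i. lin (c i j) p) \<in> forms (\<Sum>j<n i. 1)"
    by (rule forms_prod) (auto intro: lin_forms[unfolded One_nat_def])
  thus ?thesis by (simp add: blk_def[abs_def])
qed

lemma cof_forms: "cof r n c i \<in> forms (\<Sum>j\<in>{..<r} - {i}. n j)"
  unfolding cof_def[abs_def] by (rule forms_prod) (auto intro: blk_forms)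

lemma tsp_forms:
  assumes "f \<in> tsp S r n u"
  shows "f \<in> forms (\<Sum>i<r. n i)"
proof -
  obtain a where a: "f = tval S r n u a" "tcoef r n a" using assms by (auto simp: tsp_def)
  have "(\<lambda>p. a s i p * cof r n (u s) i p) \<in> forms (\<Sum>i<r. n i)" if "i < r" for s i
  proof -
    have "(\<lambda>p. a s i p * cof r n (u s) i p) \<in> forms (n i + (\<Sum>j\<in>{..<r} - {i}. n j))"
      using a(2) that by (intro forms_mult cof_forms) (auto simp: tcoef_def)
    thus ?thesis using that by (simp add: sum.remove[of "{..<r}" i n])
  qed
  thus ?thesis unfolding a(1) tval_def[abs_def] by (intro forms_sum) auto
qed

lemma rank_geI:
  assumes "finite I" "N \<le> card I" "\<And>k. k \<in> I \<Longrightarrow> b k \<in> tsp S r n u" "indep I b (UNIV :: 'k::field pt set)"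
  shows "rank_ge TYPE('k) S r n N"
proof -
  obtain J where J: "J \<subseteq> I" "card J = N" using assms(2) obtain_subset_with_card_n by metis
  have "finite J" using J assms(1) finite_subset by blast
  then obtain h where h: "bij_betw h {..<N} J"
    using J(2) by (metis bij_betw_from_nat_into_finite card_Collect_less_nat ex_bij_betw_nat_finite lessThan_atLeast0)
  have "indep J b UNIV" by (rule indep_subset[OF assms(4) J(1) assms(1)])
  moreover have inj: "inj_on h {..<N}" and im: "h ` {..<N} = J" using h by (auto simp: bij_betw_def)
  ultimately have "indep {..<N} (\<lambda>k. b (h k)) UNIV" using indep_reindex[OF inj, of b UNIV] by simp
  moreover have "\<forall>k<N. b (h k) \<in> tsp S r n u" using h J assms(3) unfolding bij_betw_def by blast
  ultimately show ?thesis unfolding rank_ge_def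
    by (intro exI[of _ u] exI[of _ "\<lambda>k. b (h k)"]) auto
qed

subsection \<open>Generic configurations\<close>

definition cpath :: "'k::field config \<Rightarrow> 'k config \<Rightarrow> 'k \<Rightarrow> 'k config" where
  "cpath u v t s i j = comb (1 - t) (u s i j) t (v s i j)"

definition polyc :: "('k::field config \<Rightarrow> 'k) \<Rightarrow> bool" where
  "polyc \<Phi> \<longleftrightarrow> (\<forall>u v. \<exists>p. \<forall>t. \<Phi> (cpath u v t) = poly p t)"

text \<open>Only the behaviour along lines through a member is recorded. This weak openness is
  enough to meet two nonempty open sets: they intersect on the line joining a member of
  each.\<close>

definition zopen :: "('k::field config \<Rightarrow> bool) \<Rightarrow> bool" where
  "zopen C \<longleftrightarrow> (\<forall>u v. C u \<longrightarrow> (\<forall>\<^sub>F t in cofinite. C (cpath u v t)))"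

lemma cpath_0 [simp]: "cpath u v 0 = u"
proof (intro ext)
  fix s i j show "cpath u v 0 s i j = u s i j"
    by (cases "u s i j"; cases "v s i j") (simp add: cpath_def)
qed

lemma cpath_swap: "cpath u v t = cpath v u (1 - t)"
proof (intro ext)
  fix s i j show "cpath u v t s i j = cpath v u (1 - t) s i j"
    by (cases "u s i j"; cases "v s i j") (simp add: cpath_def)
qed

lemma polyc_const: "polyc (\<lambda>u. a)"
  unfolding polyc_def by (intro allI exI[of _ "[:a:]"]) simp

lemma polyc_add: "polyc f \<Longrightarrow> polyc g \<Longrightarrow> polyc (\<lambda>u. f u + g u)"
  unfolding polyc_def by (metis poly_add)

lemma polyc_diff: "polyc f \<Longrightarrow> polyc g \<Longrightarrow> polyc (\<lambda>u. f u - g u)"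
  unfolding polyc_def by (metis poly_diff)

lemma polyc_mult: "polyc f \<Longrightarrow> polyc g \<Longrightarrow> polyc (\<lambda>u. f u * g u)"
  unfolding polyc_def by (metis poly_mult)

lemma polyc_sum: "(\<And>i. i \<in> I \<Longrightarrow> polyc (f i)) \<Longrightarrow> polyc (\<lambda>u. \<Sum>i\<in>I. f i u)"
  by (induction I rule: infinite_finite_induct) (auto intro: polyc_const polyc_add)

lemma polyc_prod: "(\<And>i. i \<in> I \<Longrightarrow> polyc (f i)) \<Longrightarrow> polyc (\<lambda>u. \<Prod>i\<in>I. f i u)"
  by (induction I rule: infinite_finite_induct) (auto intro: polyc_const polyc_mult)

definition polyv :: "('k::field config \<Rightarrow> 'k pt) \<Rightarrow> bool" where
  "polyv A \<longleftrightarrow> polyc (\<lambda>u. fst (A u)) \<and> polyc (\<lambda>u. fst (snd (A u))) \<and> polyc (\<lambda>u. snd (snd (A u)))"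

lemma polyv_line: "polyv (\<lambda>u. u s i j)"
proof -
  have "\<exists>p. \<forall>t. fst (cpath u v t s i j) = poly p t" for u v :: "'a config"
    by (intro exI[of _ "[:fst (u s i j), fst (v s i j) - fst (u s i j):]"] allI, cases "u s i j"; cases "v s i j")
      (simp add: cpath_def algebra_simps)
  moreover have "\<exists>p. \<forall>t. fst (snd (cpath u v t s i j)) = poly p t" for u v :: "'a config"
    by (intro exI[of _ "[:fst (snd (u s i j)), fst (snd (v s i j)) - fst (snd (u s i j)):]"] allI, cases "u s i j"; cases "v s i j")
      (simp add: cpath_def algebra_simps)
  moreover have "\<exists>p. \<forall>t. snd (snd (cpath u v t s i j)) = poly p t" for u v :: "'a config"
    by (intro exI[of _ "[:snd (snd (u s i j)), snd (snd (v s i j)) - snd (snd (u s i j)):]"] allI, cases "u s i j"; cases "v s i j")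
      (simp add: cpath_def algebra_simps)
  ultimately show ?thesis unfolding polyv_def polyc_def by blast
qed

lemma polyv_const: "polyv (\<lambda>u. p)"
  by (simp add: polyv_def polyc_const)

lemma cross_alt: "cross p q = (fst (snd p) * snd (snd q) - snd (snd p) * fst (snd q),
    snd (snd p) * fst q - fst p * snd (snd q), fst p * fst (snd q) - fst (snd p) * fst q)"
  by (cases p; cases q) simp

lemma lin_alt: "lin p q = fst p * fst q + fst (snd p) * fst (snd q) + snd (snd p) * snd (snd q)"
  by (cases p; cases q) simp

lemma polyv_cross: "polyv A \<Longrightarrow> polyv B \<Longrightarrow> polyv (\<lambda>u. cross (A u) (B u))"
  unfolding polyv_def cross_alt by (auto intro!: polyc_diff polyc_mult)

lemma polyc_lin: "polyv A \<Longrightarrow> polyv B \<Longrightarrow> polyc (\<lambda>u. lin (A u) (B u))"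
  unfolding polyv_def lin_alt by (auto intro!: polyc_add polyc_mult)

lemma polyc_tval: "polyc (\<lambda>u. tval S r n u a p)"
  unfolding tval_def cof_def blk_def
  by (intro polyc_sum polyc_mult polyc_prod polyc_const polyc_lin polyv_line polyv_const)

lemma zopen_nonzero:
  assumes "polyc \<Phi>" shows "zopen (\<lambda>u. \<Phi> u \<noteq> 0)"
  unfolding zopen_def
proof (intro allI impI)
  fix u v assume nz: "\<Phi> u \<noteq> 0"
  obtain p where p: "\<And>t. \<Phi> (cpath u v t) = poly p t" using assms unfolding polyc_def by blast
  have "poly p 0 \<noteq> 0" using nz p[of 0] by simp
  hence "p \<noteq> 0" by auto
  thus "\<forall>\<^sub>F t in cofinite. \<Phi> (cpath u v t) \<noteq> 0" unfolding p by (rule cofinite_poly_nonzero)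
qed

lemma zopen_indep:
  fixes b :: "'i \<Rightarrow> 'k::alg_closed_field config \<Rightarrow> 'k pt \<Rightarrow> 'k"
  assumes "finite I" "\<And>i p. i \<in> I \<Longrightarrow> polyc (\<lambda>u. b i u p)"
  shows "zopen (\<lambda>u. indep I (\<lambda>i. b i u) UNIV)"
  unfolding zopen_def
proof (intro allI impI)
  fix u v assume "indep I (\<lambda>i. b i u) UNIV"
  thus "\<forall>\<^sub>F t in cofinite. indep I (\<lambda>i. b i (cpath u v t)) UNIV"
    using assms by (intro indep_cofinite[where ?t0.0 = 0]) (auto simp: polyc_def)
qed

lemma zopen_conj: "zopen C \<Longrightarrow> zopen D \<Longrightarrow> zopen (\<lambda>u. C u \<and> D u)"
  unfolding zopen_def by (auto intro: eventually_conj)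

lemma zopen_meet:
  fixes C :: "'k::alg_closed_field config \<Rightarrow> bool"
  assumes "zopen C" "zopen D" "C u" "D v"
  shows "\<exists>w. C w \<and> D w"
proof -
  have "\<forall>\<^sub>F t in cofinite. C (cpath u v t)" using assms unfolding zopen_def by blast
  moreover have "\<forall>\<^sub>F t in cofinite. D (cpath u v t)"
  proof -
    have "finite {t. \<not> D (cpath v u t)}" using assms unfolding zopen_def eventually_cofinite by blast
    moreover have "{t. \<not> D (cpath u v t)} \<subseteq> (\<lambda>t. 1 - t) ` {t. \<not> D (cpath v u t)}"
    proof
      fix t assume "t \<in> {t. \<not> D (cpath u v t)}"
      hence "1 - t \<in> {t. \<not> D (cpath v u t)}" by (simp add: cpath_swap[of u v])
      thus "t \<in> (\<lambda>t. 1 - t) ` {t. \<not> D (cpath v u t)}" by (intro image_eqI[of _ _ "1 - t"]) auto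
    qed
    ultimately show ?thesis unfolding eventually_cofinite using finite_surj by blast
  qed
  ultimately have "\<forall>\<^sub>F t in cofinite. C (cpath u v t) \<and> D (cpath u v t)" by (rule eventually_conj)
  thus ?thesis using cofinite_exists by blast
qed

lemma zopen_meet_ball:
  fixes C :: "'k::alg_closed_field config \<Rightarrow> bool"
  assumes "finite T" "\<And>\<tau>. \<tau> \<in> T \<Longrightarrow> zopen (E \<tau>)" "\<And>\<tau>. \<tau> \<in> T \<Longrightarrow> \<exists>u. E \<tau> u" "zopen C" "C u"
  shows "zopen (\<lambda>u. C u \<and> (\<forall>\<tau>\<in>T. E \<tau> u)) \<and> (\<exists>w. C w \<and> (\<forall>\<tau>\<in>T. E \<tau> w))"
  using assms
proof (induction T rule: finite_induct)
  case empty
  thus ?case by auto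
next
  case (insert \<tau> T)
  have IH: "zopen (\<lambda>u. C u \<and> (\<forall>\<tau>\<in>T. E \<tau> u))" "\<exists>w. C w \<and> (\<forall>\<tau>\<in>T. E \<tau> w)"
    using insert.IH insert.prems by auto
  obtain v where v: "E \<tau> v" using insert.prems(2)[of \<tau>] by blast
  have o: "zopen (E \<tau>)" using insert.prems(1) by blast
  have eq: "(C u \<and> (\<forall>\<tau>'\<in>insert \<tau> T. E \<tau>' u)) = ((C u \<and> (\<forall>\<tau>\<in>T. E \<tau> u)) \<and> E \<tau> u)" for u by blast
  show ?case unfolding eq
    using zopen_conj[OF IH(1) o] zopen_meet[OF IH(1) o _ v] IH(2) by blast
qed

type_synonym lidx = "bool \<times> nat \<times> nat"

definition lne :: "'k config \<Rightarrow> lidx \<Rightarrow> 'k pt" where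
  "lne u = (\<lambda>(s, i, j). u s i j)"

definition lidx :: "nat \<Rightarrow> (nat \<Rightarrow> nat) \<Rightarrow> lidx set" where
  "lidx r n = UNIV \<times> (SIGMA i:{..<r}. {..<n i})"

text \<open>Besides general position of pairs and triples, the last clause says that the join of two
  meets misses a third meet of other lines. It is needed when the new line has to pass through two
  prescribed meets.\<close>

definition generic :: "lidx set \<Rightarrow> 'k::field config \<Rightarrow> bool" where
  "generic L u \<longleftrightarrow>
     (\<forall>x\<in>L. \<forall>y\<in>L. x \<noteq> y \<longrightarrow> cross (lne u x) (lne u y) \<noteq> z3) \<and> (\<forall>x\<in>L. lne u x \<noteq> z3) \<and>
     (\<forall>x\<in>L. \<forall>y\<in>L. \<forall>z\<in>L. distinct [x, y, z] \<longrightarrow> det3 (lne u x) (lne u y) (lne u z) \<noteq> 0) \<and>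
     (\<forall>a\<in>L. \<forall>b\<in>L. \<forall>c\<in>L. \<forall>d\<in>L. \<forall>e\<in>L. \<forall>f\<in>L. distinct [a, b, c, d, e, f] \<longrightarrow>
        det3 (cross (cross (lne u a) (lne u b)) (cross (lne u c) (lne u d))) (lne u e) (lne u f) \<noteq> 0)"

lemma polyv_lne: "polyv (\<lambda>u. lne u x)"
  by (cases x) (simp add: lne_def polyv_line)

lemma config_of: "\<exists>u. lne u = h"
  by (intro exI[of _ "\<lambda>s i j. h (s, i, j)"]) (simp add: lne_def fun_eq_iff)

lemma generic_exists:
  fixes C :: "'k::alg_closed_field config \<Rightarrow> bool"
  assumes "finite L" "zopen C" "C u"
  shows "\<exists>w. C w \<and> generic L w"
proof -
  define E1 :: "lidx \<Rightarrow> 'k config \<Rightarrow> bool" where "E1 = (\<lambda>x u. lin e1 (lne u x) \<noteq> 0)"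
  define E2 :: "lidx \<times> lidx \<Rightarrow> 'k config \<Rightarrow> bool" where
    "E2 = (\<lambda>(x, y) u. lin e3 (cross (lne u x) (lne u y)) \<noteq> 0)"
  define E3 :: "lidx \<times> lidx \<times> lidx \<Rightarrow> 'k config \<Rightarrow> bool" where
    "E3 = (\<lambda>(x, y, z) u. det3 (lne u x) (lne u y) (lne u z) \<noteq> 0)"
  define E6 :: "lidx \<times> lidx \<times> lidx \<times> lidx \<times> lidx \<times> lidx \<Rightarrow> 'k config \<Rightarrow> bool" where
    "E6 = (\<lambda>(a, b, c, d, e, f) u. det3 (cross (cross (lne u a) (lne u b)) (cross (lne u c) (lne u d))) (lne u e) (lne u f) \<noteq> 0)"
  define T2 where "T2 = (L \<times> L) \<inter> {(x, y). x \<noteq> y}"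
  define T3 where "T3 = (L \<times> L \<times> L) \<inter> {(x, y, z). distinct [x, y, z]}"
  define T6 where "T6 = (L \<times> L \<times> L \<times> L \<times> L \<times> L) \<inter> {(a, b, c, d, e, f). distinct [a, b, c, d, e, f]}"
  have fin: "finite T2" "finite T3" "finite T6"
  proof -
    have "T2 \<subseteq> L \<times> L" "T3 \<subseteq> L \<times> L \<times> L" "T6 \<subseteq> L \<times> L \<times> L \<times> L \<times> L \<times> L"
      unfolding T2_def T3_def T6_def by (rule Int_lower1)+
    thus "finite T2" "finite T3" "finite T6"
      using assms(1) by (meson finite_SigmaI finite_subset)+
  qed
  have o1: "zopen (E1 x)" for x unfolding E1_def
    by (intro zopen_nonzero polyc_lin polyv_lne polyv_const)
  have o2: "zopen (E2 x)" for x unfolding E2_def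
    by (cases x) (simp only: prod.case, intro zopen_nonzero polyc_lin polyv_lne polyv_const polyv_cross)
  have o3: "zopen (E3 x)" for x unfolding E3_def det3_def
    by (cases x) (simp only: prod.case, intro zopen_nonzero polyc_lin polyv_lne polyv_const polyv_cross)
  have o6: "zopen (E6 x)" for x unfolding E6_def det3_def
    by (cases x) (simp only: prod.case, intro zopen_nonzero polyc_lin polyv_lne polyv_const polyv_cross)
  have w1: "\<exists>u. E1 x u" for x
  proof -
    obtain u :: "'k config" where "lne u = (\<lambda>x. e1)" using config_of[of "\<lambda>_. e1"] by blast
    thus ?thesis by (intro exI[of _ u]) (simp add: E1_def)
  qed
  have w2: "\<exists>u. E2 \<tau> u" if \<tau>: "\<tau> \<in> T2" for \<tau>
  proof -
    obtain x y where t1: "\<tau> = (x, y)" by (cases \<tau>)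
    hence t: "\<tau> = (x, y)" "x \<noteq> y" using \<tau> by (simp_all add: T2_def)
    obtain u :: "'k config" where "lne u = (\<lambda>z. if z = x then e1 else e2)"
      using config_of[of "\<lambda>z. if z = x then e1 else e2"] by blast
    thus ?thesis using t by (intro exI[of _ u]) (simp add: E2_def)
  qed
  have w3: "\<exists>u. E3 \<tau> u" if \<tau>: "\<tau> \<in> T3" for \<tau>
  proof -
    obtain x y z where t1: "\<tau> = (x, y, z)" by (rule prod_cases3)
    hence t: "\<tau> = (x, y, z)" "distinct [x, y, z]" using \<tau> by (simp_all add: T3_def)
    obtain u :: "'k config" where "lne u = (\<lambda>w. if w = x then e1 else if w = y then e2 else e3)"
      using config_of[of "\<lambda>w. if w = x then e1 else if w = y then e2 else e3"] by blast
    thus ?thesis using t by (intro exI[of _ u]) (auto simp: E3_def det3_def)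
  qed
  have w6: "\<exists>u. E6 \<tau> u" if \<tau>: "\<tau> \<in> T6" for \<tau>
  proof -
    obtain a b c d e f where t1: "\<tau> = (a, b, c, d, e, f)" by (rule prod_cases6)
    hence t: "\<tau> = (a, b, c, d, e, f)" "distinct [a, b, c, d, e, f]" using \<tau> by (simp_all add: T6_def)
    \<comment> \<open>The meets of \<open>a\<close>, \<open>b\<close> and of \<open>c\<close>,
      \<open>d\<close> become \<open>e1\<close> and \<open>e2\<close>; their join is
      \<open>e3\<close>, and \<open>e3\<close>, \<open>e1\<close>, \<open>e2\<close> have
      determinant 1.\<close>
    obtain u :: "'k config" where "lne u = (\<lambda>w. if w = a then e2 else if w = b then e3 else if w = c then e3
       else if w = d then e1 else if w = e then e1 else e2)"
      using config_of[of "\<lambda>w. if w = a then e2 else if w = b then e3 else if w = c then e3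
       else if w = d then e1 else if w = e then e1 else e2"] by blast
    thus ?thesis using t by (intro exI[of _ u]) (auto simp: E6_def det3_def)
  qed
  note s1 = zopen_meet_ball[where E = E1, OF assms(1) o1 w1 assms(2,3)]
  then obtain u1 where u1: "C u1 \<and> (\<forall>\<tau>\<in>L. E1 \<tau> u1)" by blast
  note s2 = zopen_meet_ball[where E = E2, OF fin(1) o2 w2 conjunct1[OF s1] u1]
  then obtain u2 where u2: "(C u2 \<and> (\<forall>\<tau>\<in>L. E1 \<tau> u2)) \<and> (\<forall>\<tau>\<in>T2. E2 \<tau> u2)" by blast
  note s3 = zopen_meet_ball[where E = E3, OF fin(2) o3 w3 conjunct1[OF s2] u2]
  then obtain u3 where u3: "((C u3 \<and> (\<forall>\<tau>\<in>L. E1 \<tau> u3)) \<and> (\<forall>\<tau>\<in>T2. E2 \<tau> u3)) \<and> (\<forall>\<tau>\<in>T3. E3 \<tau> u3)" by blast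
  note s6 = zopen_meet_ball[where E = E6, OF fin(3) o6 w6 conjunct1[OF s3] u3]
  then obtain w where w: "C w" "\<forall>\<tau>\<in>L. E1 \<tau> w" "\<forall>\<tau>\<in>T2. E2 \<tau> w" "\<forall>\<tau>\<in>T3. E3 \<tau> w" "\<forall>\<tau>\<in>T6. E6 \<tau> w" by blast
  have "generic L w" unfolding generic_def
  proof (intro conjI ballI impI)
    fix x y assume "x \<in> L" "y \<in> L" "x \<noteq> y"
    hence "(x, y) \<in> T2" by (simp add: T2_def)
    hence "E2 (x, y) w" using w(3) by blast
    thus "cross (lne w x) (lne w y) \<noteq> z3" by (auto simp: E2_def)
  next
    fix x assume "x \<in> L"
    hence "E1 x w" using w(2) by blast
    thus "lne w x \<noteq> z3" by (auto simp: E1_def)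
  next
    fix x y z assume "x \<in> L" "y \<in> L" "z \<in> L" "distinct [x, y, z]"
    hence "(x, y, z) \<in> T3" by (simp add: T3_def)
    hence "E3 (x, y, z) w" using w(4) by blast
    thus "det3 (lne w x) (lne w y) (lne w z) \<noteq> 0" by (simp add: E3_def)
  next
    fix a b c d e f assume "a \<in> L" "b \<in> L" "c \<in> L" "d \<in> L" "e \<in> L" "f \<in> L" "distinct [a, b, c, d, e, f]"
    hence "(a, b, c, d, e, f) \<in> T6" unfolding T6_def by simp
    hence "E6 (a, b, c, d, e, f) w" using w(5) by blast
    thus "det3 (cross (cross (lne w a) (lne w b)) (cross (lne w c) (lne w d))) (lne w e) (lne w f) \<noteq> 0"
      by (simp add: E6_def)
  qed
  thus ?thesis using w(1) by blast
qed

subsection \<open>Adding a line to a block\<close>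

text \<open>Elimination in four layers. At the points \<open>P i\<close> only the functions
  \<open>h\<close> survive; on \<open>Q\<close>, where \<open>G\<close> vanishes and
  \<open>F\<close> does not, the second family is isolated; at points of the line off
  \<open>G\<close> the third one is; what remains is a multiple of \<open>v\<close>, which can be
  cancelled. The factor \<open>W\<close> pads the binary forms of degree \<open>E - 1\<close> to the
  degree of the block when \<open>Q\<close> is too small for the full range.\<close>

lemma trace_indep:
  fixes v :: "'k::alg_closed_field pt" and b :: "'i \<Rightarrow> 'k pt \<Rightarrow> 'k" and h :: "nat \<Rightarrow> 'k pt \<Rightarrow> 'k"
  assumes fr: "det3 v \<beta> \<gamma> \<noteq> 0"
    and b: "finite I" "\<And>k. k \<in> I \<Longrightarrow> b k \<in> forms D" "indep I b UNIV"
    and G: "G \<in> forms g" "lin v q0 = 0" "q0 \<noteq> z3" "G q0 \<noteq> 0"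
    and Q: "gen_pts v Q" "E \<le> card Q" "\<And>p. p \<in> Q \<Longrightarrow> G p = 0 \<and> F p \<noteq> 0 \<and> W p \<noteq> 0"
    and P: "\<And>i. i < q \<Longrightarrow> lin v (P i) = 0 \<and> F (P i) = 0 \<and> G (P i) = 0"
    and h: "\<And>i. i < q \<Longrightarrow> h i (P i) \<noteq> 0" "\<And>i j. i < q \<Longrightarrow> j < i \<Longrightarrow> h i (P j) = 0"
  shows "indep (I <+> ({..<E} <+> ({..M} <+> {..<q})))
    (case_sum (\<lambda>k p. lin v p * b k p) (case_sum (\<lambda>i p. F p * W p * (lin \<beta> p ^ i * lin \<gamma> p ^ (E - 1 - i)))
      (case_sum (\<lambda>i p. G p * (lin \<beta> p ^ i * lin \<gamma> p ^ (M - i))) h))) UNIV"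
proof (rule indepI)
  fix c :: "'i + (nat + (nat + nat)) \<Rightarrow> 'k" and x
  define cb where "cb k = c (Inl k)" for k
  define cE where "cE k = c (Inr (Inl k))" for k
  define cM where "cM k = c (Inr (Inr (Inl k)))" for k
  define ch where "ch k = c (Inr (Inr (Inr k)))" for k
  define BE where "BE p = (\<Sum>i<E. cE i * (lin \<beta> p ^ i * lin \<gamma> p ^ (E - 1 - i)))" for p
  define BM where "BM p = (\<Sum>i\<le>M. cM i * (lin \<beta> p ^ i * lin \<gamma> p ^ (M - i)))" for p
  assume z: "\<And>p. p \<in> UNIV \<Longrightarrow> (\<Sum>x\<in>I <+> ({..<E} <+> ({..M} <+> {..<q})). c x *
    case_sum (\<lambda>k p. lin v p * b k p) (case_sum (\<lambda>i p. F p * W p * (lin \<beta> p ^ i * lin \<gamma> p ^ (E - 1 - i)))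
      (case_sum (\<lambda>i p. G p * (lin \<beta> p ^ i * lin \<gamma> p ^ (M - i))) h)) x p) = 0"
    and x: "x \<in> I <+> ({..<E} <+> ({..M} <+> {..<q}))"
  have zz: "lin v p * (\<Sum>k\<in>I. cb k * b k p) + (F p * W p * BE p + (G p * BM p + (\<Sum>i<q. ch i * h i p))) = 0" for p
    using z[of p] b(1)
    by (simp add: sum.Plus BE_def BM_def sum_distrib_left mult_ac cb_def cE_def cM_def ch_def comp_def)
  have ch: "ch i = 0" if "i < q" for i
    using that
  proof (induction i rule: less_induct)
    case (less i)
    \<comment> \<open>Coefficients with smaller index are zero by induction, and functions with
      larger index vanish at \<open>P i\<close>.\<close>
    have "(\<Sum>j<q. ch j * h j (P i)) = (\<Sum>j\<in>{i}. ch j * h j (P i))"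
    proof (rule sum.mono_neutral_right)
      show "\<forall>j\<in>{..<q} - {i}. ch j * h j (P i) = 0"
      proof
        fix j assume j: "j \<in> {..<q} - {i}"
        show "ch j * h j (P i) = 0"
        proof (cases "j < i")
          case True thus ?thesis using less.IH[of j] j by simp
        next
          case False thus ?thesis using h(2)[of j i] j by simp
        qed
      qed
    qed (use less.prems in auto)
    thus ?case using zz[of "P i"] P[OF less.prems] h(1)[OF less.prems] by simp
  qed
  hence z2: "lin v p * (\<Sum>k\<in>I. cb k * b k p) + (F p * W p * BE p + G p * BM p) = 0" for p
    using zz[of p] by simp
  have cE: "cE i = 0" if i: "i < E" for i
  proof -
    have Es: "{..<E} = {..E - 1}" using i by auto
    show ?thesis
    proof (rule binary_form_zero_on_line[OF fr Q(1), of "E - 1"])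
      show "E - 1 < card Q" using Q(2) i by simp
      fix p assume p: "p \<in> Q"
      have "lin v p = 0" using p Q(1) by (simp add: gen_pts_def)
      hence "BE p = 0" using z2[of p] Q(3)[OF p] by simp
      thus "(\<Sum>i\<le>E - 1. cE i * (lin \<beta> p ^ i * lin \<gamma> p ^ (E - 1 - i))) = 0" unfolding BE_def Es .
    qed (use i in simp)
  qed
  hence "BE p = 0" for p by (simp add: BE_def)
  hence z3: "lin v p * (\<Sum>k\<in>I. cb k * b k p) + G p * BM p = 0" for p using z2[of p] by simp
  have v0: "v \<noteq> z3" using fr by (cases \<beta>; cases \<gamma>) (auto simp: det3_def)
  obtain Q' where Q': "gen_pts v Q'" "card Q' = Suc M" "\<forall>p\<in>Q'. G p \<noteq> 0"
    using gen_pts_avoiding[OF v0 G] by blast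
  have cM: "cM i = 0" if i: "i \<le> M" for i
  proof (rule binary_form_zero_on_line[OF fr Q'(1) _ _ i])
    show "M < card Q'" using Q' by simp
    fix p assume p: "p \<in> Q'"
    have "lin v p = 0" using p Q'(1) by (simp add: gen_pts_def)
    hence "BM p = 0" using z3[of p] Q'(3) p by simp
    thus "(\<Sum>i\<le>M. cM i * (lin \<beta> p ^ i * lin \<gamma> p ^ (M - i))) = 0" unfolding BM_def .
  qed
  hence "BM p = 0" for p by (simp add: BM_def)
  hence z4: "lin v p * (\<Sum>k\<in>I. cb k * b k p) = 0" for p using z3[of p] by simp
  have "(\<Sum>k\<in>I. cb k * b k p) = 0" for p
  proof (rule ccontr)
    assume n: "(\<Sum>k\<in>I. cb k * b k p) \<noteq> 0"
    have f: "(\<lambda>p. \<Sum>k\<in>I. cb k * b k p) \<in> forms D" by (intro forms_sum forms_scale b)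
    obtain w where "lin v w \<noteq> 0" using nonzero_witness[OF v0] lin_commute by metis
    from forms_nonzero_both[OF lin_forms f this n] obtain y
      where "lin v y \<noteq> 0" "(\<Sum>k\<in>I. cb k * b k y) \<noteq> 0" by blast
    thus False using z4[of y] by simp
  qed
  hence cb: "cb k = 0" if "k \<in> I" for k using indepD[OF b(3), of cb k] that by simp
  show "c x = 0"
    using x cb cE cM ch by (auto simp: cb_def cE_def cM_def ch_def)
qed

definition ext_cfg :: "nat \<Rightarrow> nat \<Rightarrow> (bool \<Rightarrow> 'k pt) \<Rightarrow> 'k config \<Rightarrow> 'k config" where
  "ext_cfg i0 m w u s i j = (if i = i0 \<and> j = m then w s else u s i j)"

context
  fixes i0 r :: nat and n :: "nat \<Rightarrow> nat" and w :: "bool \<Rightarrow> 'k::field pt" and u u' :: "'k config"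
    and n' :: "nat \<Rightarrow> nat"
  assumes i0: "i0 < r" and n': "n' = n(i0 := Suc (n i0))" and u': "u' = ext_cfg i0 (n i0) w u"
begin

lemma blk_ext: "blk (u' s) n' i p = (if i = i0 then lin (w s) p * blk (u s) n i0 p else blk (u s) n i p)"
proof (cases "i = i0")
  case True
  have "(\<Prod>j<n i0. lin (u' s i0 j) p) = (\<Prod>j<n i0. lin (u s i0 j) p)"
    by (intro prod.cong) (auto simp: u' ext_cfg_def)
  moreover have "u' s i0 (n i0) = w s" by (simp add: u' ext_cfg_def)
  ultimately show ?thesis using True by (simp add: blk_def n' mult.commute)
next
  case False
  thus ?thesis by (simp add: blk_def n' u' ext_cfg_def)
qed

lemma cof_ext_same: "cof r n' (u' s) i0 p = cof r n (u s) i0 p"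
  unfolding cof_def by (intro prod.cong) (auto simp: blk_ext)

lemma cof_ext_other:
  assumes "i \<noteq> i0"
  shows "cof r n' (u' s) i p = lin (w s) p * cof r n (u s) i p"
proof -
  have split: "{..<r} - {i} = insert i0 ({..<r} - {i} - {i0})" using i0 assms by auto
  have 1: "(\<Prod>j\<in>{..<r} - {i} - {i0}. blk (u' s) n' j p) = (\<Prod>j\<in>{..<r} - {i} - {i0}. blk (u s) n j p)"
    by (intro prod.cong) (auto simp: blk_ext)
  have "cof r n' (u' s) i p = blk (u' s) n' i0 p * (\<Prod>j\<in>{..<r} - {i} - {i0}. blk (u' s) n' j p)"
    unfolding cof_def by (subst split, subst prod.insert) auto
  moreover have "cof r n (u s) i p = blk (u s) n i0 p * (\<Prod>j\<in>{..<r} - {i} - {i0}. blk (u s) n j p)"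
    unfolding cof_def by (subst split, subst prod.insert) auto
  ultimately show ?thesis by (simp add: 1 blk_ext)
qed

text \<open>A tangent vector times the new line is again tangent: the block \<open>i0\<close>
  absorbs the line into its coefficient, every other block into its cofactor. The scalars
  \<open>c\<close> allow difference quotients to be formed.\<close>

lemma tsp_extI:
  assumes "tcoef r n a"
  shows "(\<lambda>p. \<Sum>s\<in>S. c s * lin (w s) p * tval {s} r n u a p) \<in> tsp S r n' u'"
proof -
  define a' where "a' s i p = c s * (if i = i0 then lin (w s) p * a s i p else a s i p)" for s i p
  have "a' s i \<in> forms (n' i)" if "i < r" for s i
  proof (cases "i = i0")
    case True
    have "(\<lambda>p. c s * (lin (w s) p * a s i0 p)) \<in> forms (Suc (n i0))"
      using assms i0 by (intro forms_scale forms_lin_mult) (auto simp: tcoef_def)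
    thus ?thesis by (simp add: True a'_def[abs_def] n')
  next
    case False
    thus ?thesis using assms that by (auto simp: a'_def[abs_def] n' tcoef_def intro!: forms_scale)
  qed
  hence "tcoef r n' a'" by (simp add: tcoef_def)
  moreover have "tval S r n' u' a' p = (\<Sum>s\<in>S. c s * lin (w s) p * tval {s} r n u a p)" for p
    unfolding tval_def
  proof (rule sum.cong)
    fix s
    have "a' s i p * cof r n' (u' s) i p = c s * lin (w s) p * (a s i p * cof r n (u s) i p)" for i
      by (cases "i = i0") (simp_all add: a'_def cof_ext_same cof_ext_other mult_ac)
    thus "(\<Sum>i<r. a' s i p * cof r n' (u' s) i p) = c s * lin (w s) p * (\<Sum>s\<in>{s}. \<Sum>i<r. a s i p * cof r n (u s) i p)"
      by (simp add: sum_distrib_left)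
  qed simp
  ultimately show ?thesis unfolding tsp_def by (auto intro!: exI[of _ a'])
qed

lemma tsp_ext_cofI:
  assumes "A \<in> forms (Suc (n i0))" "s \<in> S"
  shows "(\<lambda>p. cof r n (u s) i0 p * A p) \<in> tsp S r n' u'"
proof -
  define a' where "a' s' i p = (if s' = s \<and> i = i0 then A p else 0)" for s' i p
  have "a' s' i \<in> forms (n' i)" if "i < r" for s' i
    using assms by (cases "s' = s \<and> i = i0") (auto simp: a'_def[abs_def] n')
  hence "tcoef r n' a'" by (simp add: tcoef_def)
  moreover have "tval S r n' u' a' p = cof r n (u s) i0 p * A p" for p
  proof -
    have "(\<Sum>i<r. a' s' i p * cof r n' (u' s') i p) = (if s' = s then cof r n (u s) i0 p * A p else 0)" for s'
    proof -
      have "(\<Sum>i<r. a' s' i p * cof r n' (u' s') i p) = (\<Sum>i\<in>{i0}. a' s' i p * cof r n' (u' s') i p)"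
        using i0 by (intro sum.mono_neutral_right) (auto simp: a'_def)
      thus ?thesis by (simp add: a'_def cof_ext_same)
    qed
    thus ?thesis using assms(2) by (simp add: tval_def)
  qed
  ultimately show ?thesis unfolding tsp_def by (auto intro!: exI[of _ a'])
qed

end

lemma tval_single_cong: "(\<And>i. a s i = a' s i) \<Longrightarrow> tval {s} r n u a = tval {s} r n u a'"
  by (simp add: tval_def fun_eq_iff)

text \<open>The line \<open>v\<close> is added to the block \<open>i0\<close> of the first product and \<open>v + t \<mu>\<close> to that of the
  second. For \<open>t \<noteq> 0\<close> and \<open>K\<close> in both tangent spaces, the span contains
  \<open>\<mu> K = ((v + t \<mu>) K - v K) / t\<close>, which makes up for a deficient trace on the line \<open>v\<close>.\<close>

lemma rank_extend:
  fixes u :: "'k::alg_closed_field config"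
  assumes i0: "i0 < r"
    and a: "\<And>k. k < N \<Longrightarrow> tcoef r n (a k)" "indep {..<N} (\<lambda>k. tval UNIV r n u (a k)) UNIV"
    and M: "M = Suc (n i0)" "E \<le> Suc M" "1 \<le> E"
    and v: "v \<noteq> z3"
    and W: "W \<in> forms (M - (E - 1))"
    and G: "lin v q0 = 0" "q0 \<noteq> z3" "cof r n (u False) i0 q0 \<noteq> 0"
    and Q: "gen_pts v Q" "E \<le> card Q" "\<And>p. p \<in> Q \<Longrightarrow> cof r n (u False) i0 p = 0 \<and> cof r n (u True) i0 p \<noteq> 0 \<and> W p \<noteq> 0"
    and P: "\<And>i. i < q \<Longrightarrow> lin v (P i) = 0 \<and> cof r n (u True) i0 (P i) = 0 \<and> cof r n (u False) i0 (P i) = 0"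
    and K: "\<And>i s. i < q \<Longrightarrow> K i \<in> tsp {s} r n u"
    and h: "\<And>i. i < q \<Longrightarrow> K i (P i) \<noteq> 0 \<and> lin \<mu> (P i) \<noteq> 0" "\<And>i j. i < q \<Longrightarrow> j < i \<Longrightarrow> K i (P j) = 0"
  shows "rank_ge TYPE('k) UNIV r (n(i0 := M)) (N + E + (M + 1) + q)"
proof -
  obtain \<beta> \<gamma> where fr: "det3 v \<beta> \<gamma> \<noteq> 0" using frame_exists[OF v] by blast
  define F where "F = cof r n (u True) i0"
  define G' where "G' = cof r n (u False) i0"
  define w where "w t s = (if s then v else comb 1 v t \<mu>)" for t s
  define I where "I = {..<N} <+> ({..<E} <+> ({..M} <+> {..<q}))"
  \<comment> \<open>At \<open>t = 0\<close> the first family becomes \<open>v\<close> times the sum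
    of the two tangent spaces, which is the situation of \<open>trace_indep\<close>; the other three
    families do not involve \<open>t\<close>.\<close>
  define f where "f t = case_sum (\<lambda>k p. lin v p * tval {True} r n u (a k) p + lin (comb 1 v t \<mu>) p * tval {False} r n u (a k) p)
     (case_sum (\<lambda>i p. F p * W p * (lin \<beta> p ^ i * lin \<gamma> p ^ (E - 1 - i)))
      (case_sum (\<lambda>i p. G' p * (lin \<beta> p ^ i * lin \<gamma> p ^ (M - i))) (\<lambda>i p. lin \<mu> p * K i p)))" for t
  have fin: "finite I" by (simp add: I_def)
  have U: "tval UNIV r n u (a k) p = tval {True} r n u (a k) p + tval {False} r n u (a k) p" for k p
    by (simp add: tval_def UNIV_bool)
  have f0: "f 0 = case_sum (\<lambda>k p. lin v p * tval UNIV r n u (a k) p) (case_sum (\<lambda>i p. F p * W p * (lin \<beta> p ^ i * lin \<gamma> p ^ (E - 1 - i)))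
      (case_sum (\<lambda>i p. G' p * (lin \<beta> p ^ i * lin \<gamma> p ^ (M - i))) (\<lambda>i p. lin \<mu> p * K i p)))"
    unfolding f_def lin_comb_left U by (simp add: algebra_simps)
  have "indep I (f 0) UNIV"
    unfolding I_def f0
  proof (rule trace_indep[OF fr _ _ a(2) _ G(1,2)])
    show "tval UNIV r n u (a k) \<in> forms (\<Sum>i<r. n i)" if "k \<in> {..<N}" for k
      using a(1)[of k] that by (intro tsp_forms[of _ UNIV _ _ u]) (auto simp: tsp_def)
    show "G' \<in> forms (\<Sum>j\<in>{..<r} - {i0}. n j)" unfolding G'_def by (rule cof_forms)
    show "G' q0 \<noteq> 0" using G by (simp add: G'_def)
    show "gen_pts v Q" "E \<le> card Q" by fact+
    show "G' p = 0 \<and> F p \<noteq> 0 \<and> W p \<noteq> 0" if "p \<in> Q" for p using Q(3)[OF that] by (simp add: F_def G'_def)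
    show "lin v (P i) = 0 \<and> F (P i) = 0 \<and> G' (P i) = 0" if "i < q" for i
      using P[OF that] by (simp add: F_def G'_def)
    show "lin \<mu> (P i) * K i (P i) \<noteq> 0" if "i < q" for i using h(1)[OF that] by simp
    show "lin \<mu> (P j) * K i (P j) = 0" if "i < q" "j < i" for i j using h(2)[OF that] by simp
  qed simp
  hence "\<forall>\<^sub>F t in cofinite. indep I (\<lambda>x. f t x) UNIV"
  proof (intro indep_cofinite[where b = "\<lambda>i t. f t i" and ?t0.0 = 0] fin)
    fix x p assume "x \<in> I"
    show "\<exists>g. \<forall>t. f t x p = poly g t"
    proof (cases x)
      case (Inl k)
      show ?thesis unfolding Inl f_def lin_comb_left
        by (intro exI[of _ "[:lin v p * tval {True} r n u (a k) p + lin v p * tval {False} r n u (a k) p,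
             lin \<mu> p * tval {False} r n u (a k) p:]"]) (simp add: algebra_simps)
    next
      case (Inr y)
      have "f t x p = f 0 x p" for t unfolding Inr f_def by simp
      thus ?thesis by (intro exI[of _ "[:f 0 x p:]"]) simp
    qed
  qed
  moreover have "\<forall>\<^sub>F t in cofinite. t \<noteq> (0::'k)" by (simp add: eventually_cofinite)
  ultimately have "\<forall>\<^sub>F t in cofinite. indep I (f t) UNIV \<and> t \<noteq> 0" by (rule eventually_conj)
  then obtain t where t: "indep I (f t) UNIV" "t \<noteq> 0" using cofinite_exists by blast
  define u' where "u' = ext_cfg i0 (n i0) (w t) u"
  define n' where "n' = n(i0 := Suc (n i0))"
  note X = tsp_extI[OF i0 n'_def u'_def] and Y = tsp_ext_cofI[OF i0 n'_def u'_def]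
  have "rank_ge TYPE('k) UNIV r n' (N + E + (M + 1) + q)"
  proof (rule rank_geI[OF fin _ _ t(1), of _ _ _ _ u'])
    show "N + E + (M + 1) + q \<le> card I" by (simp add: I_def card_Plus)
    fix x assume x: "x \<in> I"
    consider k where "x = Inl k" "k < N" | i where "x = Inr (Inl i)" "i < E"
      | i where "x = Inr (Inr (Inl i))" "i \<le> M" | i where "x = Inr (Inr (Inr i))" "i < q"
      using x by (auto simp: I_def)
    thus "f t x \<in> tsp UNIV r n' u'"
    proof cases
      case 1
      have "(\<lambda>p. \<Sum>s\<in>UNIV. 1 * lin (w t s) p * tval {s} r n u (a k) p) \<in> tsp UNIV r n' u'"
        by (rule X) (rule a(1)[OF 1(2)])
      thus ?thesis using 1 by (simp add: f_def w_def UNIV_bool add.commute)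
    next
      case 2
      have "(\<lambda>p. lin \<beta> p ^ i * lin \<gamma> p ^ (E - 1 - i)) \<in> forms (E - 1)"
        using binary_forms[of \<beta> i \<gamma> "E - 1 - i"] 2 by simp
      from forms_mult[OF W this] have "(\<lambda>p. W p * (lin \<beta> p ^ i * lin \<gamma> p ^ (E - 1 - i))) \<in> forms (Suc (n i0))"
        using M by simp
      from Y[OF this, of True] show ?thesis using 2 by (simp add: f_def F_def mult.assoc)
    next
      case 3
      have "(\<lambda>p. lin \<beta> p ^ i * lin \<gamma> p ^ (M - i)) \<in> forms (Suc (n i0))"
        using binary_forms[of \<beta> i \<gamma> "M - i"] 3 M by simp
      from Y[OF this, of False] show ?thesis using 3 by (simp add: f_def G'_def)
    next
      case 4
      obtain a1 where a1: "tcoef r n a1" "K i = tval {True} r n u a1"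
        using K[OF 4(2), of True] by (auto simp: tsp_def)
      obtain a2 where a2: "tcoef r n a2" "K i = tval {False} r n u a2"
        using K[OF 4(2), of False] by (auto simp: tsp_def)
      define a3 where "a3 s = (if s then a1 s else a2 s)" for s
      have tc: "tcoef r n a3" using a1(1) a2(1) by (simp add: a3_def tcoef_def)
      have "tval {True} r n u a3 = tval {True} r n u a1" "tval {False} r n u a3 = tval {False} r n u a2"
        by (rule tval_single_cong, simp add: a3_def)+
      hence Ks: "tval {s} r n u a3 = K i" for s
        using a1(2) a2(2) by (cases s) simp_all
      have "(\<lambda>p. \<Sum>s\<in>UNIV. (if s then - 1 / t else 1 / t) * lin (w t s) p * tval {s} r n u a3 p) \<in> tsp UNIV r n' u'"
        by (rule X) (rule tc)
      also have "(\<lambda>p. \<Sum>s\<in>UNIV. (if s then - 1 / t else 1 / t) * lin (w t s) p * tval {s} r n u a3 p) = (\<lambda>p. lin \<mu> p * K i p)"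
        unfolding Ks using t(2) by (auto simp: UNIV_bool w_def lin_comb_left fun_eq_iff field_simps)
      finally show ?thesis using 4 by (simp add: f_def)
    qed
  qed
  thus ?thesis by (simp add: n'_def M)
qed

text \<open>For one product, the trace on the new line is the cofactor times all binary forms of
  degree \<open>n i0 + 1\<close>, hence the gain \<open>n i0 + 2\<close>. The elimination is the
  same, with the second and fourth families empty.\<close>

lemma rank_extend_single:
  fixes u :: "'k::alg_closed_field config"
  assumes "i0 < r" "rank_ge TYPE('k) {True} r n N"
  shows "rank_ge TYPE('k) {True} r (n(i0 := Suc (n i0))) (N + n i0 + 2)"
proof -
  define L where "L = lidx r n"
  have finL: "finite L" by (simp add: L_def lidx_def)
  obtain u0 b where b: "\<And>k. k < N \<Longrightarrow> b k \<in> tsp {True} r n u0" "indep {..<N} b (UNIV :: 'k pt set)"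
    using assms(2) unfolding rank_ge_def by blast
  have "\<forall>k. \<exists>a. k < N \<longrightarrow> tcoef r n a \<and> b k = tval {True} r n u0 a"
    using b(1) unfolding tsp_def by blast
  then obtain a where a: "\<And>k. k < N \<Longrightarrow> tcoef r n (a k) \<and> b k = tval {True} r n u0 (a k)" by metis
  have "zopen (\<lambda>u. indep {..<N} (\<lambda>k. tval {True} r n u (a k)) UNIV)"
    by (rule zopen_indep) (auto intro: polyc_tval)
  moreover have "indep {..<N} (\<lambda>k. tval {True} r n u0 (a k)) UNIV"
    using b(2) a by (subst indep_cong[of _ _ _ b]) auto
  ultimately obtain u where u: "indep {..<N} (\<lambda>k. tval {True} r n u (a k)) UNIV" "generic L u"
    using generic_exists[OF finL] by blast
  define G where "G = cof r n (u True) i0"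
  have Gf: "G \<in> forms (\<Sum>j\<in>{..<r} - {i0}. n j)" unfolding G_def by (rule cof_forms)
  have Lnz: "u s i j \<noteq> z3" if "i < r" "j < n i" for s i j
    using u(2) that unfolding generic_def L_def lidx_def lne_def by auto
  have lin_nz: "\<exists>p. lin x p \<noteq> 0" if "x \<noteq> z3" for x :: "'k pt"
    using nonzero_witness[OF that] lin_commute by metis
  have "\<exists>p. (\<Prod>x\<in>T. f x p) \<noteq> 0" if "finite T" "\<And>x. x \<in> T \<Longrightarrow> f x \<in> forms (e x) \<and> (\<exists>p. f x p \<noteq> 0)"
    for T and f :: "nat \<times> nat \<Rightarrow> 'k pt \<Rightarrow> 'k" and e :: "nat \<times> nat \<Rightarrow> nat"
    using that
  proof (induction T rule: finite_induct)
    case (insert x T)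
    then obtain p1 p2 where "f x p1 \<noteq> 0" "(\<Prod>x\<in>T. f x p2) \<noteq> 0" by blast
    moreover have "f x \<in> forms (e x)" "(\<lambda>p. \<Prod>x\<in>T. f x p) \<in> forms (\<Sum>x\<in>T. e x)"
      using insert by (auto intro: forms_prod)
    ultimately obtain z where "f x z \<noteq> 0" "(\<Prod>x\<in>T. f x z) \<noteq> 0"
      using forms_nonzero_both[of "f x" "e x" "\<lambda>p. \<Prod>x\<in>T. f x p"] by blast
    thus ?case using insert.hyps by (intro exI[of _ z]) simp
  qed simp
  note prod_nz = this
  have Gprod: "G p = (\<Prod>(i, j)\<in>(SIGMA i:{..<r} - {i0}. {..<n i}). lin (u True i j) p)" for p
    unfolding G_def cof_def blk_def by (subst prod.Sigma) auto
  have "\<exists>p. (\<Prod>x\<in>(SIGMA i:{..<r} - {i0}. {..<n i}). (case x of (i, j) \<Rightarrow> lin (u True i j)) p) \<noteq> 0"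
  proof (rule prod_nz[where e = "\<lambda>_. 1"])
    fix x assume "x \<in> (SIGMA i:{..<r} - {i0}. {..<n i})"
    then obtain i j where x: "x = (i, j)" "i < r" "j < n i" by auto
    show "(case x of (i, j) \<Rightarrow> lin (u True i j)) \<in> forms 1 \<and> (\<exists>p. (case x of (i, j) \<Rightarrow> lin (u True i j)) p \<noteq> 0)"
      unfolding x(1) prod.case by (intro conjI lin_forms lin_nz Lnz x)
  qed simp
  then obtain q1 where "G q1 \<noteq> 0" unfolding Gprod by (auto simp: case_prod_unfold)
  have "\<exists>q0. G q0 \<noteq> 0 \<and> q0 \<noteq> z3"
    using forms_nonzero_both[OF Gf lin_forms[of e1] \<open>G q1 \<noteq> 0\<close>, of e1] by force
  then obtain q0 where q0: "G q0 \<noteq> 0" "q0 \<noteq> z3" by blast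
  obtain x where x: "lin x q0 \<noteq> 0" using nonzero_witness[OF q0(2)] by blast
  \<comment> \<open>The new line is drawn through a point off the cofactor, so that the cofactor has
    a nonzero trace on it.\<close>
  have "\<exists>v. v \<noteq> z3 \<and> lin v q0 = 0"
  proof -
    have "cross q0 e1 \<noteq> z3 \<or> cross q0 e2 \<noteq> z3" using q0(2) by (cases q0) auto
    thus ?thesis using lin_cross_self(1)[of q0] lin_commute by metis
  qed
  then obtain v where v: "v \<noteq> z3" "lin v q0 = 0" by blast
  obtain \<beta> \<gamma> where fr: "det3 v \<beta> \<gamma> \<noteq> 0" using frame_exists[OF v(1)] by blast
  define M where "M = Suc (n i0)"
  define I where "I = {..<N} <+> ({..<(0::nat)} <+> ({..M} <+> {..<(0::nat)}))"
  define f where "f = case_sum (\<lambda>k p. lin v p * tval {True} r n u (a k) p) (case_sum (\<lambda>i p. 0 * 0 * (lin \<beta> p ^ i * lin \<gamma> p ^ (0 - 1 - i)))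
      (case_sum (\<lambda>i p. G p * (lin \<beta> p ^ i * lin \<gamma> p ^ (M - i))) (\<lambda>(_::nat) _. 0)))"
  have ind: "indep I f UNIV" unfolding I_def f_def
  proof (rule trace_indep[OF fr _ _ u(1) Gf v(2) q0(2,1)])
    show "tval {True} r n u (a k) \<in> forms (\<Sum>i<r. n i)" if "k \<in> {..<N}" for k
      using a[of k] that by (intro tsp_forms[of _ "{True}" _ _ u]) (auto simp: tsp_def)
    show "gen_pts v {}" by (simp add: gen_pts_def)
  qed auto
  define u' where "u' = ext_cfg i0 (n i0) (\<lambda>_. v) u"
  define n' where "n' = n(i0 := Suc (n i0))"
  note X = tsp_extI[OF assms(1) n'_def u'_def] and Y = tsp_ext_cofI[OF assms(1) n'_def u'_def]
  have "rank_ge TYPE('k) {True} r n' (N + n i0 + 2)"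
  proof (rule rank_geI[OF _ _ _ ind, of _ _ _ _ u'])
    show "finite I" "N + n i0 + 2 \<le> card I" by (simp_all add: I_def card_Plus M_def)
    fix x assume x: "x \<in> I"
    consider k where "x = Inl k" "k < N" | i where "x = Inr (Inr (Inl i))" "i \<le> M"
      using x by (auto simp: I_def)
    thus "f x \<in> tsp {True} r n' u'"
    proof cases
      case 1
      have "(\<lambda>p. \<Sum>s\<in>{True}. 1 * lin v p * tval {s} r n u (a k) p) \<in> tsp {True} r n' u'"
        by (rule X) (use a[of k] 1 in simp)
      thus ?thesis using 1 by (simp add: f_def)
    next
      case 2
      have "(\<lambda>p. lin \<beta> p ^ i * lin \<gamma> p ^ (M - i)) \<in> forms (Suc (n i0))"
        using binary_forms[of \<beta> i \<gamma> "M - i"] 2 by (simp add: M_def)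
      from Y[OF this, of True "{True}"] show ?thesis using 2 by (simp add: f_def G_def)
    qed
  qed
  thus ?thesis by (simp add: n'_def)
qed

lemma gen_pts_of_lines:
  fixes x :: "'k::field pt"
  assumes "x \<noteq> z3" "finite Y" "\<And>y y'. y \<in> Y \<Longrightarrow> y' \<in> Y \<Longrightarrow> y \<noteq> y' \<Longrightarrow> det3 x (l y) (l y') \<noteq> 0"
  shows "gen_pts x ((\<lambda>y. cross x (l y)) ` Y)" "card ((\<lambda>y. cross x (l y)) ` Y) = card Y"
proof -
  have cr: "cross (cross x a) (cross x b) = comb (det3 x a b) x 0 z3" for a b
    by (cases x; cases a; cases b; hypsubst) (simp add: det3_def algebra_simps)
  have ne: "cross (cross x (l y)) (cross x (l y')) \<noteq> z3" if "y \<in> Y" "y' \<in> Y" "y \<noteq> y'" for y y'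
    using assms(1) assms(3)[OF that] unfolding cr by (cases x) auto
  have self: "cross p p = z3" for p :: "'k pt" by (cases p) simp
  have inj: "inj_on (\<lambda>y. cross x (l y)) Y"
  proof (rule inj_onI, rule ccontr)
    fix y y' assume y: "y \<in> Y" "y' \<in> Y" "cross x (l y) = cross x (l y')" "y \<noteq> y'"
    show False using ne[OF y(1,2,4)] y(3) self by simp
  qed
  show "card ((\<lambda>y. cross x (l y)) ` Y) = card Y" by (rule card_image[OF inj])
  show "gen_pts x ((\<lambda>y. cross x (l y)) ` Y)" unfolding gen_pts_def
  proof (intro conjI ballI impI)
    fix p q assume "p \<in> (\<lambda>y. cross x (l y)) ` Y" "q \<in> (\<lambda>y. cross x (l y)) ` Y" "p \<noteq> q"
    then obtain y y' where "y \<in> Y" "y' \<in> Y" "p = cross x (l y)" "q = cross x (l y')" "y \<noteq> y'" by blast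
    thus "cross p q \<noteq> z3" using ne by simp
  next
    fix p assume "p \<in> (\<lambda>y. cross x (l y)) ` Y"
    then obtain y where "p = cross x (l y)" by blast
    thus "lin x p = 0" by (simp only: lin_cross_self)
  qed (use assms(2) in simp)
qed

lemma avoid_points:
  fixes X :: "'k::alg_closed_field pt set"
  assumes "finite X" "z3 \<notin> X"
  shows "\<exists>v. \<forall>p\<in>X. lin v p \<noteq> 0"
proof -
  have "\<exists>v. (\<Prod>p\<in>X. lin p v) \<noteq> 0" using assms
  proof (induction X rule: finite_induct)
    case (insert p X)
    then obtain v where v: "(\<Prod>p\<in>X. lin p v) \<noteq> 0" by auto
    obtain w where w: "lin p w \<noteq> 0" using nonzero_witness[of p] insert.prems lin_commute by (metis insertI1)
    have "(\<lambda>v. \<Prod>p\<in>X. lin p v) \<in> forms (\<Sum>p\<in>X. 1)"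
      using insert.hyps by (intro forms_prod lin_forms)
    from forms_nonzero_both[OF lin_forms this w v] obtain z where "lin p z \<noteq> 0" "(\<Prod>p\<in>X. lin p z) \<noteq> 0" by blast
    thus ?case using insert.hyps by (intro exI[of _ z]) simp
  qed simp
  thus ?thesis using assms(1) lin_commute by (metis prod_zero_iff)
qed

lemma forms_homogeneous:
  assumes "f \<in> forms e"
  shows "f (comb c p 0 z3) = c ^ e * f p"
proof -
  obtain a where a: "\<And>x. f x = (\<Sum>m\<in>mons e. a m * mono3 m x)" using forms_coeffs[OF assms] by blast
  have "mono3 m (comb c p 0 z3) = c ^ e * mono3 m p" if "m \<in> mons e" for m
  proof -
    obtain i j k where m: "m = (i, j, k)" by (cases m) auto
    have "e = i + j + k" using that m by simp
    thus ?thesis by (cases p) (simp add: m power_mult_distrib power_add mult_ac)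
  qed
  thus ?thesis unfolding a sum_distrib_left by (intro sum.cong) (auto simp: mult_ac)
qed

text \<open>The lines making up the cofactor of the block \<open>i0\<close> in the product
  \<open>s\<close>.\<close>

definition olines :: "nat \<Rightarrow> (nat \<Rightarrow> nat) \<Rightarrow> nat \<Rightarrow> bool \<Rightarrow> lidx set" where
  "olines r n i0 s = {s} \<times> (SIGMA i:{..<r} - {i0}. {..<n i})"

lemma finite_olines [simp]: "finite (olines r n i0 s)"
  by (simp add: olines_def)

lemma finite_lidx [simp]: "finite (lidx r n)"
  by (simp add: lidx_def)

lemma olines_subset: "x \<in> olines r n i0 s \<Longrightarrow> x \<in> lidx r n"
  by (auto simp: olines_def lidx_def)

lemma card_olines: "card (olines r n i0 s) = (\<Sum>i\<in>{..<r} - {i0}. n i)"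
  by (simp add: olines_def card_cartesian_product)

lemma olines_disjoint: "x \<in> olines r n i0 True \<Longrightarrow> y \<in> olines r n i0 False \<Longrightarrow> x \<noteq> y"
  by (auto simp: olines_def)

lemma cof_olines: "cof r n (u s) i0 p = (\<Prod>x\<in>olines r n i0 s. lin (lne u x) p)"
proof -
  have "(\<Prod>x\<in>olines r n i0 s. lin (lne u x) p) = (\<Prod>y\<in>(SIGMA i:{..<r} - {i0}. {..<n i}). lin (lne u (s, y)) p)"
  proof -
    have eq: "olines r n i0 s = Pair s ` (SIGMA i:{..<r} - {i0}. {..<n i})" by (auto simp: olines_def)
    show ?thesis unfolding eq by (subst prod.reindex) (auto simp: inj_on_def)
  qed
  also have "\<dots> = (\<Prod>(i, j)\<in>(SIGMA i:{..<r} - {i0}. {..<n i}). lin (u s i j) p)"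
    by (intro prod.cong) (auto simp: lne_def)
  also have "\<dots> = cof r n (u s) i0 p"
    unfolding cof_def blk_def by (subst prod.Sigma) auto
  finally show ?thesis by simp
qed

lemma cof_zero_iff: "cof r n (u s) i0 p = 0 \<longleftrightarrow> (\<exists>x\<in>olines r n i0 s. lin (lne u x) p = 0)"
  by (simp add: cof_olines)

text \<open>Supplies the points for \<open>rank_extend\<close> from the lines themselves:
  \<open>Q\<close> consists of the meets of \<open>v\<close> with the second cofactor,
  \<open>q0\<close> is its meet with a line \<open>f1\<close> of the first cofactor, and
  \<open>W\<close> is a power of \<open>f1\<close>. Lines through the special points
  \<open>P i\<close> are put into \<open>Gr\<close> and skipped, because the first cofactor vanishes
  there too.\<close>

lemma rank_extend_lines:
  fixes u :: "'k::alg_closed_field config"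
  assumes i0: "i0 < r"
    and a: "\<And>k. k < N \<Longrightarrow> tcoef r n (a k)" "indep {..<N} (\<lambda>k. tval UNIV r n u (a k)) UNIV"
    and M: "M = Suc (n i0)" "E \<le> Suc M" "1 \<le> E" "E \<le> card (olines r n i0 False - Gr)"
    and v: "v \<noteq> z3"
    and c1: "\<And>g f. g \<in> olines r n i0 False - Gr \<Longrightarrow> f \<in> olines r n i0 True \<Longrightarrow> det3 v (lne u g) (lne u f) \<noteq> 0"
    and c2: "\<And>g g'. g \<in> olines r n i0 False - Gr \<Longrightarrow> g' \<in> olines r n i0 False - Gr \<Longrightarrow> g \<noteq> g' \<Longrightarrow> det3 v (lne u g) (lne u g') \<noteq> 0"
    and c3: "f1 \<in> olines r n i0 True" "\<And>g. g \<in> olines r n i0 False \<Longrightarrow> det3 v (lne u f1) (lne u g) \<noteq> 0"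
    and P: "\<And>i. i < q \<Longrightarrow> lin v (P i) = 0 \<and> cof r n (u True) i0 (P i) = 0 \<and> cof r n (u False) i0 (P i) = 0"
    and K: "\<And>i s. i < q \<Longrightarrow> K i \<in> tsp {s} r n u"
    and h: "\<And>i. i < q \<Longrightarrow> K i (P i) \<noteq> 0 \<and> lin \<mu> (P i) \<noteq> 0" "\<And>i j. i < q \<Longrightarrow> j < i \<Longrightarrow> K i (P j) = 0"
  shows "rank_ge TYPE('k) UNIV r (n(i0 := M)) (N + E + (M + 1) + q)"
proof -
  define OF where "OF = olines r n i0 False"
  define Q where "Q = (\<lambda>g. cross v (lne u g)) ` (OF - Gr)"
  have Q: "gen_pts v Q" "card Q = card (OF - Gr)"
    unfolding Q_def by (rule gen_pts_of_lines[OF v]; use c2 in \<open>simp add: OF_def\<close>)+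
  define q0 where "q0 = cross v (lne u f1)"
  have q0: "lin (lne u g) q0 \<noteq> 0" if "g \<in> OF" for g
    using c3(2)[of g] that unfolding q0_def OF_def det3_def by (simp add: lin_cross_rotate[of v])
  have "OF \<noteq> {}" using M(3,4) unfolding OF_def by auto
  then obtain g0 where "g0 \<in> OF" by blast
  hence q0z: "q0 \<noteq> z3" using q0[of g0] by (cases "lne u g0") auto
  show ?thesis
  proof (rule rank_extend[OF i0 a M(1-3) v _ _ q0z _ Q(1) _ _ P K h, where W = "\<lambda>p. lin (lne u f1) p ^ (M - (E - 1))"])
    show "(\<lambda>p. lin (lne u f1) p ^ (M - (E - 1))) \<in> forms (M - (E - 1))"
      using forms_power[OF lin_forms, of "lne u f1" "M - (E - 1)"] by simp
    show "lin v q0 = 0" by (simp add: q0_def lin_cross_self)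
    show "cof r n (u False) i0 q0 \<noteq> 0" using q0 by (auto simp: cof_zero_iff OF_def)
    show "E \<le> card Q" using Q(2) M(4) by (simp add: OF_def)
    fix p assume "p \<in> Q"
    then obtain g where g: "g \<in> OF - Gr" "p = cross v (lne u g)" by (auto simp: Q_def)
    have "lin (lne u g) p = 0" using g by (simp add: lin_cross_self)
    hence "cof r n (u False) i0 p = 0" using g by (auto simp: cof_zero_iff OF_def)
    moreover have f: "lin (lne u f) p \<noteq> 0" if "f \<in> olines r n i0 True" for f
      using c1[of g f] g that unfolding OF_def det3_def by (simp add: lin_cross_rotate[of v])
    moreover have "cof r n (u True) i0 p \<noteq> 0" using f by (auto simp: cof_zero_iff)
    ultimately show "cof r n (u False) i0 p = 0 \<and> cof r n (u True) i0 p \<noteq> 0 \<and> lin (lne u f1) p ^ (M - (E - 1)) \<noteq> 0"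
      using c3(1) by simp
  qed
qed

section \<open>Elements common to both tangent spaces\<close>

lemma tsp_lincomb:
  assumes "\<And>k. k \<in> I \<Longrightarrow> b k \<in> tsp S r n u"
  shows "(\<lambda>p. \<Sum>k\<in>I. c k * b k p) \<in> tsp S r n u"
proof -
  have "\<forall>k. \<exists>a. k \<in> I \<longrightarrow> tcoef r n a \<and> b k = tval S r n u a" using assms unfolding tsp_def by blast
  then obtain a where a: "\<And>k. k \<in> I \<Longrightarrow> tcoef r n (a k) \<and> b k = tval S r n u (a k)" by metis
  define a' where "a' s i p = (\<Sum>k\<in>I. c k * a k s i p)" for s i p
  have "tcoef r n a'" unfolding tcoef_def a'_def[abs_def]
    using a by (auto simp: tcoef_def intro!: forms_sum forms_scale)
  moreover have "tval S r n u a' p = (\<Sum>k\<in>I. c k * b k p)" for p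
  proof -
    have "tval S r n u a' p = (\<Sum>s\<in>S. \<Sum>k\<in>I. \<Sum>i<r. c k * (a k s i p * cof r n (u s) i p))"
      unfolding tval_def a'_def sum_distrib_right
      by (intro sum.cong refl, subst sum.swap) (simp add: mult.assoc)
    also have "\<dots> = (\<Sum>k\<in>I. c k * tval S r n u (a k) p)"
      by (subst sum.swap) (simp add: tval_def sum_distrib_left)
    also have "\<dots> = (\<Sum>k\<in>I. c k * b k p)" using a by (intro sum.cong) auto
    finally show ?thesis .
  qed
  ultimately show ?thesis unfolding tsp_def by (auto intro!: exI[of _ a'])
qed

text \<open>Dimension count: two spaces of dimension \<open>t\<close> meet in dimension at least
  \<open>2 * t\<close> minus that of the ambient space, and each prescribed zero costs at most one
  more. The unknowns of the linear system are the coordinates with respect to both bases.\<close>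

lemma common_element:
  fixes u :: "'k::alg_closed_field config"
  assumes b: "\<And>s k. k < t \<Longrightarrow> b s k \<in> tsp {s} r n u" "\<And>s. indep {..<t} (b s) UNIV"
    and Z: "finite Z" "card (mons (\<Sum>i<r. n i)) + card Z < 2 * t"
  shows "\<exists>K. (\<forall>s. K \<in> tsp {s} r n u) \<and> (\<exists>p. K p \<noteq> 0) \<and> (\<forall>p\<in>Z. K p = 0)"
proof -
  define D where "D = (\<Sum>i<r. n i)"
  have "\<forall>s k. \<exists>c. k < t \<longrightarrow> (\<forall>p. b s k p = (\<Sum>m\<in>mons D. c m * mono3 m p))"
    using b(1) tsp_forms forms_coeffs unfolding D_def by metis
  then obtain c where c: "\<And>s k p. k < t \<Longrightarrow> b s k p = (\<Sum>m\<in>mons D. c s k m * mono3 m p)" by metis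
  define M :: "bool \<times> nat \<Rightarrow> mon + 'k pt \<Rightarrow> 'k" where
    "M = (\<lambda>(s, k). case_sum (\<lambda>m. if s then c s k m else - c s k m) (\<lambda>p. if s then b s k p else 0))"
  define I where "I = (UNIV :: bool set) \<times> {..<t}"
  have "\<exists>x. (\<exists>i\<in>I. x i \<noteq> 0) \<and> (\<forall>j\<in>mons D <+> Z. (\<Sum>i\<in>I. x i * M i j) = 0)"
    by (rule homogeneous_system_solvable) (use Z in \<open>auto simp: I_def card_Plus card_cartesian_product D_def\<close>)
  then obtain x where x: "\<exists>i\<in>I. x i \<noteq> 0" "\<And>j. j \<in> mons D <+> Z \<Longrightarrow> (\<Sum>i\<in>I. x i * M i j) = 0" by blast
  have Isum: "(\<Sum>i\<in>I. g i) = (\<Sum>k<t. g (True, k)) + (\<Sum>k<t. g (False, k))" for g :: "bool \<times> nat \<Rightarrow> 'k"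
  proof -
    have "(\<Sum>i\<in>I. g i) = (\<Sum>s\<in>UNIV. \<Sum>k<t. g (s, k))"
      unfolding I_def by (subst sum.cartesian_product) (simp add: case_prod_eta)
    thus ?thesis by (simp add: UNIV_bool add.commute)
  qed
  define K where "K s p = (\<Sum>k<t. x (s, k) * b s k p)" for s p
  have Kc: "K s p = (\<Sum>m\<in>mons D. (\<Sum>k<t. x (s, k) * c s k m) * mono3 m p)" for s p
  proof -
    have "K s p = (\<Sum>k<t. \<Sum>m\<in>mons D. x (s, k) * c s k m * mono3 m p)"
      unfolding K_def by (intro sum.cong) (auto simp: c sum_distrib_left mult.assoc)
    thus ?thesis by (subst (asm) sum.swap) (simp add: sum_distrib_right)
  qed
  have "(\<Sum>k<t. x (True, k) * c True k m) = (\<Sum>k<t. x (False, k) * c False k m)" if "m \<in> mons D" for m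
    using x(2)[OF InlI[OF that]] unfolding Isum by (simp add: M_def sum_negf)
  hence KK: "K True p = K False p" for p unfolding Kc by (intro sum.cong) auto
  have "K True p = 0" if "p \<in> Z" for p
    using x(2)[OF InrI[OF that]] unfolding Isum by (simp add: M_def K_def)
  moreover have "K True \<in> tsp {s} r n u" for s
  proof -
    have "K s \<in> tsp {s} r n u" unfolding K_def[abs_def] by (rule tsp_lincomb) (use b in auto)
    moreover have "K True = K s" using KK by (cases s) auto
    ultimately show ?thesis by simp
  qed
  moreover have "\<exists>p. K True p \<noteq> 0"
  proof (rule ccontr)
    assume "\<not> ?thesis"
    hence "K True p = 0" for p by blast
    hence z: "K s p = 0" for s p using KK[of p] by (cases s) simp_all
    have "x (s, k) = 0" if "k < t" for s k
      using indepD[OF b(2)[of s], of "\<lambda>k. x (s, k)" k] z[of s] that by (simp add: K_def)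
    thus False using x(1) by (auto simp: I_def)
  qed
  ultimately show ?thesis by blast
qed

text \<open>Every cofactor contains the block \<open>i\<close> or the block \<open>i'\<close>, so it
  vanishes where lines of these two blocks meet.\<close>

lemma tsp_vanish:
  assumes "f \<in> tsp {s} r n u" "(s, i, j) \<in> lidx r n" "(s, i', j') \<in> lidx r n" "i \<noteq> i'"
    "lin (u s i j) p = 0" "lin (u s i' j') p = 0"
  shows "f p = 0"
proof -
  obtain a where a: "f = tval {s} r n u a" using assms(1) by (auto simp: tsp_def)
  have z: "blk (u s) n i p = 0" "blk (u s) n i' p = 0"
    using assms by (auto simp: blk_def lidx_def)
  have "cof r n (u s) k p = 0" for k
  proof (cases "k = i")
    case True
    thus ?thesis using z assms by (auto simp: cof_def lidx_def)
  next
    case False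
    thus ?thesis using z assms by (auto simp: cof_def lidx_def)
  qed
  thus ?thesis by (simp add: a tval_def)
qed

text \<open>A common element \<open>K\<close> of both tangent spaces that vanishes at all points where a line of the
  first cofactor meets a line of the second one vanishes at too many points of each of these lines,
  hence is divisible by all of them, which is impossible for degree reasons.\<close>

lemma exists_nonvanishing_meet:
  fixes u :: "'k::alg_closed_field config"
  assumes i0: "i0 < r" and gen: "generic (lidx r n) u"
    and K: "\<And>s. K \<in> tsp {s} r n u" "K p0 \<noteq> 0"
    and S: "S = (\<Sum>i\<in>{..<r} - {i0}. n i)"
    and Rm: "\<And>s. Rm s \<subseteq> olines r n i0 s" "\<And>s. card (Rm s) \<le> \<rho>"
    and n: "\<And>i. i < r \<Longrightarrow> i \<noteq> i0 \<Longrightarrow> n i + 1 + \<rho> \<le> S" "n i0 + 2 * \<rho> < S"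
  shows "\<exists>x\<in>olines r n i0 True - Rm True. \<exists>y\<in>olines r n i0 False - Rm False. K (cross (lne u x) (lne u y)) \<noteq> 0"
proof (rule ccontr)
  assume neg: "\<not> ?thesis"
  define D where "D = (\<Sum>i<r. n i)"
  have D: "D = n i0 + S" unfolding D_def S using i0 by (simp add: sum.remove)
  have Kf: "K \<in> forms D" unfolding D_def by (rule tsp_forms[OF K(1)])
  define Ob where "Ob s = olines r n i0 s - Rm s" for s
  have cO: "card (Ob s) \<ge> S - \<rho>" for s
  proof -
    have "card (Ob s) = S - card (Rm s)"
      unfolding Ob_def using Rm(1)[of s] by (subst card_Diff_subset) (auto simp: card_olines S intro: finite_subset[OF _ finite_olines])
    thus ?thesis using Rm(2)[of s] by simp
  qed
  have OL: "x \<in> lidx r n" if "x \<in> Ob s" for x s using that unfolding Ob_def by (blast intro: olines_subset)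
  have Odis: "Ob True \<inter> Ob False = {}" unfolding Ob_def using olines_disjoint by blast
  have fO: "finite (Ob s)" for s by (simp add: Ob_def)
  have sym: "K (cross a b) = 0 \<longleftrightarrow> K (cross b a) = 0" for a b
  proof -
    have "cross a b = comb (-1) (cross b a) 0 z3" by (cases a; cases b) simp
    thus ?thesis using forms_homogeneous[OF Kf, of "-1" "cross b a"] by simp
  qed
  have meet: "K (cross (lne u x) (lne u y)) = 0" if "x \<in> Ob s" "y \<in> Ob (\<not> s)" for x y s
  proof (cases s)
    case True
    thus ?thesis using that neg unfolding Ob_def by simp
  next
    case False
    hence "K (cross (lne u y) (lne u x)) = 0" using that neg unfolding Ob_def by simp
    thus ?thesis using sym by blast
  qed
  have g2: "lne u x \<noteq> z3" if "x \<in> lidx r n" for x using gen that unfolding generic_def by blast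
  have g1: "cross (lne u x) (lne u y) \<noteq> z3" if "x \<in> lidx r n" "y \<in> lidx r n" "x \<noteq> y" for x y
    using gen that unfolding generic_def by blast
  have g3: "det3 (lne u x) (lne u y) (lne u z) \<noteq> 0"
    if "x \<in> lidx r n" "y \<in> lidx r n" "z \<in> lidx r n" "x \<noteq> y" "x \<noteq> z" "y \<noteq> z" for x y z
  proof -
    have "distinct [x, y, z]" using that by simp
    thus ?thesis using gen that(1-3) unfolding generic_def by blast
  qed
  have line: "K p = 0" if x: "x \<in> Ob s" and p: "lin (lne u x) p = 0" for x s p
  proof -
    obtain i j where xs: "x = (s, i, j)" "i < r" "i \<noteq> i0" "j < n i" using x by (auto simp: Ob_def olines_def)
    \<comment> \<open>Lines of the same product in other blocks. They meet \<open>x\<close> in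
      \<open>D - n i\<close> points at which all tangent vectors of this product vanish; with at
      least \<open>S - \<rho>\<close> meets with the other cofactor, this is more than the degree
      \<open>D\<close>.\<close>
    define Y1 where "Y1 = {s} \<times> (SIGMA i':{..<r} - {i}. {..<n i'})"
    define Y where "Y = Ob (\<not> s) \<union> Y1"
    have Y1: "finite Y1" "card Y1 = D - n i"
      using xs(2) by (auto simp: Y1_def card_cartesian_product D_def sum.remove)
    have "Y1 \<subseteq> lidx r n" by (auto simp: Y1_def lidx_def)
    hence YL: "Y \<subseteq> lidx r n" using OL unfolding Y_def by blast
    have xY: "x \<notin> Y" by (auto simp: Y_def Y1_def xs(1) Ob_def olines_def)
    have "Ob (\<not> s) \<inter> Y1 = {}" by (auto simp: Y1_def Ob_def olines_def)
    hence "card Y = card (Ob (\<not> s)) + (D - n i)" unfolding Y_def using Y1 fO by (subst card_Un_disjoint) auto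
    moreover have "n i \<le> D" unfolding D_def using xs(2) by (intro member_le_sum) auto
    ultimately have cY: "D < card Y" using cO[of "\<not> s"] n(1)[OF xs(2,3)] by linarith
    have fY: "finite Y" using Y1 fO by (simp add: Y_def)
    note xL = OL[OF x]
    have dt: "det3 (lne u x) (lne u y) (lne u y') \<noteq> 0" if "y \<in> Y" "y' \<in> Y" "y \<noteq> y'" for y y'
      using that YL xY by (intro g3 xL) blast+
    note gp = gen_pts_of_lines[OF g2[OF xL] fY dt]
    have van: "K q = 0" if q: "q \<in> (\<lambda>y. cross (lne u x) (lne u y)) ` Y" for q
    proof -
      obtain y where y: "y \<in> Y" "q = cross (lne u x) (lne u y)" using q by blast
      show ?thesis
      proof (cases "y \<in> Ob (\<not> s)")
        case True
        thus ?thesis using meet[OF x] y by simp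
      next
        case False
        then obtain i' j' where y': "y = (s, i', j')" "i' \<noteq> i" using y by (auto simp: Y_def Y1_def)
        show ?thesis
        proof (rule tsp_vanish[OF K(1)[of s], of i j i' j'])
          show "(s, i, j) \<in> lidx r n" "(s, i', j') \<in> lidx r n" using xL YL y(1) xs(1) y'(1) by auto
          show "i \<noteq> i'" using y' by simp
          show "lin (u s i j) q = 0" using lin_cross_self(1)[of "lne u x" "lne u y"] y(2) xs(1) by (simp add: lne_def)
          show "lin (u s i' j') q = 0" using lin_cross_self(2)[of "lne u y" "lne u x"] y(2) y'(1) by (simp add: lne_def)
        qed
      qed
    qed
    have "D < card ((\<lambda>y. cross (lne u x) (lne u y)) ` Y)" using cY gp(2) by simp
    from forms_divisible_by_line[OF g2[OF xL] Kf gp(1) this van]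
    obtain g where "K p = lin (lne u x) p * g p" by blast
    thus ?thesis using p by simp
  qed
  have "K p0 = 0"
  proof (rule forms_zero_of_many_lines[of "Ob True \<union> Ob False" K D "lne u"])
    \<comment> \<open>There are at least \<open>2 * (S - \<rho>)\<close> lines, against the degree
      \<open>D = n i0 + S\<close>.\<close>
    show "D < card (Ob True \<union> Ob False)"
      using Odis fO cO[of True] cO[of False] n(2) D by (subst card_Un_disjoint) auto
    show "finite (Ob True \<union> Ob False)" using fO by simp
    show "K \<in> forms D" by fact
    show "cross (lne u i) (lne u j) \<noteq> z3" if "i \<in> Ob True \<union> Ob False" "j \<in> Ob True \<union> Ob False" "i \<noteq> j" for i j
      using that OL by (intro g1) blast+
    show "lne u j \<noteq> z3" if "j \<in> Ob True \<union> Ob False" for j using that OL by (intro g2) blast+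
    show "K p = 0" if "j \<in> Ob True \<union> Ob False" "lin (lne u j) p = 0" for j p
      using that line by blast
  qed
  thus False using K(2) by simp
qed

text \<open>The two rank hypotheses may be witnessed by different configurations. Openness merges
  them, together with general position, into one; a witness for the second product is obtained from
  one for the first by exchanging the roles of the products.\<close>

lemma rank_generic:
  assumes "rank_ge TYPE('k::alg_closed_field) UNIV r n N" "rank_ge TYPE('k) {True} r n t"
  shows "\<exists>u a (b :: bool \<Rightarrow> nat \<Rightarrow> 'k pt \<Rightarrow> 'k). generic (lidx r n) u \<and> (\<forall>k<N. tcoef r n (a k)) \<and>
     indep {..<N} (\<lambda>k. tval UNIV r n u (a k)) UNIV \<and>
     (\<forall>s. \<forall>k<t. b s k \<in> tsp {s} r n u) \<and> (\<forall>s. indep {..<t} (b s) UNIV)"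
proof -
  have ex: "\<exists>u0 a. (\<forall>k<M. tcoef r n (a k)) \<and> indep {..<M} (\<lambda>k. tval S r n u0 (a k)) (UNIV :: 'k pt set)"
    if rk: "rank_ge TYPE('k) S r n M" for S M
  proof -
    obtain u0 b where b: "\<And>k. k < M \<Longrightarrow> b k \<in> tsp S r n u0" "indep {..<M} b (UNIV :: 'k pt set)"
      using rk unfolding rank_ge_def by blast
    have "\<forall>k. \<exists>a. k < M \<longrightarrow> tcoef r n a \<and> b k = tval S r n u0 a"
      using b(1) unfolding tsp_def by blast
    then obtain a where a: "\<And>k. k < M \<Longrightarrow> tcoef r n (a k) \<and> b k = tval S r n u0 (a k)" by metis
    have "indep {..<M} (\<lambda>k. tval S r n u0 (a k)) UNIV"
      using b(2) a by (subst indep_cong[of _ _ _ b]) auto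
    thus ?thesis using a by (intro exI[of _ u0] exI[of _ a]) simp
  qed
  obtain u0 a where a: "\<And>k. k < N \<Longrightarrow> tcoef r n (a k)" "indep {..<N} (\<lambda>k. tval UNIV r n u0 (a k)) (UNIV :: 'k pt set)"
    using ex[OF assms(1)] by blast
  obtain u1 a1 where a1: "\<And>k. k < t \<Longrightarrow> tcoef r n (a1 k)" "indep {..<t} (\<lambda>k. tval {True} r n u1 (a1 k)) (UNIV :: 'k pt set)"
    using ex[OF assms(2)] by blast
  define u2 where "u2 s = u1 (\<not> s)" for s
  define a2 where "a2 k s = a1 k (\<not> s)" for k s
  have a2: "tval {False} r n u2 (a2 k) = tval {True} r n u1 (a1 k)" for k
    by (simp add: tval_def u2_def a2_def fun_eq_iff)
  define C where "C u \<longleftrightarrow> indep {..<N} (\<lambda>k. tval UNIV r n u (a k)) (UNIV :: 'k pt set)" for u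
  define C1 where "C1 u \<longleftrightarrow> indep {..<t} (\<lambda>k. tval {True} r n u (a1 k)) (UNIV :: 'k pt set)" for u
  define C2 where "C2 u \<longleftrightarrow> indep {..<t} (\<lambda>k. tval {False} r n u (a2 k)) (UNIV :: 'k pt set)" for u
  have o: "zopen C" "zopen C1" "zopen C2"
    unfolding C_def C1_def C2_def by (rule zopen_indep, simp, rule polyc_tval)+
  have c: "C u0" "C1 u1" "C2 u2" using a(2) a1(2) by (simp_all add: C_def C1_def C2_def a2)
  obtain w where w: "C w \<and> C1 w" using zopen_meet[OF o(1,2) c(1,2)] by blast
  obtain w' where w': "(C w' \<and> C1 w') \<and> C2 w'" using zopen_meet[OF zopen_conj[OF o(1,2)] o(3) w c(3)] by blast
  obtain u where u: "(C u \<and> C1 u) \<and> C2 u" "generic (lidx r n) u"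
    using generic_exists[OF finite_lidx zopen_conj[OF zopen_conj[OF o(1,2)] o(3)] w'] by blast
  define b where "b s k = (if s then tval {True} r n u (a1 k) else tval {False} r n u (a2 k))" for s k
  have "b s k \<in> tsp {s} r n u" if "k < t" for s k
  proof -
    have "tcoef r n (a2 k)" using a1(1)[OF that] by (simp add: a2_def tcoef_def)
    thus ?thesis using a1(1)[OF that] by (cases s) (auto simp: b_def tsp_def)
  qed
  moreover have "indep {..<t} (b s) UNIV" for s
    using u(1) by (cases s) (simp_all add: b_def[abs_def] C1_def C2_def)
  ultimately show ?thesis using u a(1) unfolding C_def
    by (intro exI[of _ u] exI[of _ a] exI[of _ b]) blast
qed

section \<open>New lines through no, one or two prescribed meets\<close>

lemma generic_rules:
  assumes "generic L u"
  shows "x \<in> L \<Longrightarrow> y \<in> L \<Longrightarrow> x \<noteq> y \<Longrightarrow> cross (lne u x) (lne u y) \<noteq> z3"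
    and "x \<in> L \<Longrightarrow> y \<in> L \<Longrightarrow> z \<in> L \<Longrightarrow> x \<noteq> y \<Longrightarrow> x \<noteq> z \<Longrightarrow> y \<noteq> z \<Longrightarrow>
      lin (lne u x) (cross (lne u y) (lne u z)) \<noteq> 0"
    and "a \<in> L \<Longrightarrow> b \<in> L \<Longrightarrow> c \<in> L \<Longrightarrow> d \<in> L \<Longrightarrow> e \<in> L \<Longrightarrow> f \<in> L \<Longrightarrow> distinct [a, b, c, d, e, f] \<Longrightarrow>
      det3 (cross (cross (lne u a) (lne u b)) (cross (lne u c) (lne u d))) (lne u e) (lne u f) \<noteq> 0"
proof -
  show "cross (lne u x) (lne u y) \<noteq> z3" if "x \<in> L" "y \<in> L" "x \<noteq> y"
    using assms that unfolding generic_def by blast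
  show "lin (lne u x) (cross (lne u y) (lne u z)) \<noteq> 0"
    if "x \<in> L" "y \<in> L" "z \<in> L" "x \<noteq> y" "x \<noteq> z" "y \<noteq> z"
  proof -
    have "distinct [x, y, z]" using that by simp
    thus ?thesis using assms that(1-3) unfolding generic_def det3_def by blast
  qed
  show "det3 (cross (cross (lne u a) (lne u b)) (cross (lne u c) (lne u d))) (lne u e) (lne u f) \<noteq> 0"
    if "a \<in> L" "b \<in> L" "c \<in> L" "d \<in> L" "e \<in> L" "f \<in> L" "distinct [a, b, c, d, e, f]"
    using assms that unfolding generic_def by blast
qed

lemma rank_ge_0: "rank_ge TYPE('k::field) S r n 0"
  unfolding rank_ge_def by (simp add: indep_def)

text \<open>The new line avoids all meets of the configuration, and only the traces of the two
  blocks are counted.\<close>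

lemma rank_extend0:
  assumes "rank_ge TYPE('k::alg_closed_field) UNIV r n N" "i0 < r"
    "1 \<le> E" "E \<le> n i0 + 2" "E \<le> (\<Sum>i\<in>{..<r} - {i0}. n i)"
  shows "rank_ge TYPE('k) UNIV r (n(i0 := Suc (n i0))) (N + E + (n i0 + 2))"
proof -
  obtain u :: "'k config" and a where gen: "generic (lidx r n) u" and a: "\<And>k. k < N \<Longrightarrow> tcoef r n (a k)"
     "indep {..<N} (\<lambda>k. tval UNIV r n u (a k)) UNIV"
    using rank_generic[OF assms(1) rank_ge_0] by blast
  define X where "X = (\<lambda>(x, y). cross (lne u x) (lne u y)) ` (SIGMA x:lidx r n. lidx r n - {x})"
  have "finite X" by (simp add: X_def)
  moreover have "z3 \<notin> X"
  proof
    assume "z3 \<in> X"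
    then obtain x y where "x \<in> lidx r n" "y \<in> lidx r n" "x \<noteq> y" "cross (lne u x) (lne u y) = z3"
      unfolding X_def by (elim imageE SigmaE DiffE) simp
    thus False using generic_rules(1)[OF gen] by blast
  qed
  ultimately obtain v where v: "\<And>p. p \<in> X \<Longrightarrow> lin v p \<noteq> 0" using avoid_points[of X] by blast
  have vd: "det3 v (lne u x) (lne u y) \<noteq> 0" if "x \<in> lidx r n" "y \<in> lidx r n" "x \<noteq> y" for x y
    unfolding det3_def by (rule v, unfold X_def, rule image_eqI[of _ _ "(x, y)"]) (use that in simp_all)
  have ne: "olines r n i0 s \<noteq> {}" for s using assms(3,5) card_olines[of r n i0 s] by force
  obtain f1 g1 where fg: "f1 \<in> olines r n i0 True" "g1 \<in> olines r n i0 False" using ne by blast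
  have v0: "v \<noteq> z3"
    using vd[OF olines_subset[OF fg(1)] olines_subset[OF fg(2)] olines_disjoint[OF fg]]
    by (cases "lne u f1"; cases "lne u g1") (auto simp: det3_def)
  have "rank_ge TYPE('k) UNIV r (n(i0 := Suc (n i0))) (N + E + (Suc (n i0) + 1) + 0)"
  proof (rule rank_extend_lines[OF assms(2) a refl _ assms(3) _ v0 _ _ fg(1), where Gr = "{}"])
    show "E \<le> Suc (Suc (n i0))" using assms(4) by simp
    show "E \<le> card (olines r n i0 False - {})" using assms(5) by (simp add: card_olines)
    show "det3 v (lne u g) (lne u f) \<noteq> 0" if "g \<in> olines r n i0 False - {}" "f \<in> olines r n i0 True" for g f
      using that olines_disjoint by (intro vd) (blast intro: olines_subset)+
    show "det3 v (lne u g) (lne u g') \<noteq> 0" if "g \<in> olines r n i0 False - {}" "g' \<in> olines r n i0 False - {}" "g \<noteq> g'" for g g'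
      using that by (intro vd) (blast intro: olines_subset)+
    show "det3 v (lne u f1) (lne u g) \<noteq> 0" if "g \<in> olines r n i0 False" for g
      using that fg(1) olines_disjoint by (intro vd) (blast intro: olines_subset)+
  qed simp_all
  thus ?thesis by simp
qed

lemma cross_nonprop:
  assumes "lin g p = 0" "lin g P \<noteq> 0" "p \<noteq> z3"
  shows "cross p P \<noteq> (z3 :: 'k::field pt)"
proof
  assume z: "cross p P = z3"
  have "comb (lin g P) p (- lin g p) P = cross g (cross p P)"
    by (cases g; cases p; cases P) (simp add: algebra_simps)
  also have "\<dots> = z3" unfolding z by (cases g) simp
  finally show False using assms by (cases p; cases P) auto
qed

text \<open>The new line passes through a meet \<open>P\<close> of the two cofactors at which a
  common element \<open>K\<close> is nonzero. The traces of both blocks vanish at \<open>P\<close>,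
  so \<open>\<mu> K\<close> is independent of them. The price is one point of \<open>Q\<close>,
  since the line of the second cofactor through \<open>P\<close> must be skipped; hence the bound
  \<open>n i0 + 2 < S\<close>.\<close>

lemma rank_extend1:
  assumes i0: "i0 < r"
    and rk: "rank_ge TYPE('k::alg_closed_field) UNIV r n (card (mons (\<Sum>i<r. n i)))" "rank_ge TYPE('k) {True} r n t"
      "card (mons (\<Sum>i<r. n i)) + 1 \<le> 2 * t"
    and S: "S = (\<Sum>i\<in>{..<r} - {i0}. n i)" "n i0 + 2 < S" "\<And>i. i < r \<Longrightarrow> i \<noteq> i0 \<Longrightarrow> n i + 1 \<le> S"
  shows "rank_ge TYPE('k) UNIV r (n(i0 := Suc (n i0))) (card (mons (\<Sum>i<r. n i)) + 2 * (n i0 + 2) + 1)"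
proof -
  define N where "N = card (mons (\<Sum>i<r. n i))"
  obtain u :: "'k config" and a b where gen: "generic (lidx r n) u" and a: "\<And>k. k < N \<Longrightarrow> tcoef r n (a k)"
     "indep {..<N} (\<lambda>k. tval UNIV r n u (a k)) UNIV"
     and b: "\<And>s k. k < t \<Longrightarrow> b s k \<in> tsp {s} r n u" "\<And>s. indep {..<t} (b s) UNIV"
    using rank_generic[OF rk(1,2)] unfolding N_def by blast
  note g = generic_rules[OF gen]
  obtain K where K: "\<And>s. K \<in> tsp {s} r n u" "\<exists>p. K p \<noteq> 0"
    using common_element[OF b, where Z = "{}"] rk(3) by auto
  obtain p0 where p0: "K p0 \<noteq> 0" using K(2) by blast
  have "\<exists>x\<in>olines r n i0 True - {}. \<exists>y\<in>olines r n i0 False - {}. K (cross (lne u x) (lne u y)) \<noteq> 0"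
    by (rule exists_nonvanishing_meet[OF i0 gen K(1) p0 S(1), where Rm = "\<lambda>_. {}" and \<rho> = 0]) (use S in auto)
  then obtain m m' where m: "m \<in> olines r n i0 True" "m' \<in> olines r n i0 False" "K (cross (lne u m) (lne u m')) \<noteq> 0"
    by blast
  define P where "P = cross (lne u m) (lne u m')"
  have mm: "m \<in> lidx r n" "m' \<in> lidx r n" "m \<noteq> m'"
    using m olines_disjoint by (blast intro: olines_subset)+
  \<comment> \<open>The joins of \<open>P\<close> with the other meets. A point \<open>w\<close> off
    all of them determines a line \<open>v\<close> through \<open>P\<close> that misses those
    meets.\<close>
  define X where "X = (\<lambda>(x, y). cross (cross (lne u x) (lne u y)) P) ` (SIGMA x:lidx r n - {m, m'}. lidx r n - {x})"
  have "finite X" by (simp add: X_def)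
  moreover have "z3 \<notin> X"
  proof
    assume "z3 \<in> X"
    then obtain x y where xy: "x \<in> lidx r n" "y \<in> lidx r n" "x \<noteq> y" "x \<noteq> m" "x \<noteq> m'"
      "cross (cross (lne u x) (lne u y)) P = z3" unfolding X_def by (elim imageE SigmaE DiffE) simp
    have "cross (cross (lne u x) (lne u y)) P \<noteq> z3"
      unfolding P_def using xy mm by (intro cross_nonprop[of "lne u x"] g lin_cross_self) auto
    thus False using xy(6) by simp
  qed
  ultimately obtain w where w: "\<And>p. p \<in> X \<Longrightarrow> lin w p \<noteq> 0" using avoid_points[of X] by blast
  define v where "v = cross P w"
  have vd: "det3 v (lne u x) (lne u y) \<noteq> 0" if "x \<in> lidx r n" "y \<in> lidx r n" "x \<noteq> y" "x \<noteq> m" "x \<noteq> m'" for x y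
  proof -
    have "lin w (cross (cross (lne u x) (lne u y)) P) \<noteq> 0"
      by (rule w, unfold X_def, rule image_eqI[of _ _ "(x, y)"]) (use that in simp_all)
    thus ?thesis unfolding det3_def v_def lin_commute[of "cross P w"]
      by (simp only: lin_cross_rotate[of "cross (lne u x) (lne u y)" P w] not_False_eq_True)
  qed
  have cO: "card (olines r n i0 s) = S" for s by (simp add: card_olines S)
  have "card (olines r n i0 True - {m}) = S - 1" using m(1) cO by simp
  hence "olines r n i0 True - {m} \<noteq> {}" using S(2) by (intro notI) simp
  then obtain f1 where f1: "f1 \<in> olines r n i0 True" "f1 \<noteq> m" by blast
  have m'f: "f \<noteq> m'" if "f \<in> olines r n i0 True" for f using that m(2) olines_disjoint by blast
  have mg: "g \<noteq> m" if "g \<in> olines r n i0 False" for g using that m(1) olines_disjoint by blast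
  have d1: "det3 v (lne u f1) (lne u g) \<noteq> 0" if "g \<in> olines r n i0 False" for g
    using that f1 m'f olines_disjoint by (intro vd) (blast intro: olines_subset)+
  have v0: "v \<noteq> z3" using d1[OF m(2)] by (cases "lne u f1"; cases "lne u m'") (auto simp: det3_def)
  have P0: "P \<noteq> z3" unfolding P_def using mm by (intro g)
  obtain \<mu> where \<mu>: "lin \<mu> P \<noteq> 0" using nonzero_witness[OF P0] by blast
  have "rank_ge TYPE('k) UNIV r (n(i0 := Suc (n i0))) (N + (n i0 + 2) + (Suc (n i0) + 1) + 1)"
  proof (rule rank_extend_lines[OF i0 a refl _ _ _ v0 _ _ f1(1) d1, where Gr = "{m'}" and K = "\<lambda>_. K" and P = "\<lambda>_. P" and \<mu> = \<mu>])
    show "n i0 + 2 \<le> card (olines r n i0 False - {m'})" using S(2) m(2) by (simp add: cO)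
    show "det3 v (lne u g) (lne u f) \<noteq> 0" if "g \<in> olines r n i0 False - {m'}" "f \<in> olines r n i0 True" for g f
      using that mg olines_disjoint by (intro vd) (blast intro: olines_subset)+
    show "det3 v (lne u g) (lne u g') \<noteq> 0" if "g \<in> olines r n i0 False - {m'}" "g' \<in> olines r n i0 False - {m'}" "g \<noteq> g'" for g g'
      using that mg by (intro vd) (blast intro: olines_subset)+
    have "lin v P = 0" unfolding v_def lin_commute[of "cross P w"] by (rule lin_cross_self)
    moreover have "lin (lne u m) P = 0" "lin (lne u m') P = 0" by (simp_all only: P_def lin_cross_self)
    ultimately show "lin v P = 0 \<and> cof r n (u True) i0 P = 0 \<and> cof r n (u False) i0 P = 0"
      using m unfolding cof_zero_iff by blast
    show "K P \<noteq> 0 \<and> lin \<mu> P \<noteq> 0" using m(3) \<mu> by (simp add: P_def)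
  qed (use K(1) in simp_all)
  thus ?thesis by (simp add: N_def add.assoc mult_2)
qed

text \<open>The new line joins two meets of the cofactors. The second common element is chosen to
  vanish at \<open>P1\<close>, which makes the evaluations at \<open>P1\<close> and
  \<open>P2\<close> triangular; this needs a second dimension in the intersection. The second meet
  is searched among the lines other than \<open>m1\<close> and \<open>l1\<close>, so that four
  different lines are involved, and two points of \<open>Q\<close> are lost.\<close>

lemma rank_extend2:
  assumes i0: "i0 < r"
    and rk: "rank_ge TYPE('k::alg_closed_field) UNIV r n (card (mons (\<Sum>i<r. n i)))" "rank_ge TYPE('k) {True} r n t"
      "card (mons (\<Sum>i<r. n i)) + 2 \<le> 2 * t"
    and S: "S = (\<Sum>i\<in>{..<r} - {i0}. n i)" "n i0 + 3 < S" "\<And>i. i < r \<Longrightarrow> i \<noteq> i0 \<Longrightarrow> n i + 2 \<le> S"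
  shows "rank_ge TYPE('k) UNIV r (n(i0 := Suc (n i0))) (card (mons (\<Sum>i<r. n i)) + 2 * (n i0 + 2) + 2)"
proof -
  define N where "N = card (mons (\<Sum>i<r. n i))"
  obtain u :: "'k config" and a b where gen: "generic (lidx r n) u" and a: "\<And>k. k < N \<Longrightarrow> tcoef r n (a k)"
     "indep {..<N} (\<lambda>k. tval UNIV r n u (a k)) UNIV"
     and b: "\<And>s k. k < t \<Longrightarrow> b s k \<in> tsp {s} r n u" "\<And>s. indep {..<t} (b s) UNIV"
    using rank_generic[OF rk(1,2)] unfolding N_def by blast
  note g = generic_rules[OF gen]
  obtain K where K: "\<And>s. K \<in> tsp {s} r n u" "\<exists>p. K p \<noteq> 0"
    using common_element[OF b, where Z = "{}"] rk(3) by auto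
  have S1: "n i + 1 \<le> S" if "i < r" "i \<noteq> i0" for i using S(3)[OF that] by simp
  obtain p0 where p0: "K p0 \<noteq> 0" using K(2) by blast
  have "\<exists>x\<in>olines r n i0 True - {}. \<exists>y\<in>olines r n i0 False - {}. K (cross (lne u x) (lne u y)) \<noteq> 0"
    by (rule exists_nonvanishing_meet[OF i0 gen K(1) p0 S(1), where Rm = "\<lambda>_. {}" and \<rho> = 0]) (use S(2) S1 in auto)
  then obtain m1 l1 where m1: "m1 \<in> olines r n i0 True" "l1 \<in> olines r n i0 False" "K (cross (lne u m1) (lne u l1)) \<noteq> 0"
    by blast
  define P1 where "P1 = cross (lne u m1) (lne u l1)"
  obtain K' where K': "\<And>s. K' \<in> tsp {s} r n u" "\<exists>p. K' p \<noteq> 0" "K' P1 = 0"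
    using common_element[OF b, where Z = "{P1}"] rk(3) by auto
  have ex: "\<exists>x\<in>olines r n i0 True - {m1}. \<exists>y\<in>olines r n i0 False - {l1}. K' (cross (lne u x) (lne u y)) \<noteq> 0"
  proof -
    obtain p0 where p0: "K' p0 \<noteq> 0" using K'(2) by blast
    have "\<exists>x\<in>olines r n i0 True - (if True then {m1} else {l1}). \<exists>y\<in>olines r n i0 False - (if False then {m1} else {l1}).
        K' (cross (lne u x) (lne u y)) \<noteq> 0"
      by (rule exists_nonvanishing_meet[OF i0 gen K'(1) p0 S(1), where Rm = "\<lambda>s. if s then {m1} else {l1}" and \<rho> = 1])
        (use m1 S in auto)
    thus ?thesis by simp
  qed
  then obtain m2 l2 where m2: "m2 \<in> olines r n i0 True" "m2 \<noteq> m1" "l2 \<in> olines r n i0 False" "l2 \<noteq> l1"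
      "K' (cross (lne u m2) (lne u l2)) \<noteq> 0" by blast
  define P2 where "P2 = cross (lne u m2) (lne u l2)"
  define v where "v = cross P1 P2"
  have OL: "x \<in> lidx r n" if "x \<in> olines r n i0 s" for x s using that by (rule olines_subset)
  have L: "m1 \<in> lidx r n" "l1 \<in> lidx r n" "m2 \<in> lidx r n" "l2 \<in> lidx r n" using m1 m2 OL by blast+
  have dj: "m1 \<noteq> l1" "m1 \<noteq> l2" "m2 \<noteq> l1" "m2 \<noteq> l2" using m1 m2 olines_disjoint by blast+
  \<comment> \<open>If \<open>y\<close> passes through \<open>P1\<close> alone, only the first
    product survives, and symmetrically for \<open>P2\<close>. The case where \<open>y\<close>
    contains neither point is the six-line clause of \<open>generic\<close>.\<close>
  have vid: "det3 v x y = lin y P2 * lin x P1 - lin y P1 * lin x P2" for x y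
    unfolding v_def det3_def by (cases x; cases y; cases P1; cases P2; hypsubst) (simp add: algebra_simps)
  have on: "lin (lne u m1) P1 = 0" "lin (lne u l1) P1 = 0" "lin (lne u m2) P2 = 0" "lin (lne u l2) P2 = 0"
    by (simp_all only: P1_def P2_def lin_cross_self)
  have off1: "lin (lne u x) P1 \<noteq> 0" if "x \<in> lidx r n" "x \<noteq> m1" "x \<noteq> l1" for x
    unfolding P1_def using that L dj by (intro g)
  have off2: "lin (lne u x) P2 \<noteq> 0" if "x \<in> lidx r n" "x \<noteq> m2" "x \<noteq> l2" for x
    unfolding P2_def using that L dj by (intro g)
  have vd: "det3 v (lne u x) (lne u y) \<noteq> 0"
    if x: "x \<in> lidx r n" "x \<notin> {m1, l1, m2, l2}" and y: "y \<in> lidx r n" "x \<noteq> y" for x y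
  proof (cases "y \<in> {m1, l1, m2, l2}")
    case True
    then consider "y \<in> {m1, l1}" | "y \<in> {m2, l2}" by blast
    thus ?thesis
    proof cases
      case 1
      have "lin (lne u y) P1 = 0" using 1 on by auto
      moreover have "lin (lne u y) P2 \<noteq> 0" using 1 y dj m2 by (intro off2) auto
      ultimately show ?thesis using off1[of x] x by (simp add: vid)
    next
      case 2
      have "lin (lne u y) P2 = 0" using 2 on by auto
      moreover have "lin (lne u y) P1 \<noteq> 0" using 2 y dj m2 by (intro off1) auto
      ultimately show ?thesis using off2[of x] x by (simp add: vid)
    qed
  next
    case False
    have "distinct [m1, l1, m2, l2, x, y]" using False x y dj m2 by auto
    thus ?thesis unfolding v_def P1_def P2_def using L x y by (intro g)
  qed
  have cO: "card (olines r n i0 s) = S" for s by (simp add: card_olines S)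
  have "card (olines r n i0 True - {m1, m2}) = S - 2" using m1 m2 cO by (simp add: card_Diff_subset)
  hence "olines r n i0 True - {m1, m2} \<noteq> {}" using S(2) by (intro notI) simp
  then obtain f1 where f1: "f1 \<in> olines r n i0 True" "f1 \<noteq> m1" "f1 \<noteq> m2" by blast
  have TF: "f \<noteq> h" if "f \<in> olines r n i0 True" "h \<in> olines r n i0 False" for f h
    using that olines_disjoint by blast
  have d1: "det3 v (lne u f1) (lne u h) \<noteq> 0" if h: "h \<in> olines r n i0 False" for h
    using f1 TF[OF f1(1) h] TF[OF f1(1) m1(2)] TF[OF f1(1) m2(3)] OL[OF f1(1)] OL[OF h] by (intro vd) auto
  have v0: "v \<noteq> z3" using d1[OF m1(2)] by (cases "lne u f1"; cases "lne u l1") (auto simp: det3_def)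
  have P0: "P1 \<noteq> z3" "P2 \<noteq> z3" unfolding P1_def P2_def by (rule g(1)[OF L(1,2) dj(1)], rule g(1)[OF L(3,4) dj(4)])
  obtain \<mu> where \<mu>: "lin \<mu> P1 \<noteq> 0" "lin \<mu> P2 \<noteq> 0" using avoid_points[of "{P1, P2}"] P0 by auto
  define PP where "PP i = (if i = 0 then P1 else P2)" for i :: nat
  define KK where "KK i = (if i = 0 then K else K')" for i :: nat
  have "rank_ge TYPE('k) UNIV r (n(i0 := Suc (n i0))) (N + (n i0 + 2) + (Suc (n i0) + 1) + 2)"
  proof (rule rank_extend_lines[OF i0 a refl _ _ _ v0 _ _ f1(1) d1, where Gr = "{l1, l2}" and K = KK and P = PP and \<mu> = \<mu>])
    have "card (olines r n i0 False - {l1, l2}) = S - 2" using m1 m2 cO by (simp add: card_Diff_subset)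
    thus "n i0 + 2 \<le> card (olines r n i0 False - {l1, l2})" using S(2) by simp
    show "det3 v (lne u h) (lne u f) \<noteq> 0" if h: "h \<in> olines r n i0 False - {l1, l2}" and f: "f \<in> olines r n i0 True" for h f
      using h f TF[of m1 h] TF[of m2 h] TF[of f h] m1(1) m2(1) OL[of h False] OL[of f True] by (intro vd) auto
    show "det3 v (lne u h) (lne u h') \<noteq> 0" if h: "h \<in> olines r n i0 False - {l1, l2}" "h' \<in> olines r n i0 False - {l1, l2}" "h \<noteq> h'" for h h'
      using h TF[of m1 h] TF[of m2 h] m1(1) m2(1) OL[of h False] OL[of h' False] by (intro vd) auto
    have "lin v P1 = 0" "lin v P2 = 0" unfolding v_def lin_commute[of "cross P1 P2"] by (rule lin_cross_self)+
    moreover have "cof r n (u True) i0 P1 = 0" "cof r n (u False) i0 P1 = 0" "cof r n (u True) i0 P2 = 0" "cof r n (u False) i0 P2 = 0"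
      using m1 m2 on unfolding cof_zero_iff by blast+
    ultimately show "lin v (PP i) = 0 \<and> cof r n (u True) i0 (PP i) = 0 \<and> cof r n (u False) i0 (PP i) = 0" for i
      by (simp add: PP_def)
    show "KK i (PP i) \<noteq> 0 \<and> lin \<mu> (PP i) \<noteq> 0" for i
      using m1(3) m2(5) \<mu> by (simp add: PP_def KK_def P1_def P2_def)
    show "KK i \<in> tsp {s} r n u" for i s using K(1) K'(1) by (simp add: KK_def)
    show "KK i (PP j) = 0" if "i < 2" "j < i" for i j
      using that K'(3) by (simp add: KK_def PP_def)
  qed simp_all
  thus ?thesis by (simp add: N_def add.assoc mult_2)
qed

subsection \<open>The rank of the span of two tangent spaces\<close>

text \<open>The affine dimension of the cone over the variety of products: one scalar and a
  projective space for each factor.\<close>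

definition tdim :: "nat \<Rightarrow> (nat \<Rightarrow> nat) \<Rightarrow> nat" where
  "tdim r n = 1 + (\<Sum>i<r. ((n i + 2) choose 2) - 1)"

lemma two_choose: "2 * int ((k + 2) choose 2) = (int k + 1) * (int k + 2)"
proof -
  have "2 * ((k + 2) choose 2) = (k + 2) * (k + 1)" by (simp add: choose_two)
  hence "int (2 * ((k + 2) choose 2)) = int ((k + 2) * (k + 1))" by simp
  thus ?thesis by (simp add: algebra_simps)
qed

lemma two_card_mons: "2 * int (card (mons d)) = (int d + 1) * (int d + 2)"
  unfolding card_mons by (rule two_choose)

lemma card_mons_Suc: "card (mons (Suc d)) = card (mons d) + d + 2"
  by (simp add: card_mons numeral_2_eq_2)

lemma two_tdim: "2 * int (tdim r n) = 2 + (\<Sum>i<r. (int (n i))\<^sup>2) + 3 * (\<Sum>i<r. int (n i))"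
proof -
  have 1: "1 \<le> ((k + 2) choose 2)" for k :: nat by (simp add: Suc_le_eq)
  have "2 * int (((k + 2) choose 2) - 1) = (int k)\<^sup>2 + 3 * int k" for k
    using 1[of k] two_choose[of k] by (simp add: of_nat_diff algebra_simps power2_eq_square)
  thus ?thesis unfolding tdim_def
    by (simp add: sum_distrib_left sum.distrib del: of_nat_diff)
qed

lemma rank_ge_mono: "rank_ge TYPE('k::field) S r n N \<Longrightarrow> N' \<le> N \<Longrightarrow> rank_ge TYPE('k) S r n N'"
  unfolding rank_ge_def
proof (elim exE conjE)
  fix u b assume "N' \<le> N" "\<forall>k<N. b k \<in> tsp S r n u" "indep {..<N} b (UNIV :: 'k pt set)"
  thus "\<exists>u b. (\<forall>k<N'. b k \<in> tsp S r n u) \<and> indep {..<N'} b (UNIV :: 'k pt set)"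
    by (intro exI[of _ u] exI[of _ b]) (auto intro: indep_subset)
qed

text \<open>The start of the inductions: the cofactor of the only block of positive degree is 1, so
  tangent vectors are arbitrary forms.\<close>

lemma rank_ge_one_block:
  assumes "i0 < r" "\<And>i. i < r \<Longrightarrow> i \<noteq> i0 \<Longrightarrow> n i = 0" "s \<in> S" "finite S"
  shows "rank_ge TYPE('k::alg_closed_field) S r n (card (mons (\<Sum>i<r. n i)))"
proof -
  have d: "(\<Sum>i<r. n i) = n i0"
    using assms(1,2) by (subst sum.remove[of _ i0]) auto
  define u :: "'k config" where "u = (\<lambda>_ _ _. e1)"
  have cof: "cof r n (u s) i0 p = 1" for p
    unfolding cof_def blk_def by (intro prod.neutral) (use assms in auto)
  show ?thesis
  proof (rule rank_geI[of "mons (n i0)" _ mono3 _ _ _ u])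
    show "finite (mons (n i0))" "card (mons (\<Sum>i<r. n i)) \<le> card (mons (n i0))" by (simp_all add: d)
    show "indep (mons (n i0)) mono3 (UNIV :: 'k pt set)" by (rule indep_mono3)
    fix m assume m: "m \<in> mons (n i0)"
    define a :: "bool \<Rightarrow> nat \<Rightarrow> 'k pt \<Rightarrow> 'k" where "a s' i p = (if s' = s \<and> i = i0 then mono3 m p else 0)" for s' i p
    have "a s' i \<in> forms (n i)" for s' i
      using forms_mono3[OF m] by (cases "s' = s \<and> i = i0") (auto simp: a_def[abs_def])
    hence "tcoef r n a" by (simp add: tcoef_def)
    moreover have "tval S r n u a p = mono3 m p" for p
    proof -
      have "(\<Sum>i<r. a s' i p * cof r n (u s') i p) = (if s' = s then mono3 m p else 0)" for s'
      proof -
        have "(\<Sum>i<r. a s' i p * cof r n (u s') i p) = (\<Sum>i\<in>{i0}. a s' i p * cof r n (u s') i p)"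
          using assms(1) by (intro sum.mono_neutral_right) (auto simp: a_def)
        thus ?thesis by (simp add: a_def cof)
      qed
      thus ?thesis using assms(3,4) by (simp add: tval_def)
    qed
    ultimately show "mono3 m \<in> tsp S r n u" unfolding tsp_def by (auto intro!: exI[of _ a])
  qed
qed

text \<open>Adding a line to a block raises \<open>tdim\<close> by exactly the gain of
  \<open>rank_extend_single\<close>.\<close>

lemma rank_single:
  assumes "1 \<le> r"
  shows "rank_ge TYPE('k::alg_closed_field) {True} r n (tdim r n)"
proof (induction "\<Sum>i<r. n i" arbitrary: n)
  case 0
  hence z: "n i = 0" if "i < r" for i using that by simp
  have "tdim r n = 1" unfolding tdim_def using z by (simp add: numeral_2_eq_2)
  moreover have "rank_ge TYPE('k) {True} r n (card (mons (\<Sum>i<r. n i)))"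
    by (rule rank_ge_one_block[of 0]) (use assms z in auto)
  moreover have "card (mons 0) = 1" by (simp add: card_mons numeral_2_eq_2)
  ultimately show ?case using 0 by simp
next
  case (Suc d)
  then obtain i0 where i0: "i0 < r" "n i0 \<noteq> 0" by (metis lessThan_iff nat.simps(3) sum.neutral)
  define n' where "n' = n(i0 := n i0 - 1)"
  have n: "n = n'(i0 := Suc (n' i0))" using i0 by (auto simp: n'_def)
  have s: "(\<Sum>i\<in>{..<r} - {i0}. f (n' i)) = (\<Sum>i\<in>{..<r} - {i0}. f (n i))" for f :: "nat \<Rightarrow> nat"
    by (intro sum.cong) (auto simp: n'_def)
  have sp: "(\<Sum>i<r. f (n i)) = f (n i0) + (\<Sum>i\<in>{..<r} - {i0}. f (n i))" for f :: "nat \<Rightarrow> nat"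
    using i0 by (subst sum.remove[of _ i0]) auto
  have sp': "(\<Sum>i<r. f (n' i)) = f (n' i0) + (\<Sum>i\<in>{..<r} - {i0}. f (n i))" for f :: "nat \<Rightarrow> nat"
    using i0 by (subst sum.remove[of _ i0]) (auto simp: s)
  have "d = (\<Sum>i<r. n' i)" using Suc(2) sp[of "\<lambda>x. x"] sp'[of "\<lambda>x. x"] i0 by (simp add: n'_def)
  hence "rank_ge TYPE('k) {True} r n' (tdim r n')" by (rule Suc(1))
  from rank_extend_single[OF i0(1) this] have "rank_ge TYPE('k) {True} r n (tdim r n' + n' i0 + 2)"
    using n by simp
  moreover have "tdim r n = tdim r n' + n' i0 + 2"
  proof -
    have "n i0 = Suc (n' i0)" using n by (metis fun_upd_same)
    moreover have "((Suc k + 2) choose 2) - 1 = ((k + 2) choose 2) - 1 + k + 2" for k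
    proof -
      have "((Suc k + 2) choose 2) = ((k + 2) choose 2) + k + 2" by (simp add: numeral_2_eq_2)
      moreover have "1 \<le> ((k + 2) choose 2)" by (simp add: Suc_le_eq)
      ultimately show ?thesis by simp
    qed
    ultimately show ?thesis unfolding tdim_def
      using sp[of "\<lambda>k. ((k + 2) choose 2) - 1"] sp'[of "\<lambda>k. ((k + 2) choose 2) - 1"] by simp
  qed
  ultimately show ?case by simp
qed

text \<open>With \<open>d = \<Sum> n i\<close> and \<open>Q = \<Sum> (n i)\<^sup>2\<close>, the span of two tangent spaces has expected dimension
  \<open>2 + Q + 3 d\<close> in a space of dimension \<open>(d + 1) (d + 2) / 2\<close>; twice the difference is \<open>2 Q - d\<^sup>2 + 3 d + 2\<close>.
  For the block \<open>i\<close>, \<open>3 s - 2 p = 3 (d - n i) - (d - n i)\<^sup>2 + Q - (n i)\<^sup>2\<close>.\<close>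

definition fillable :: "nat \<Rightarrow> (nat \<Rightarrow> nat) \<Rightarrow> bool" where
  "fillable r n \<longleftrightarrow> (let d = (\<Sum>i<r. int (n i)); Q = (\<Sum>i<r. (int (n i))\<^sup>2) in
     0 \<le> 2 * Q - d\<^sup>2 + 3 * d + 2 \<and>
     (\<forall>i<r. d \<le> 2 * int (n i) \<longrightarrow> 0 \<le> 3 * (d - int (n i)) - (d - int (n i))\<^sup>2 + Q - (int (n i))\<^sup>2))"

lemma max_block:
  assumes "1 \<le> r"
  shows "\<exists>i0<r. \<forall>i<r. (n::nat \<Rightarrow> nat) i \<le> n i0"
proof -
  have "Max (n ` {..<r}) \<in> n ` {..<r}" using assms by (intro Max_in) (auto simp: lessThan_empty_iff)
  then obtain i0 where "i0 < r" "n i0 = Max (n ` {..<r})" by auto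
  thus ?thesis by (metis Max_ge finite_imageI finite_lessThan imageI lessThan_iff)
qed

text \<open>One induction step read downwards: \<open>n'\<close> has one line less in a largest
  block, and \<open>S\<close> is the degree of the cofactor of that block. Integers avoid truncated
  subtraction. Taking a largest block gives \<open>Q \<le> M * d\<close>, the inequality that limits
  \<open>S - M\<close>.\<close>

locale reduce_block =
  fixes r :: nat and n n' :: "nat \<Rightarrow> nat" and i0 :: nat and M S d Q :: int
  assumes i0: "i0 < r" and mx: "\<And>i. i < r \<Longrightarrow> n i \<le> n i0" and pos: "0 < S"
    and n'_def: "n' = n(i0 := n i0 - 1)" and M_def: "M = int (n i0)"
    and S_def: "S = (\<Sum>i\<in>{..<r} - {i0}. int (n i))"
    and d_def: "d = (\<Sum>i<r. int (n i))" and Q_def: "Q = (\<Sum>i<r. (int (n i))\<^sup>2)"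
begin

lemma d_eq: "d = M + S" unfolding d_def M_def S_def using i0 by (subst sum.remove[of _ i0]) auto

lemma M_pos: "1 \<le> n i0"
proof (rule ccontr)
  assume "\<not> 1 \<le> n i0"
  hence "n i = 0" if "i < r" for i using mx[OF that] by simp
  hence "S = 0" unfolding S_def by (intro sum.neutral) auto
  thus False using pos by simp
qed

lemma n_eq: "n = n'(i0 := Suc (n' i0))" using M_pos by (auto simp: n'_def)

lemma n'_i0: "int (n' i0) = M - 1" using M_pos by (simp add: n'_def M_def of_nat_diff)

lemma S_nat: "(\<Sum>i\<in>{..<r} - {i0}. n' i) = nat S" "int (nat S) = S"
proof -
  show "int (nat S) = S" using pos by simp
  have "int (\<Sum>i\<in>{..<r} - {i0}. n' i) = S"
    unfolding S_def of_nat_sum by (intro sum.cong) (auto simp: n'_def)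
  thus "(\<Sum>i\<in>{..<r} - {i0}. n' i) = nat S" by linarith
qed

lemma d': "(\<Sum>i<r. int (n' i)) = d - 1"
proof -
  have "(\<Sum>i<r. int (n' i)) = int (n' i0) + (\<Sum>i\<in>{..<r} - {i0}. int (n' i))"
    using i0 by (subst sum.remove[of _ i0]) auto
  thus ?thesis using S_nat n'_i0 d_eq by (simp flip: of_nat_sum)
qed

lemma d'_nat: "int (\<Sum>i<r. n' i) = d - 1" using d' by simp

lemma Q': "(\<Sum>i<r. (int (n' i))\<^sup>2) = Q - 2 * M + 1"
proof -
  have "(\<Sum>i<r. (int (n' i))\<^sup>2) = (M - 1)\<^sup>2 + (\<Sum>i\<in>{..<r} - {i0}. (int (n' i))\<^sup>2)"
    using i0 n'_i0 by (subst sum.remove[of _ i0]) auto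
  also have "(\<Sum>i\<in>{..<r} - {i0}. (int (n' i))\<^sup>2) = (\<Sum>i\<in>{..<r} - {i0}. (int (n i))\<^sup>2)"
    by (intro sum.cong) (auto simp: n'_def)
  also have "\<dots> = Q - M\<^sup>2" unfolding Q_def M_def using i0 by (subst sum.remove[of _ i0]) auto
  finally show ?thesis by (simp add: power2_eq_square algebra_simps)
qed

lemma Q_le: "Q \<le> M * d"
  unfolding Q_def d_def sum_distrib_left power2_eq_square M_def
  using mx by (intro sum_mono mult_right_mono) auto

lemma card_d: "card (mons (\<Sum>i<r. n i)) = card (mons (\<Sum>i<r. n' i)) + nat (d + 1)"
proof -
  have "int (\<Sum>i<r. n i) = int (Suc (\<Sum>i<r. n' i))" using d'_nat by (simp add: d_def)
  hence e: "(\<Sum>i<r. n i) = Suc (\<Sum>i<r. n' i)" by linarith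
  show ?thesis unfolding e card_mons_Suc using d'_nat by linarith
qed

lemma tdim_eq: "2 * int (tdim r n) = 2 + Q + 3 * d" by (simp add: two_tdim Q_def d_def)

lemma tdim_eq': "2 * int (tdim r n') = 2 + Q - 2 * M + 1 + 3 * (d - 1)" by (simp only: two_tdim Q' d')

lemma card_mons_d': "2 * int (card (mons (\<Sum>i<r. n' i))) = d * (d + 1)"
proof -
  have "2 * int (card (mons (\<Sum>i<r. n' i))) = (int (\<Sum>i<r. n' i) + 1) * (int (\<Sum>i<r. n' i) + 2)"
    by (rule two_card_mons)
  thus ?thesis unfolding d'_nat by (simp add: algebra_simps)
qed

lemma le_S: "i < r \<Longrightarrow> i \<noteq> i0 \<Longrightarrow> n' i \<le> n i0"
  using mx by (simp add: n'_def)

lemma extend0: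
  assumes "rank_ge TYPE('k::alg_closed_field) UNIV r n' N"
  shows "rank_ge TYPE('k) UNIV r n (N + min (nat S) (n i0 + 1) + (n i0 + 1))"
proof -
  have "rank_ge TYPE('k) UNIV r (n'(i0 := Suc (n' i0))) (N + min (nat S) (n i0 + 1) + (n' i0 + 2))"
    by (rule rank_extend0[OF assms i0]) (use pos S_nat M_pos in \<open>auto simp: n'_def\<close>)
  moreover have "n' i0 + 2 = n i0 + 1" using M_pos by (simp add: n'_def)
  ultimately show ?thesis using n_eq by simp
qed

lemma extend1:
  assumes "rank_ge TYPE('k::alg_closed_field) UNIV r n' (card (mons (\<Sum>i<r. n' i)))"
    and "card (mons (\<Sum>i<r. n' i)) + 1 \<le> 2 * tdim r n'" "M + 2 \<le> S"
  shows "rank_ge TYPE('k) UNIV r n (card (mons (\<Sum>i<r. n' i)) + 2 * (n i0 + 1) + 1)"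
proof -
  have r: "1 \<le> r" using i0 by simp
  have "rank_ge TYPE('k) UNIV r (n'(i0 := Suc (n' i0))) (card (mons (\<Sum>i<r. n' i)) + 2 * (n' i0 + 2) + 1)"
  proof (rule rank_extend1[OF i0 assms(1) rank_single[OF r] assms(2) S_nat(1)[symmetric]])
    show "n' i0 + 2 < nat S" using assms(3) S_nat n'_i0 by linarith
    show "n' i + 1 \<le> nat S" if "i < r" "i \<noteq> i0" for i
      using le_S[OF that] assms(3) S_nat unfolding M_def by linarith
  qed
  moreover have "n' i0 + 2 = n i0 + 1" using M_pos by (simp add: n'_def)
  ultimately show ?thesis using n_eq by simp
qed

lemma extend2:
  assumes "rank_ge TYPE('k::alg_closed_field) UNIV r n' (card (mons (\<Sum>i<r. n' i)))"
    and "card (mons (\<Sum>i<r. n' i)) + 2 \<le> 2 * tdim r n'" "M + 3 \<le> S"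
  shows "rank_ge TYPE('k) UNIV r n (card (mons (\<Sum>i<r. n' i)) + 2 * (n i0 + 1) + 2)"
proof -
  have r: "1 \<le> r" using i0 by simp
  have "rank_ge TYPE('k) UNIV r (n'(i0 := Suc (n' i0))) (card (mons (\<Sum>i<r. n' i)) + 2 * (n' i0 + 2) + 2)"
  proof (rule rank_extend2[OF i0 assms(1) rank_single[OF r] assms(2) S_nat(1)[symmetric]])
    show "n' i0 + 3 < nat S" using assms(3) S_nat n'_i0 by linarith
    show "n' i + 2 \<le> nat S" if "i < r" "i \<noteq> i0" for i
      using le_S[OF that] assms(3) S_nat unfolding M_def by linarith
  qed
  moreover have "n' i0 + 2 = n i0 + 1" using M_pos by (simp add: n'_def)
  ultimately show ?thesis using n_eq by simp
qed

lemma square_sum_ge: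
  assumes "i < r" "i \<noteq> i0"
  shows "M\<^sup>2 + (int (n i))\<^sup>2 + (d - M - int (n i)) \<le> Q" "M + int (n i) \<le> d"
proof -
  have sp: "(\<Sum>j<r. f j) = f i0 + f i + (\<Sum>j\<in>{..<r} - {i0} - {i}. f j)" for f :: "nat \<Rightarrow> int"
    using assms i0 by (subst sum.remove[of _ i0], simp, simp, subst sum.remove[of _ i]) auto
  have "(\<Sum>j\<in>{..<r} - {i0} - {i}. int (n j)) \<le> (\<Sum>j\<in>{..<r} - {i0} - {i}. (int (n j))\<^sup>2)"
  proof (rule sum_mono)
    fix j
    have "n j \<le> n j * n j" by (cases "n j") auto
    thus "int (n j) \<le> (int (n j))\<^sup>2" by (simp add: power2_eq_square flip: of_nat_mult)
  qed
  moreover have "0 \<le> (\<Sum>j\<in>{..<r} - {i0} - {i}. int (n j))" by (intro sum_nonneg) auto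
  ultimately show "M\<^sup>2 + (int (n i))\<^sup>2 + (d - M - int (n i)) \<le> Q" "M + int (n i) \<le> d"
    unfolding Q_def d_def M_def sp by simp_all
qed

lemma fillable_reduce:
  assumes "fillable r n"
  shows "fillable r n'"
proof -
  have H1: "0 \<le> 2 * Q - d\<^sup>2 + 3 * d + 2"
    and H2: "\<And>i. i < r \<Longrightarrow> d \<le> 2 * int (n i) \<Longrightarrow> 0 \<le> 3 * (d - int (n i)) - (d - int (n i))\<^sup>2 + Q - (int (n i))\<^sup>2"
    using assms unfolding fillable_def Let_def d_def[symmetric] Q_def[symmetric] by auto
  \<comment> \<open>Removing the line changes the surplus by \<open>2 * (d - 1 - 2 * M)\<close>,
    which is harmless while the largest block is below half the degree. Otherwise the second
    condition for this block takes over, and the rest is a product of consecutive integers.\<close>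
  have "0 \<le> 2 * (Q - 2 * M + 1) - (d - 1)\<^sup>2 + 3 * (d - 1) + 2"
  proof (cases "2 * M \<le> d - 1")
    case True
    have "2 * (Q - 2 * M + 1) - (d - 1)\<^sup>2 + 3 * (d - 1) + 2 = (2 * Q - d\<^sup>2 + 3 * d + 2) + 2 * (d - 1 - 2 * M)"
      by (simp add: power2_eq_square algebra_simps)
    moreover have "0 \<le> 2 * (d - 1 - 2 * M)" using True by simp
    ultimately show ?thesis using H1 by (metis add_nonneg_nonneg)
  next
    case False
    hence "0 \<le> 3 * (d - M) - (d - M)\<^sup>2 + Q - M\<^sup>2" using H2[OF i0] by (simp add: M_def)
    moreover have "2 * (Q - 2 * M + 1) - (d - 1)\<^sup>2 + 3 * (d - 1) + 2 =
        2 * (3 * (d - M) - (d - M)\<^sup>2 + Q - M\<^sup>2) + (2 * M - d) * (2 * M - d + 1)"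
      by (simp add: power2_eq_square algebra_simps)
    moreover have "0 \<le> (2 * M - d) * (2 * M - d + 1)" using False by (intro mult_nonneg_nonneg) auto
    ultimately show ?thesis by (metis add_nonneg_nonneg mult_nonneg_nonneg zero_le_numeral)
  qed
  moreover have "0 \<le> 3 * (d - 1 - int (n' i)) - (d - 1 - int (n' i))\<^sup>2 + (Q - 2 * M + 1) - (int (n' i))\<^sup>2"
    if i: "i < r" "d - 1 \<le> 2 * int (n' i)" for i
  proof (cases "i = i0")
    case True
    \<comment> \<open>For the shortened block, the differences \<open>d - n i\<close> and
      \<open>Q - (n i)\<close> squared are the same before and after, so the condition carries over
      unchanged.\<close>
    hence "d \<le> 2 * int (n i0)" using i(2) n'_i0 unfolding M_def by simp
    from H2[OF i0 this] show ?thesis unfolding True n'_i0 M_def[symmetric]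
      by (simp add: power2_eq_square algebra_simps)
  next
    case False
    hence ni: "n' i = n i" by (simp add: n'_def)
    define x where "x = int (n i)"
    define y where "y = d - M - x"
    note sq = square_sum_ge[OF i(1) False, folded x_def]
    have xM: "x \<le> M" using mx[OF i(1)] by (simp add: x_def M_def)
    have dx: "d - 1 \<le> 2 * x" using i(2) by (simp add: ni x_def)
    \<comment> \<open>Two different blocks, each close to half the degree, leave at most one line
      for all the others.\<close>
    have "y = 0 \<or> y = 1" using sq(2) xM dx unfolding y_def by linarith
    hence "0 \<le> 3 * (M + y - 1) - (M + y - 1)\<^sup>2 + M\<^sup>2 - 2 * M + 1 + y"
    proof
      assume "y = 0"
      thus ?thesis using M_pos by (simp add: M_def power2_eq_square algebra_simps)
    next
      assume "y = 1"
      thus ?thesis using M_pos by (simp add: M_def power2_eq_square algebra_simps)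
    qed
    also have "3 * (M + y - 1) - (M + y - 1)\<^sup>2 + M\<^sup>2 - 2 * M + 1 + y \<le>
        3 * (M + y - 1) - (M + y - 1)\<^sup>2 + (Q - 2 * M + 1) - x\<^sup>2"
      using sq(1)[folded y_def] by simp
    also have "M + y - 1 = d - 1 - x" by (simp add: y_def)
    finally show ?thesis unfolding ni x_def .
  qed
  ultimately show ?thesis unfolding fillable_def Let_def Q' d' by blast
qed

end

text \<open>The step has to gain \<open>d + 1 = M + S + 1\<close>, while the block traces give
  \<open>M + 1\<close> and \<open>min S (M + 1)\<close>. The cases are ordered by the shortfall
  \<open>S - M - 1\<close>, which is also the number of common elements to be used.\<close>

lemma rank_fill:
  assumes "1 \<le> r" "fillable r n"
  shows "rank_ge TYPE('k::alg_closed_field) UNIV r n (card (mons (\<Sum>i<r. n i)))"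
  using assms(2)
proof (induction "\<Sum>i<r. n i" arbitrary: n rule: less_induct)
  case less
  obtain i0 where i0: "i0 < r" "\<And>i. i < r \<Longrightarrow> n i \<le> n i0" using max_block[OF assms(1)] by blast
  show ?case
  proof (cases "0 < (\<Sum>i\<in>{..<r} - {i0}. int (n i))")
    case False
    have "n i = 0" if "i < r" "i \<noteq> i0" for i
    proof -
      have "int (n i) \<le> (\<Sum>i\<in>{..<r} - {i0}. int (n i))" using that by (intro member_le_sum) auto
      thus ?thesis using False by simp
    qed
    thus ?thesis using i0(1) by (intro rank_ge_one_block[of i0 _ _ True]) auto
  next
    case True
    define n' where "n' = n(i0 := n i0 - 1)"
    define M where "M = int (n i0)"
    define S where "S = (\<Sum>i\<in>{..<r} - {i0}. int (n i))"
    define d where "d = (\<Sum>i<r. int (n i))"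
    define Q where "Q = (\<Sum>i<r. (int (n i))\<^sup>2)"
    interpret reduce_block r n n' i0 M S d Q
      by unfold_locales (use i0 True in \<open>auto simp: n'_def M_def S_def d_def Q_def\<close>)
    have dn: "int (\<Sum>i<r. n i) = d" by (simp add: d_def)
    have "(\<Sum>i<r. n' i) < (\<Sum>i<r. n i)" using d'_nat dn by linarith
    from less.hyps[OF this fillable_reduce[OF less.prems]]
    have IH: "rank_ge TYPE('k) UNIV r n' (card (mons (\<Sum>i<r. n' i)))" .
    define A where "A = 2 * Q - d\<^sup>2 + 3 * d + 2"
    have H1: "0 \<le> A"
      using less.prems unfolding fillable_def Let_def d_def Q_def A_def by blast
    have M1: "1 \<le> M" using M_pos by (simp add: M_def)
    \<comment> \<open>Twice the surplus of the smaller product. It exceeds \<open>A\<close> by twice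
      the shortfall, so \<open>0 \<le> A\<close> guarantees an intersection of at least the
      dimension required.\<close>
    have key: "2 * (2 * int (tdim r n')) - 2 * int (card (mons (\<Sum>i<r. n' i))) = A + 2 * (S - 1 - M)"
      unfolding A_def tdim_eq' card_mons_d' using d_eq by (simp add: power2_eq_square algebra_simps)
    consider "S \<le> M + 1" | "S = M + 2" | "S = M + 3" | "M + 4 \<le> S" by linarith
    thus ?thesis
    proof cases
      case 1
      hence "min (nat S) (n i0 + 1) = nat S" by (simp add: M_def min_def)
      moreover have "nat S + (n i0 + 1) = nat (d + 1)" using d_eq pos by (simp add: M_def nat_add_distrib)
      ultimately have "card (mons (\<Sum>i<r. n' i)) + nat (d + 1) = card (mons (\<Sum>i<r. n' i)) + min (nat S) (n i0 + 1) + (n i0 + 1)"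
        by linarith
      thus ?thesis using extend0[OF IH] unfolding card_d by (simp only:)
    next
      case 2
      have "card (mons (\<Sum>i<r. n' i)) + 1 \<le> 2 * tdim r n'" using key H1 2 by presburger
      from extend1[OF IH this] 2 have "rank_ge TYPE('k) UNIV r n (card (mons (\<Sum>i<r. n' i)) + 2 * (n i0 + 1) + 1)" by simp
      moreover have "card (mons (\<Sum>i<r. n' i)) + nat (d + 1) = card (mons (\<Sum>i<r. n' i)) + 2 * (n i0 + 1) + 1"
        using d_eq 2 by (simp add: M_def)
      ultimately show ?thesis unfolding card_d by (simp only:)
    next
      case 3
      have "card (mons (\<Sum>i<r. n' i)) + 2 \<le> 2 * tdim r n'" using key H1 3 by presburger
      from extend2[OF IH this] 3 have "rank_ge TYPE('k) UNIV r n (card (mons (\<Sum>i<r. n' i)) + 2 * (n i0 + 1) + 2)" by simp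
      moreover have "card (mons (\<Sum>i<r. n' i)) + nat (d + 1) = card (mons (\<Sum>i<r. n' i)) + 2 * (n i0 + 1) + 2"
        using d_eq 3 by (simp add: M_def)
      ultimately show ?thesis unfolding card_d by (simp only:)
    next
      case 4
      \<comment> \<open>A shortfall of three or more makes \<open>d - 2 * M\<close> at least 4, and
        then \<open>Q \<le> M * d\<close> pushes the surplus \<open>A\<close> below zero.\<close>
      have "d * 4 \<le> d * (d - 2 * M)" using 4 d_eq M1 by (intro mult_left_mono) auto
      moreover have "A \<le> 3 * d + 2 - d * (d - 2 * M)"
        using Q_le by (simp add: A_def power2_eq_square algebra_simps)
      ultimately have False using H1 4 d_eq M1 by linarith
      thus ?thesis ..
    qed
  qed
qed

text \<open>Here each step has to gain \<open>2 * (M + 1)\<close>, which \<open>extend0\<close>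
  provides as long as the smaller tangent spaces are independent. The exceptional step starts from a
  product whose tangent spaces fill the ambient space with a surplus of exactly one; there a single
  common element repairs the loss.\<close>

lemma rank_inject:
  assumes "1 \<le> r" "2 * (\<Sum>i<r. (int (n i))\<^sup>2) - (\<Sum>i<r. int (n i))\<^sup>2 + 3 * (\<Sum>i<r. int (n i)) + 2 \<le> 0"
    "\<And>i. i < r \<Longrightarrow> 2 * int (n i) < (\<Sum>i<r. int (n i))"
  shows "rank_ge TYPE('k::alg_closed_field) UNIV r n (2 * tdim r n)"
  using assms(2,3)
proof (induction "\<Sum>i<r. n i" arbitrary: n rule: less_induct)
  case less
  obtain i0 where i0: "i0 < r" "\<And>i. i < r \<Longrightarrow> n i \<le> n i0" using max_block[OF assms(1)] by blast
  define n' where "n' = n(i0 := n i0 - 1)"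
  define M where "M = int (n i0)"
  define S where "S = (\<Sum>i\<in>{..<r} - {i0}. int (n i))"
  define d where "d = (\<Sum>i<r. int (n i))"
  define Q where "Q = (\<Sum>i<r. (int (n i))\<^sup>2)"
  have "d = M + S" unfolding d_def M_def S_def using i0 by (subst sum.remove[of _ i0]) auto
  moreover have "2 * M < d" using less.prems(2)[OF i0(1)] by (simp add: M_def d_def)
  ultimately have S0: "0 < S" unfolding M_def by linarith
  interpret reduce_block r n n' i0 M S d Q
    by unfold_locales (use i0 S0 in \<open>auto simp: n'_def M_def S_def d_def Q_def\<close>)
  have dn: "int (\<Sum>i<r. n i) = d" by (simp add: d_def)
  have lt: "(\<Sum>i<r. n' i) < (\<Sum>i<r. n i)" using d'_nat dn by linarith
  define A where "A = 2 * Q - d\<^sup>2 + 3 * d + 2"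
  have H1: "A \<le> 0" using less.prems(1) by (simp add: d_def Q_def A_def)
  have H2: "2 * int (n i) < d" if "i < r" for i using less.prems(2)[OF that] by (simp add: d_def)
  have M1: "1 \<le> M" using M_pos by (simp add: M_def)
  have cv: "2 * int (card (mons (\<Sum>i<r. n i))) = (d + 1) * (d + 2)"
    using two_card_mons[of "\<Sum>i<r. n i"] unfolding dn .
  have u2: "2 * (2 * int (tdim r n)) - 2 * int (card (mons (\<Sum>i<r. n i))) = A"
    unfolding tdim_eq cv A_def by (simp add: power2_eq_square algebra_simps)
  have key: "2 * (2 * int (tdim r n')) - 2 * int (card (mons (\<Sum>i<r. n' i))) = A + 2 * (d - 1 - 2 * M)"
    unfolding tdim_eq' card_mons_d' A_def by (simp add: power2_eq_square algebra_simps)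
  have tt: "2 * int (tdim r n) = 2 * int (tdim r n') + 2 * M + 2" unfolding tdim_eq tdim_eq' by simp
  show ?case
  proof (cases "A = 0")
    case True
    have "fillable r n" unfolding fillable_def Let_def d_def[symmetric] Q_def[symmetric] A_def[symmetric]
      using True H2 by (auto simp: not_le[symmetric])
    moreover have "2 * tdim r n = card (mons (\<Sum>i<r. n i))" using u2 True by presburger
    ultimately show ?thesis using rank_fill[OF assms(1)] by (simp only:)
  next
    case False
    hence neg: "A < 0" using H1 by simp
    define \<delta> where "\<delta> = A + 2 * (d - 1 - 2 * M)"
    have \<delta>': "2 * (Q - 2 * M + 1) - (d - 1)\<^sup>2 + 3 * (d - 1) + 2 = \<delta>"
      unfolding \<delta>_def A_def by (simp add: power2_eq_square algebra_simps)
    have H2': "2 * int (n' i) < d - 1" if i: "i < r" for i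
    proof (cases "i = i0")
      case True
      thus ?thesis using n'_i0 H2[OF i0] unfolding M_def by simp
    next
      case i: False
      hence ni: "n' i = n i" by (simp add: n'_def)
      show ?thesis
      proof (rule ccontr)
        assume "\<not> ?thesis"
        hence e: "2 * int (n i) = d - 1" using H2[OF \<open>i < r\<close>] by (simp add: ni)
        \<comment> \<open>Two blocks of degree \<open>M\<close> with total degree
          \<open>2 * M + 1\<close> would make \<open>A\<close> positive, because the squares
          contribute at least \<open>2 * M\<close> squared plus one.\<close>
        have "int (n i) = M" using e mx[OF \<open>i < r\<close>] H2[OF i0] unfolding M_def by linarith
        with square_sum_ge[OF \<open>i < r\<close> i] e have "2 * M\<^sup>2 + 1 \<le> Q" and "d = 2 * M + 1" by auto
        thus False using neg M1 by (simp add: A_def power2_eq_square algebra_simps)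
      qed
    qed
    have cS: "M + 1 \<le> S" using H2[OF i0] d_eq unfolding M_def by linarith
    show ?thesis
    proof (cases "\<delta> \<le> 0")
      case True
      have "rank_ge TYPE('k) UNIV r n' (2 * tdim r n')"
        by (rule less.hyps[OF lt]) (use True H2' \<delta>' in \<open>simp_all only: Q' d'\<close>)
      from extend0[OF this] show ?thesis
      proof (rule rank_ge_mono)
        have "min (nat S) (n i0 + 1) = n i0 + 1" using cS unfolding M_def by linarith
        thus "2 * tdim r n \<le> 2 * tdim r n' + min (nat S) (n i0 + 1) + (n i0 + 1)"
          using tt unfolding M_def by (linarith | presburger)
      qed
    next
      case False
      have "fillable r n'" unfolding fillable_def Let_def Q' d' \<delta>' using False H2'
        by (auto simp: not_le[symmetric])
      from rank_fill[OF assms(1) this] have IH: "rank_ge TYPE('k) UNIV r n' (card (mons (\<Sum>i<r. n' i)))" .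
      have ev: "\<delta> = 2 * (2 * int (tdim r n') - int (card (mons (\<Sum>i<r. n' i))))" using key unfolding \<delta>_def by simp
      have c1: "card (mons (\<Sum>i<r. n' i)) + 1 \<le> 2 * tdim r n'" using ev False by presburger
      \<comment> \<open>With \<open>c = S - M - 1\<close> the surplus of the smaller product is
        \<open>A + 2 * c\<close>. If it were 4 or more, then \<open>c\<close> would be at least 3,
        because \<open>A\<close> is at most -2; but \<open>A \<le> 2 - d * (c - 2)\<close> with
        \<open>d \<ge> c + 3\<close> is then too negative.\<close>
      have "\<delta> \<le> 2"
      proof (rule ccontr)
        assume "\<not> \<delta> \<le> 2"
        hence d4: "4 \<le> \<delta>" using ev by presburger
        define c where "c = d - 1 - 2 * M"
        have neg2: "A \<le> - 2" using neg u2 by presburger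
        have c3: "3 \<le> c" using d4 neg2 unfolding \<delta>_def c_def by presburger
        have "A \<le> 2 - d * (c - 2)"
          using Q_le by (simp add: A_def c_def power2_eq_square algebra_simps)
        hence "d * (c - 2) \<le> 2 * c - 2" using d4 unfolding \<delta>_def c_def[symmetric] by (smt (verit))
        moreover have "(c + 3) * (c - 2) \<le> d * (c - 2)" using c3 M1 by (intro mult_right_mono) (auto simp: c_def)
        ultimately have "c * c \<le> c + 4" by (simp add: algebra_simps)
        moreover have "3 * c \<le> c * c" using c3 by (intro mult_right_mono) auto
        ultimately show False using c3 by (smt (verit))
      qed
      hence d2: "2 * int (tdim r n') = int (card (mons (\<Sum>i<r. n' i))) + 1" using ev False by presburger
      have "M + 2 \<le> S" using False neg d_eq unfolding \<delta>_def by presburger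
      from extend1[OF IH c1 this] show ?thesis
      proof (rule rank_ge_mono)
        show "2 * tdim r n \<le> card (mons (\<Sum>i<r. n' i)) + 2 * (n i0 + 1) + 1"
          using tt d2 unfolding M_def by (presburger | linarith)
      qed
    qed
  qed
qed

section \<open>Dimension of closed cones\<close>

subsection \<open>Homogeneous polynomial functions\<close>

definition mf :: "(mon \<Rightarrow>\<^sub>0 nat) \<Rightarrow> (mon \<Rightarrow> 'k::field) \<Rightarrow> 'k" where
  "mf \<alpha> F = (\<Prod>m\<in>Poly_Mapping.keys \<alpha>. F m ^ Poly_Mapping.lookup \<alpha> m)"

definition pmdeg :: "(mon \<Rightarrow>\<^sub>0 nat) \<Rightarrow> nat" where
  "pmdeg \<alpha> = (\<Sum>m\<in>Poly_Mapping.keys \<alpha>. Poly_Mapping.lookup \<alpha> m)"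

text \<open>\<open>Hom t\<close> and \<open>PF\<close> are the functions behind
  \<open>coordpoly\<close>, homogeneous of degree \<open>t\<close> and arbitrary. As functions they
  are multiplied and substituted pointwise; \<open>Hom_peval\<close> and
  \<open>homogeneous_peval_Hom\<close> connect them with the coordinate polynomials.\<close>

definition Hom :: "nat \<Rightarrow> ((mon \<Rightarrow> 'k::field) \<Rightarrow> 'k) set" where
  "Hom t = lspan (mf ` {\<alpha>. pmdeg \<alpha> = t})"

definition PF :: "((mon \<Rightarrow> 'k::field) \<Rightarrow> 'k) set" where
  "PF = lspan (range mf)"

lemma mf_superset:
  assumes "finite A" "Poly_Mapping.keys \<alpha> \<subseteq> A"
  shows "mf \<alpha> F = (\<Prod>m\<in>A. F m ^ Poly_Mapping.lookup \<alpha> m)"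
  unfolding mf_def using assms by (intro prod.mono_neutral_left) (auto simp: in_keys_iff)

lemma mf_add: "mf (\<alpha> + \<beta>) F = mf \<alpha> F * mf \<beta> F"
proof -
  define A where "A = Poly_Mapping.keys \<alpha> \<union> Poly_Mapping.keys \<beta>"
  have A: "finite A" "Poly_Mapping.keys \<alpha> \<subseteq> A" "Poly_Mapping.keys \<beta> \<subseteq> A" "Poly_Mapping.keys (\<alpha> + \<beta>) \<subseteq> A"
    using Poly_Mapping.keys_add[of \<alpha> \<beta>] by (auto simp: A_def)
  show ?thesis unfolding mf_superset[OF A(1,2)] mf_superset[OF A(1,3)] mf_superset[OF A(1,4)]
    by (simp add: lookup_add power_add prod.distrib)
qed

lemma mf_scale: "mf \<alpha> (\<lambda>m. c * F m) = c ^ pmdeg \<alpha> * mf \<alpha> F"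
  unfolding mf_def pmdeg_def by (simp add: power_mult_distrib prod.distrib power_sum)

lemma Hom_scale:
  assumes "f \<in> Hom t"
  shows "f (\<lambda>m. c * F m) = c ^ t * f F"
  using assms unfolding Hom_def
  by (induction rule: lspan.induct) (auto simp: mf_scale algebra_simps)

lemma PF_mult: "f \<in> PF \<Longrightarrow> g \<in> PF \<Longrightarrow> (\<lambda>F. f F * g F) \<in> PF"
  unfolding PF_def
proof (erule lspan_mult, assumption)
  fix b c :: "(mon \<Rightarrow> 'a) \<Rightarrow> 'a" assume "b \<in> range mf" "c \<in> range mf"
  then obtain \<alpha> \<beta> where "b = mf \<alpha>" "c = mf \<beta>" by blast
  hence "(\<lambda>x. b x * c x) = mf (\<alpha> + \<beta>)" by (auto simp: mf_add)
  thus "(\<lambda>x. b x * c x) \<in> lspan (range mf)" by (auto intro: lspan_base)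
qed

lemma Hom_PF: "f \<in> Hom t \<Longrightarrow> f \<in> PF"
  unfolding Hom_def PF_def by (erule lspan_mono) (auto intro: lspan_base)

lemma mf_0: "mf 0 = (\<lambda>_. 1)" by (simp add: mf_def fun_eq_iff)

lemma PF_const: "(\<lambda>F. c) \<in> PF"
proof -
  have "(\<lambda>F. c * mf 0 F) \<in> PF" unfolding PF_def by (intro lspan_scale lspan_base) auto
  thus ?thesis by (simp add: mf_0)
qed

lemma PF_power: "f \<in> PF \<Longrightarrow> (\<lambda>F. f F ^ k) \<in> PF"
  by (induction k) (auto intro: PF_const PF_mult)

lemma PF_prod: "(\<And>i. i \<in> I \<Longrightarrow> f i \<in> PF) \<Longrightarrow> (\<lambda>F. \<Prod>i\<in>I. f i F) \<in> PF"
  by (induction I rule: infinite_finite_induct) (auto intro: PF_const PF_mult)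

lemma PF_lincomb: "(\<And>i. i \<in> I \<Longrightarrow> f i \<in> PF) \<Longrightarrow> (\<lambda>F. \<Sum>i\<in>I. c i * f i F) \<in> PF"
  unfolding PF_def by (rule lspan_lincomb)

lemma Hom_coord: "(\<lambda>F. F m) \<in> Hom 1"
proof -
  have "pmdeg (Poly_Mapping.single m 1) = 1" by (simp add: pmdeg_def)
  hence "(mf (Poly_Mapping.single m 1) :: (mon \<Rightarrow> 'a) \<Rightarrow> 'a) \<in> Hom 1" unfolding Hom_def by (intro lspan_base) simp
  moreover have "mf (Poly_Mapping.single m 1) = (\<lambda>F::mon \<Rightarrow> 'a. F m)" by (auto simp: mf_def)
  ultimately show ?thesis by simp
qed

lemma PF_coord: "(\<lambda>F. F m) \<in> PF"
  using Hom_coord by (rule Hom_PF)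

lemma PF_components:
  assumes "g \<in> PF"
  shows "\<exists>T f. (\<forall>t. f t \<in> Hom t) \<and> (\<forall>F. g F = (\<Sum>t\<le>T. f t F))"
  using assms unfolding PF_def
proof (induction rule: lspan.induct)
  case lspan_zero
  show ?case by (intro exI[of _ 0] exI[of _ "\<lambda>_ _. 0"]) (simp add: Hom_def lspan.lspan_zero)
next
  case (lspan_step g b c)
  obtain \<beta> where b: "b = mf \<beta>" using lspan_step.hyps by blast
  obtain T f where f: "\<And>t. f t \<in> Hom t" "\<And>F. g F = (\<Sum>t\<le>T. f t F)" using lspan_step.IH by blast
  define T' where "T' = max T (pmdeg \<beta>)"
  define f' where "f' t F = (if t \<le> T then f t F else 0) + (if t = pmdeg \<beta> then c * mf \<beta> F else 0)" for t F
  have "f' t \<in> Hom t" for t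
  proof -
    have "(\<lambda>F. if t \<le> T then f t F else 0) \<in> Hom t"
      using f(1)[of t] by (cases "t \<le> T") (auto simp: Hom_def lspan_zero)
    moreover have "(\<lambda>F. if t = pmdeg \<beta> then c * mf \<beta> F else 0) \<in> Hom t"
    proof (cases "t = pmdeg \<beta>")
      case True
      have "(\<lambda>F. c * mf \<beta> F) \<in> Hom (pmdeg \<beta>)" unfolding Hom_def by (rule lspan_scale, rule lspan_base) simp
      thus ?thesis using True by simp
    qed (simp add: Hom_def lspan.lspan_zero)
    ultimately show ?thesis unfolding f'_def[abs_def] Hom_def by (rule lspan_add)
  qed
  moreover have "g F + c * b F = (\<Sum>t\<le>T'. f' t F)" for F
  proof -
    have "(\<Sum>t\<le>T'. if t \<le> T then f t F else 0) = (\<Sum>t\<le>T. f t F)"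
      by (intro sum.mono_neutral_cong_right) (auto simp: T'_def)
    thus ?thesis by (simp add: f'_def sum.distrib f(2) b T'_def)
  qed
  ultimately show ?case by blast
qed

text \<open>Along the multiples of \<open>F\<close> the sum is a polynomial in the scalar, with the
  values of the components at \<open>F\<close> as coefficients.\<close>

lemma PF_components_vanish:
  fixes f :: "nat \<Rightarrow> (mon \<Rightarrow> 'k::alg_closed_field) \<Rightarrow> 'k"
  assumes "\<And>t. f t \<in> Hom t" "\<And>c. c \<noteq> 0 \<Longrightarrow> (\<Sum>t\<le>T. f t (\<lambda>m. c * F m)) = 0" "t \<le> T"
  shows "f t F = 0"
proof -
  define p where "p = (\<Sum>t\<le>T. monom (f t F) t)"
  have "poly p c = 0" if "c \<noteq> 0" for c
    using assms(2)[OF that] by (simp add: p_def poly_sum poly_monom Hom_scale[OF assms(1)] mult.commute)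
  hence "\<forall>\<^sub>F c in cofinite. poly p c = 0"
    unfolding eventually_cofinite by (rule_tac finite_subset[of _ "{0}"]) auto
  hence "p = 0" by (rule poly_zero_cofinite)
  hence "coeff p t = 0" by simp
  thus ?thesis using assms(3) by (simp add: p_def coeff_sum)
qed

lemma peval_superset:
  assumes "finite A" "Poly_Mapping.keys P \<subseteq> A"
  shows "peval P F = (\<Sum>\<alpha>\<in>A. Poly_Mapping.lookup P \<alpha> * mf \<alpha> F)"
  unfolding peval_def mf_def using assms by (intro sum.mono_neutral_left) (auto simp: in_keys_iff)

lemma Hom_peval:
  assumes "f \<in> Hom t"
  shows "\<exists>P. homogeneous_cp P \<and> peval P = f"
proof -
  have "\<exists>P. (\<forall>\<alpha>\<in>Poly_Mapping.keys P. pmdeg \<alpha> = t) \<and> peval P = f"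
    using assms unfolding Hom_def
  proof (induction rule: lspan.induct)
    case lspan_zero
    show ?case by (intro exI[of _ 0]) (auto simp: peval_def)
  next
    case (lspan_step g b c)
    then obtain P \<beta> where P: "\<forall>\<alpha>\<in>Poly_Mapping.keys P. pmdeg \<alpha> = t" "peval P = g"
      and \<beta>: "b = mf \<beta>" "pmdeg \<beta> = t" by blast
    define P' where "P' = P + Poly_Mapping.single \<beta> c"
    define A where "A = insert \<beta> (Poly_Mapping.keys P)"
    have A: "finite A" "Poly_Mapping.keys P \<subseteq> A" "Poly_Mapping.keys P' \<subseteq> A"
      using Poly_Mapping.keys_add[of P "Poly_Mapping.single \<beta> c"] by (auto simp: A_def P'_def split: if_splits)
    have "peval P' F = g F + c * b F" for F
    proof -
      have "peval P' F = (\<Sum>\<alpha>\<in>A. Poly_Mapping.lookup P \<alpha> * mf \<alpha> F + (if \<alpha> = \<beta> then c * mf \<beta> F else 0))"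
        unfolding peval_superset[OF A(1,3)]
        by (intro sum.cong) (auto simp: P'_def lookup_add lookup_single when_def algebra_simps)
      also have "\<dots> = peval P F + c * mf \<beta> F"
        unfolding peval_superset[OF A(1,2)] using A(1) by (simp add: sum.distrib A_def)
      finally show ?thesis by (simp add: P(2) \<beta>(1))
    qed
    moreover have "\<forall>\<alpha>\<in>Poly_Mapping.keys P'. pmdeg \<alpha> = t" using A(3) P(1) \<beta>(2) by (auto simp: A_def)
    ultimately show ?case by (intro exI[of _ P']) auto
  qed
  thus ?thesis unfolding homogeneous_cp_def pmdeg_def by blast
qed

lemma homogeneous_peval_Hom:
  assumes "homogeneous_cp P"
  shows "\<exists>t. peval P \<in> Hom t"
proof -
  obtain t where t: "\<forall>\<alpha>\<in>Poly_Mapping.keys P. pmdeg \<alpha> = t"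
    using assms unfolding homogeneous_cp_def pmdeg_def by blast
  have "peval P = (\<lambda>F. \<Sum>\<alpha>\<in>Poly_Mapping.keys P. Poly_Mapping.lookup P \<alpha> * mf \<alpha> F)"
    by (auto simp: peval_superset)
  also have "\<dots> \<in> Hom t" unfolding Hom_def by (rule lspan_lincomb) (use t in \<open>auto intro: lspan_base\<close>)
  finally show ?thesis by blast
qed

subsection \<open>Closed sets\<close>

definition pforms_set :: "nat \<Rightarrow> (mon \<Rightarrow> 'k::field) set" where
  "pforms_set d = {F. is_form d F \<and> F \<noteq> (\<lambda>_. 0)}"

lemma zclosed_iff:
  "zclosed d Z \<longleftrightarrow> (\<exists>S. (\<forall>f\<in>S. \<exists>t. f \<in> Hom t) \<and> Z = {F \<in> pforms_set d. \<forall>f\<in>S. f F = 0})"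
proof
  assume "zclosed d Z"
  then obtain S :: "'a coordpoly set" where S: "\<forall>P\<in>S. homogeneous_cp P"
    "Z = {F. is_form d F \<and> F \<noteq> (\<lambda>_. 0) \<and> (\<forall>P\<in>S. peval P F = 0)}" unfolding zclosed_def by blast
  show "\<exists>S. (\<forall>f\<in>S. \<exists>t. f \<in> Hom t) \<and> Z = {F \<in> pforms_set d. \<forall>f\<in>S. f F = 0}"
    using S homogeneous_peval_Hom by (intro exI[of _ "peval ` S"]) (auto simp: pforms_set_def)
next
  assume "\<exists>S. (\<forall>f\<in>S. \<exists>t. f \<in> Hom t) \<and> Z = {F \<in> pforms_set d. \<forall>f\<in>S. f F = 0}"
  then obtain S where S: "\<forall>f\<in>S. \<exists>t. f \<in> Hom t" "Z = {F \<in> pforms_set d. \<forall>f\<in>S. f F = 0}" by blast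
  have "\<forall>f. \<exists>P. f \<in> S \<longrightarrow> homogeneous_cp P \<and> peval P = f" using S(1) Hom_peval by blast
  from choice[OF this] obtain p where p: "\<And>f. f \<in> S \<Longrightarrow> homogeneous_cp (p f) \<and> peval (p f) = f" by blast
  have "Z = {F. is_form d F \<and> F \<noteq> (\<lambda>_. 0) \<and> (\<forall>P\<in>p ` S. peval P F = 0)}"
    unfolding S(2) pforms_set_def using p by auto
  thus "zclosed d Z" unfolding zclosed_def using p by (intro exI[of _ "p ` S"]) auto
qed

lemma zclosed_pforms: "zclosed d Z \<Longrightarrow> Z \<subseteq> pforms_set d"
  unfolding zclosed_iff by blast

lemma zclosed_hom: "f \<in> Hom t \<Longrightarrow> zclosed d {F \<in> pforms_set d. f F = 0}"
  unfolding zclosed_iff by (intro exI[of _ "{f}"]) auto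

lemma pforms_scale_set:
  assumes "F \<in> pforms_set d" "c \<noteq> 0"
  shows "(\<lambda>m. c * F m) \<in> pforms_set d"
  using assms unfolding pforms_set_def is_form_def by (auto simp: fun_eq_iff)

lemma zclosed_cone:
  assumes "zclosed d Z" "F \<in> Z" "c \<noteq> 0"
  shows "(\<lambda>m. c * F m) \<in> Z"
proof -
  obtain S where S: "\<And>f. f \<in> S \<Longrightarrow> \<exists>t. f \<in> Hom t" "Z = {F \<in> pforms_set d. \<forall>f\<in>S. f F = 0}"
    using assms(1) unfolding zclosed_iff by blast
  have "f (\<lambda>m. c * F m) = 0" if fS: "f \<in> S" for f
  proof -
    obtain t where "f \<in> Hom t" using S(1)[OF fS] by blast
    thus ?thesis using Hom_scale[of f t c F] assms(2) fS S(2) by simp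
  qed
  thus ?thesis using assms S(2) pforms_scale_set by auto
qed

lemma zclosure_subset: "A \<subseteq> zclosure d A"
  unfolding zclosure_def by blast

lemma zclosure_minimal: "zclosed d Z \<Longrightarrow> A \<subseteq> Z \<Longrightarrow> zclosure d A \<subseteq> Z"
  unfolding zclosure_def by blast

lemma zclosed_zclosure:
  assumes "A \<subseteq> pforms_set d"
  shows "zclosed d (zclosure d A)"
proof -
  define C where "C = {Z. zclosed d Z \<and> A \<subseteq> Z}"
  have "\<forall>Z. \<exists>S. Z \<in> C \<longrightarrow> (\<forall>f\<in>S. \<exists>t. f \<in> Hom t) \<and> Z = {F \<in> pforms_set d. \<forall>f\<in>S. f F = 0}"
    unfolding C_def zclosed_iff by blast
  from choice[OF this] obtain S where
    S: "\<And>Z. Z \<in> C \<Longrightarrow> (\<forall>f\<in>S Z. \<exists>t. f \<in> Hom t) \<and> Z = {F \<in> pforms_set d. \<forall>f\<in>S Z. f F = 0}" by blast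
  have "zclosed d (pforms_set d)" unfolding zclosed_iff by (intro exI[of _ "{}"]) auto
  hence "pforms_set d \<in> C" using assms by (simp add: C_def)
  hence "zclosure d A = {F \<in> pforms_set d. \<forall>f\<in>(\<Union>Z\<in>C. S Z). f F = 0}"
    unfolding zclosure_def C_def[symmetric] using S by blast
  moreover have "\<forall>f\<in>(\<Union>Z\<in>C. S Z). \<exists>t. f \<in> Hom t" using S by blast
  ultimately show ?thesis unfolding zclosed_iff by (intro exI[of _ "\<Union>Z\<in>C. S Z"] conjI)
qed

lemma zclosure_mono: "A \<subseteq> B \<Longrightarrow> zclosure d A \<subseteq> zclosure d B"
  unfolding zclosure_def by blast

text \<open>Closed sets are cut out by homogeneous functions only. On a cone the homogeneous
  components of a vanishing function vanish separately, so an inhomogeneous relation passes to the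
  closure as well.\<close>

lemma PF_vanish_zclosure:
  fixes g :: "(mon \<Rightarrow> 'k::alg_closed_field) \<Rightarrow> 'k"
  assumes "g \<in> PF" "A \<subseteq> pforms_set d" "\<And>F c. F \<in> A \<Longrightarrow> c \<noteq> 0 \<Longrightarrow> (\<lambda>m. c * F m) \<in> A"
    "\<And>F. F \<in> A \<Longrightarrow> g F = 0" "F \<in> zclosure d A"
  shows "g F = 0"
proof -
  obtain T f where f: "\<And>t. f t \<in> Hom t" "\<And>F. g F = (\<Sum>t\<le>T. f t F)" using PF_components[OF assms(1)] by blast
  have "f t F = 0" if "t \<le> T" for t
  proof -
    have "f t G = 0" if "G \<in> A" for G
      by (rule PF_components_vanish[OF f(1) _ \<open>t \<le> T\<close>]) (use assms(3,4) that f(2) in force)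
    hence "zclosure d A \<subseteq> {F \<in> pforms_set d. f t F = 0}"
      using assms(2) by (intro zclosure_minimal zclosed_hom[OF f(1)]) auto
    thus ?thesis using assms(5) by blast
  qed
  thus ?thesis by (simp add: f(2))
qed

text \<open>The ideal of an irreducible set is prime. Irreducibility speaks of homogeneous
  equations, so it is applied to each component of \<open>Q\<close>.\<close>

lemma zirreducible_mult_zero:
  fixes g Q :: "(mon \<Rightarrow> 'k::alg_closed_field) \<Rightarrow> 'k"
  assumes "zirreducible d Z" "g \<in> Hom a" "Q \<in> PF" "\<And>F. F \<in> Z \<Longrightarrow> g F ^ j * Q F = 0"
    "F0 \<in> Z" "g F0 \<noteq> 0" "F \<in> Z"
  shows "Q F = 0"
proof -
  have Zc: "zclosed d Z" using assms(1) by (simp add: zirreducible_def)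
  obtain T f where f: "\<And>t. f t \<in> Hom t" "\<And>F. Q F = (\<Sum>t\<le>T. f t F)" using PF_components[OF assms(3)] by blast
  have "f t F = 0" if t: "t \<le> T" for t
  proof -
    have "f t G = 0" if G: "G \<in> Z" "g G \<noteq> 0" for G
    proof (rule PF_components_vanish[OF f(1) _ t])
      fix c :: 'k assume c: "c \<noteq> 0"
      have "g (\<lambda>m. c * G m) \<noteq> 0" using G(2) c by (simp add: Hom_scale[OF assms(2)])
      thus "(\<Sum>t\<le>T. f t (\<lambda>m. c * G m)) = 0"
        using assms(4)[OF zclosed_cone[OF Zc G(1) c]] by (simp add: f(2))
    qed
    hence "Z \<subseteq> {F \<in> pforms_set d. g F = 0} \<union> {F \<in> pforms_set d. f t F = 0}"
      using zclosed_pforms[OF Zc] by blast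
    hence "Z \<subseteq> {F \<in> pforms_set d. g F = 0} \<or> Z \<subseteq> {F \<in> pforms_set d. f t F = 0}"
      using assms(1) zclosed_hom[OF assms(2), of d] zclosed_hom[OF f(1)[of t], of d] unfolding zirreducible_def by blast
    thus ?thesis using assms(5-7) by blast
  qed
  thus ?thesis by (simp add: f(2))
qed

subsection \<open>Algebraic independence on closed sets\<close>

text \<open>Algebraic independence of the restrictions to \<open>Z\<close>, stated as linear
  independence of their monomials. Extensional exponents make different exponent functions stand for
  different monomials.\<close>

definition aindep :: "nat \<Rightarrow> (nat \<Rightarrow> (mon \<Rightarrow> 'k::field) \<Rightarrow> 'k) \<Rightarrow> (mon \<Rightarrow> 'k) set \<Rightarrow> bool" where
  "aindep n f Z \<longleftrightarrow> (\<forall>i<n. f i \<in> PF) \<and>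
     (\<forall>S. finite S \<longrightarrow> S \<subseteq> extensional {..<n} \<longrightarrow> indep S (\<lambda>\<alpha> z. \<Prod>i<n. f i z ^ \<alpha> i) Z)"

text \<open>The additional function is an equation \<open>g\<close> of \<open>Z\<close> that does
  not vanish on \<open>Z'\<close>. From a relation on \<open>Z'\<close> the highest common power of
  \<open>g\<close> is cancelled, using irreducibility; what is left restricts to a nontrivial
  relation of the old functions on \<open>Z\<close>.\<close>

lemma aindep_Suc:
  fixes f :: "nat \<Rightarrow> (mon \<Rightarrow> 'k::alg_closed_field) \<Rightarrow> 'k"
  assumes "zirreducible d Z'" "zclosed d Z" "Z \<subset> Z'" "aindep n f Z"
  shows "\<exists>f'. aindep (Suc n) f' Z'"
proof -
  obtain S0 where S0: "\<And>f. f \<in> S0 \<Longrightarrow> \<exists>t. f \<in> Hom t" "Z = {F \<in> pforms_set d. \<forall>f\<in>S0. f F = 0}"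
    using assms(2) unfolding zclosed_iff by blast
  obtain F0 where F0: "F0 \<in> Z'" "F0 \<notin> Z" using assms(3) by blast
  have "F0 \<in> pforms_set d" using F0 assms(1) zclosed_pforms unfolding zirreducible_def by blast
  then obtain g where g: "g \<in> S0" "g F0 \<noteq> 0" using F0 S0(2) by blast
  obtain a where a: "g \<in> Hom a" using S0(1)[OF g(1)] by blast
  have gZ: "g F = 0" if "F \<in> Z" for F using that S0(2) g(1) by blast
  define f' where "f' = f(n := g)"
  have pf: "f' i \<in> PF" if "i < Suc n" for i
    using that assms(4) Hom_PF[OF a] by (auto simp: f'_def aindep_def less_Suc_eq)
  have f'n: "(\<Prod>i<Suc n. f' i z ^ \<alpha> i) = (\<Prod>i<n. f i z ^ \<alpha> i) * g z ^ \<alpha> n" for z \<alpha>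
  proof -
    have "(\<Prod>i<n. f' i z ^ \<alpha> i) = (\<Prod>i<n. f i z ^ \<alpha> i)" by (intro prod.cong) (auto simp: f'_def)
    thus ?thesis by (simp add: f'_def)
  qed
  have "indep S (\<lambda>\<alpha> z. \<Prod>i<Suc n. f' i z ^ \<alpha> i) Z'"
    if S: "finite S" "S \<subseteq> extensional {..<Suc n}" for S
  proof (rule indepI, rule ccontr)
    fix c :: "(nat \<Rightarrow> nat) \<Rightarrow> 'k" and \<alpha>0
    assume z: "\<And>z. z \<in> Z' \<Longrightarrow> (\<Sum>\<alpha>\<in>S. c \<alpha> * (\<Prod>i<Suc n. f' i z ^ \<alpha> i)) = 0" and \<alpha>0: "\<alpha>0 \<in> S" "c \<alpha>0 \<noteq> 0"
    define S1 where "S1 = {\<alpha> \<in> S. c \<alpha> \<noteq> 0}"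
    have fS1: "finite S1" using S by (simp add: S1_def)
    define j where "j = Min ((\<lambda>\<alpha>. \<alpha> n) ` S1)"
    have ne: "S1 \<noteq> {}" using \<alpha>0 by (auto simp: S1_def)
    have jle: "j \<le> \<alpha> n" if "\<alpha> \<in> S1" for \<alpha> unfolding j_def using that fS1 by (intro Min_le) auto
    have "j \<in> (\<lambda>\<alpha>. \<alpha> n) ` S1" unfolding j_def using fS1 ne by (intro Min_in) auto
    then obtain \<alpha>1 where \<alpha>1: "\<alpha>1 \<in> S1" "\<alpha>1 n = j" by auto
    define Q where "Q z = (\<Sum>\<alpha>\<in>S1. c \<alpha> * ((\<Prod>i<n. f i z ^ \<alpha> i) * g z ^ (\<alpha> n - j)))" for z
    have QPF: "Q \<in> PF" unfolding Q_def[abs_def]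
      using assms(4) Hom_PF[OF a] by (intro PF_lincomb PF_mult PF_prod PF_power) (auto simp: aindep_def)
    have "g z ^ j * Q z = 0" if "z \<in> Z'" for z
    proof -
      have "g z ^ j * Q z = (\<Sum>\<alpha>\<in>S1. c \<alpha> * ((\<Prod>i<n. f i z ^ \<alpha> i) * g z ^ \<alpha> n))"
        unfolding Q_def sum_distrib_left
      proof (rule sum.cong)
        fix \<alpha> assume "\<alpha> \<in> S1"
        hence "g z ^ \<alpha> n = g z ^ j * g z ^ (\<alpha> n - j)" using jle by (simp flip: power_add)
        thus "g z ^ j * (c \<alpha> * ((\<Prod>i<n. f i z ^ \<alpha> i) * g z ^ (\<alpha> n - j))) = c \<alpha> * ((\<Prod>i<n. f i z ^ \<alpha> i) * g z ^ \<alpha> n)"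
          by (simp add: mult_ac)
      qed simp
      also have "\<dots> = (\<Sum>\<alpha>\<in>S. c \<alpha> * (\<Prod>i<Suc n. f' i z ^ \<alpha> i))"
        unfolding f'n S1_def using S(1) by (intro sum.mono_neutral_left) auto
      finally show ?thesis using z[OF that] by simp
    qed
    hence Qz: "Q z = 0" if "z \<in> Z'" for z
      using zirreducible_mult_zero[OF assms(1) a QPF _ F0(1) g(2) that] by blast
    define S2 where "S2 = {\<alpha> \<in> S1. \<alpha> n = j}"
    define rs where "rs \<alpha> = restrict \<alpha> {..<n}" for \<alpha> :: "nat \<Rightarrow> nat"
    have inj: "inj_on rs S2"
    proof (rule inj_onI)
      fix \<alpha> \<beta> assume ab: "\<alpha> \<in> S2" "\<beta> \<in> S2" "rs \<alpha> = rs \<beta>"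
      have "\<alpha> \<in> extensional {..<Suc n}" "\<beta> \<in> extensional {..<Suc n}" using ab S(2) by (auto simp: S2_def S1_def)
      thus "\<alpha> = \<beta>"
      proof (rule extensionalityI)
        fix i assume "i \<in> {..<Suc n}"
        moreover have "rs \<alpha> i = rs \<beta> i" using ab(3) by simp
        ultimately show "\<alpha> i = \<beta> i" using ab(1,2) by (cases "i = n") (auto simp: rs_def S2_def)
      qed
    qed
    have "indep (rs ` S2) (\<lambda>\<alpha> z. \<Prod>i<n. f i z ^ \<alpha> i) Z"
    proof -
      have "finite (rs ` S2)" "rs ` S2 \<subseteq> extensional {..<n}" using fS1 by (auto simp: S2_def rs_def)
      thus ?thesis using assms(4) unfolding aindep_def by blast
    qed
    hence I: "indep S2 (\<lambda>\<alpha> z. \<Prod>i<n. f i z ^ rs \<alpha> i) Z" by (simp only: indep_reindex[OF inj])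
    have "c \<alpha>1 = 0"
    proof (rule indepD[OF I, of c \<alpha>1])
      fix z assume zZ: "z \<in> Z"
      have "Q z = (\<Sum>\<alpha>\<in>S2. c \<alpha> * (\<Prod>i<n. f i z ^ rs \<alpha> i))"
        unfolding Q_def
      proof (rule sum.mono_neutral_cong_right)
        show "\<forall>\<alpha>\<in>S1 - S2. c \<alpha> * ((\<Prod>i<n. f i z ^ \<alpha> i) * g z ^ (\<alpha> n - j)) = 0"
        proof
          fix \<alpha> assume "\<alpha> \<in> S1 - S2"
          hence "\<alpha> n - j > 0" using jle[of \<alpha>] by (auto simp: S2_def)
          thus "c \<alpha> * ((\<Prod>i<n. f i z ^ \<alpha> i) * g z ^ (\<alpha> n - j)) = 0" using gZ[OF zZ] by simp
        qed
        fix \<alpha> assume "\<alpha> \<in> S2"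
        moreover have "(\<Prod>i<n. f i z ^ rs \<alpha> i) = (\<Prod>i<n. f i z ^ \<alpha> i)" by (intro prod.cong) (auto simp: rs_def)
        ultimately show "c \<alpha> * ((\<Prod>i<n. f i z ^ \<alpha> i) * g z ^ (\<alpha> n - j)) = c \<alpha> * (\<Prod>i<n. f i z ^ rs \<alpha> i)"
          by (simp add: S2_def)
      qed (use fS1 in \<open>auto simp: S2_def\<close>)
      thus "(\<Sum>\<alpha>\<in>S2. c \<alpha> * (\<Prod>i<n. f i z ^ rs \<alpha> i)) = 0" using Qz zZ assms(3) by auto
    qed (use \<alpha>1 in \<open>auto simp: S2_def\<close>)
    thus False using \<alpha>1 by (simp add: S1_def)
  qed
  thus ?thesis using pf unfolding aindep_def by blast
qed

text \<open>A nonempty closed set contains all nonzero multiples of a vector, and a coordinate is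
  transcendental along them. This is the shift by one between projective dimension and the number of
  independent functions.\<close>

lemma aindep_one:
  fixes Z :: "(mon \<Rightarrow> 'k::alg_closed_field) set"
  assumes "zclosed d Z" "Z \<noteq> {}"
  shows "\<exists>f. aindep (Suc 0) f Z"
proof -
  obtain F where F: "F \<in> Z" using assms by blast
  have "F \<noteq> (\<lambda>_. 0)" using F zclosed_pforms[OF assms(1)] by (auto simp: pforms_set_def)
  hence "\<exists>m. F m \<noteq> 0" by (rule contrapos_np) (intro ext, blast)
  then obtain m where m: "F m \<noteq> 0" by blast
  define f :: "nat \<Rightarrow> (mon \<Rightarrow> 'k) \<Rightarrow> 'k" where "f = (\<lambda>_ F. F m)"
  have "indep S (\<lambda>\<alpha> z. \<Prod>i<Suc 0. f i z ^ \<alpha> i) Z" if S: "finite S" "S \<subseteq> extensional {..<Suc 0}" for S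
  proof (rule indepI)
    fix c :: "(nat \<Rightarrow> nat) \<Rightarrow> 'k" and \<alpha>0
    assume z: "\<And>z. z \<in> Z \<Longrightarrow> (\<Sum>\<alpha>\<in>S. c \<alpha> * (\<Prod>i<Suc 0. f i z ^ \<alpha> i)) = 0" and \<alpha>0: "\<alpha>0 \<in> S"
    define p where "p = (\<Sum>\<alpha>\<in>S. monom (c \<alpha> * F m ^ \<alpha> 0) (\<alpha> 0))"
    have "poly p t = 0" if "t \<noteq> 0" for t
      using z[OF zclosed_cone[OF assms(1) F that]]
      by (simp add: p_def poly_sum poly_monom f_def power_mult_distrib mult_ac)
    hence "\<forall>\<^sub>F t in cofinite. poly p t = 0"
      unfolding eventually_cofinite by (rule_tac finite_subset[of _ "{0}"]) auto
    hence "coeff p (\<alpha>0 0) = 0" using poly_zero_cofinite by fastforce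
    moreover have "coeff p (\<alpha>0 0) = (\<Sum>\<alpha>\<in>S. if \<alpha> = \<alpha>0 then c \<alpha>0 * F m ^ \<alpha>0 0 else 0)"
      unfolding p_def coeff_sum
    proof (rule sum.cong)
      fix \<alpha> assume "\<alpha> \<in> S"
      hence "\<alpha> = \<alpha>0" if "\<alpha> 0 = \<alpha>0 0"
        using S(2) \<alpha>0 that by (intro extensionalityI[of _ "{..<Suc 0}"]) auto
      thus "coeff (monom (c \<alpha> * F m ^ \<alpha> 0) (\<alpha> 0)) (\<alpha>0 0) = (if \<alpha> = \<alpha>0 then c \<alpha>0 * F m ^ \<alpha>0 0 else 0)"
        by auto
    qed simp
    ultimately show "c \<alpha>0 = 0" using S(1) \<alpha>0 m by simp
  qed
  moreover have "f i \<in> PF" for i unfolding f_def by (rule PF_coord)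
  ultimately show ?thesis unfolding aindep_def by blast
qed

subsection \<open>Parametrised cones\<close>

text \<open>Polynomials with the degree bounded in each variable separately. Their monomials are
  counted by a plain power, \<open>(b + 1) ^ card I\<close>, without binomial coefficients.\<close>

definition box :: "'v set \<Rightarrow> nat \<Rightarrow> (('v \<Rightarrow> 'k::field) \<Rightarrow> 'k) set" where
  "box I b = lspan ((\<lambda>\<alpha> u. \<Prod>i\<in>I. u i ^ \<alpha> i) ` (I \<rightarrow>\<^sub>E {..b}))"

lemma box_add: "f \<in> box I b \<Longrightarrow> g \<in> box I b \<Longrightarrow> (\<lambda>u. f u + g u) \<in> box I b"
  unfolding box_def by (rule lspan_add)

lemma box_scale: "f \<in> box I b \<Longrightarrow> (\<lambda>u. a * f u) \<in> box I b"
  unfolding box_def by (rule lspan_scale)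

lemma box_mono:
  assumes "f \<in> box I b" "b \<le> b'"
  shows "f \<in> box I b'"
proof -
  have "(I \<rightarrow>\<^sub>E {..b}) \<subseteq> (I \<rightarrow>\<^sub>E {..b'})" using assms(2) by (intro PiE_mono) auto
  thus ?thesis using assms(1) unfolding box_def by (elim lspan_mono) (auto intro: lspan_base)
qed

lemma box_monomial:
  fixes I :: "'v set"
  assumes "\<And>i. i \<in> I \<Longrightarrow> \<alpha> i \<le> b"
  shows "(\<lambda>u :: 'v \<Rightarrow> 'k::field. \<Prod>i\<in>I. u i ^ \<alpha> i) \<in> box I b"
proof -
  have "(\<lambda>u :: 'v \<Rightarrow> 'k. \<Prod>i\<in>I. u i ^ (restrict \<alpha> I) i) \<in> box I b"
    unfolding box_def by (rule lspan_base, rule image_eqI[of _ _ "restrict \<alpha> I"]) (use assms in auto)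
  moreover have "(\<Prod>i\<in>I. u i ^ (restrict \<alpha> I) i) = (\<Prod>i\<in>I. u i ^ \<alpha> i)" for u :: "'v \<Rightarrow> 'k"
    by (intro prod.cong) auto
  ultimately show ?thesis by simp
qed

lemma box_const: "(\<lambda>u. a) \<in> box I b"
proof -
  have "(\<lambda>u. a * (\<Prod>i\<in>I. u i ^ (\<lambda>_. 0) i)) \<in> box I b" by (intro box_scale box_monomial) simp
  thus ?thesis by simp
qed

lemma box_var:
  fixes I :: "'v set"
  assumes "finite I" "i \<in> I" "1 \<le> b"
  shows "(\<lambda>u :: 'v \<Rightarrow> 'k::field. u i) \<in> box I b"
proof -
  have "(\<lambda>u :: 'v \<Rightarrow> 'k. \<Prod>j\<in>I. u j ^ (if j = i then 1 else 0)) \<in> box I b" by (intro box_monomial) (use assms in auto)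
  moreover have "(\<Prod>j\<in>I. u j ^ (if j = i then 1 else 0)) = u i" for u :: "'v \<Rightarrow> 'k"
    using assms by (subst prod.remove[of _ i]) auto
  ultimately show ?thesis by simp
qed

lemma box_mult:
  assumes "f \<in> box I b" "g \<in> box I c"
  shows "(\<lambda>u. f u * g u) \<in> box I (b + c)"
proof -
  have "(\<lambda>u. f u * g u) \<in> lspan ((\<lambda>\<alpha> u. \<Prod>i\<in>I. u i ^ \<alpha> i) ` (I \<rightarrow>\<^sub>E {..b + c}))"
  proof (rule lspan_mult[OF assms[unfolded box_def]])
    fix f g :: "('a \<Rightarrow> 'b) \<Rightarrow> 'b"
    assume "f \<in> (\<lambda>\<alpha> u. \<Prod>i\<in>I. u i ^ \<alpha> i) ` (I \<rightarrow>\<^sub>E {..b})" "g \<in> (\<lambda>\<alpha> u. \<Prod>i\<in>I. u i ^ \<alpha> i) ` (I \<rightarrow>\<^sub>E {..c})"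
    then obtain \<alpha> \<beta> where a: "f = (\<lambda>u. \<Prod>i\<in>I. u i ^ \<alpha> i)" "\<alpha> \<in> I \<rightarrow>\<^sub>E {..b}"
      and b: "g = (\<lambda>u. \<Prod>i\<in>I. u i ^ \<beta> i)" "\<beta> \<in> I \<rightarrow>\<^sub>E {..c}" by blast
    have "(\<lambda>u. f u * g u) = (\<lambda>u. \<Prod>i\<in>I. u i ^ (\<alpha> i + \<beta> i))"
      by (simp add: a(1) b(1) power_add prod.distrib)
    also have "\<dots> \<in> box I (b + c)"
      by (rule box_monomial) (use a(2) b(2) in \<open>auto intro!: add_mono simp: PiE_iff\<close>)
    finally show "(\<lambda>u. f u * g u) \<in> lspan ((\<lambda>\<alpha> u. \<Prod>i\<in>I. u i ^ \<alpha> i) ` (I \<rightarrow>\<^sub>E {..b + c}))"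
      by (simp add: box_def)
  qed
  thus ?thesis by (simp add: box_def)
qed

lemma box_prod:
  assumes "finite J" "\<And>j. j \<in> J \<Longrightarrow> f j \<in> box I b"
  shows "(\<lambda>u. \<Prod>j\<in>J. f j u) \<in> box I (card J * b)"
  using assms by (induction J rule: finite_induct) (auto intro: box_const box_mult)

lemma box_power: "f \<in> box I b \<Longrightarrow> (\<lambda>u. f u ^ k) \<in> box I (k * b)"
  using box_prod[of "{..<k}" "\<lambda>_. f" I b] by simp

lemma box_path:
  assumes "f \<in> box I b"
  shows "\<exists>p. \<forall>t. f (\<lambda>i. poly (X i) t) = poly p t"
  using assms unfolding box_def
proof (induction rule: lspan.induct)
  case lspan_zero
  show ?case by (rule exI[of _ 0]) simp
next
  case (lspan_step g h k)
  then obtain p \<alpha> where "\<forall>t. g (\<lambda>i. poly (X i) t) = poly p t" "h = (\<lambda>u. \<Prod>i\<in>I. u i ^ \<alpha> i)" by blast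
  thus ?case by (intro exI[of _ "p + smult k (\<Prod>i\<in>I. X i ^ \<alpha> i)"]) (simp add: poly_prod)
qed

definition polymap :: "'v set \<Rightarrow> (('v \<Rightarrow> 'k::field) \<Rightarrow> mon \<Rightarrow> 'k) \<Rightarrow> bool" where
  "polymap I \<phi> \<longleftrightarrow> (\<forall>m. \<exists>b. (\<lambda>u. \<phi> u m) \<in> box I b)"

lemma PF_polymap:
  assumes "polymap I \<phi>" "f \<in> PF"
  shows "\<exists>b. (\<lambda>u. f (\<phi> u)) \<in> box I b"
  using assms(2) unfolding PF_def
proof (induction rule: lspan.induct)
  case lspan_zero
  show ?case using box_const by blast
next
  case (lspan_step g h c)
  then obtain b \<alpha> where b: "(\<lambda>u. g (\<phi> u)) \<in> box I b" and h: "h = mf \<alpha>" by blast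
  have "\<forall>m. \<exists>b. (\<lambda>u. \<phi> u m) \<in> box I b" using assms(1) by (simp add: polymap_def)
  from choice[OF this] obtain B where B: "\<And>m. (\<lambda>u. \<phi> u m) \<in> box I (B m)" by blast
  define B' where "B' = Max ((\<lambda>m. Poly_Mapping.lookup \<alpha> m * B m) ` Poly_Mapping.keys \<alpha>)"
  have "(\<lambda>u. \<Prod>m\<in>Poly_Mapping.keys \<alpha>. \<phi> u m ^ Poly_Mapping.lookup \<alpha> m) \<in> box I (card (Poly_Mapping.keys \<alpha>) * B')"
  proof (rule box_prod)
    fix m assume "m \<in> Poly_Mapping.keys \<alpha>"
    hence "Poly_Mapping.lookup \<alpha> m * B m \<le> B'" unfolding B'_def by (intro Max_ge) auto
    thus "(\<lambda>u. \<phi> u m ^ Poly_Mapping.lookup \<alpha> m) \<in> box I B'" using box_power[OF B[of m]] box_mono by blast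
  qed simp
  hence "\<exists>b'. (\<lambda>u. h (\<phi> u)) \<in> box I b'" unfolding h mf_def by blast
  then obtain b' where "(\<lambda>u. h (\<phi> u)) \<in> box I b'" by blast
  hence "(\<lambda>u. g (\<phi> u) + c * h (\<phi> u)) \<in> box I (max b b')"
    using b by (intro box_add box_scale) (auto elim: box_mono)
  thus ?case by blast
qed

text \<open>The number of monomials of bounded degree in the functions exceeds the dimension of the space of
  polynomials in the parameters that contains them.\<close>

lemma param_not_aindep:
  fixes \<phi> :: "('v \<Rightarrow> 'k::alg_closed_field) \<Rightarrow> mon \<Rightarrow> 'k"
  assumes "finite I" "polymap I \<phi>" "A \<subseteq> pforms_set d" "A = {\<phi> u | u. \<phi> u \<noteq> (\<lambda>_. 0)}"
    "\<And>F c. F \<in> A \<Longrightarrow> c \<noteq> 0 \<Longrightarrow> (\<lambda>m. c * F m) \<in> A" "Z \<subseteq> zclosure d A" "card I < n"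
  shows "\<not> aindep n f Z"
proof
  assume ai: "aindep n f Z"
  have "\<forall>i. \<exists>b. i < n \<longrightarrow> (\<lambda>u. f i (\<phi> u)) \<in> box I b"
  proof
    fix i
    show "\<exists>b. i < n \<longrightarrow> (\<lambda>u. f i (\<phi> u)) \<in> box I b"
      using ai PF_polymap[OF assms(2), of "f i"] by (cases "i < n") (auto simp: aindep_def)
  qed
  from choice[OF this] obtain B0 where B0: "\<And>i. i < n \<Longrightarrow> (\<lambda>u. f i (\<phi> u)) \<in> box I (B0 i)" by blast
  define B where "B = Max (B0 ` {..<n})"
  have B: "(\<lambda>u. f i (\<phi> u)) \<in> box I B" if "i < n" for i
    using B0[OF that] by (rule box_mono) (use that in \<open>auto simp: B_def intro!: Max_ge\<close>)
  define K where "K = n * B + 1"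
  \<comment> \<open>Chosen such that \<open>(K * (t + 1)) ^ card I\<close> equals
    \<open>t * (t + 1) ^ card I\<close>, just below \<open>(t + 1) ^ (card I + 1)\<close>.\<close>
  define t where "t = K ^ card I"
  define S where "S = {..<n} \<rightarrow>\<^sub>E {..t}"
  have "finite S" by (simp add: S_def finite_PiE)
  moreover have "S \<subseteq> extensional {..<n}" by (auto simp: S_def PiE_def)
  ultimately have S: "finite S" "S \<subseteq> extensional {..<n}" by simp_all
  have cS: "card S = (t + 1) ^ n" by (simp add: S_def card_PiE)
  define J where "J = I \<rightarrow>\<^sub>E {..n * (t * B)}"
  have J: "finite J" "card J = (n * (t * B) + 1) ^ card I"
    using assms(1) by (simp_all add: J_def finite_PiE card_PiE)
  have "card J \<le> (K * (t + 1)) ^ card I" unfolding J(2)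
    by (rule power_mono) (simp_all add: K_def algebra_simps)
  also have "\<dots> = t * (t + 1) ^ card I" by (simp only: power_mult_distrib t_def)
  also have "\<dots> < (t + 1) ^ Suc (card I)" by simp
  also have "\<dots> \<le> (t + 1) ^ n" using assms(7) by (intro power_increasing) auto
  finally have cJ: "card J < card S" by (simp add: cS)
  have "\<exists>c. \<forall>u. (\<Prod>i<n. f i (\<phi> u) ^ \<alpha> i) = (\<Sum>j\<in>J. c j * (\<Prod>i\<in>I. u i ^ j i))" if \<alpha>: "\<alpha> \<in> S" for \<alpha>
  proof -
    have "(\<lambda>u. \<Prod>i<n. f i (\<phi> u) ^ \<alpha> i) \<in> box I (card {..<n} * (t * B))"
    proof (rule box_prod)
      fix i assume i: "i \<in> {..<n}"
      have "\<alpha> i \<le> t" using \<alpha> i by (auto simp: S_def)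
      hence "\<alpha> i * B \<le> t * B" by simp
      thus "(\<lambda>u. f i (\<phi> u) ^ \<alpha> i) \<in> box I (t * B)" using box_power[OF B[of i]] i box_mono by blast
    qed simp
    thus ?thesis unfolding box_def J_def using assms(1)
      by (intro lspan_finite_image) (simp_all add: finite_PiE)
  qed
  hence "\<forall>\<alpha>. \<exists>c. \<alpha> \<in> S \<longrightarrow> (\<forall>u. (\<Prod>i<n. f i (\<phi> u) ^ \<alpha> i) = (\<Sum>j\<in>J. c j * (\<Prod>i\<in>I. u i ^ j i)))" by blast
  from choice[OF this] obtain c where
    c: "\<And>\<alpha> u. \<alpha> \<in> S \<Longrightarrow> (\<Prod>i<n. f i (\<phi> u) ^ \<alpha> i) = (\<Sum>j\<in>J. c \<alpha> j * (\<Prod>i\<in>I. u i ^ j i))" by blast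
  have "\<not> indep S (\<lambda>\<alpha> u. \<Prod>i<n. f i (\<phi> u) ^ \<alpha> i) UNIV"
    by (rule not_indep_span[OF J(1) S(1) cJ, of _ _ c "\<lambda>j u. \<Prod>i\<in>I. u i ^ j i"]) (rule c)
  then obtain x \<alpha>0 where x: "\<And>u. (\<Sum>\<alpha>\<in>S. x \<alpha> * (\<Prod>i<n. f i (\<phi> u) ^ \<alpha> i)) = 0" "\<alpha>0 \<in> S" "x \<alpha>0 \<noteq> 0"
    unfolding indep_def by blast
  define g where "g z = (\<Sum>\<alpha>\<in>S. x \<alpha> * (\<Prod>i<n. f i z ^ \<alpha> i))" for z
  have gPF: "g \<in> PF" unfolding g_def[abs_def]
    using ai by (intro PF_lincomb PF_prod PF_power) (auto simp: aindep_def)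
  have "g F = 0" if "F \<in> A" for F
    using that x(1) unfolding assms(4) g_def by blast
  hence "g F = 0" if "F \<in> Z" for F
    using PF_vanish_zclosure[OF gPF assms(3,5)] that assms(6) by blast
  moreover have "indep S (\<lambda>\<alpha> z. \<Prod>i<n. f i z ^ \<alpha> i) Z" using ai S unfolding aindep_def by blast
  ultimately have "x \<alpha>0 = 0"
    using indepD[of S "\<lambda>\<alpha> z. \<Prod>i<n. f i z ^ \<alpha> i" Z x \<alpha>0] x(2) by (simp add: g_def)
  thus False using x(3) by simp
qed

text \<open>A chain with \<open>n\<close> strict inclusions yields \<open>n + 1\<close> independent
  functions: one on the smallest set, and one more for each inclusion. There are at most as many as
  parameters.\<close>

lemma pdim_le:
  fixes \<phi> :: "('v \<Rightarrow> 'k::alg_closed_field) \<Rightarrow> mon \<Rightarrow> 'k"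
  assumes "finite I" "polymap I \<phi>" "A \<subseteq> pforms_set d" "A = {\<phi> u | u. \<phi> u \<noteq> (\<lambda>_. 0)}"
    "\<And>F c. F \<in> A \<Longrightarrow> c \<noteq> 0 \<Longrightarrow> (\<lambda>m. c * F m) \<in> A" "zclosure d X \<subseteq> zclosure d A"
  shows "pdim d X \<le> enat (card I - 1)"
  unfolding pdim_def
proof (rule SUP_least)
  fix n assume "n \<in> {n. \<exists>Z. (\<forall>i\<le>n. zirreducible d (Z i) \<and> Z i \<subseteq> zclosure d X) \<and> (\<forall>i<n. Z i \<subset> Z (Suc i))}"
  then obtain Z where Z: "\<And>i. i \<le> n \<Longrightarrow> zirreducible d (Z i)" "\<And>i. i \<le> n \<Longrightarrow> Z i \<subseteq> zclosure d X"
    "\<And>i. i < n \<Longrightarrow> Z i \<subset> Z (Suc i)" by blast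
  have "\<exists>f. aindep (Suc i) f (Z i)" if "i \<le> n" for i
    using that
  proof (induction i)
    case 0
    thus ?case using Z(1)[of 0] unfolding zirreducible_def by (intro aindep_one) auto
  next
    case (Suc i)
    then obtain f where "aindep (Suc i) f (Z i)" by auto
    thus ?case using Z(1)[of "Suc i"] Z(1)[of i] Z(3)[of i] Suc.prems
      by (intro aindep_Suc[of d "Z (Suc i)" "Z i"]) (auto simp: zirreducible_def)
  qed
  then obtain f where f: "aindep (Suc n) f (Z n)" by blast
  have "\<not> card I < Suc n"
  proof
    assume "card I < Suc n"
    from param_not_aindep[OF assms(1-5) _ this, of "Z n" f] f Z(2)[of n] assms(6) show False by blast
  qed
  thus "enat n \<le> enat (card I - 1)" by simp
qed

subsection \<open>Tangent vectors\<close>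

text \<open>All that is needed of a Taylor coefficient, as a function of the direction, is that it
  stays polynomial along polynomial curves. This property passes through sums and products without
  explicit coefficients.\<close>

definition pcurve :: "((nat \<Rightarrow> 'k::field) \<Rightarrow> 'k) \<Rightarrow> bool" where
  "pcurve q \<longleftrightarrow> (\<forall>X. \<exists>r. \<forall>\<tau>. q (\<lambda>i. poly (X i) \<tau>) = poly r \<tau>)"

lemma pcurve_const: "pcurve (\<lambda>x. a)"
  unfolding pcurve_def by (intro allI exI[of _ "[:a:]"]) simp

lemma pcurve_var: "pcurve (\<lambda>x. x i)"
  unfolding pcurve_def by blast

lemma pcurve_add: "pcurve f \<Longrightarrow> pcurve g \<Longrightarrow> pcurve (\<lambda>x. f x + g x)"
  unfolding pcurve_def by (metis poly_add)

lemma pcurve_mult: "pcurve f \<Longrightarrow> pcurve g \<Longrightarrow> pcurve (\<lambda>x. f x * g x)"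
  unfolding pcurve_def by (metis poly_mult)

lemma pcurve_sum: "(\<And>i. i \<in> I \<Longrightarrow> pcurve (f i)) \<Longrightarrow> pcurve (\<lambda>x. \<Sum>i\<in>I. f i x)"
  by (induction I rule: infinite_finite_induct) (auto intro: pcurve_const pcurve_add)

text \<open>Taylor expansion \<open>Q (p + \<tau> x) = \<Sum>\<^sub>k \<tau>\<^sup>k q\<^sub>k(x)\<close>; the coefficients are collected in a
  polynomial in \<open>\<tau>\<close>.\<close>

definition taylor :: "(nat \<Rightarrow> 'k::field) \<Rightarrow> ((nat \<Rightarrow> 'k) \<Rightarrow> 'k) \<Rightarrow> bool" where
  "taylor p Q \<longleftrightarrow> (\<exists>G T. (\<forall>x \<tau>. Q (\<lambda>i. p i + \<tau> * x i) = poly (G x) \<tau>) \<and> (\<forall>x. degree (G x) \<le> T) \<and>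
     (\<forall>k. pcurve (\<lambda>x. coeff (G x) k)))"

lemma taylor_const: "taylor p (\<lambda>x. a)"
  unfolding taylor_def
proof (intro exI conjI allI)
  show "a = poly ((\<lambda>_. [:a:]) x) \<tau>" for x :: "nat \<Rightarrow> 'a" and \<tau> by simp
  show "degree ((\<lambda>_. [:a:]) x) \<le> 0" for x :: "nat \<Rightarrow> 'a" by simp
  show "pcurve (\<lambda>x. coeff ((\<lambda>_. [:a:]) x) k)" for k by (simp add: pcurve_const)
qed

lemma taylor_var: "taylor p (\<lambda>x. x i)"
  unfolding taylor_def
proof (intro exI conjI allI)
  show "p i + \<tau> * x i = poly ((\<lambda>x. [:p i, x i:]) x) \<tau>" for x :: "nat \<Rightarrow> 'a" and \<tau> by simp
  show "degree ((\<lambda>x. [:p i, x i:]) x) \<le> 1" for x :: "nat \<Rightarrow> 'a" by simp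
  show "pcurve (\<lambda>x. coeff ((\<lambda>x. [:p i, x i:]) x) k)" for k
  proof -
    consider "k = 0" | "k = 1" | "k \<ge> 2" by linarith
    thus ?thesis
    proof cases
      case 3
      hence "coeff [:p i, x i:] k = 0" for x by (intro coeff_eq_0) (auto simp: Suc_le_eq)
      thus ?thesis by (simp add: pcurve_const)
    qed (simp_all add: pcurve_const pcurve_var)
  qed
qed

lemma taylor_add: "taylor p f \<Longrightarrow> taylor p g \<Longrightarrow> taylor p (\<lambda>x. f x + g x)"
proof -
  assume "taylor p f" "taylor p g"
  then obtain G T G' T' where G: "\<And>x \<tau>. f (\<lambda>i. p i + \<tau> * x i) = poly (G x) \<tau>" "\<And>x. degree (G x) \<le> T"
      "\<And>k. pcurve (\<lambda>x. coeff (G x) k)"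
    and G': "\<And>x \<tau>. g (\<lambda>i. p i + \<tau> * x i) = poly (G' x) \<tau>" "\<And>x. degree (G' x) \<le> T'"
      "\<And>k. pcurve (\<lambda>x. coeff (G' x) k)" unfolding taylor_def by blast
  have "degree (G x + G' x) \<le> max T T'" for x
    using G(2)[of x] G'(2)[of x] degree_add_le_max[of "G x" "G' x"] by linarith
  moreover have "pcurve (\<lambda>x. coeff (G x + G' x) k)" for k using pcurve_add[OF G(3) G'(3)] by simp
  ultimately show ?thesis unfolding taylor_def
    by (intro exI[of _ "\<lambda>x. G x + G' x"] exI[of _ "max T T'"]) (simp add: G(1) G'(1))
qed

lemma taylor_mult: "taylor p f \<Longrightarrow> taylor p g \<Longrightarrow> taylor p (\<lambda>x. f x * g x)"
proof -
  assume "taylor p f" "taylor p g"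
  then obtain G T G' T' where G: "\<And>x \<tau>. f (\<lambda>i. p i + \<tau> * x i) = poly (G x) \<tau>" "\<And>x. degree (G x) \<le> T"
      "\<And>k. pcurve (\<lambda>x. coeff (G x) k)"
    and G': "\<And>x \<tau>. g (\<lambda>i. p i + \<tau> * x i) = poly (G' x) \<tau>" "\<And>x. degree (G' x) \<le> T'"
      "\<And>k. pcurve (\<lambda>x. coeff (G' x) k)" unfolding taylor_def by blast
  have "degree (G x * G' x) \<le> T + T'" for x
    using G(2)[of x] G'(2)[of x] degree_mult_le[of "G x" "G' x"] by linarith
  moreover have "pcurve (\<lambda>x. coeff (G x * G' x) k)" for k
    unfolding coeff_mult by (intro pcurve_sum pcurve_mult G(3) G'(3))
  ultimately show ?thesis unfolding taylor_def
    by (intro exI[of _ "\<lambda>x. G x * G' x"] exI[of _ "T + T'"]) (simp add: G(1) G'(1))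
qed

lemma taylor_power: "taylor p f \<Longrightarrow> taylor p (\<lambda>x. f x ^ k)"
  by (induction k) (auto intro: taylor_const taylor_mult)

lemma taylor_prod: "(\<And>i. i \<in> I \<Longrightarrow> taylor p (f i)) \<Longrightarrow> taylor p (\<lambda>x. \<Prod>i\<in>I. f i x)"
  by (induction I rule: infinite_finite_induct) (auto intro: taylor_const taylor_mult)

lemma taylor_sum: "(\<And>i. i \<in> I \<Longrightarrow> taylor p (f i)) \<Longrightarrow> taylor p (\<lambda>x. \<Sum>i\<in>I. f i x)"
  by (induction I rule: infinite_finite_induct) (auto intro: taylor_const taylor_add)

text \<open>The lowest nonvanishing Taylor coefficient of a relation gives a relation between the
  linear parts, so this works in every characteristic.\<close>

lemma tangent_aindep:
  fixes w :: "nat \<Rightarrow> mon \<Rightarrow> 'k::alg_closed_field"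
  assumes "indep {..<n} w (mons d)"
    and curve: "\<And>b. \<exists>y. (\<forall>m\<in>mons d. coeff (y m) 0 = base m \<and> coeff (y m) 1 = (\<Sum>i<n. b i * w i m)) \<and>
      (\<forall>\<^sub>F \<tau> in cofinite. \<exists>z\<in>Z. \<forall>m\<in>mons d. z m = poly (y m) \<tau>)"
  shows "\<exists>f. aindep n f Z"
proof -
  obtain L where L: "\<And>i k. i < n \<Longrightarrow> k < n \<Longrightarrow> (\<Sum>m\<in>mons d. L i m * w k m) = (if i = k then 1 else 0)"
    using indep_dual_functionals[OF finite_mons _ assms(1)] by (auto simp: Ball_def)
  \<comment> \<open>Coordinates dual to the tangent vectors: in them the curve with direction
    \<open>b\<close> starts at \<open>p\<close> with velocity \<open>b\<close>.\<close>
  define f where "f i z = (\<Sum>m\<in>mons d. L i m * z m)" for i z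
  define p where "p i = (\<Sum>m\<in>mons d. L i m * base m)" for i
  have "indep S (\<lambda>\<alpha> z. \<Prod>i<n. f i z ^ \<alpha> i) Z" if S: "finite S" "S \<subseteq> extensional {..<n}" for S
  proof (rule indepI)
    fix c :: "(nat \<Rightarrow> nat) \<Rightarrow> 'k" and \<alpha>0
    assume rel: "\<And>z. z \<in> Z \<Longrightarrow> (\<Sum>\<alpha>\<in>S. c \<alpha> * (\<Prod>i<n. f i z ^ \<alpha> i)) = 0" and \<alpha>0: "\<alpha>0 \<in> S"
    define Q where "Q x = (\<Sum>\<alpha>\<in>S. c \<alpha> * (\<Prod>i<n. x i ^ \<alpha> i))" for x
    have "taylor p Q" unfolding Q_def[abs_def]
      by (intro taylor_sum taylor_mult taylor_const taylor_prod taylor_power taylor_var)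
    then obtain G T where G: "\<And>x \<tau>. Q (\<lambda>i. p i + \<tau> * x i) = poly (G x) \<tau>" "\<And>x. degree (G x) \<le> T"
      "\<And>k. pcurve (\<lambda>x. coeff (G x) k)" unfolding taylor_def by blast
    have Gx: "poly (G x) \<tau> = (\<Sum>k\<le>T. coeff (G x) k * \<tau> ^ k)" for x \<tau>
      unfolding poly_altdef using G(2)[of x]
      by (intro sum.mono_neutral_left) (auto simp: coeff_eq_0)
    have G0: "G x = 0" for x
    proof (rule ccontr)
      assume "G x \<noteq> 0"
      hence "\<exists>k x. coeff (G x) k \<noteq> 0" by (metis leading_coeff_0_iff)
      define k where "k = (LEAST k. \<exists>x. coeff (G x) k \<noteq> 0)"
      have "\<exists>b. coeff (G b) k \<noteq> 0" unfolding k_def by (rule LeastI_ex) fact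
      then obtain b where b: "coeff (G b) k \<noteq> 0" by blast
      have lt: "coeff (G x) j = 0" if "j < k" for j x using not_less_Least[of j "\<lambda>k. \<exists>x. coeff (G x) k \<noteq> 0"] that
        unfolding k_def by blast
      have kT: "k \<le> T" using b G(2)[of b] le_degree[OF b] by linarith
      obtain y where y: "\<And>m. m \<in> mons d \<Longrightarrow> coeff (y m) 0 = base m \<and> coeff (y m) 1 = (\<Sum>i<n. b i * w i m)"
        "\<forall>\<^sub>F \<tau> in cofinite. \<exists>z\<in>Z. \<forall>m\<in>mons d. z m = poly (y m) \<tau>" using curve[of b] by blast
      define Y where "Y i = (\<Sum>m\<in>mons d. smult (L i m) (y m))" for i
      \<comment> \<open>The curve in these coordinates is \<open>p + \<tau> X\<close> with
        \<open>X = b\<close> at \<open>\<tau> = 0\<close>. Indices from \<open>n\<close> on are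
        given constant values so that this holds for every index.\<close>
      define X where "X i = (if i < n then poly_shift 1 (Y i) else [:b i:])" for i
      have Y0: "coeff (Y i) 0 = p i" for i
        unfolding Y_def p_def coeff_sum using y(1) by (intro sum.cong) auto
      have Y1: "coeff (Y i) 1 = b i" if i: "i < n" for i
      proof -
        have "coeff (Y i) 1 = (\<Sum>m\<in>mons d. L i m * (\<Sum>k<n. b k * w k m))"
          unfolding Y_def coeff_sum using y(1) by (intro sum.cong) auto
        also have "\<dots> = (\<Sum>m\<in>mons d. \<Sum>k<n. b k * (L i m * w k m))" by (simp add: sum_distrib_left mult_ac)
        also have "\<dots> = (\<Sum>k<n. b k * (\<Sum>m\<in>mons d. L i m * w k m))"
          by (subst sum.swap) (simp add: sum_distrib_left)
        also have "\<dots> = (\<Sum>k<n. if k = i then b k else 0)" using L i by (intro sum.cong) auto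
        finally show ?thesis using i by simp
      qed
      have YX: "poly (Y i) \<tau> = p i + \<tau> * poly (X i) \<tau>" if "i < n" for i \<tau>
      proof -
        have "Y i = pCons (p i) (poly_shift 1 (Y i))"
          by (rule poly_eqI) (auto simp: coeff_pCons coeff_poly_shift Y0 split: nat.splits)
        hence "poly (Y i) \<tau> = poly (pCons (p i) (poly_shift 1 (Y i))) \<tau>" by simp
        thus ?thesis using that by (simp add: X_def)
      qed
      have X0: "poly (X i) 0 = b i" for i
        using Y1[of i] by (simp add: X_def poly_0_coeff_0 coeff_poly_shift)
      have "\<forall>j. \<exists>r. \<forall>\<tau>. coeff (G (\<lambda>i. poly (X i) \<tau>)) j = poly r \<tau>" using G(3) unfolding pcurve_def by blast
      from choice[OF this] obtain R where R: "\<And>j \<tau>. coeff (G (\<lambda>i. poly (X i) \<tau>)) j = poly (R j) \<tau>" by blast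
      \<comment> \<open>The relation along the curve divided by the \<open>k\<close>-th power of
        \<open>\<tau>\<close>. Lower coefficients vanish identically, so its value at 0 is the
        \<open>k\<close>-th Taylor coefficient at \<open>b\<close>, which was chosen
        nonzero.\<close>
      define s where "s = (\<Sum>j\<in>{k..T}. R j * monom 1 (j - k))"
      have "\<forall>\<^sub>F \<tau> in cofinite. poly s \<tau> = 0"
      proof -
        have "\<forall>\<^sub>F \<tau> in cofinite. \<tau> \<noteq> (0::'k)" by (simp add: eventually_cofinite)
        with y(2) show ?thesis
        proof eventually_elim
          case (elim \<tau>)
          then obtain z where z: "z \<in> Z" "\<And>m. m \<in> mons d \<Longrightarrow> z m = poly (y m) \<tau>" by blast
          have fz: "f i z = p i + \<tau> * poly (X i) \<tau>" if "i < n" for i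
          proof -
            have "f i z = poly (Y i) \<tau>" unfolding f_def Y_def poly_sum using z(2) by (intro sum.cong) auto
            thus ?thesis using YX[OF that] by simp
          qed
          have "(\<Prod>i<n. f i z ^ \<alpha> i) = (\<Prod>i<n. (p i + \<tau> * poly (X i) \<tau>) ^ \<alpha> i)" for \<alpha>
            using fz by (intro prod.cong) auto
          hence "Q (\<lambda>i. p i + \<tau> * poly (X i) \<tau>) = 0" using rel[OF z(1)] by (simp add: Q_def)
          hence "(\<Sum>j\<le>T. poly (R j) \<tau> * \<tau> ^ j) = 0" unfolding G(1) Gx R .
          moreover have "(\<Sum>j\<le>T. poly (R j) \<tau> * \<tau> ^ j) = (\<Sum>j\<in>{k..T}. poly (R j) \<tau> * \<tau> ^ j)"
          proof -
            have "poly (R j) \<tau> = 0" if "j < k" for j using lt[OF that] R[of \<tau> j] by simp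
            thus ?thesis by (intro sum.mono_neutral_right) auto
          qed
          moreover have "(\<Sum>j\<in>{k..T}. poly (R j) \<tau> * \<tau> ^ j) = \<tau> ^ k * poly s \<tau>"
            unfolding s_def poly_sum sum_distrib_left
            by (intro sum.cong) (auto simp: poly_monom mult_ac simp flip: power_add)
          ultimately show ?case using elim by simp
        qed
      qed
      hence "s = 0" by (rule poly_zero_cofinite)
      hence "0 = poly s 0" by simp
      also have "poly s 0 = (\<Sum>j\<in>{k..T}. if j = k then poly (R k) 0 else 0)"
        unfolding s_def poly_sum by (intro sum.cong) (auto simp: poly_monom)
      also have "\<dots> = poly (R k) 0" using kT by simp
      also have "\<dots> = coeff (G b) k" using R[of 0 k] X0 by simp
      finally show False using b by simp
    qed
    have Q0: "Q x = 0" for x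
      using G(1)[of 1 "\<lambda>i. x i - p i"] G0 by simp
    have "indep S (\<lambda>\<alpha> (u :: nat \<Rightarrow> 'k). \<Prod>v\<in>{..<n}. u v ^ \<alpha> v) UNIV"
      by (rule indep_monomials) (use S in \<open>auto intro: extensionalityI\<close>)
    from indepD[OF this, of c \<alpha>0] show "c \<alpha>0 = 0" using Q0 \<alpha>0 by (simp add: Q_def)
  qed
  moreover have "f i \<in> PF" for i unfolding f_def[abs_def] by (intro PF_lincomb PF_coord)
  ultimately show ?thesis unfolding aindep_def by blast
qed

section \<open>Chains of irreducible closures of parametrised cones\<close>

lemma box_subst:
  assumes "finite I" "f \<in> box I b" "\<And>i. i \<in> I \<Longrightarrow> \<exists>b'. (\<lambda>c. X c i) \<in> box J b'"
  shows "\<exists>b'. (\<lambda>c. f (X c)) \<in> box J b'"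
  using assms(2) unfolding box_def[of I]
proof (induction rule: lspan.induct)
  case lspan_zero
  show ?case using box_const by blast
next
  case (lspan_step g h c)
  then obtain b \<alpha> where b: "(\<lambda>u. g (X u)) \<in> box J b" and h: "h = (\<lambda>u. \<Prod>i\<in>I. u i ^ \<alpha> i)" by blast
  have "\<forall>i. \<exists>b'. i \<in> I \<longrightarrow> (\<lambda>c. X c i) \<in> box J b'" using assms(3) by blast
  from choice[OF this] obtain B where B: "\<And>i. i \<in> I \<Longrightarrow> (\<lambda>u. X u i) \<in> box J (B i)" by blast
  define B' where "B' = Max ((\<lambda>i. \<alpha> i * B i) ` I)"
  have "(\<lambda>u. \<Prod>i\<in>I. X u i ^ \<alpha> i) \<in> box J (card I * B')"
  proof (rule box_prod[OF assms(1)])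
    fix i assume "i \<in> I"
    hence "\<alpha> i * B i \<le> B'" unfolding B'_def using assms(1) by (intro Max_ge) auto
    thus "(\<lambda>u. X u i ^ \<alpha> i) \<in> box J B'" using box_power[OF B[OF \<open>i \<in> I\<close>]] box_mono by blast
  qed
  hence "(\<lambda>u. g (X u) + c * h (X u)) \<in> box J (max b (card I * B'))"
    using b unfolding h by (intro box_add box_scale) (auto elim: box_mono)
  thus ?case by blast
qed

lemma box_depends:
  assumes "f \<in> box I b" "\<And>i. i \<in> I \<Longrightarrow> u i = v i"
  shows "f u = f v"
  using assms(1) unfolding box_def
proof (induction rule: lspan.induct)
  case (lspan_step g h c)
  then obtain \<alpha> where h: "h = (\<lambda>u. \<Prod>i\<in>I. u i ^ \<alpha> i)" by blast
  have "h u = h v" unfolding h using assms(2) by (intro prod.cong) auto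
  thus ?case using lspan_step.IH by simp
qed simp

text \<open>Equations of \<open>Z1\<close> and \<open>Z2\<close> that fail somewhere on the image
  become nonzero polynomials on the line joining two parameter points. A coordinate of the image is
  treated in the same way, so that the common good parameter gives a nonzero vector.\<close>

lemma param_irreducible:
  fixes \<phi> :: "('v \<Rightarrow> 'k::alg_closed_field) \<Rightarrow> mon \<Rightarrow> 'k"
  assumes "polymap I \<phi>" "A \<subseteq> pforms_set d" "A = {\<phi> u | u. \<phi> u \<noteq> (\<lambda>_. 0)}" "A \<noteq> {}"
  shows "zirreducible d (zclosure d A)"
  unfolding zirreducible_def
proof (intro conjI allI impI)
  show "zclosed d (zclosure d A)" by (rule zclosed_zclosure[OF assms(2)])
  show "zclosure d A \<noteq> {}" using assms(4) zclosure_subset[of A d] by blast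
  fix Z1 Z2 assume Z: "zclosed d Z1" "zclosed d Z2" "zclosure d A \<subseteq> Z1 \<union> Z2"
  show "zclosure d A \<subseteq> Z1 \<or> zclosure d A \<subseteq> Z2"
  proof (rule ccontr)
    assume "\<not> ?thesis"
    hence nA: "\<not> A \<subseteq> Z1" "\<not> A \<subseteq> Z2" using zclosure_minimal Z(1,2) by blast+
    have wit: "\<exists>u f t. f \<in> Hom t \<and> \<phi> u \<noteq> (\<lambda>_. 0) \<and> f (\<phi> u) \<noteq> 0 \<and> (\<forall>F\<in>Z. f F = 0)"
      if cl: "zclosed d Z" and no: "\<not> A \<subseteq> Z" for Z
    proof -
      obtain S where S: "\<And>f. f \<in> S \<Longrightarrow> \<exists>t. f \<in> Hom t" "Z = {F \<in> pforms_set d. \<forall>f\<in>S. f F = 0}"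
        using cl unfolding zclosed_iff by blast
      obtain F where F: "F \<in> A" "F \<notin> Z" using no by blast
      obtain u where u: "F = \<phi> u" "\<phi> u \<noteq> (\<lambda>_. 0)" using F(1) assms(3) by blast
      obtain f where f: "f \<in> S" "f F \<noteq> 0" using F assms(2) S(2) by blast
      obtain t where "f \<in> Hom t" using S(1)[OF f(1)] by blast
      thus ?thesis using u f S(2) by blast
    qed
    obtain u1 f1 t1 where 1: "f1 \<in> Hom t1" "\<phi> u1 \<noteq> (\<lambda>_. 0)" "f1 (\<phi> u1) \<noteq> 0" "\<And>F. F \<in> Z1 \<Longrightarrow> f1 F = 0"
      using wit[OF Z(1) nA(1)] by blast
    obtain u2 f2 t2 where 2: "f2 \<in> Hom t2" "\<phi> u2 \<noteq> (\<lambda>_. 0)" "f2 (\<phi> u2) \<noteq> 0" "\<And>F. F \<in> Z2 \<Longrightarrow> f2 F = 0"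
      using wit[OF Z(2) nA(2)] by blast
    have "\<exists>m. \<phi> u1 m \<noteq> 0" using 1(2) by (rule contrapos_np) (intro ext, blast)
    then obtain m where m: "\<phi> u1 m \<noteq> 0" by blast
    define w where "w t i = poly [:u1 i, u2 i - u1 i:] t" for t i
    have w0: "w 0 = u1" and w1: "w 1 = u2" by (auto simp: w_def)
    have path: "\<exists>p. \<forall>t. f (\<phi> (w t)) = poly p t" if fPF: "f \<in> PF" for f
    proof -
      obtain b where "(\<lambda>u. f (\<phi> u)) \<in> box I b" using PF_polymap[OF assms(1) fPF] by blast
      from box_path[OF this, of "\<lambda>i. [:u1 i, u2 i - u1 i:]"] show ?thesis unfolding w_def .
    qed
    obtain p1 where p1: "\<And>t. f1 (\<phi> (w t)) = poly p1 t" using path[OF Hom_PF[OF 1(1)]] by blast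
    obtain p2 where p2: "\<And>t. f2 (\<phi> (w t)) = poly p2 t" using path[OF Hom_PF[OF 2(1)]] by blast
    obtain p3 where p3: "\<And>t. \<phi> (w t) m = poly p3 t" using path[OF PF_coord[of m]] by blast
    have "p1 \<noteq> 0" using p1[of 0] 1(3) w0 by auto
    moreover have "p2 \<noteq> 0" using p2[of 1] 2(3) w1 by auto
    moreover have "p3 \<noteq> 0" using p3[of 0] m w0 by auto
    ultimately have "\<forall>\<^sub>F t in cofinite. (poly p1 t \<noteq> 0 \<and> poly p2 t \<noteq> 0) \<and> poly p3 t \<noteq> 0"
      by (intro eventually_conj cofinite_poly_nonzero)
    then obtain t where t: "poly p1 t \<noteq> 0" "poly p2 t \<noteq> 0" "poly p3 t \<noteq> 0" using cofinite_exists by blast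
    have "\<phi> (w t) \<noteq> (\<lambda>_. 0)" using p3[of t] t(3) by auto
    hence "\<phi> (w t) \<in> A" using assms(3) by blast
    hence "\<phi> (w t) \<in> Z1 \<union> Z2" using Z(3) zclosure_subset[of A d] by blast
    thus False using 1(4) 2(4) p1[of t] p2[of t] t by auto
  qed
qed

text \<open>The \<open>j\<close>-th set of the chain is the closure of the cone over the family with
  only the first \<open>j\<close> parameters free. Its tangent vectors give \<open>j + 1\<close>
  independent functions, and its \<open>j + 1\<close> parameters allow no more; therefore the
  inclusions are strict.\<close>

lemma pdim_ge:
  fixes \<Psi> :: "(nat \<Rightarrow> 'k::alg_closed_field) \<Rightarrow> mon \<Rightarrow> 'k"
  assumes w: "indep {..n} w (mons d)"
    and form: "\<And>c. is_form d (\<Psi> c)"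
    and pm: "polymap {1..n} \<Psi>"
    and A: "A \<subseteq> pforms_set d" "\<And>c. \<Psi> c \<noteq> (\<lambda>_. 0) \<Longrightarrow> \<Psi> c \<in> A"
    and tan: "\<And>b. \<exists>y. \<forall>m. (\<forall>\<tau>. \<Psi> (\<lambda>i. \<tau> * b i) m = poly (y m) \<tau>) \<and> coeff (y m) 0 = w 0 m \<and>
      coeff (y m) 1 = (\<Sum>i=1..n. b i * w i m)"
  shows "enat n \<le> pdim d A"
proof -
  define cut where "cut j c i = (if i \<le> j then c i else 0)" for j :: nat and c :: "nat \<Rightarrow> 'k" and i
  \<comment> \<open>The parameter with index 0 is the scale of the cone. Its tangent vector is the
    base point \<open>w 0\<close> itself.\<close>
  define \<phi> where "\<phi> j c m = c 0 * \<Psi> (cut j c) m" for j c m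
  define B where "B j = {\<phi> j c | c. \<phi> j c \<noteq> (\<lambda>_. 0)}" for j
  define Z where "Z j = zclosure d (B j)" for j
  have pm\<phi>: "polymap {..j} (\<phi> j)" for j
    unfolding polymap_def
  proof
    fix m
    obtain b where b: "(\<lambda>u. \<Psi> u m) \<in> box {1..n} b" using pm unfolding polymap_def by blast
    have cutbox: "\<exists>b'. (\<lambda>c. cut j c i) \<in> box {..j} b'" for i
    proof (cases "i \<le> j")
      case True
      hence "(\<lambda>c. cut j c i) = (\<lambda>c. c i)" by (auto simp: cut_def)
      moreover have "(\<lambda>c :: nat \<Rightarrow> 'k. c i) \<in> box {..j} 1" by (rule box_var) (use True in auto)
      ultimately show ?thesis by auto
    next
      case False
      hence "(\<lambda>c. cut j c i) = (\<lambda>c. 0)" by (auto simp: cut_def)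
      thus ?thesis using box_const[of 0 "{..j}" 0] by auto
    qed
    obtain b' where b': "(\<lambda>c. \<Psi> (cut j c) m) \<in> box {..j} b'"
      using box_subst[OF _ b, where X = "cut j" and J = "{..j}"] cutbox by auto
    have "(\<lambda>c. c 0 * \<Psi> (cut j c) m) \<in> box {..j} (1 + b')"
      by (rule box_mult[OF box_var b']) auto
    thus "\<exists>b. (\<lambda>u. \<phi> j u m) \<in> box {..j} b" unfolding \<phi>_def by blast
  qed
  have B_forms: "B j \<subseteq> pforms_set d" for j
    unfolding B_def pforms_set_def \<phi>_def using form by (auto simp: is_form_def)
  have B_A: "B j \<subseteq> zclosure d A" for j
  proof
    fix F assume "F \<in> B j"
    then obtain c where c: "F = (\<lambda>m. c 0 * \<Psi> (cut j c) m)" "F \<noteq> (\<lambda>_. 0)" unfolding B_def \<phi>_def[abs_def] by auto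
    have "c 0 \<noteq> 0" "\<Psi> (cut j c) \<noteq> (\<lambda>_. 0)" using c by auto
    thus "F \<in> zclosure d A" unfolding c(1)
      by (intro zclosed_cone[OF zclosed_zclosure[OF A(1)]]) (use A(2) zclosure_subset in blast)+
  qed
  have cone: "(\<lambda>m. a * F m) \<in> B j" if F: "F \<in> B j" and a: "a \<noteq> 0" for F a j
  proof -
    obtain c where c: "F = \<phi> j c" "F \<noteq> (\<lambda>_. 0)" using F unfolding B_def by blast
    define c' where "c' = c(0 := a * c 0)"
    have dep: "\<Psi> (cut j c') m = \<Psi> (cut j c) m" for m
    proof -
      obtain b where b: "(\<lambda>u. \<Psi> u m) \<in> box {1..n} b" using pm unfolding polymap_def by blast
      show ?thesis by (rule box_depends[OF b]) (auto simp: cut_def c'_def)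
    qed
    have eq: "(\<lambda>m. a * F m) = \<phi> j c'" by (simp add: c(1) \<phi>_def dep fun_eq_iff) (simp add: c'_def)
    have "\<exists>m. F m \<noteq> 0" using c(2) by (rule contrapos_np) (intro ext, blast)
    then obtain m where "F m \<noteq> 0" by blast
    hence "a * F m \<noteq> 0" using a by simp
    hence "\<phi> j c' \<noteq> (\<lambda>_. 0)" unfolding eq[symmetric] by (metis (no_types))
    thus ?thesis unfolding eq B_def by blast
  qed
  have "\<exists>m0\<in>mons d. w 0 m0 \<noteq> 0"
  proof (rule ccontr)
    assume no: "\<not> ?thesis"
    define e :: "nat \<Rightarrow> 'k" where "e i = (if i = 0 then 1 else 0)" for i
    have "e 0 = 0"
    proof (rule indepD[OF w, of e 0])
      fix m assume "m \<in> mons d"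
      hence "e i * w i m = 0" for i using no by (auto simp: e_def)
      thus "(\<Sum>i\<le>n. e i * w i m) = 0" by (intro sum.neutral) blast
    qed simp
    thus False by (simp add: e_def)
  qed
  then obtain m0 where m0: "m0 \<in> mons d" "w 0 m0 \<noteq> 0" by blast
  have ai: "\<exists>f. aindep (Suc j) f (Z j)" if j: "j \<le> n" for j
  proof (rule tangent_aindep[where d = d and w = w and base = "w 0"])
    show "indep {..<Suc j} w (mons d)" by (rule indep_subset[OF w]) (use j in auto)
    fix b :: "nat \<Rightarrow> 'k"
    obtain y where y: "\<And>m \<tau>. \<Psi> (\<lambda>i. \<tau> * cut j b i) m = poly (y m) \<tau>" "\<And>m. coeff (y m) 0 = w 0 m"
      "\<And>m. coeff (y m) 1 = (\<Sum>i=1..n. cut j b i * w i m)" using tan[of "cut j b"] by blast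
    \<comment> \<open>The scale moves as \<open>1 + \<tau> * b 0\<close>, which adds
      \<open>b 0 * w 0 m\<close> to the linear part.\<close>
    define y' where "y' m = [:1, b 0:] * y m" for m
    have c0: "coeff (y' m) 0 = w 0 m" for m by (simp add: y'_def y(2) coeff_mult)
    have c1: "coeff (y' m) 1 = (\<Sum>i<Suc j. b i * w i m)" for m
    proof -
      have "coeff (y' m) 1 = coeff (y m) 1 + b 0 * w 0 m"
        unfolding y'_def using y(2)[of m] by (simp add: coeff_pCons algebra_simps)
      also have "coeff (y m) 1 = (\<Sum>i=1..j. b i * w i m)"
        unfolding y(3) using j by (intro sum.mono_neutral_cong_right) (auto simp: cut_def)
      also have "\<dots> + b 0 * w 0 m = (\<Sum>i<Suc j. b i * w i m)"
      proof -
        have "{..<Suc j} = insert 0 {1..j}" by auto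
        thus ?thesis by (simp add: add.commute)
      qed
      finally show ?thesis .
    qed
    have ev: "\<forall>\<^sub>F \<tau> in cofinite. poly (y' m0) \<tau> \<noteq> 0"
      by (rule cofinite_poly_nonzero) (use c0[of m0] m0(2) in auto)
    have "\<forall>\<^sub>F \<tau> in cofinite. \<exists>z\<in>Z j. \<forall>m\<in>mons d. z m = poly (y' m) \<tau>"
      using ev
    proof eventually_elim
      case (elim \<tau>)
      define c where "c i = (if i = 0 then 1 + \<tau> * b 0 else \<tau> * b i)" for i
      have eq: "\<phi> j c m = poly (y' m) \<tau>" for m
      proof -
        obtain bb where "(\<lambda>u. \<Psi> u m) \<in> box {1..n} bb" using pm unfolding polymap_def by blast
        from box_depends[OF this, of "cut j c" "\<lambda>i. \<tau> * cut j b i"]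
        have "\<Psi> (cut j c) m = \<Psi> (\<lambda>i. \<tau> * cut j b i) m" by (auto simp: cut_def c_def)
        thus ?thesis by (simp add: \<phi>_def y(1) y'_def c_def algebra_simps)
      qed
      have "\<phi> j c m0 \<noteq> 0" using elim eq by simp
      hence "\<phi> j c \<noteq> (\<lambda>_. 0)" by (metis (no_types))
      hence "\<phi> j c \<in> Z j" unfolding Z_def using zclosure_subset[of "B j" d] by (auto simp: B_def)
      thus ?case using eq by (intro bexI[of _ "\<phi> j c"]) auto
    qed
    thus "\<exists>y. (\<forall>m\<in>mons d. coeff (y m) 0 = w 0 m \<and> coeff (y m) 1 = (\<Sum>i<Suc j. b i * w i m)) \<and>
        (\<forall>\<^sub>F \<tau> in cofinite. \<exists>z\<in>Z j. \<forall>m\<in>mons d. z m = poly (y m) \<tau>)"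
      using c0 c1 by (intro exI[of _ y']) auto
  qed
  have ne: "B j \<noteq> {}" for j
  proof -
    obtain y where y: "\<And>m \<tau>. \<Psi> (\<lambda>i. \<tau> * 0) m = poly (y m) \<tau>" "\<And>m. coeff (y m) 0 = w 0 m"
      using tan[of "\<lambda>_. 0"] by blast
    define c :: "nat \<Rightarrow> 'k" where "c i = (if i = 0 then 1 else 0)" for i
    obtain bb where "(\<lambda>u. \<Psi> u m0) \<in> box {1..n} bb" using pm unfolding polymap_def by blast
    from box_depends[OF this, of "cut j c" "\<lambda>i. 0 * 0"] have "\<Psi> (cut j c) m0 = \<Psi> (\<lambda>i. 0 * 0) m0"
      by (auto simp: cut_def c_def)
    hence "\<phi> j c m0 = w 0 m0" using y(1)[of 0 m0] y(2)[of m0] by (simp add: \<phi>_def c_def poly_0_coeff_0)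
    hence "\<phi> j c \<noteq> (\<lambda>_. 0)" using m0(2) by (metis (no_types))
    thus ?thesis unfolding B_def by blast
  qed
  have irr: "zirreducible d (Z j)" for j
    unfolding Z_def by (rule param_irreducible[OF pm\<phi> B_forms _ ne]) (simp add: B_def)
  have ZA: "Z j \<subseteq> zclosure d A" for j
    unfolding Z_def by (rule zclosure_minimal[OF zclosed_zclosure[OF A(1)] B_A])
  have sub: "Z j \<subset> Z (Suc j)" if jn: "j < n" for j
  proof
    have "B j \<subseteq> B (Suc j)"
    proof
      fix F assume "F \<in> B j"
      then obtain c where c: "F = \<phi> j c" "F \<noteq> (\<lambda>_. 0)" unfolding B_def by blast
      have "cut (Suc j) (cut j c) = cut j c" by (auto simp: cut_def)
      hence "\<phi> (Suc j) (cut j c) = F" unfolding c(1) \<phi>_def by (simp add: cut_def[of j c 0])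
      thus "F \<in> B (Suc j)" using c(2) unfolding B_def by blast
    qed
    thus "Z j \<subseteq> Z (Suc j)" unfolding Z_def by (rule zclosure_mono)
    show "Z j \<noteq> Z (Suc j)"
    proof
      assume eq: "Z j = Z (Suc j)"
      obtain f where f: "aindep (Suc (Suc j)) f (Z (Suc j))" using ai[of "Suc j"] jn by auto
      have "\<not> aindep (Suc (Suc j)) f (Z (Suc j))"
        by (rule param_not_aindep[OF _ pm\<phi>[of j] B_forms B_def cone])
          (use eq in \<open>auto simp: Z_def\<close>)
      thus False using f by blast
    qed
  qed
  have "n \<in> {n. \<exists>Z. (\<forall>i\<le>n. zirreducible d (Z i) \<and> Z i \<subseteq> zclosure d A) \<and> (\<forall>i<n. Z i \<subset> Z (Suc i))}"
    using irr ZA sub by (intro CollectI exI[of _ Z]) auto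
  thus ?thesis unfolding pdim_def by (rule SUP_upper)
qed

section \<open>Coefficient vectors of forms\<close>

text \<open>The bridge from coefficient vectors to functions. Together with \<open>ev_inj\<close> it
  reduces identities between products \<open>fmul\<close> to pointwise ones.\<close>

definition ev :: "nat \<Rightarrow> (mon \<Rightarrow> 'k::field) \<Rightarrow> 'k pt \<Rightarrow> 'k" where
  "ev d F p = (\<Sum>m\<in>mons d. F m * mono3 m p)"

lemma ev_forms: "ev d F \<in> forms d"
  unfolding ev_def[abs_def] by (intro forms_sum forms_scale forms_mono3)

lemma ev_surj:
  assumes "f \<in> forms d"
  shows "\<exists>F. is_form d F \<and> ev d F = f"
proof -
  obtain c where c: "\<And>x. f x = (\<Sum>m\<in>mons d. c m * mono3 m x)" using forms_coeffs[OF assms] by blast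
  define F where "F m = (if m \<in> mons d then c m else 0)" for m
  have "is_form d F" by (auto simp: is_form_def F_def mons_def)
  moreover have "ev d F x = f x" for x unfolding ev_def c by (intro sum.cong) (auto simp: F_def)
  ultimately show ?thesis by blast
qed

lemma ev_zero:
  fixes F :: "mon \<Rightarrow> 'k::alg_closed_field"
  assumes "\<And>p. ev d F p = 0" "m \<in> mons d"
  shows "F m = 0"
proof (rule indepD[OF indep_mono3 _ assms(2)])
  show "(\<Sum>i\<in>mons d. F i * mono3 i p) = 0" for p using assms(1)[of p] by (simp add: ev_def)
qed

lemma is_formD: "is_form d F \<Longrightarrow> a + b + c \<noteq> d \<Longrightarrow> F (a, b, c) = 0"
  by (simp add: is_form_def mdeg_def)

lemma is_form_outside: "is_form d F \<Longrightarrow> m \<notin> mons d \<Longrightarrow> F m = 0"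
  by (cases m) (auto intro: is_formD)

lemma ev_add: "ev d (\<lambda>m. F m + G m) p = ev d F p + ev d G p"
  by (simp add: ev_def algebra_simps sum.distrib)

lemma ev_diff: "ev d (\<lambda>m. F m - G m) p = ev d F p - ev d G p"
  by (simp add: ev_def algebra_simps sum_subtractf)

lemma ev_scale: "ev d (\<lambda>m. c * F m) p = c * ev d F p"
  by (simp add: ev_def sum_distrib_left mult.assoc)

lemma ev_sum: "ev d (\<lambda>m. \<Sum>k\<in>I. F k m) p = (\<Sum>k\<in>I. ev d (F k) p)"
  unfolding ev_def by (subst sum.swap) (simp add: sum_distrib_right)

lemma ev_inj:
  fixes F G :: "mon \<Rightarrow> 'k::alg_closed_field"
  assumes "is_form d F" "is_form d G" "\<And>p. ev d F p = ev d G p"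
  shows "F = G"
proof
  fix m
  show "F m = G m"
  proof (cases "m \<in> mons d")
    case True
    have "ev d (\<lambda>m. F m - G m) p = 0" for p using assms(3)[of p] by (simp add: ev_diff)
    from ev_zero[OF this True] show ?thesis by simp
  next
    case False
    thus ?thesis using assms(1,2) by (simp add: is_form_outside)
  qed
qed

lemma is_form_add: "is_form d F \<Longrightarrow> is_form d G \<Longrightarrow> is_form d (\<lambda>m. F m + G m)"
  by (simp add: is_form_def)

lemma is_form_diff: "is_form d F \<Longrightarrow> is_form d G \<Longrightarrow> is_form d (\<lambda>m. F m - G m)"
  by (simp add: is_form_def)

lemma is_form_scale: "is_form d F \<Longrightarrow> is_form d (\<lambda>m. c * F m)"
  by (simp add: is_form_def)

lemma is_form_sum: "(\<And>k. k \<in> I \<Longrightarrow> is_form d (F k)) \<Longrightarrow> is_form d (\<lambda>m. \<Sum>k\<in>I. F k m)"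
  by (simp add: is_form_def)

lemma fmul_apply: "fmul F G (a, b, c) = (\<Sum>(i, j, l)\<in>{0..a} \<times> {0..b} \<times> {0..c}. F (i, j, l) * G (a - i, b - j, c - l))"
  by (simp add: fmul_def)

lemma is_form_fmul:
  assumes "is_form a F" "is_form b G"
  shows "is_form (a + b) (fmul F G)"
  unfolding is_form_def
proof (intro allI impI)
  fix m assume m: "mdeg m \<noteq> a + b"
  obtain x y z where xyz: "m = (x, y, z)" by (cases m) auto
  have "F (i, j, l) * G (x - i, y - j, z - l) = 0" if "i \<le> x" "j \<le> y" "l \<le> z" for i j l
  proof -
    have "mdeg (i, j, l) \<noteq> a \<or> mdeg (x - i, y - j, z - l) \<noteq> b" using m that by (auto simp: xyz mdeg_def)
    thus ?thesis using assms by (auto simp: is_form_def)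
  qed
  thus "fmul F G m = 0" unfolding xyz fmul_apply by (intro sum.neutral) auto
qed

lemma ev_fmul:
  fixes F G :: "mon \<Rightarrow> 'k::field"
  assumes "is_form a F" "is_form b G"
  shows "ev (a + b) (fmul F G) p = ev a F p * ev b G p"
proof -
  \<comment> \<open>Only divisors of \<open>m\<close> of degree \<open>a\<close> contribute, which
    turns the convolution into a sum over pairs of monomials of degrees \<open>a\<close> and
    \<open>b\<close>.\<close>
  define C where "C m = (case m of (x, y, z) \<Rightarrow> {(i, j, l). i \<le> x \<and> j \<le> y \<and> l \<le> z \<and> i + j + l = a})" for m :: mon
  define msub where "msub m k = (case (m, k) of ((x, y, z), (i, j, l)) \<Rightarrow> (x - i, y - j, z - l))" for m k :: mon
  define madd where "madd m k = (case (m, k) of ((x, y, z), (i, j, l)) \<Rightarrow> (x + i, y + j, z + l))" for m k :: mon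
  have C_sub: "C m \<subseteq> mons a" for m by (auto simp: C_def)
  have C_fin: "finite (C m)" for m using C_sub finite_mons finite_subset by blast
  have fm: "fmul F G m = (\<Sum>k\<in>C m. F k * G (msub m k))" for m
  proof -
    obtain x y z where xyz: "m = (x, y, z)" by (cases m) auto
    have "(\<Sum>k\<in>C m. F k * G (msub m k)) = (\<Sum>(i, j, l)\<in>{0..x} \<times> {0..y} \<times> {0..z}. F (i, j, l) * G (x - i, y - j, z - l))"
    proof (rule sum.mono_neutral_cong_left)
      show "C m \<subseteq> {0..x} \<times> {0..y} \<times> {0..z}" by (auto simp: C_def xyz)
      show "\<forall>k\<in>{0..x} \<times> {0..y} \<times> {0..z} - C m. (case k of (i, j, l) \<Rightarrow> F (i, j, l) * G (x - i, y - j, z - l)) = 0"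
        by (auto simp: C_def xyz intro: is_formD[OF assms(1)])
    qed (auto simp: msub_def xyz split: prod.splits)
    thus ?thesis by (simp add: xyz fmul_apply)
  qed
  have "ev (a + b) (fmul F G) p = (\<Sum>m\<in>mons (a + b). \<Sum>k\<in>C m. F k * G (msub m k) * mono3 m p)"
    by (simp add: ev_def fm sum_distrib_right)
  also have "\<dots> = (\<Sum>(m, k)\<in>(SIGMA m:mons (a + b). C m). F k * G (msub m k) * mono3 m p)"
    using C_fin by (subst sum.Sigma) auto
  also have "\<dots> = (\<Sum>(k, l)\<in>mons a \<times> mons b. F k * G l * (mono3 k p * mono3 l p))"
  proof (rule sum.reindex_bij_witness[where i = "\<lambda>(k, l). (madd k l, k)" and j = "\<lambda>(m, k). (k, msub m k)"])
    fix x assume xC: "x \<in> (SIGMA m:mons (a + b). C m)"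
    obtain x1 y1 z1 i j l where xe: "x = ((x1, y1, z1), (i, j, l))" by (metis prod.exhaust)
    have x: "x = ((x1, y1, z1), (i, j, l))" "x1 + y1 + z1 = a + b"
      "i \<le> x1" "j \<le> y1" "l \<le> z1" "i + j + l = a" using xC by (simp_all add: xe C_def)
    show "(case case x of (m, k) \<Rightarrow> (k, msub m k) of (k, l) \<Rightarrow> (madd k l, k)) = x"
      using x by (auto simp: msub_def madd_def)
    show "(case x of (m, k) \<Rightarrow> (k, msub m k)) \<in> mons a \<times> mons b"
      using x by (auto simp: msub_def)
    have "mono3 (x1, y1, z1) p = mono3 (i, j, l) p * mono3 (x1 - i, y1 - j, z1 - l) p"
    proof -
      obtain p1 p2 p3 where p: "p = (p1, p2, p3)" by (cases p) auto
      have "p1 ^ x1 = p1 ^ i * p1 ^ (x1 - i)" "p2 ^ y1 = p2 ^ j * p2 ^ (y1 - j)" "p3 ^ z1 = p3 ^ l * p3 ^ (z1 - l)"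
        using x by (simp_all flip: power_add)
      thus ?thesis by (simp add: p mult_ac)
    qed
    thus "(case case x of (m, k) \<Rightarrow> (k, msub m k) of (k, l) \<Rightarrow> F k * G l * (mono3 k p * mono3 l p)) =
        (case x of (m, k) \<Rightarrow> F k * G (msub m k) * mono3 m p)"
      by (simp add: x(1) msub_def)
  next
    fix y assume yC: "y \<in> mons a \<times> mons b"
    obtain i j l i' j' l' where ye: "y = ((i, j, l), (i', j', l'))" by (metis prod.exhaust)
    have y: "y = ((i, j, l), (i', j', l'))" "i + j + l = a" "i' + j' + l' = b" using yC by (simp_all add: ye)
    show "(case case y of (k, l) \<Rightarrow> (madd k l, k) of (m, k) \<Rightarrow> (k, msub m k)) = y"
      by (simp add: y(1) msub_def madd_def)
    show "(case y of (k, l) \<Rightarrow> (madd k l, k)) \<in> (SIGMA m:mons (a + b). C m)"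
      using y by (auto simp: madd_def C_def)
  qed
  also have "\<dots> = ev a F p * ev b G p"
    unfolding ev_def sum_product by (subst sum.cartesian_product) (auto simp: mult_ac intro!: sum.cong)
  finally show ?thesis .
qed

lemma is_form_fone: "is_form 0 fone" by (auto simp: is_form_def fone_def mdeg_def)

lemma ev_fone: "ev 0 fone p = 1"
proof -
  have "mons 0 = {(0, 0, 0)}" by (auto simp: mons_def mdeg_def)
  thus ?thesis by (cases p) (simp add: ev_def fone_def)
qed

lemma fmul_lead:
  assumes "is_form a F" "is_form b G"
  shows "fmul F G (a + b, 0, 0) = F (a, 0, 0) * G (b, 0, 0)"
proof -
  have "fmul F G (a + b, 0, 0) = (\<Sum>k\<in>{(a, 0, 0)}. case k of (i, j, l) \<Rightarrow> F (i, j, l) * G (a + b - i, 0 - j, 0 - l))"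
    unfolding fmul_apply
  proof (rule sum.mono_neutral_right)
    show "\<forall>k\<in>{0..a + b} \<times> {0..0} \<times> {0..0} - {(a, 0, 0)}. (case k of (i, j, l) \<Rightarrow> F (i, j, l) * G (a + b - i, 0 - j, 0 - l)) = 0"
    proof
      fix k :: mon assume k: "k \<in> {0..a + b} \<times> {0..0} \<times> {0..0} - {(a, 0, 0)}"
      obtain i j l where ijl: "k = (i, j, l)" by (cases k) auto
      have "i + j + l \<noteq> a" using k ijl by auto
      thus "(case k of (i, j, l) \<Rightarrow> F (i, j, l) * G (a + b - i, 0 - j, 0 - l)) = 0"
        using is_formD[OF assms(1)] by (simp add: ijl)
    qed
  qed auto
  thus ?thesis by simp
qed

lemma fmul_add_left: "fmul (\<lambda>m. F m + F' m) G m = fmul F G m + fmul F' G m"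
proof -
  obtain x y z where m: "m = (x, y, z)" by (cases m) auto
  show ?thesis unfolding m fmul_apply sum.distrib[symmetric]
    by (intro sum.cong) (auto simp: algebra_simps)
qed

text \<open>Division with remainder by a form that is monic in the first variable, one power of that
  variable at a time. The remainder has no monomial in which its exponent reaches
  \<open>s\<close>.\<close>

lemma monic_division:
  fixes F G :: "mon \<Rightarrow> 'k::field"
  assumes "is_form e F" "is_form s G" "G (s, 0, 0) = 1" "s \<le> e"
  shows "\<exists>A. is_form (e - s) A \<and> (\<forall>a b c. s \<le> a \<longrightarrow> F (a, b, c) = fmul A G (a, b, c))"
proof -
  have "\<exists>A. is_form (e - s) A \<and> (\<forall>a b c. s \<le> a \<longrightarrow> F (a, b, c) = fmul A G (a, b, c))"
    if "is_form e F" "\<forall>a b c. s + k \<le> a \<longrightarrow> F (a, b, c) = 0" for k and F :: "mon \<Rightarrow> 'k"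
    using that
  proof (induction k arbitrary: F)
    case 0
    have "fmul (\<lambda>_. 0) G m = 0" for m by (cases m) (simp add: fmul_apply case_prod_unfold)
    thus ?case using 0 by (intro exI[of _ "\<lambda>_. 0"]) (auto simp: is_form_def)
  next
    case (Suc k)
    \<comment> \<open>The top layer of \<open>F\<close>, divided by the \<open>s\<close>-th power of
      the first variable. Since \<open>G\<close> is monic, subtracting \<open>fmul A0 G\<close>
      clears this layer and affects only lower ones.\<close>
    define A0 where "A0 = (\<lambda>(i, j, l). if i = k then F (s + k, j, l) else 0)"
    have A0: "is_form (e - s) A0"
      using Suc.prems(1) assms(4) by (auto simp: is_form_def A0_def mdeg_def)
    have f0: "fmul A0 G (a, b, c) = (if a = s + k then F (a, b, c) else 0)" if a: "s + k \<le> a" for a b c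
    proof -
      have z: "A0 (i, j, l) * G (a - i, b - j, c - l) = 0"
        if "i \<le> a" "j \<le> b" "l \<le> c" "(i, j, l) \<noteq> (k, b, c)" for i j l
      proof (cases "i = k")
        case True
        hence "mdeg (a - i, b - j, c - l) \<noteq> s" using that a by (auto simp: mdeg_def)
        thus ?thesis using assms(2) by (auto simp: is_form_def)
      qed (simp add: A0_def)
      have "fmul A0 G (a, b, c) = (\<Sum>x\<in>{(k, b, c)}. case x of (i, j, l) \<Rightarrow> A0 (i, j, l) * G (a - i, b - j, c - l))"
        unfolding fmul_apply
      proof (rule sum.mono_neutral_right)
        show "{(k, b, c)} \<subseteq> {0..a} \<times> {0..b} \<times> {0..c}" using a by auto
        show "\<forall>x\<in>{0..a} \<times> {0..b} \<times> {0..c} - {(k, b, c)}. (case x of (i, j, l) \<Rightarrow> A0 (i, j, l) * G (a - i, b - j, c - l)) = 0"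
        proof
          fix x assume x: "x \<in> {0..a} \<times> {0..b} \<times> {0..c} - {(k, b, c)}"
          obtain i j l where ijl: "x = (i, j, l)" by (cases x) auto
          have "i \<le> a" "j \<le> b" "l \<le> c" "(i, j, l) \<noteq> (k, b, c)" using x ijl by auto
          from z[OF this] show "(case x of (i, j, l) \<Rightarrow> A0 (i, j, l) * G (a - i, b - j, c - l)) = 0" by (simp add: ijl)
        qed
      qed simp
      hence "fmul A0 G (a, b, c) = F (s + k, b, c) * G (a - k, 0, 0)" by (simp add: A0_def)
      moreover have "G (a - k, 0, 0) = (if a = s + k then 1 else 0)"
        using assms(2,3) a by (auto simp: is_form_def mdeg_def)
      ultimately show ?thesis by simp
    qed
    define F1 where "F1 m = F m - fmul A0 G m" for m
    have "is_form e F1" unfolding F1_def[abs_def] using is_form_fmul[OF A0 assms(2)] assms(4)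
      by (intro is_form_diff Suc.prems(1)) simp
    moreover have "F1 (a, b, c) = 0" if "s + k \<le> a" for a b c
    proof (cases "a = s + k")
      case False
      hence "s + Suc k \<le> a" using that by simp
      thus ?thesis using Suc.prems(2) False f0[OF that] by (simp add: F1_def)
    qed (simp add: F1_def f0)
    ultimately obtain A1 where A1: "is_form (e - s) A1" "\<And>a b c. s \<le> a \<Longrightarrow> F1 (a, b, c) = fmul A1 G (a, b, c)"
      using Suc.IH[of F1] by blast
    have "F (a, b, c) = fmul (\<lambda>m. A0 m + A1 m) G (a, b, c)" if "s \<le> a" for a b c
      using A1(2)[OF that] by (simp add: F1_def fmul_add_left algebra_simps)
    thus ?case using is_form_add[OF A0 A1(1)] by blast
  qed
  \<comment> \<open>Exponents above the degree \<open>e\<close> do not occur, so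
    \<open>Suc e\<close> layers cover everything.\<close>
  from this[OF assms(1), of "Suc e"] show ?thesis
    using is_formD[OF assms(1)] by fastforce
qed

section \<open>Products of forms and their first-order variation\<close>

fun pr :: "nat \<Rightarrow> (nat \<Rightarrow> mon \<Rightarrow> 'k::field) \<Rightarrow> mon \<Rightarrow> 'k" where
  "pr 0 F = fone"
| "pr (Suc r) F = fmul (pr r F) (F r)"

text \<open>The derivative of the product at \<open>F\<close> in the direction \<open>A\<close>, by
  the Leibniz rule. Its evaluation in \<open>ev_dpr\<close> has the shape of an element of the
  tangent space.\<close>

fun dpr :: "nat \<Rightarrow> (nat \<Rightarrow> mon \<Rightarrow> 'k::field) \<Rightarrow> (nat \<Rightarrow> mon \<Rightarrow> 'k) \<Rightarrow> mon \<Rightarrow> 'k" where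
  "dpr 0 F A = (\<lambda>_. 0)"
| "dpr (Suc r) F A = (\<lambda>m. fmul (dpr r F A) (F r) m + fmul (pr r F) (A r) m)"

lemma pr_form:
  assumes "\<And>i. i < r \<Longrightarrow> is_form (n i) (F i)"
  shows "is_form (\<Sum>i<r. n i) (pr r F)"
  using assms by (induction r) (auto intro: is_form_fone is_form_fmul)

lemma ev_pr:
  assumes "\<And>i. i < r \<Longrightarrow> is_form (n i) (F i)"
  shows "ev (\<Sum>i<r. n i) (pr r F) p = (\<Prod>i<r. ev (n i) (F i) p)"
  using assms by (induction r) (simp_all add: ev_fone ev_fmul pr_form)

lemma dpr_form:
  assumes "\<And>i. i < r \<Longrightarrow> is_form (n i) (F i)" "\<And>i. i < r \<Longrightarrow> is_form (n i) (A i)"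
  shows "is_form (\<Sum>i<r. n i) (dpr r F A)"
  using assms
proof (induction r)
  case 0
  show ?case by (simp add: is_form_def)
next
  case (Suc r)
  have "is_form ((\<Sum>i<r. n i) + n r) (fmul (dpr r F A) (F r))" using Suc by (intro is_form_fmul) auto
  moreover have "is_form ((\<Sum>i<r. n i) + n r) (fmul (pr r F) (A r))"
    using Suc by (intro is_form_fmul pr_form) auto
  ultimately show ?case by (simp add: is_form_add)
qed

lemma ev_dpr:
  assumes "\<And>i. i < r \<Longrightarrow> is_form (n i) (F i)" "\<And>i. i < r \<Longrightarrow> is_form (n i) (A i)"
  shows "ev (\<Sum>i<r. n i) (dpr r F A) p = (\<Sum>i<r. ev (n i) (A i) p * (\<Prod>j\<in>{..<r} - {i}. ev (n j) (F j) p))"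
  using assms
proof (induction r)
  case 0
  show ?case by (simp add: ev_def)
next
  case (Suc r)
  have f: "is_form (\<Sum>i<r. n i) (dpr r F A)" "is_form (\<Sum>i<r. n i) (pr r F)" "is_form (n r) (F r)" "is_form (n r) (A r)"
    using Suc.prems by (auto intro: dpr_form pr_form)
  have "ev (\<Sum>i<Suc r. n i) (dpr (Suc r) F A) p =
     ev (\<Sum>i<r. n i) (dpr r F A) p * ev (n r) (F r) p + ev (\<Sum>i<r. n i) (pr r F) p * ev (n r) (A r) p"
    by (simp add: ev_add ev_fmul f)
  also have "ev (\<Sum>i<r. n i) (dpr r F A) p * ev (n r) (F r) p
     = (\<Sum>i<r. ev (n i) (A i) p * (\<Prod>j\<in>{..<Suc r} - {i}. ev (n j) (F j) p))"
  proof -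
    have "(\<Prod>j\<in>{..<Suc r} - {i}. ev (n j) (F j) p) = (\<Prod>j\<in>{..<r} - {i}. ev (n j) (F j) p) * ev (n r) (F r) p" if "i < r" for i
    proof -
      have "{..<Suc r} - {i} = insert r ({..<r} - {i})" using that by auto
      thus ?thesis by (simp add: mult.commute)
    qed
    thus ?thesis using Suc by (simp add: sum_distrib_right mult.assoc)
  qed
  also have "ev (\<Sum>i<r. n i) (pr r F) p * ev (n r) (A r) p = ev (n r) (A r) p * (\<Prod>j\<in>{..<Suc r} - {r}. ev (n j) (F j) p)"
  proof -
    have "{..<Suc r} - {r} = {..<r}" by auto
    thus ?thesis using Suc.prems by (simp add: ev_pr mult.commute)
  qed
  finally show ?case by simp
qed

lemma pr_lead:
  assumes "\<And>i. i < r \<Longrightarrow> is_form (n i) (F i)"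
  shows "pr r F (\<Sum>i<r. n i, 0, 0) = (\<Prod>i<r. F i (n i, 0, 0))"
  using assms
proof (induction r)
  case 0
  show ?case by (simp add: fone_def)
next
  case (Suc r)
  thus ?case by (simp add: fmul_lead pr_form)
qed

definition fmul_poly :: "(mon \<Rightarrow> 'k::field poly) \<Rightarrow> (mon \<Rightarrow> 'k poly) \<Rightarrow> mon \<Rightarrow> 'k poly" where
  "fmul_poly y y' = (\<lambda>(a, b, c). \<Sum>(i, j, l)\<in>{0..a} \<times> {0..b} \<times> {0..c}. y (i, j, l) * y' (a - i, b - j, c - l))"

lemma fmul_curve:
  assumes "\<And>m. F m = poly (y m) \<tau>" "\<And>m. G m = poly (y' m) \<tau>"
  shows "fmul F G m = poly (fmul_poly y y' m) \<tau>"
  using assms by (cases m) (simp add: fmul_apply fmul_poly_def poly_sum case_prod_unfold)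

lemma pr_curve:
  assumes "\<And>i m \<tau>. i < r \<Longrightarrow> F \<tau> i m = poly (y i m) \<tau>"
    "\<And>i m. i < r \<Longrightarrow> coeff (y i m) 0 = F0 i m" "\<And>i m. i < r \<Longrightarrow> coeff (y i m) 1 = A i m"
  shows "\<exists>Y. \<forall>m. (\<forall>\<tau>. pr r (F \<tau>) m = poly (Y m) \<tau>) \<and> coeff (Y m) 0 = pr r F0 m \<and> coeff (Y m) 1 = dpr r F0 A m"
  using assms
proof (induction r)
  case 0
  show ?case by (intro exI[of _ "\<lambda>m. [:fone m:]"]) simp
next
  case (Suc r)
  then obtain Y where Y: "\<And>m \<tau>. pr r (F \<tau>) m = poly (Y m) \<tau>" "\<And>m. coeff (Y m) 0 = pr r F0 m"
    "\<And>m. coeff (Y m) 1 = dpr r F0 A m" by (metis less_SucI)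
  define Y' where "Y' = fmul_poly Y (y r)"
  have 1: "pr (Suc r) (F \<tau>) m = poly (Y' m) \<tau>" for \<tau> m
    unfolding Y'_def by (simp, rule fmul_curve) (auto simp: Y(1) Suc.prems(1))
  have c1: "coeff (p * q) 1 = coeff p 0 * coeff q 1 + coeff p 1 * coeff q 0" for p q :: "'a poly"
    by (simp add: coeff_mult)
  have 2: "coeff (Y' m) 0 = pr (Suc r) F0 m" for m
    by (cases m) (simp add: Y'_def fmul_poly_def coeff_sum fmul_apply case_prod_unfold coeff_mult Y(2) Suc.prems(2))
  have 3: "coeff (Y' m) 1 = dpr (Suc r) F0 A m" for m
  proof -
    obtain a b c where m: "m = (a, b, c)" by (cases m) auto
    show ?thesis unfolding m Y'_def fmul_poly_def dpr.simps fmul_apply sum.distrib[symmetric] prod.case coeff_sum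
      by (intro sum.cong) (auto simp: case_prod_unfold c1 Y(2) Y(3) Suc.prems(2) Suc.prems(3) simp del: One_nat_def split: prod.splits)
  qed
  show ?case using 1 2 3 by (intro exI[of _ Y']) blast
qed

section \<open>Dimensions of the varieties\<close>

lemma PF_curve:
  assumes "f \<in> PF"
  shows "\<exists>p. \<forall>t. f (\<lambda>m. poly (y m) t) = poly p t"
  using assms unfolding PF_def
proof (induction rule: lspan.induct)
  case lspan_zero
  show ?case by (rule exI[of _ 0]) simp
next
  case (lspan_step g h c)
  then obtain p \<alpha> where "\<forall>t. g (\<lambda>m. poly (y m) t) = poly p t" "h = mf \<alpha>" by blast
  thus ?case
    by (intro exI[of _ "p + smult c (\<Prod>m\<in>Poly_Mapping.keys \<alpha>. y m ^ Poly_Mapping.lookup \<alpha> m)"])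
      (simp add: poly_prod mf_def)
qed

text \<open>An equation of the closure is a polynomial along the curve; it vanishes at almost all
  parameters, hence at 0.\<close>

lemma zclosure_limit:
  fixes F :: "mon \<Rightarrow> 'k::alg_closed_field"
  assumes "A \<subseteq> pforms_set d" "F \<in> pforms_set d" "\<And>m. F m = poly (y m) 0"
    "\<forall>\<^sub>F t in cofinite. (\<lambda>m. poly (y m) t) \<in> zclosure d A"
  shows "F \<in> zclosure d A"
proof -
  obtain S where S: "\<And>f. f \<in> S \<Longrightarrow> \<exists>t. f \<in> Hom t" "zclosure d A = {F \<in> pforms_set d. \<forall>f\<in>S. f F = 0}"
    using zclosed_zclosure[OF assms(1)] unfolding zclosed_iff by blast
  have "f F = 0" if fS: "f \<in> S" for f
  proof -
    obtain t where "f \<in> Hom t" using S(1)[OF fS] by blast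
    then obtain p where p: "\<And>t. f (\<lambda>m. poly (y m) t) = poly p t" using PF_curve[OF Hom_PF] by blast
    have "\<forall>\<^sub>F t in cofinite. poly p t = 0"
      using assms(4) by eventually_elim (use S(2) fS p in auto)
    hence "p = 0" by (rule poly_zero_cofinite)
    moreover have "F = (\<lambda>m. poly (y m) 0)" using assms(3) by blast
    ultimately show ?thesis using p[of 0] by simp
  qed
  thus ?thesis using S(2) assms(2) by blast
qed

lemma pr_cong: "(\<And>i. i < r \<Longrightarrow> F i = G i) \<Longrightarrow> pr r F = pr r G"
  by (induction r) auto

lemma fprod_pr:
  fixes Fs :: "(mon \<Rightarrow> 'k::alg_closed_field) list"
  assumes "\<And>i. i < length Fs \<Longrightarrow> is_form (n i) (Fs ! i)"
  shows "fprod Fs = pr (length Fs) (\<lambda>i. Fs ! i)"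
proof (rule ev_inj[of "\<Sum>i<length Fs. n i"])
  have "is_form (\<Sum>i<length Fs. n i) (fprod Fs) \<and> (\<forall>p. ev (\<Sum>i<length Fs. n i) (fprod Fs) p = (\<Prod>i<length Fs. ev (n i) (Fs ! i) p))"
    using assms
  proof (induction Fs arbitrary: n)
    case Nil
    show ?case by (simp add: fprod_def is_form_fone ev_fone)
  next
    case (Cons F Fs)
    have IH: "is_form (\<Sum>i<length Fs. n (Suc i)) (fprod Fs)"
      "\<And>p. ev (\<Sum>i<length Fs. n (Suc i)) (fprod Fs) p = (\<Prod>i<length Fs. ev (n (Suc i)) (Fs ! i) p)"
      using Cons.IH[of "\<lambda>i. n (Suc i)"] Cons.prems[of "Suc i" for i] by auto
    have F: "is_form (n 0) F" using Cons.prems[of 0] by simp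
    have e: "fprod (F # Fs) = fmul F (fprod Fs)" by (simp add: fprod_def)
    have d: "(\<Sum>i<length (F # Fs). n i) = n 0 + (\<Sum>i<length Fs. n (Suc i))"
      by (simp add: sum.lessThan_Suc_shift del: sum.lessThan_Suc)
    have pd: "(\<Prod>i<length (F # Fs). ev (n i) ((F # Fs) ! i) p) = ev (n 0) F p * (\<Prod>i<length Fs. ev (n (Suc i)) (Fs ! i) p)" for p
      by (simp add: prod.lessThan_Suc_shift del: prod.lessThan_Suc)
    show ?case unfolding e d pd using is_form_fmul[OF F IH(1)] ev_fmul[OF F IH(1)] IH(2) by simp
  qed
  thus "is_form (\<Sum>i<length Fs. n i) (fprod Fs)"
    "ev (\<Sum>i<length Fs. n i) (fprod Fs) p = ev (\<Sum>i<length Fs. n i) (pr (length Fs) ((!) Fs)) p" for p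
    using assms by (simp, simp only: ev_pr)
  show "is_form (\<Sum>i<length Fs. n i) (pr (length Fs) ((!) Fs))" using assms by (rule pr_form)
qed

text \<open>One definition for both varieties: \<open>{True}\<close> gives products,
  \<open>UNIV\<close> gives sums of two products. The scalars of a secant line are absorbed into the
  factors.\<close>

definition sumpr :: "bool set \<Rightarrow> nat \<Rightarrow> (bool \<Rightarrow> nat \<Rightarrow> mon \<Rightarrow> 'k::field) \<Rightarrow> mon \<Rightarrow> 'k" where
  "sumpr S r F m = (\<Sum>s\<in>S. pr r (F s) m)"

lemma sumpr_form:
  assumes "\<And>s i. i < r \<Longrightarrow> is_form (n i) (F s i)"
  shows "is_form (\<Sum>i<r. n i) (sumpr S r F)"
  unfolding sumpr_def[abs_def] using assms by (intro is_form_sum pr_form)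

subsection \<open>Lower bounds\<close>

definition boxable :: "'v set \<Rightarrow> (('v \<Rightarrow> 'k::field) \<Rightarrow> 'k) \<Rightarrow> bool" where
  "boxable I f \<longleftrightarrow> (\<exists>b. f \<in> box I b)"

lemma boxable_const: "boxable I (\<lambda>u. a)"
  unfolding boxable_def using box_const by blast

lemma boxable_var: "finite I \<Longrightarrow> i \<in> I \<Longrightarrow> boxable I (\<lambda>u. u i)"
  unfolding boxable_def using box_var[of I i 1] by blast

lemma boxable_add: "boxable I f \<Longrightarrow> boxable I g \<Longrightarrow> boxable I (\<lambda>u. f u + g u)"
  unfolding boxable_def
proof (elim exE)
  fix b b' assume "f \<in> box I b" "g \<in> box I b'"
  hence "(\<lambda>u. f u + g u) \<in> box I (max b b')" by (intro box_add) (auto elim: box_mono)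
  thus "\<exists>b. (\<lambda>u. f u + g u) \<in> box I b" by blast
qed

lemma boxable_mult: "boxable I f \<Longrightarrow> boxable I g \<Longrightarrow> boxable I (\<lambda>u. f u * g u)"
  unfolding boxable_def using box_mult by blast

lemma boxable_sum: "(\<And>j. j \<in> J \<Longrightarrow> boxable I (f j)) \<Longrightarrow> boxable I (\<lambda>u. \<Sum>j\<in>J. f j u)"
  by (induction J rule: infinite_finite_induct) (auto intro: boxable_const boxable_add)

lemma polymap_boxable: "polymap I \<phi> \<longleftrightarrow> (\<forall>m. boxable I (\<lambda>u. \<phi> u m))"
  by (simp add: polymap_def boxable_def)

lemma polymap_fmul:
  assumes "polymap I F" "polymap I G"
  shows "polymap I (\<lambda>u. fmul (F u) (G u))"
  unfolding polymap_boxable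
proof
  fix m :: mon
  obtain a b c where m: "m = (a, b, c)" by (cases m) auto
  show "boxable I (\<lambda>u. fmul (F u) (G u) m)" unfolding m fmul_apply
  proof (rule boxable_sum)
    fix x :: mon
    obtain i j l where x: "x = (i, j, l)" by (cases x) auto
    show "boxable I (\<lambda>u. case x of (i, j, l) \<Rightarrow> F u (i, j, l) * G u (a - i, b - j, c - l))"
      unfolding x prod.case using assms unfolding polymap_boxable by (intro boxable_mult) auto
  qed
qed

lemma polymap_pr: "(\<And>i. i < r \<Longrightarrow> polymap I (\<lambda>u. F u i)) \<Longrightarrow> polymap I (\<lambda>u. pr r (F u))"
proof (induction r)
  case 0
  show ?case by (simp add: polymap_boxable boxable_const)
next
  case (Suc r)
  thus ?case by (simp add: polymap_fmul)
qed

lemma polymap_sumpr: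
  assumes "\<And>s i. i < r \<Longrightarrow> polymap I (\<lambda>u. F u s i)"
  shows "polymap I (\<lambda>u. sumpr S r (F u))"
proof -
  have "polymap I (\<lambda>u. pr r (F u s))" for s by (rule polymap_pr) (rule assms)
  thus ?thesis unfolding polymap_boxable sumpr_def by (intro allI boxable_sum) auto
qed

lemma dpr_lincomb:
  fixes F :: "nat \<Rightarrow> mon \<Rightarrow> 'k::alg_closed_field"
  assumes "\<And>i. i < r \<Longrightarrow> is_form (n i) (F i)" "\<And>k i. k \<in> I \<Longrightarrow> i < r \<Longrightarrow> is_form (n i) (A k i)"
  shows "dpr r F (\<lambda>i m. \<Sum>k\<in>I. b k * A k i m) = (\<lambda>m. \<Sum>k\<in>I. b k * dpr r F (A k) m)"
proof (rule ev_inj[of "\<Sum>i<r. n i"])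
  have f: "is_form (n i) (\<lambda>m. \<Sum>k\<in>I. b k * A k i m)" if "i < r" for i
    using assms(2) that by (intro is_form_sum is_form_scale) auto
  show "is_form (\<Sum>i<r. n i) (dpr r F (\<lambda>i m. \<Sum>k\<in>I. b k * A k i m))" by (rule dpr_form[OF assms(1) f])
  show "is_form (\<Sum>i<r. n i) (\<lambda>m. \<Sum>k\<in>I. b k * dpr r F (A k) m)"
    using assms by (intro is_form_sum is_form_scale dpr_form) auto
  fix p
  have "ev (\<Sum>i<r. n i) (dpr r F (\<lambda>i m. \<Sum>k\<in>I. b k * A k i m)) p =
     (\<Sum>i<r. \<Sum>k\<in>I. b k * (ev (n i) (A k i) p * (\<Prod>j\<in>{..<r} - {i}. ev (n j) (F j) p)))"
    by (subst ev_dpr[OF assms(1) f]) (simp_all add: ev_sum ev_scale sum_distrib_right mult.assoc)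
  also have "\<dots> = (\<Sum>k\<in>I. b k * ev (\<Sum>i<r. n i) (dpr r F (A k)) p)"
    by (subst sum.swap, intro sum.cong refl) (simp add: ev_dpr[OF assms(1) assms(2)] sum_distrib_left)
  finally show "ev (\<Sum>i<r. n i) (dpr r F (\<lambda>i m. \<Sum>k\<in>I. b k * A k i m)) p = ev (\<Sum>i<r. n i) (\<lambda>m. \<Sum>k\<in>I. b k * dpr r F (A k) m) p"
    by (simp add: ev_sum ev_scale)
qed

lemma rank_ge_coeffs:
  assumes "rank_ge TYPE('k::field) S r n N"
  shows "\<exists>u a. (\<forall>k<N. tcoef r n (a k)) \<and> indep {..<N} (\<lambda>k. tval S r n u (a k)) (UNIV :: 'k pt set)"
proof -
  obtain u b where b: "\<And>k. k < N \<Longrightarrow> b k \<in> tsp S r n u" "indep {..<N} b (UNIV :: 'k pt set)"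
    using assms unfolding rank_ge_def by blast
  have "\<forall>k. \<exists>a. k < N \<longrightarrow> tcoef r n a \<and> b k = tval S r n u a" using b(1) unfolding tsp_def by blast
  from choice[OF this] obtain a where a: "\<And>k. k < N \<Longrightarrow> tcoef r n (a k) \<and> b k = tval S r n u (a k)" by blast
  have "indep {..<N} (\<lambda>k. tval S r n u (a k)) UNIV"
    using b(2) a by (subst indep_cong[of _ _ _ b]) auto
  thus ?thesis using a by (intro exI[of _ u] exI[of _ a]) simp
qed

text \<open>The point lies in its own tangent space, with a block as its own coefficient. Once it is
  nonzero it can be exchanged for a basis vector and moved to position 0, where
  \<open>pdim_ge\<close> expects the base point.\<close>

lemma rank_generic_point:
  fixes n :: "nat \<Rightarrow> nat"
  assumes "rank_ge TYPE('k::alg_closed_field) S r n N" "True \<in> S" "1 \<le> (\<Sum>i<r. n i)" "1 \<le> N"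
  shows "\<exists>u a. (\<forall>k<N. tcoef r n (a k)) \<and> indep {..<N} (\<lambda>k. tval S r n u (a k)) (UNIV :: 'k pt set) \<and>
     tval S r n u (a 0) = (\<lambda>p. \<Sum>s\<in>S. \<Prod>i<r. blk (u s) n i p)"
proof -
  have r: "0 < r" using assms(3) by (cases r) auto
  obtain u0 a where a: "\<forall>k<N. tcoef r n (a k)" "indep {..<N} (\<lambda>k. tval S r n u0 (a k)) (UNIV :: 'k pt set)"
    using rank_ge_coeffs[OF assms(1)] by (elim exE conjE) (rule that)
  define g where "g u p = (\<Sum>s\<in>S. \<Prod>i<r. blk (u s) n i p)" for u :: "'k config" and p
  define C where "C u \<longleftrightarrow> indep {..<N} (\<lambda>k. tval S r n u (a k)) (UNIV :: 'k pt set)" for u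
  have oC: "zopen C" unfolding C_def by (rule zopen_indep, simp, rule polyc_tval)
  have oD: "zopen (\<lambda>u. g u e1 \<noteq> 0)" unfolding g_def blk_def
    by (intro zopen_nonzero polyc_sum polyc_prod polyc_lin polyv_line polyv_const)
  \<comment> \<open>At the point \<open>e1\<close> the lines \<open>e1\<close> have value 1 and the
    lines \<open>e2\<close> have value 0, so only the first product contributes.\<close>
  define u1 :: "'k config" where "u1 s i j = (if s then e1 else e2)" for s i j
  have "g u1 e1 = (\<Sum>s\<in>S. if s then 1 else 0)" unfolding g_def
  proof (rule sum.cong)
    fix s
    show "(\<Prod>i<r. blk (u1 s) n i e1) = (if s then 1 else 0)"
    proof (cases s)
      case False
      have "\<exists>i<r. n i \<noteq> 0" using assms(3) sum.neutral[of "{..<r}" n] by (cases "\<exists>i<r. n i \<noteq> 0") auto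
      then obtain i where "i < r" "n i \<noteq> 0" by blast
      hence "blk (u1 s) n i e1 = 0" using False by (simp add: blk_def u1_def)
      thus ?thesis using False \<open>i < r\<close> by (auto intro: prod_zero)
    qed (simp add: blk_def u1_def)
  qed simp
  also have "\<dots> = 1"
  proof -
    have "S = {True} \<or> S = {True, False}" using assms(2) unfolding set_eq_iff all_bool_eq by auto
    thus ?thesis by auto
  qed
  finally have w: "g u1 e1 \<noteq> 0" by simp
  obtain u where u: "C u" "g u e1 \<noteq> 0" using zopen_meet[OF oC oD _ w, of u0] a(2) unfolding C_def by blast
  define a0 :: "bool \<Rightarrow> nat \<Rightarrow> 'k pt \<Rightarrow> 'k" where "a0 s i p = (if i = 0 then blk (u s) n 0 p else 0)" for s i p
  have ta0: "tcoef r n a0" unfolding tcoef_def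
  proof (intro allI impI)
    fix s i show "a0 s i \<in> forms (n i)"
      using blk_forms[of "u s" n 0] by (cases "i = 0") (auto simp: a0_def[abs_def])
  qed
  have ga0: "tval S r n u a0 = g u"
  proof
    fix p
    have "(\<Sum>i<r. a0 s i p * cof r n (u s) i p) = (\<Prod>i<r. blk (u s) n i p)" for s
    proof -
      have "(\<Sum>i<r. a0 s i p * cof r n (u s) i p) = (\<Sum>i\<in>{0}. a0 s i p * cof r n (u s) i p)"
        using r by (intro sum.mono_neutral_right) (auto simp: a0_def)
      also have "\<dots> = (\<Prod>i<r. blk (u s) n i p)"
        using r prod.remove[of "{..<r}" 0 "\<lambda>i. blk (u s) n i p"] by (simp add: a0_def cof_def)
      finally show ?thesis .
    qed
    thus "tval S r n u a0 p = g u p" by (simp add: tval_def g_def)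
  qed
  obtain k0 where k0: "k0 < N" "indep {..<N} ((\<lambda>k. tval S r n u (a k))(k0 := g u)) UNIV"
    using indep_exchange[of "{..<N}" "\<lambda>k. tval S r n u (a k)" UNIV e1 "g u"] u assms(4) unfolding C_def
    by (auto simp: lessThan_empty_iff)
  define \<sigma> where "\<sigma> k = (if k = 0 then k0 else if k = k0 then 0 else k)" for k
  have inj: "inj_on \<sigma> {..<N}" by (rule inj_onI) (auto simp: \<sigma>_def split: if_splits)
  have im: "\<sigma> ` {..<N} = {..<N}"
  proof (rule endo_inj_surj[OF _ _ inj])
    show "\<sigma> ` {..<N} \<subseteq> {..<N}" using k0(1) by (auto simp: \<sigma>_def)
  qed simp
  define a' where "a' k = (a(k0 := a0)) (\<sigma> k)" for k
  have eq: "((\<lambda>k. tval S r n u (a k))(k0 := g u)) (\<sigma> k) = tval S r n u (a' k)" for k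
    by (simp add: a'_def ga0)
  have "indep (\<sigma> ` {..<N}) ((\<lambda>k. tval S r n u (a k))(k0 := g u)) UNIV" using k0(2) im by simp
  hence "indep {..<N} (\<lambda>k. tval S r n u (a' k)) UNIV" unfolding indep_reindex[OF inj] eq .
  moreover have "tcoef r n (a' k)" if "k < N" for k
    using a(1) ta0 that im by (auto simp: a'_def)
  moreover have "tval S r n u (a' 0) = g u" by (simp add: a'_def \<sigma>_def ga0)
  ultimately show ?thesis unfolding g_def[abs_def] by (intro exI[of _ u] exI[of _ a']) simp
qed

text \<open>All factors move linearly in the parameters, starting from products of lines. The
  first-order parts of this family are the independent tangent vectors counted by
  \<open>rank_ge\<close>.\<close>

lemma pdim_lower:
  fixes A :: "(mon \<Rightarrow> 'k::alg_closed_field) set" and n :: "nat \<Rightarrow> nat"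
  assumes rk: "rank_ge TYPE('k) S r n N" and S: "True \<in> S" and d: "d = (\<Sum>i<r. n i)" "1 \<le> d" and N: "1 \<le> N"
    and A: "A \<subseteq> pforms_set d"
      "\<And>F. (\<And>s i. i < r \<Longrightarrow> is_form (n i) (F s i)) \<Longrightarrow> sumpr S r F \<noteq> (\<lambda>_. 0) \<Longrightarrow> sumpr S r F \<in> A"
  shows "enat (N - 1) \<le> pdim d A"
proof -
  have "1 \<le> (\<Sum>i<r. n i)" using d by simp
  from rank_generic_point[OF rk S this N] obtain u a where a: "\<And>k. k < N \<Longrightarrow> tcoef r n (a k)"
    "indep {..<N} (\<lambda>k. tval S r n u (a k)) (UNIV :: 'k pt set)"
    "tval S r n u (a 0) = (\<lambda>p. \<Sum>s\<in>S. \<Prod>i<r. blk (u s) n i p)" by blast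
  define base where "base s i = (SOME G. is_form (n i) G \<and> ev (n i) G = blk (u s) n i)" for s i
  have base: "is_form (n i) (base s i)" "ev (n i) (base s i) = blk (u s) n i" for s i
    using someI_ex[OF ev_surj[OF blk_forms[of "u s" n i]]] unfolding base_def by auto
  define dir where "dir k s i = (SOME G. is_form (n i) G \<and> ev (n i) G = a k s i)" for k s i
  have dir: "is_form (n i) (dir k s i)" "ev (n i) (dir k s i) = a k s i" if "k < N" "i < r" for k s i
  proof -
    have "a k s i \<in> forms (n i)" using a(1)[OF that(1)] that(2) by (simp add: tcoef_def)
    from someI_ex[OF ev_surj[OF this]] show "is_form (n i) (dir k s i)" "ev (n i) (dir k s i) = a k s i"
      unfolding dir_def by auto
  qed
  define w where "w k m = (\<Sum>s\<in>S. if k = 0 then pr r (base s) m else dpr r (base s) (dir k s) m)" for k m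
  have evw: "ev d (w k) p = tval S r n u (a k) p" if k: "k < N" for k p
  proof (cases "k = 0")
    case True
    have "ev d (w 0) p = (\<Sum>s\<in>S. ev d (pr r (base s)) p)" unfolding w_def by (simp add: ev_sum)
    also have "\<dots> = (\<Sum>s\<in>S. \<Prod>i<r. blk (u s) n i p)"
      unfolding d(1) by (intro sum.cong refl) (simp add: ev_pr[OF base(1)] base(2))
    finally show ?thesis using a(3) True by simp
  next
    case False
    have "ev d (w k) p = (\<Sum>s\<in>S. ev d (dpr r (base s) (dir k s)) p)" unfolding w_def using False by (simp add: ev_sum)
    also have "\<dots> = tval S r n u (a k) p" unfolding d(1) tval_def cof_def
      by (intro sum.cong refl) (simp add: ev_dpr[OF base(1) dir(1)[OF k]] base(2) dir(2)[OF k])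
    finally show ?thesis .
  qed
  have NN: "{..N - 1} = {..<N}" using N by auto
  have w: "indep {..N - 1} w (mons d)" unfolding NN
  proof (rule indepI)
    fix c i assume z: "\<And>m. m \<in> mons d \<Longrightarrow> (\<Sum>k<N. c k * w k m) = 0" and i: "i \<in> {..<N}"
    show "c i = 0"
    proof (rule indepD[OF a(2) _ i])
      fix p
      have "(\<Sum>k<N. c k * tval S r n u (a k) p) = ev d (\<lambda>m. \<Sum>k<N. c k * w k m) p"
        by (simp add: ev_sum ev_scale evw)
      also have "\<dots> = 0" unfolding ev_def using z by simp
      finally show "(\<Sum>k<N. c k * tval S r n u (a k) p) = 0" .
    qed
  qed
  define fam where "fam c s i m = base s i m + (\<Sum>k=1..N - 1. c k * dir k s i m)" for c s i m
  define \<Psi> where "\<Psi> c = sumpr S r (fam c)" for c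
  have fam_form: "is_form (n i) (fam c s i)" if "i < r" for c s i
    unfolding fam_def[abs_def] using that N by (intro is_form_add base is_form_sum is_form_scale dir) auto
  show ?thesis
  proof (rule pdim_ge[OF w, of \<Psi>])
    show "is_form d (\<Psi> c)" for c unfolding \<Psi>_def d(1) by (rule sumpr_form) (rule fam_form)
    show "polymap {1..N - 1} \<Psi>" unfolding \<Psi>_def[abs_def]
      by (rule polymap_sumpr)
        (auto simp: polymap_boxable fam_def intro!: boxable_add boxable_const boxable_sum boxable_mult boxable_var)
    show "A \<subseteq> pforms_set d" by fact
    show "\<Psi> c \<in> A" if "\<Psi> c \<noteq> (\<lambda>_. 0)" for c
      using that unfolding \<Psi>_def by (intro A(2) fam_form) auto
    fix b :: "nat \<Rightarrow> 'k"
    define B where "B s i m = (\<Sum>k=1..N - 1. b k * dir k s i m)" for s i m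
    have "\<exists>Y. \<forall>m. (\<forall>\<tau>. pr r (fam (\<lambda>i. \<tau> * b i) s) m = poly (Y m) \<tau>) \<and> coeff (Y m) 0 = pr r (base s) m \<and>
        coeff (Y m) 1 = dpr r (base s) (B s) m" for s
      by (rule pr_curve[where y = "\<lambda>i m. [:base s i m, B s i m:]"])
        (simp_all add: fam_def B_def sum_distrib_left mult_ac)
    hence "\<forall>s. \<exists>Y. \<forall>m. (\<forall>\<tau>. pr r (fam (\<lambda>i. \<tau> * b i) s) m = poly (Y m) \<tau>) \<and> coeff (Y m) 0 = pr r (base s) m \<and>
        coeff (Y m) 1 = dpr r (base s) (B s) m" by blast
    from choice[OF this] obtain Y where Y: "\<And>s m \<tau>. pr r (fam (\<lambda>i. \<tau> * b i) s) m = poly (Y s m) \<tau>"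
      "\<And>s m. coeff (Y s m) 0 = pr r (base s) m" "\<And>s m. coeff (Y s m) 1 = dpr r (base s) (B s) m" by blast
    have dB: "dpr r (base s) (B s) m = (\<Sum>k=1..N - 1. b k * dpr r (base s) (dir k s) m)" for s m
    proof -
      have "dpr r (base s) (\<lambda>i m. \<Sum>k\<in>{1..N - 1}. b k * dir k s i m) = (\<lambda>m. \<Sum>k\<in>{1..N - 1}. b k * dpr r (base s) (dir k s) m)"
        by (rule dpr_lincomb[where n = n]) (use base dir N in auto)
      thus ?thesis unfolding B_def[abs_def] by (metis (no_types))
    qed
    have "coeff (\<Sum>s\<in>S. Y s m) 1 = (\<Sum>i=1..N - 1. b i * w i m)" for m
    proof -
      have "coeff (\<Sum>s\<in>S. Y s m) 1 = (\<Sum>s\<in>S. \<Sum>k=1..N - 1. b k * dpr r (base s) (dir k s) m)"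
        by (simp only: coeff_sum Y(3) dB)
      also have "\<dots> = (\<Sum>k=1..N - 1. b k * w k m)"
        by (subst sum.swap, intro sum.cong refl) (simp add: w_def sum_distrib_left)
      finally show ?thesis .
    qed
    thus "\<exists>y. \<forall>m. (\<forall>\<tau>. \<Psi> (\<lambda>i. \<tau> * b i) m = poly (y m) \<tau>) \<and> coeff (y m) 0 = w 0 m \<and>
        coeff (y m) 1 = (\<Sum>i=1..N - 1. b i * w i m)"
      by (intro exI[of _ "\<lambda>m. \<Sum>s\<in>S. Y s m"] allI conjI)
        (simp_all add: \<Psi>_def sumpr_def Y(1,2) poly_sum coeff_sum w_def)
  qed
qed

subsection \<open>Upper bounds\<close>

lemma fmul_scale: "fmul (\<lambda>m. a * F m) (\<lambda>m. b * G m) = (\<lambda>m. a * b * fmul F G m)"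
proof
  fix m :: mon
  obtain x y z where m: "m = (x, y, z)" by (cases m) auto
  show "fmul (\<lambda>m. a * F m) (\<lambda>m. b * G m) m = a * b * fmul F G m"
    unfolding m fmul_apply sum_distrib_left by (intro sum.cong) (auto simp: mult_ac)
qed

lemma pr_scale: "pr r (\<lambda>i m. c i * F i m) = (\<lambda>m. (\<Prod>i<r. c i) * pr r F m)"
  by (induction r) (simp_all add: fmul_scale)

lemma fmul_nonzero:
  fixes F G :: "mon \<Rightarrow> 'k::alg_closed_field"
  assumes "is_form a F" "is_form b G" "F \<noteq> (\<lambda>_. 0)" "G \<noteq> (\<lambda>_. 0)"
  shows "fmul F G \<noteq> (\<lambda>_. 0)"
proof
  assume z: "fmul F G = (\<lambda>_. 0)"
  have nz: "\<exists>p. ev e H p \<noteq> 0" if H: "is_form e H" "H \<noteq> (\<lambda>_. 0)" for e and H :: "mon \<Rightarrow> 'k"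
  proof (rule ccontr)
    assume "\<not> ?thesis"
    hence "H m = 0" for m using ev_zero[of e H m] is_form_outside[OF H(1), of m] by blast
    thus False using H(2) by blast
  qed
  obtain p q where "ev a F p \<noteq> 0" "ev b G q \<noteq> 0" using nz assms by meson
  then obtain x where "ev a F x \<noteq> 0" "ev b G x \<noteq> 0"
    using forms_nonzero_both[OF ev_forms ev_forms, of a F p b G q] by blast
  moreover have "ev (a + b) (fmul F G) x = 0" unfolding z by (simp add: ev_def)
  ultimately show False using ev_fmul[OF assms(1,2), of x] by simp
qed

lemma pr_nonzero_iff:
  fixes F :: "nat \<Rightarrow> mon \<Rightarrow> 'k::alg_closed_field"
  assumes "\<And>i. i < r \<Longrightarrow> is_form (n i) (F i)"
  shows "pr r F \<noteq> (\<lambda>_. 0) \<longleftrightarrow> (\<forall>i<r. F i \<noteq> (\<lambda>_. 0))"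
proof
  assume nz: "pr r F \<noteq> (\<lambda>_. 0)"
  show "\<forall>i<r. F i \<noteq> (\<lambda>_. 0)"
  proof (intro allI impI notI)
    fix i assume i: "i < r" "F i = (\<lambda>_. 0)"
    have "pr r F = pr r (\<lambda>j m. (if j = i then 0 else 1) * F j m)"
      using i by (intro pr_cong) auto
    also have "\<dots> = (\<lambda>_. 0)" unfolding pr_scale using i(1) by (auto simp: fun_eq_iff)
    finally show False using nz by simp
  qed
next
  show "\<forall>i<r. F i \<noteq> (\<lambda>_. 0) \<Longrightarrow> pr r F \<noteq> (\<lambda>_. 0)"
    using assms
  proof (induction r)
    case 0
    have "(fone :: mon \<Rightarrow> 'k) (0, 0, 0) \<noteq> 0" by (simp add: fone_def)
    thus ?case by (metis pr.simps(1))
  next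
    case (Suc r)
    have f: "is_form (\<Sum>i<r. n i) (pr r F)" using Suc.prems(2) by (intro pr_form) auto
    have n: "pr r F \<noteq> (\<lambda>_. 0)" using Suc by simp
    show ?case using fmul_nonzero[OF f Suc.prems(2)[of r] n] Suc.prems(1) by simp
  qed
qed

lemma pr_Suc_shift:
  fixes F :: "nat \<Rightarrow> mon \<Rightarrow> 'k::alg_closed_field"
  assumes "\<And>i. i < Suc r \<Longrightarrow> is_form (n i) (F i)"
  shows "pr (Suc r) F = fmul (F 0) (pr r (\<lambda>i. F (Suc i)))"
proof (rule ev_inj[of "\<Sum>i<Suc r. n i"])
  have d: "(\<Sum>i<Suc r. n i) = n 0 + (\<Sum>i<r. n (Suc i))" by (rule sum.lessThan_Suc_shift)
  have f: "is_form (n 0) (F 0)" "is_form (\<Sum>i<r. n (Suc i)) (pr r (\<lambda>i. F (Suc i)))"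
    using assms by (auto intro: pr_form)
  show "is_form (\<Sum>i<Suc r. n i) (pr (Suc r) F)" by (rule pr_form) (rule assms)
  show "is_form (\<Sum>i<Suc r. n i) (fmul (F 0) (pr r (\<lambda>i. F (Suc i))))"
    unfolding d by (rule is_form_fmul[OF f])
  fix p
  have "ev (\<Sum>i<Suc r. n i) (pr (Suc r) F) p = (\<Prod>i<Suc r. ev (n i) (F i) p)"
    by (rule ev_pr) (rule assms)
  also have "\<dots> = ev (n 0) (F 0) p * ev (\<Sum>i<r. n (Suc i)) (pr r (\<lambda>i. F (Suc i))) p"
    unfolding prod.lessThan_Suc_shift using assms by (subst ev_pr) auto
  finally show "ev (\<Sum>i<Suc r. n i) (pr (Suc r) F) p = ev (\<Sum>i<Suc r. n i) (fmul (F 0) (pr r (\<lambda>i. F (Suc i)))) p"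
    unfolding d ev_fmul[OF f] .
qed

lemma sumpr_cong: "(\<And>s i. s \<in> S \<Longrightarrow> i < r \<Longrightarrow> F s i = G s i) \<Longrightarrow> sumpr S r F = sumpr S r G"
  unfolding sumpr_def[abs_def] by (intro ext sum.cong refl) (metis pr_cong)

text \<open>Normalised factors: the coefficients at monomials in \<open>M\<close> are free, and
  every factor after the zeroth is monic in the first variable once its top monomial is left out of
  \<open>M\<close>. This removes the freedom of moving scalars between factors.\<close>

definition nform :: "(nat \<Rightarrow> nat) \<Rightarrow> (bool \<Rightarrow> nat \<Rightarrow> mon set) \<Rightarrow> (bool \<times> nat \<times> mon \<Rightarrow> 'k::field)
    \<Rightarrow> bool \<Rightarrow> nat \<Rightarrow> mon \<Rightarrow> 'k" where
  "nform n M u s i m = (if m \<in> M s i then u (s, i, m) else if i \<noteq> 0 \<and> m = (n i, 0, 0) then 1 else 0)"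

lemma nform_form: "M s i \<subseteq> mons (n i) \<Longrightarrow> is_form (n i) (nform n M u s i)"
  unfolding is_form_def nform_def mons_def by (auto simp: mdeg_def)

lemma nform_pforms:
  assumes "\<And>s i. i < r \<Longrightarrow> M s i \<subseteq> mons (n i)"
  shows "{sumpr S r (nform n M u) | u. sumpr S r (nform n M u) \<noteq> (\<lambda>_. 0)} \<subseteq> pforms_set (\<Sum>i<r. n i)"
proof -
  have "is_form (\<Sum>i<r. n i) (sumpr S r (nform n M u))" for u
    by (rule sumpr_form, rule nform_form, rule assms)
  thus ?thesis unfolding pforms_set_def by auto
qed

lemma pdim_nform:
  fixes X :: "(mon \<Rightarrow> 'k::alg_closed_field) set"
  assumes r: "0 < r" and d: "d = (\<Sum>i<r. n i)" and M: "\<And>s i. i < r \<Longrightarrow> M s i \<subseteq> mons (n i)"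
    and X: "X \<subseteq> zclosure d {sumpr S r (nform n M u) | u. sumpr S r (nform n M u) \<noteq> (\<lambda>_. 0)}"
  shows "pdim d X \<le> enat ((\<Sum>s\<in>S. \<Sum>i<r. card (M s i)) - 1)"
proof -
  define I where "I = (SIGMA s:S. SIGMA i:{..<r}. M s i)"
  define A where "A = {sumpr S r (nform n M u :: _ \<Rightarrow> _ \<Rightarrow> _ \<Rightarrow> 'k) | u. sumpr S r (nform n M u) \<noteq> (\<lambda>_. 0)}"
  have finS: "finite S" by (rule finite_subset[OF subset_UNIV]) simp
  have finM: "finite (M s i)" if "i < r" for s i using finite_subset[OF M[OF that]] by simp
  have finI: "finite I" unfolding I_def using finS finM by (intro finite_SigmaI) auto
  have card: "card I = (\<Sum>s\<in>S. \<Sum>i<r. card (M s i))"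
    unfolding I_def using finS finM by (subst card_SigmaI) (auto intro!: finite_SigmaI sum.cong)
  have AP: "A \<subseteq> pforms_set d"
    unfolding A_def d by (rule nform_pforms) (rule M)
  have "polymap I (\<lambda>u. sumpr S r (nform n M u) :: mon \<Rightarrow> 'k)"
  proof -
    \<comment> \<open>The index set \<open>I\<close> has variables for members of \<open>S\<close>
      only. Outside \<open>S\<close> the factors are replaced by zero, which does not affect
      \<open>sumpr S\<close>.\<close>
    have "polymap I (\<lambda>u. \<lambda>m. if s \<in> S then nform n M u s i m else (0::'k))" if i: "i < r" for s i
      unfolding polymap_boxable
    proof
      fix m
      show "boxable I (\<lambda>u. if s \<in> S then nform n M u s i m else (0::'k))"
      proof (cases "s \<in> S \<and> m \<in> M s i")
        case True
        thus ?thesis using i finI by (auto simp: nform_def I_def intro: boxable_var)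
      next
        case False
        thus ?thesis by (cases "s \<in> S") (auto simp: nform_def intro: boxable_const)
      qed
    qed
    hence "polymap I (\<lambda>u. sumpr S r (\<lambda>s i m. if s \<in> S then nform n M u s i m else 0) :: mon \<Rightarrow> 'k)"
      by (rule polymap_sumpr)
    moreover have "sumpr S r (\<lambda>s i m. if s \<in> S then nform n M u s i m else 0) = sumpr S r (nform n M u)"
      for u :: "_ \<Rightarrow> 'k" by (rule sumpr_cong) auto
    ultimately show ?thesis by simp
  qed
  moreover have "(\<lambda>m. c * F m) \<in> A" if F: "F \<in> A" "c \<noteq> 0" for F c
  proof -
    obtain u where u: "F = sumpr S r (nform n M u)" "F \<noteq> (\<lambda>_. 0)" using F(1) unfolding A_def by auto
    \<comment> \<open>Only the zeroth factor can be rescaled, since the normalisation of the others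
      must be kept.\<close>
    define u' where "u' = (\<lambda>(s, i, m). (if i = 0 then c else 1) * u (s, i, m))"
    have e: "nform n M u' s i = (\<lambda>m. (if i = 0 then c else 1) * nform n M u s i m)" for s i
      by (auto simp: nform_def u'_def)
    have pc: "(\<Prod>i<r. if i = 0 then c else 1) = c" using r by (simp add: prod.delta)
    have "sumpr S r (nform n M u') = (\<lambda>m. c * F m)"
      unfolding u(1) sumpr_def[abs_def] e[abs_def] pr_scale pc sum_distrib_left ..
    moreover have "(\<lambda>m. c * F m) \<noteq> (\<lambda>_. 0)" using u(2) F(2) by (auto simp: fun_eq_iff)
    ultimately show ?thesis unfolding A_def by (metis (mono_tags, lifting) mem_Collect_eq)
  qed
  moreover have "zclosure d X \<subseteq> zclosure d A"
    using X zclosure_minimal[OF zclosed_zclosure[OF AP]] unfolding A_def by blast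
  ultimately show ?thesis
    using pdim_le[OF finI _ AP, of "\<lambda>u. sumpr S r (nform n M u)" X] A_def card by simp
qed

text \<open>Adding \<open>\<tau>\<close> times the top power of the first variable makes the leading
  coefficients nonzero for almost all \<open>\<tau>\<close>. The factors can then be made monic,
  with the scalars collected in the zeroth factor, and \<open>\<tau> = 0\<close> is reached as a
  limit.\<close>

lemma monic_dense:
  fixes F :: "bool \<Rightarrow> nat \<Rightarrow> mon \<Rightarrow> 'k::alg_closed_field"
  assumes r: "0 < r" and d: "d = (\<Sum>i<r. n i)" and A: "A \<subseteq> pforms_set d"
    and monic: "\<And>G. (\<And>s i. i < r \<Longrightarrow> is_form (n i) (G s i)) \<Longrightarrow>
      (\<And>s i. s \<in> S \<Longrightarrow> 1 \<le> i \<Longrightarrow> i < r \<Longrightarrow> G s i (n i, 0, 0) = 1) \<Longrightarrow> sumpr S r G \<noteq> (\<lambda>_. 0) \<Longrightarrow> sumpr S r G \<in> A"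
    and F: "\<And>s i. i < r \<Longrightarrow> is_form (n i) (F s i)" "sumpr S r F \<noteq> (\<lambda>_. 0)"
  shows "sumpr S r F \<in> zclosure d A"
proof -
  define P where "P \<tau> s i m = F s i m + (if 1 \<le> i \<and> m = (n i, 0, 0) then \<tau> else 0)" for \<tau> s i m
  have finS: "finite S" by (rule finite_subset[OF subset_UNIV]) simp
  have P_form: "is_form (n i) (P \<tau> s i)" if "i < r" for \<tau> s i
    using F(1)[OF that, of s] unfolding is_form_def P_def by (auto simp: mdeg_def)
  have "\<exists>Y. \<forall>m. (\<forall>\<tau>. pr r (P \<tau> s) m = poly (Y m) \<tau>) \<and> coeff (Y m) 0 = pr r (F s) m \<and>
      coeff (Y m) 1 = dpr r (F s) (\<lambda>i m. if 1 \<le> i \<and> m = (n i, 0, 0) then 1 else 0) m" for s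
    by (rule pr_curve[where y = "\<lambda>i m. [:F s i m, if 1 \<le> i \<and> m = (n i, 0, 0) then 1 else 0:]"])
      (simp_all add: P_def)
  hence "\<forall>s. \<exists>Y. \<forall>m. (\<forall>\<tau>. pr r (P \<tau> s) m = poly (Y m) \<tau>) \<and> coeff (Y m) 0 = pr r (F s) m" by meson
  from choice[OF this] obtain Y where Y: "\<And>s m \<tau>. pr r (P \<tau> s) m = poly (Y s m) \<tau>"
    "\<And>s m. coeff (Y s m) 0 = pr r (F s) m" by blast
  define y where "y m = (\<Sum>s\<in>S. Y s m)" for m
  have Py: "sumpr S r (P \<tau>) = (\<lambda>m. poly (y m) \<tau>)" for \<tau>
    by (simp add: sumpr_def[abs_def] y_def Y(1) poly_sum)
  have y0: "sumpr S r F m = poly (y m) 0" for m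
    by (simp add: sumpr_def y_def Y(2)[symmetric] poly_0_coeff_0 coeff_sum)
  obtain m0 where m0: "sumpr S r F m0 \<noteq> 0" using F(2) by blast
  have "y m0 \<noteq> 0" using m0 y0[of m0] by auto
  hence ev1: "\<forall>\<^sub>F \<tau> in cofinite. poly (y m0) \<tau> \<noteq> 0" by (rule cofinite_poly_nonzero)
  have "\<forall>\<^sub>F \<tau> in cofinite. \<tau> \<notin> (\<lambda>(s, i). - F s i (n i, 0, 0)) ` (S \<times> {..<r})"
    unfolding eventually_cofinite using finS by simp
  hence ev2: "\<forall>\<^sub>F \<tau> in cofinite. \<forall>s\<in>S. \<forall>i<r. F s i (n i, 0, 0) + \<tau> \<noteq> 0"
  proof eventually_elim
    case (elim \<tau>)
    show ?case
    proof (intro ballI allI impI notI)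
      fix s i assume si: "s \<in> S" "i < r" and z: "F s i (n i, 0, 0) + \<tau> = 0"
      have "\<tau> = - F s i (n i, 0, 0)" using z by (simp add: eq_neg_iff_add_eq_0 add.commute)
      thus False using elim si by force
    qed
  qed
  show ?thesis
  proof (rule zclosure_limit[OF A])
    show "sumpr S r F \<in> pforms_set d" using sumpr_form[of r n F S] F d unfolding pforms_set_def by blast
    show "sumpr S r F m = poly (y m) 0" for m by (rule y0)
    show "\<forall>\<^sub>F \<tau> in cofinite. (\<lambda>m. poly (y m) \<tau>) \<in> zclosure d A"
      using ev1 ev2
    proof eventually_elim
      case (elim \<tau>)
      define l where "l s i = F s i (n i, 0, 0) + \<tau>" for s i
      have l: "l s i \<noteq> 0" if "s \<in> S" "i < r" for s i using elim(2) that by (simp add: l_def)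
      define c where "c s i = (if i = 0 then \<Prod>j\<in>{1..<r}. l s j else inverse (l s i))" for s i
      have c1: "(\<Prod>i<r. c s i) = 1" if s: "s \<in> S" for s
      proof -
        have "{..<r} = insert 0 {1..<r}" using r by auto
        hence "(\<Prod>i<r. c s i) = c s 0 * (\<Prod>i\<in>{1..<r}. c s i)" by simp
        also have "\<dots> = (\<Prod>i\<in>{1..<r}. l s i) * (\<Prod>i\<in>{1..<r}. inverse (l s i))" by (simp add: c_def)
        also have "\<dots> = (\<Prod>i\<in>{1..<r}. l s i * inverse (l s i))" by (simp only: prod.distrib)
        also have "\<dots> = 1" by (rule prod.neutral) (use l s in auto)
        finally show ?thesis .
      qed
      define G where "G s i m = c s i * P \<tau> s i m" for s i m
      have GP: "sumpr S r G = (\<lambda>m. poly (y m) \<tau>)"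
        unfolding Py[symmetric] sumpr_def[abs_def] G_def[abs_def] pr_scale
        by (intro ext sum.cong refl) (simp add: c1)
      have "sumpr S r G \<in> A"
      proof (rule monic)
        show "is_form (n i) (G s i)" if "i < r" for s i
          unfolding G_def[abs_def] by (rule is_form_scale[OF P_form[OF that]])
        show "G s i (n i, 0, 0) = 1" if "s \<in> S" "1 \<le> i" "i < r" for s i
          using l[OF that(1,3)] that(2) by (simp add: G_def c_def P_def l_def[symmetric])
        show "sumpr S r G \<noteq> (\<lambda>_. 0)" unfolding GP using elim(1) by metis
      qed
      thus ?case unfolding GP using zclosure_subset by blast
    qed
  qed
qed

lemma sum_card_free:
  assumes "0 < r"
  shows "(\<Sum>i<r. card (if i = 0 then mons (n 0) else mons (n i) - {(n i, 0, 0)})) = tdim r n"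
proof -
  have I: "{..<r} = insert 0 {1..<r}" using assms by auto
  have c: "Suc (card (mons e) - Suc 0) = card (mons e)" for e
    using Suc_pred[of "card (mons e)"] by (simp add: card_mons)
  show ?thesis unfolding tdim_def I card_mons[symmetric] by (simp add: card_Diff_singleton c)
qed

lemma pdim_products_le:
  fixes X :: "(mon \<Rightarrow> 'k::alg_closed_field) set"
  assumes r: "0 < r" and d: "d = (\<Sum>i<r. n i)"
    and X: "\<And>H. H \<in> X \<Longrightarrow> \<exists>F. (\<forall>s. \<forall>i<r. is_form (n i) (F s i)) \<and> H = sumpr {True} r F \<and> H \<noteq> (\<lambda>_. 0)"
  shows "pdim d X \<le> enat (tdim r n - 1)"
proof -
  define M :: "bool \<Rightarrow> nat \<Rightarrow> mon set" where
    "M s i = (if i = 0 then mons (n 0) else mons (n i) - {(n i, 0, 0)})" for s i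
  define A where "A = {sumpr {True} r (nform n M u :: _ \<Rightarrow> _ \<Rightarrow> _ \<Rightarrow> 'k) | u. sumpr {True} r (nform n M u) \<noteq> (\<lambda>_. 0)}"
  have M: "M s i \<subseteq> mons (n i)" for s i by (auto simp: M_def)
  have A: "A \<subseteq> pforms_set d"
    unfolding A_def d by (rule nform_pforms) (rule M)
  have "X \<subseteq> zclosure d A"
  proof
    fix H assume "H \<in> X"
    from X[OF this] obtain F where F: "\<And>s i. i < r \<Longrightarrow> is_form (n i) (F s i)" "H = sumpr {True} r F"
      "sumpr {True} r F \<noteq> (\<lambda>_. 0)" by blast
    show "H \<in> zclosure d A" unfolding F(2)
    proof (rule monic_dense[OF r d A _ F(1,3)])
      fix G :: "bool \<Rightarrow> nat \<Rightarrow> mon \<Rightarrow> 'k"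
      assume G: "\<And>s i. i < r \<Longrightarrow> is_form (n i) (G s i)"
        "\<And>s i. s \<in> {True} \<Longrightarrow> 1 \<le> i \<Longrightarrow> i < r \<Longrightarrow> G s i (n i, 0, 0) = 1" "sumpr {True} r G \<noteq> (\<lambda>_. 0)"
      have "sumpr {True} r G = sumpr {True} r (nform n M (\<lambda>(s, i, m). G s i m))"
      proof (rule sumpr_cong, rule ext)
        fix s i m assume si: "s \<in> {True}" "i < r"
        show "G s i m = nform n M (\<lambda>(s, i, m). G s i m) s i m"
          using is_form_outside[OF G(1)[OF si(2)], of m s] G(2)[OF si(1) _ si(2)] by (auto simp: nform_def M_def)
      qed
      thus "sumpr {True} r G \<in> A" using G(3) unfolding A_def by auto
    qed
  qed
  from pdim_nform[OF r d M this[unfolded A_def]] show ?thesis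
    using sum_card_free[OF r, of n] by (simp add: M_def)
qed

text \<open>A sum \<open>F\<^sub>0F' + G\<^sub>0G'\<close> does not change if a multiple \<open>AG'\<close> is subtracted from \<open>F\<^sub>0\<close>
  and \<open>AF'\<close> is added to \<open>G\<^sub>0\<close>. If \<open>G'\<close> is monic of degree \<open>s\<close>, all monomials of \<open>F\<^sub>0\<close> divisible
  by \<open>x\<^sup>s\<close> can be removed in this way.\<close>

lemma pdim_sums_le:
  fixes X :: "(mon \<Rightarrow> 'k::alg_closed_field) set"
  assumes r: "r = Suc q" and d: "d = (\<Sum>i<r. n i)" and s0: "s0 = (\<Sum>i<q. n (Suc i))" "s0 \<le> n 0"
    and X: "\<And>H. H \<in> X \<Longrightarrow> \<exists>F. (\<forall>s. \<forall>i<r. is_form (n i) (F s i)) \<and> H = sumpr UNIV r F \<and> H \<noteq> (\<lambda>_. 0)"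
  shows "pdim d X \<le> enat (2 * tdim r n - card (mons (n 0 - s0)) - 1)"
proof -
  \<comment> \<open>Only the first summand loses monomials; the zeroth factor of the second stays
    unrestricted and absorbs the correction.\<close>
  define M :: "bool \<Rightarrow> nat \<Rightarrow> mon set" where
    "M s i = (if i = 0 then {m \<in> mons (n 0). s \<longrightarrow> fst m < s0} else mons (n i) - {(n i, 0, 0)})" for s i
  define A where "A = {sumpr UNIV r (nform n M u :: _ \<Rightarrow> _ \<Rightarrow> _ \<Rightarrow> 'k) | u. sumpr UNIV r (nform n M u) \<noteq> (\<lambda>_. 0)}"
  have r0: "0 < r" using r by simp
  have M: "M s i \<subseteq> mons (n i)" for s i by (auto simp: M_def)
  have A: "A \<subseteq> pforms_set d"
    unfolding A_def d by (rule nform_pforms) (rule M)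
  have "X \<subseteq> zclosure d A"
  proof
    fix H assume "H \<in> X"
    from X[OF this] obtain F where F: "\<And>s i. i < r \<Longrightarrow> is_form (n i) (F s i)" "H = sumpr UNIV r F"
      "sumpr UNIV r F \<noteq> (\<lambda>_. 0)" by blast
    show "H \<in> zclosure d A" unfolding F(2)
    proof (rule monic_dense[OF r0 d A _ F(1,3)])
      fix G :: "bool \<Rightarrow> nat \<Rightarrow> mon \<Rightarrow> 'k"
      assume G: "\<And>s i. i < r \<Longrightarrow> is_form (n i) (G s i)"
        "\<And>s i. s \<in> UNIV \<Longrightarrow> 1 \<le> i \<Longrightarrow> i < r \<Longrightarrow> G s i (n i, 0, 0) = 1" "sumpr UNIV r G \<noteq> (\<lambda>_. 0)"
      define T where "T s = pr q (\<lambda>i. G s (Suc i))" for s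
      have T: "is_form s0 (T s)" for s unfolding T_def s0(1) by (rule pr_form) (use G(1) r in auto)
      have "T False (s0, 0, 0) = (\<Prod>i<q. G False (Suc i) (n (Suc i), 0, 0))"
        unfolding T_def s0(1) by (rule pr_lead) (use G(1) r in auto)
      also have "\<dots> = 1" by (rule prod.neutral) (use G(2) r in auto)
      finally have Tlead: "T False (s0, 0, 0) = 1" .
      obtain B where B: "is_form (n 0 - s0) B"
        "\<And>a b c. s0 \<le> a \<Longrightarrow> G True 0 (a, b, c) = fmul B (T False) (a, b, c)"
        using monic_division[OF G(1)[OF r0] T Tlead s0(2)] by blast
      have BT: "is_form (n 0) (fmul B (T s))" for s using is_form_fmul[OF B(1) T] s0(2) by simp
      define G' where "G' s i m = (if i = 0 then if s then G True 0 m - fmul B (T False) m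
        else G False 0 m + fmul B (T True) m else G s i m)" for s i m
      have G'0: "is_form (n 0) (G' s 0)" for s
        unfolding G'_def[abs_def] using is_form_diff[OF G(1)[OF r0] BT] is_form_add[OF G(1)[OF r0] BT] by (cases s) simp_all
      have G'S: "G' s (Suc i) = G s (Suc i)" for s i by (simp add: G'_def[abs_def])
      have G': "is_form (n i) (G' s i)" if "i < r" for s i
        using that G'0 G'S G(1) by (cases i) simp_all
      have sp: "sumpr UNIV r K = (\<lambda>m. fmul (K False 0) (pr q (\<lambda>i. K False (Suc i))) m + fmul (K True 0) (pr q (\<lambda>i. K True (Suc i))) m)"
        if "\<And>s i. i < r \<Longrightarrow> is_form (n i) (K s i)" for K :: "bool \<Rightarrow> nat \<Rightarrow> mon \<Rightarrow> 'k"
      proof -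
        have "pr r (K s) = fmul (K s 0) (pr q (\<lambda>i. K s (Suc i)))" for s
          unfolding r by (rule pr_Suc_shift[of q n]) (use that r in auto)
        thus ?thesis unfolding sumpr_def[abs_def] by (simp add: UNIV_bool)
      qed
      have dd: "d = n 0 + s0" unfolding d r s0(1) by (rule sum.lessThan_Suc_shift)
      have e: "sumpr UNIV r G' = sumpr UNIV r G"
      proof (rule ev_inj)
        show "is_form d (sumpr UNIV r G')" "is_form d (sumpr UNIV r G)"
          unfolding d by (rule sumpr_form, rule G', assumption)+ (rule sumpr_form, rule G(1), assumption)
        fix p
        have 1: "ev (n 0) (G' False 0) p = ev (n 0) (G False 0) p + ev (n 0 - s0) B p * ev s0 (T True) p"
          using ev_fmul[OF B(1) T[of True], of p] s0(2) by (simp add: G'_def[abs_def] ev_add)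
        have 2: "ev (n 0) (G' True 0) p = ev (n 0) (G True 0) p - ev (n 0 - s0) B p * ev s0 (T False) p"
          using ev_fmul[OF B(1) T[of False], of p] s0(2) by (simp add: G'_def[abs_def] ev_diff)
        have s1: "sumpr UNIV r G' = (\<lambda>m. fmul (G' False 0) (pr q (\<lambda>i. G' False (Suc i))) m + fmul (G' True 0) (pr q (\<lambda>i. G' True (Suc i))) m)"
          by (rule sp) (rule G')
        have s2: "sumpr UNIV r G = (\<lambda>m. fmul (G False 0) (pr q (\<lambda>i. G False (Suc i))) m + fmul (G True 0) (pr q (\<lambda>i. G True (Suc i))) m)"
          by (rule sp) (rule G(1))
        show "ev d (sumpr UNIV r G') p = ev d (sumpr UNIV r G) p"
          unfolding s1 s2 G'S T_def[symmetric] dd ev_add ev_fmul[OF G'0 T] ev_fmul[OF G(1)[OF r0] T] 1 2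
          by (simp add: algebra_simps)
      qed
      have "sumpr UNIV r G = sumpr UNIV r (nform n M (\<lambda>(s, i, m). G' s i m))"
        unfolding e[symmetric]
      proof (rule sumpr_cong, rule ext)
        fix s i and m :: mon assume si: "i < r"
        obtain a b c where m: "m = (a, b, c)" by (cases m) auto
        have out: "m \<notin> mons (n i) \<Longrightarrow> G' s i m = 0" using is_form_outside[OF G'[OF si]] by blast
        show "G' s i m = nform n M (\<lambda>(s, i, m). G' s i m) s i m"
        proof (cases "i = 0")
          case True
          have "G' True 0 m = 0" if "\<not> fst m < s0" using B(2)[of a b c] that m by (simp add: G'_def)
          thus ?thesis using out True by (cases s) (auto simp: nform_def M_def)
        next
          case False
          have "G' s i (n i, 0, 0) = 1" using G(2)[of s i] si False by (simp add: G'_def)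
          thus ?thesis using out False by (auto simp: nform_def M_def)
        qed
      qed
      thus "sumpr UNIV r G \<in> A" using G(3) unfolding A_def by auto
    qed
  qed
  from pdim_nform[OF r0 d M this[unfolded A_def]]
  have "pdim d X \<le> enat ((\<Sum>i<r. card (M False i)) + (\<Sum>i<r. card (M True i)) - 1)" by (simp add: UNIV_bool)
  moreover have F: "(\<Sum>i<r. card (M False i)) = tdim r n"
    unfolding sum_card_free[OF r0, of n, symmetric] by (rule sum.cong) (auto simp: M_def)
  moreover have "(\<Sum>i<r. card (M True i)) + card (mons (n 0 - s0)) = (\<Sum>i<r. card (M False i))"
  proof -
    \<comment> \<open>The removed monomials are those of degree \<open>n 0 - s0\<close>, shifted by
      the \<open>s0\<close>-th power of the first variable; their number is the saving.\<close>
    have sh: "bij_betw (\<lambda>(a, b, c). (a + s0, b, c)) (mons (n 0 - s0)) {m \<in> mons (n 0). s0 \<le> fst m}"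
      using s0(2) by (intro bij_betwI[where g = "\<lambda>(a, b, c). (a - s0, b, c)"]) auto
    have "mons (n 0) = M True 0 \<union> {m \<in> mons (n 0). s0 \<le> fst m}" by (auto simp: M_def)
    hence "card (mons (n 0)) = card (M True 0 \<union> {m \<in> mons (n 0). s0 \<le> fst m})" by simp
    also have "\<dots> = card (M True 0) + card {m \<in> mons (n 0). s0 \<le> fst m}"
      by (rule card_Un_disjoint) (auto simp: M_def)
    also have "card {m \<in> mons (n 0). s0 \<le> fst m} = card (mons (n 0 - s0))" using bij_betw_same_card[OF sh] by simp
    finally have "card (M True 0) + card (mons (n 0 - s0)) = card (M False 0)" by (simp add: M_def)
    moreover have "(\<Sum>i<q. card (M True (Suc i))) = (\<Sum>i<q. card (M False (Suc i)))" by (simp add: M_def)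
    ultimately show ?thesis unfolding r sum.lessThan_Suc_shift by simp
  qed
  moreover have "a + b - 1 = 2 * t - k - 1" if "a = t" "b + k = a" for a b k t :: nat using that by simp
  ultimately show ?thesis by metis
qed

subsection \<open>The varieties of the theorem\<close>

lemma Xlam_iff:
  fixes H :: "mon \<Rightarrow> 'k::alg_closed_field"
  shows "H \<in> Xlam TYPE('k) ds \<longleftrightarrow>
    (\<exists>F. (\<forall>i<length ds. is_form (ds ! i) (F i)) \<and> H = pr (length ds) F \<and> H \<noteq> (\<lambda>_. 0))"
proof
  assume "H \<in> Xlam TYPE('k) ds"
  then obtain Fs where Fs: "length Fs = length ds" "\<And>i. i < length ds \<Longrightarrow> is_form (ds ! i) (Fs ! i)"
    "\<And>i. i < length ds \<Longrightarrow> Fs ! i \<noteq> (\<lambda>_. 0)" "H = fprod Fs" unfolding Xlam_def by blast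
  have "H = pr (length ds) (\<lambda>i. Fs ! i)" using fprod_pr[of Fs "(!) ds"] Fs by simp
  thus "\<exists>F. (\<forall>i<length ds. is_form (ds ! i) (F i)) \<and> H = pr (length ds) F \<and> H \<noteq> (\<lambda>_. 0)"
    using pr_nonzero_iff[of "length ds" "(!) ds" "(!) Fs"] Fs(2,3) by (intro exI[of _ "(!) Fs"]) simp
next
  assume "\<exists>F. (\<forall>i<length ds. is_form (ds ! i) (F i)) \<and> H = pr (length ds) F \<and> H \<noteq> (\<lambda>_. 0)"
  then obtain F where F: "\<And>i. i < length ds \<Longrightarrow> is_form (ds ! i) (F i)" "H = pr (length ds) F" "H \<noteq> (\<lambda>_. 0)"
    by blast
  define Fs where "Fs = map F [0..<length ds]"
  have Fs: "length Fs = length ds" "\<And>i. i < length ds \<Longrightarrow> Fs ! i = F i" by (simp_all add: Fs_def)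
  have "fprod Fs = pr (length ds) (\<lambda>i. Fs ! i)" using fprod_pr[of Fs "(!) ds"] Fs F(1) by simp
  also have "\<dots> = H" unfolding F(2) by (rule pr_cong) (rule Fs(2))
  finally have "H = fprod Fs" by simp
  moreover have "F i \<noteq> (\<lambda>_. 0)" if "i < length ds" for i
    using pr_nonzero_iff[of "length ds" "(!) ds" F] F that by simp
  ultimately show "H \<in> Xlam TYPE('k) ds" unfolding Xlam_def using Fs F(1) by (auto intro!: exI[of _ Fs])
qed

context
  fixes ds :: "nat list" and X :: "(mon \<Rightarrow> 'k::alg_closed_field) set" and r :: nat and n :: "nat \<Rightarrow> nat"
  defines "X \<equiv> Xlam TYPE('k) ds" and "r \<equiv> length ds" and "n \<equiv> \<lambda>i. ds ! i"
  assumes r2: "2 \<le> length ds" and pos: "\<forall>x\<in>set ds. 1 \<le> x"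
begin

lemma r_pos: "0 < r" using r2 unfolding r_def by linarith

lemma n_pos: "i < r \<Longrightarrow> 1 \<le> n i" using pos by (simp add: r_def n_def)

lemma sum_list_n: "sum_list ds = (\<Sum>i<r. n i)"
  by (simp add: r_def n_def sum_list_sum_nth atLeast0LessThan)

lemma degree_pos: "1 \<le> (\<Sum>i<r. n i)"
  using member_le_sum[of 0 "{..<r}" n] r_pos n_pos[OF r_pos] by simp

lemma X_iff: "H \<in> X \<longleftrightarrow> (\<exists>F. (\<forall>i<r. is_form (n i) (F i)) \<and> H = pr r F \<and> H \<noteq> (\<lambda>_. 0))"
  unfolding X_def r_def n_def by (rule Xlam_iff)

lemma X_pforms: "X \<subseteq> pforms_set (\<Sum>i<r. n i)"
proof
  fix H assume "H \<in> X"
  then obtain F where F: "\<forall>i<r. is_form (n i) (F i)" "H = pr r F" "H \<noteq> (\<lambda>_. 0)" using X_iff by blast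
  have "is_form (\<Sum>i<r. n i) (pr r F)" by (rule pr_form) (use F(1) in blast)
  thus "H \<in> pforms_set (\<Sum>i<r. n i)" using F(2,3) by (simp add: pforms_set_def)
qed

lemma X_scale:
  assumes "H \<in> X" "c \<noteq> 0"
  shows "(\<lambda>m. c * H m) \<in> X"
proof -
  obtain F where F: "\<And>i. i < r \<Longrightarrow> is_form (n i) (F i)" "H = pr r F" "H \<noteq> (\<lambda>_. 0)" using assms(1) X_iff by blast
  have "pr r (\<lambda>i m. (if i = 0 then c else 1) * F i m) = (\<lambda>m. c * H m)"
    unfolding pr_scale F(2) using r_pos by (simp add: prod.delta)
  moreover have "(\<lambda>m. c * H m) \<noteq> (\<lambda>_. 0)" using F(3) assms(2) by (auto simp: fun_eq_iff)
  moreover have "\<forall>i<r. is_form (n i) (\<lambda>m. (if i = 0 then c else 1) * F i m)"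
    using F(1) by (intro allI impI is_form_scale)
  ultimately show ?thesis unfolding X_iff
    by (intro exI[of _ "\<lambda>i m. (if i = 0 then c else 1) * F i m"]) simp
qed

text \<open>Pure powers of the first and of the second variable lie in \<open>X\<close>, and one of
  them is not a multiple of \<open>F\<close>. Secant lines join distinct points, so this is what
  puts every point of \<open>X\<close> on one.\<close>

lemma X_nonproportional:
  assumes "F \<in> X"
  shows "\<exists>G\<in>X. \<not> (\<exists>c. G = (\<lambda>m. c * F m))"
proof -
  let ?d = "\<Sum>i<r. n i"
  define P :: "bool \<Rightarrow> nat \<Rightarrow> mon \<Rightarrow> 'k" where
    "P s i m = (if m = (if s then (n i, 0, 0) else (0, n i, 0)) then 1 else 0)" for s i m
  have P: "is_form (n i) (P s i)" for s i by (auto simp: is_form_def P_def mdeg_def)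
  have "P s i \<noteq> (\<lambda>_. 0)" for s i
  proof -
    have "P s i (if s then (n i, 0, 0) else (0, n i, 0)) \<noteq> 0" by (simp add: P_def)
    thus ?thesis by metis
  qed
  hence nz: "pr r (P s) \<noteq> (\<lambda>_. 0)" for s using pr_nonzero_iff[of r n "P s"] P by simp
  have PX: "pr r (P s) \<in> X" for s unfolding X_iff using P nz by blast
  have lead: "pr r (P s) (?d, 0, 0) = (if s then 1 else 0)" for s
  proof -
    have "pr r (P s) (?d, 0, 0) = (\<Prod>i<r. P s i (n i, 0, 0))" by (rule pr_lead) (rule P)
    also have "\<dots> = (if s then 1 else 0)"
      using r_pos n_pos[OF r_pos] by (auto simp: P_def intro!: prod_zero bexI[of _ 0])
    finally show ?thesis .
  qed
  show ?thesis
  proof (cases "F (?d, 0, 0) = 0")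
    case True
    have "\<not> (\<exists>c. pr r (P True) = (\<lambda>m. c * F m))"
    proof
      assume "\<exists>c. pr r (P True) = (\<lambda>m. c * F m)"
      then obtain c where "pr r (P True) = (\<lambda>m. c * F m)" ..
      from fun_cong[OF this, of "(?d, 0, 0)"] show False unfolding lead using True by simp
    qed
    thus ?thesis using PX by blast
  next
    case False
    have "\<not> (\<exists>c. pr r (P False) = (\<lambda>m. c * F m))"
    proof
      assume "\<exists>c. pr r (P False) = (\<lambda>m. c * F m)"
      then obtain c where c: "pr r (P False) = (\<lambda>m. c * F m)" ..
      from fun_cong[OF this, of "(?d, 0, 0)"] have "c = 0" unfolding lead using False by simp
      thus False using c nz[of False] by simp
    qed
    thus ?thesis using PX by blast
  qed
qed

lemma X_secant:
  assumes "F \<in> X"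
  shows "F \<in> secant_lines d X"
proof -
  obtain G where "G \<in> X" "\<not> (\<exists>c. G = (\<lambda>m. c * F m))" using X_nonproportional[OF assms] by blast
  thus ?thesis unfolding secant_lines_def using assms
    by (intro CollectI exI[of _ F] exI[of _ G] exI[of _ 1] exI[of _ 0]) simp
qed

text \<open>If one product is zero or the two are proportional, the sum is a point of
  \<open>X\<close> and \<open>X_secant\<close> applies; otherwise it lies on the line joining the
  two products.\<close>

lemma sumpr_secant:
  assumes F: "\<And>s i. i < r \<Longrightarrow> is_form (n i) (F s i)" and nz: "sumpr UNIV r F \<noteq> (\<lambda>_. 0)"
  shows "sumpr UNIV r F \<in> secant_lines d X"
proof -
  define P where "P s = pr r (F s)" for s
  have s: "sumpr UNIV r F = (\<lambda>m. P True m + P False m)"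
    by (auto simp: sumpr_def UNIV_bool P_def add.commute)
  have PX: "P s \<in> X" if "P s \<noteq> (\<lambda>_. 0)" for s using that F unfolding X_iff P_def by blast
  show ?thesis
  proof (cases "P True = (\<lambda>_. 0)")
    case True
    hence e: "sumpr UNIV r F = P False" using s by simp
    show ?thesis unfolding e by (rule X_secant, rule PX) (use nz e in simp)
  next
    case T: False
    show ?thesis
    proof (cases "\<exists>c. P False = (\<lambda>m. c * P True m)")
      case True
      then obtain c where c: "P False = (\<lambda>m. c * P True m)" ..
      have e: "sumpr UNIV r F = (\<lambda>m. (1 + c) * P True m)" unfolding s c by (simp add: algebra_simps)
      have "1 + c \<noteq> 0" using nz unfolding e by (intro notI) simp
      thus ?thesis unfolding e by (intro X_secant X_scale PX T)
    next
      case False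
      hence "P False \<noteq> (\<lambda>_. 0)" by (intro notI) (simp, metis mult_zero_left)
      thus ?thesis using PX[OF T] PX[of False] False unfolding s secant_lines_def
        by (intro CollectI exI[of _ "P True"] exI[of _ "P False"] exI[of _ 1]) simp
    qed
  qed
qed

lemma secant_sumpr:
  assumes "H \<in> secant_lines d X"
  shows "\<exists>F. (\<forall>s. \<forall>i<r. is_form (n i) (F s i)) \<and> H = sumpr UNIV r F \<and> H \<noteq> (\<lambda>_. 0)"
proof -
  obtain P Q a b where PQ: "P \<in> X" "Q \<in> X" "\<not> (\<exists>c. Q = (\<lambda>m. c * P m))" "a \<noteq> 0 \<or> b \<noteq> 0"
    "H = (\<lambda>m. a * P m + b * Q m)" using assms unfolding secant_lines_def by auto
  obtain F G where F: "\<And>i. i < r \<Longrightarrow> is_form (n i) (F i)" "P = pr r F" "P \<noteq> (\<lambda>_. 0)"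
    and G: "\<And>i. i < r \<Longrightarrow> is_form (n i) (G i)" "Q = pr r G" using PQ(1,2) X_iff by metis
  define K where "K s i m = (if i = 0 then if s then a else b else 1) * (if s then F i m else G i m)" for s i m
  have K: "is_form (n i) (K s i)" if "i < r" for s i
    unfolding K_def[abs_def] using F(1)[OF that] G(1)[OF that] by (intro is_form_scale) (cases s; simp)
  have "pr r (K s) = (\<lambda>m. (if s then a else b) * (if s then P m else Q m))" for s
    unfolding K_def[abs_def] pr_scale F(2) G(2) using r_pos by (cases s) (simp_all add: prod.delta)
  hence "H = sumpr UNIV r K" unfolding PQ(5) sumpr_def[abs_def] by (simp add: UNIV_bool add.commute)
  moreover have "H \<noteq> (\<lambda>_. 0)"
  proof
    assume z: "H = (\<lambda>_. 0)"
    hence z': "a * P m + b * Q m = 0" for m using PQ(5) by metis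
    show False
    proof (cases "b = 0")
      case True
      hence "P m = 0" for m using z'[of m] PQ(4) by simp
      thus False using F(3) by blast
    next
      case False
      have "Q m = (- a / b) * P m" for m using z'[of m] False by (simp add: field_simps eq_neg_iff_add_eq_0)
      thus False using PQ(3) by blast
    qed
  qed
  ultimately show ?thesis using K by (intro exI[of _ K]) simp
qed

lemma secant_pforms: "secant_lines d X \<subseteq> pforms_set (\<Sum>i<r. n i)"
proof
  fix H assume "H \<in> secant_lines d X"
  from secant_sumpr[OF this] show "H \<in> pforms_set (\<Sum>i<r. n i)"
    unfolding pforms_set_def using sumpr_form[of r n] by blast
qed

lemma pdim_X: "pdim (\<Sum>i<r. n i) X = enat (tdim r n - 1)"
proof (rule antisym)
  have sp: "sumpr {True} r F = pr r (F True)" for F :: "bool \<Rightarrow> nat \<Rightarrow> mon \<Rightarrow> 'k"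
    by (simp add: sumpr_def[abs_def])
  show "pdim (\<Sum>i<r. n i) X \<le> enat (tdim r n - 1)"
  proof (rule pdim_products_le[OF r_pos refl])
    fix H assume "H \<in> X"
    then obtain F where "\<forall>i<r. is_form (n i) (F i)" "H = pr r F" "H \<noteq> (\<lambda>_. 0)" using X_iff by blast
    thus "\<exists>F. (\<forall>s. \<forall>i<r. is_form (n i) (F s i)) \<and> H = sumpr {True} r F \<and> H \<noteq> (\<lambda>_. 0)"
      by (intro exI[of _ "\<lambda>_. F"]) (simp add: sp)
  qed
  have "1 \<le> r" using r_pos by simp
  from rank_single[OF this]
  show "enat (tdim r n - 1) \<le> pdim (\<Sum>i<r. n i) X"
  proof (rule pdim_lower[OF _ _ refl degree_pos _ X_pforms])
    show "1 \<le> tdim r n" by (simp add: tdim_def)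
    fix F :: "bool \<Rightarrow> nat \<Rightarrow> mon \<Rightarrow> 'k"
    assume "\<And>s i. i < r \<Longrightarrow> is_form (n i) (F s i)" "sumpr {True} r F \<noteq> (\<lambda>_. 0)"
    thus "sumpr {True} r F \<in> X" unfolding X_iff sp by blast
  qed simp
qed

lemma zclosure_sigma2: "zclosure (\<Sum>i<r. n i) (secant_lines (\<Sum>i<r. n i) X) \<subseteq> pforms_set (\<Sum>i<r. n i)"
  by (rule zclosed_pforms[OF zclosed_zclosure[OF secant_pforms]])

lemma pdim_sigma2_ge:
  assumes "rank_ge TYPE('k) UNIV r n N" "1 \<le> N"
  shows "enat (N - 1) \<le> pdim (\<Sum>i<r. n i) (sigma2 (\<Sum>i<r. n i) X)"
  unfolding sigma2_def
proof (rule pdim_lower[OF assms(1) _ refl degree_pos assms(2) zclosure_sigma2])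
  fix F :: "bool \<Rightarrow> nat \<Rightarrow> mon \<Rightarrow> 'k"
  assume F: "\<And>s i. i < r \<Longrightarrow> is_form (n i) (F s i)" "sumpr UNIV r F \<noteq> (\<lambda>_. 0)"
  show "sumpr UNIV r F \<in> zclosure (\<Sum>i<r. n i) (secant_lines (\<Sum>i<r. n i) X)"
    using sumpr_secant[OF F] zclosure_subset by blast
qed simp

lemma pdim_sigma2_le:
  assumes "(\<Sum>i\<in>{1..<r}. n i) \<le> n 0"
  shows "pdim (\<Sum>i<r. n i) (sigma2 (\<Sum>i<r. n i) X)
    \<le> enat (2 * tdim r n - card (mons (n 0 - (\<Sum>i\<in>{1..<r}. n i))) - 1)"
proof -
  let ?d = "\<Sum>i<r. n i"
  obtain q where q: "r = Suc q" using r_pos by (cases r) auto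
  have s: "(\<Sum>i\<in>{1..<r}. n i) = (\<Sum>i<q. n (Suc i))"
    unfolding q using sum.shift_bounds_Suc_ivl[of n 0 q] by (simp add: atLeast0LessThan)
  have "zclosure ?d (zclosure ?d (secant_lines ?d X)) \<subseteq> zclosure ?d (secant_lines ?d X)"
    by (rule zclosure_minimal[OF zclosed_zclosure[OF secant_pforms] subset_refl])
  moreover have "zclosure ?d (secant_lines ?d X) \<subseteq> zclosure ?d (zclosure ?d (secant_lines ?d X))"
    by (rule zclosure_subset)
  ultimately have e: "zclosure ?d (zclosure ?d (secant_lines ?d X)) = zclosure ?d (secant_lines ?d X)"
    by (rule subset_antisym)
  have "pdim ?d (sigma2 ?d X) = pdim ?d (secant_lines ?d X)" unfolding sigma2_def pdim_def e ..
  also have "\<dots> \<le> enat (2 * tdim r n - card (mons (n 0 - (\<Sum>i\<in>{1..<r}. n i))) - 1)"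
    by (rule pdim_sums_le[OF q refl s assms secant_sumpr])
  finally show ?thesis .
qed

end

text \<open>Expresses \<open>p\<close> through the sum and the sum of squares of the smaller
  degrees, the quantities in which \<open>fillable\<close> is stated.\<close>

lemma two_sum_pairs:
  fixes f :: "nat \<Rightarrow> int"
  shows "2 * (\<Sum>(i, j)\<in>{(i, j). 1 \<le> i \<and> i < j \<and> j < r}. f i * f j) = (\<Sum>i\<in>{1..<r}. f i)\<^sup>2 - (\<Sum>i\<in>{1..<r}. (f i)\<^sup>2)"
proof (induction r)
  case 0
  have "{(i, j). 1 \<le> i \<and> i < j \<and> j < (0::nat)} = {}" by auto
  thus ?case by (simp only: sum.empty) simp
next
  case (Suc r)
  let ?P = "\<lambda>r. {(i, j). 1 \<le> i \<and> i < j \<and> j < (r::nat)}"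
  have u: "?P (Suc r) = ?P r \<union> (\<lambda>i. (i, r)) ` {1..<r}" by auto
  have fin: "finite (?P r)" by (rule finite_subset[of _ "{..<r} \<times> {..<r}"]) auto
  have "(\<Sum>(i, j)\<in>?P (Suc r). f i * f j) = (\<Sum>(i, j)\<in>?P r. f i * f j) + (\<Sum>(i, j)\<in>(\<lambda>i. (i, r)) ` {1..<r}. f i * f j)"
    unfolding u by (rule sum.union_disjoint[OF fin]) auto
  also have "(\<Sum>(i, j)\<in>(\<lambda>i. (i, r)) ` {1..<r}. f i * f j) = (\<Sum>i\<in>{1..<r}. f i) * f r"
    by (subst sum.reindex) (auto simp: inj_on_def sum_distrib_right)
  finally have e: "(\<Sum>(i, j)\<in>?P (Suc r). f i * f j) = (\<Sum>(i, j)\<in>?P r. f i * f j) + (\<Sum>i\<in>{1..<r}. f i) * f r" .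
  show ?case
  proof (cases "r = 0")
    case True
    thus ?thesis unfolding e using Suc by simp
  next
    case False
    hence I: "{1..<Suc r} = insert r {1..<r}" by auto
    show ?thesis unfolding e I using Suc by (simp add: power2_sum distrib_left)
  qed
qed

theorem theorem3p1:
  fixes ds :: "nat list"
  assumes "length ds \<ge> 2"
    and "sorted (rev ds)"
    and "\<forall>x\<in>set ds. x \<ge> 1"
  shows "sigma2_defective TYPE('k::alg_closed_field) ds \<longleftrightarrow>
           (let r = length ds;
                s = (\<Sum>i\<in>{1..<r}. ds ! i);
                p = (\<Sum>(i, j)\<in>{(i, j). 1 \<le> i \<and> i < j \<and> j < r}. ds ! i * ds ! j)
            in ds ! 0 \<ge> s \<and> (2 * int p - 3 * int s > 0))"
proof -
  define r where "r = length ds"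
  define n where "n i = ds ! i" for i
  define s where "s = (\<Sum>i\<in>{1..<r}. n i)"
  define p where "p = (\<Sum>(i, j)\<in>{(i, j). 1 \<le> i \<and> i < j \<and> j < r}. n i * n j)"
  define d where "d = (\<Sum>i<r. n i)"
  define t where "t = tdim r n"
  define v where "v = card (mons d)"
  define q where "q = (\<Sum>i\<in>{1..<r}. (int (n i))\<^sup>2)"
  define P where "P = pdim d (sigma2 d (Xlam TYPE('k) ds))"
  have n: "n = (\<lambda>i. ds ! i)" by (simp add: n_def fun_eq_iff)
  note ctx = assms(1,3)
  have r1: "1 \<le> r" using assms(1) by (simp add: r_def)
  have I: "{..<r} = insert 0 {1..<r}" using r1 by auto
  have d_int: "int d = int (n 0) + int s" unfolding d_def s_def I by simp
  have sum_n: "(\<Sum>i<r. int (n i)) = int d" by (simp add: d_def)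
  have sum_n2: "(\<Sum>i<r. (int (n i))\<^sup>2) = (int (n 0))\<^sup>2 + q" unfolding q_def I by simp
  have p2: "2 * int p = (int s)\<^sup>2 - q"
    using two_sum_pairs[of "\<lambda>i. int (n i)" r] unfolding p_def s_def q_def
    by (simp add: case_prod_beta)
  have n_le: "n i \<le> n 0" if "i < r" for i
    using that assms(2) sorted_rev_nth_mono[of ds 0 i] by (simp add: n_def r_def)
  have t1: "1 \<le> t" by (simp add: t_def tdim_def)
  have dX: "pdim d (Xlam TYPE('k) ds) = enat (t - 1)"
    unfolding d_def t_def n r_def by (rule pdim_X[OF ctx])
  have le: "sum_list ds = d"
    unfolding d_def n r_def by (rule sum_list_n[OF ctx])
  have def_iff: "sigma2_defective TYPE('k) ds \<longleftrightarrow> P < min (enat (v - 1)) (enat (2 * t - 1))"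
  proof -
    have "2 * enat (t - 1) + 1 = enat (2 * t - 1)"
      using t1 by (simp add: numeral_eq_enat one_enat_def)
    thus ?thesis unfolding sigma2_defective_def Let_def le dX P_def v_def card_mons by simp
  qed
  have t2: "2 * int t = 2 + (int (n 0))\<^sup>2 + q + 3 * int d" unfolding t_def two_tdim sum_n sum_n2 by simp
  have v2: "2 * int v = (int d + 1) * (int d + 2)" unfolding v_def by (rule two_card_mons)
  have v_ge: "2 \<le> v"
  proof -
    have "1 \<le> d" unfolding d_def n r_def by (rule degree_pos[OF ctx])
    hence "2 * 3 \<le> (int d + 1) * (int d + 2)" by (intro mult_mono) auto
    thus ?thesis using v2 by simp
  qed
  have "P < min (enat (v - 1)) (enat (2 * t - 1)) \<longleftrightarrow> s \<le> n 0 \<and> 2 * int p - 3 * int s > 0"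
  proof (cases "s \<le> n 0 \<and> 2 * int p - 3 * int s > 0")
    case True
    define K where "K = card (mons (n 0 - s))"
    have K2: "2 * int K = (int (n 0) - int s + 1) * (int (n 0) - int s + 2)"
      unfolding K_def two_card_mons using True by (simp add: of_nat_diff)
    have K1: "1 \<le> K" by (simp add: K_def card_mons Suc_le_eq)
    have "P \<le> enat (2 * t - K - 1)"
      using pdim_sigma2_le[OF ctx, where 'k = 'k] True unfolding P_def d_def t_def K_def s_def n r_def by simp
    \<comment> \<open>The origin of the criterion: the number of parameters left after the
      reduction, minus the dimension of the ambient space.\<close>
    moreover have "2 * int t - int K - int v = 3 * int s - 2 * int p"
      using t2 v2 K2 p2 unfolding d_int by (simp add: algebra_simps power2_eq_square)
    hence "2 * int t < int K + int v" using True by linarith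
    hence "2 * t - K - 1 < v - 1" using v_ge by linarith
    moreover have "2 * t - K - 1 < 2 * t - 1" using K1 t1 by linarith
    ultimately have "P < min (enat (v - 1)) (enat (2 * t - 1))" by (auto intro: le_less_trans)
    thus ?thesis using True by simp
  next
    case False
    have "rank_ge TYPE('k) UNIV r n v \<or> rank_ge TYPE('k) UNIV r n (2 * t)"
    proof (cases "s \<le> n 0")
      case True
      hence neg: "2 * int p \<le> 3 * int s" using False by simp
      have "fillable r n" unfolding fillable_def Let_def sum_n sum_n2
      proof (intro conjI allI impI)
        have "2 * ((int (n 0))\<^sup>2 + q) - (int d)\<^sup>2 + 3 * int d + 2
          = (int (n 0) - int s)\<^sup>2 + 3 * (int (n 0) - int s) + 2 * (3 * int s - 2 * int p) + 2"
          unfolding d_int p2 by (simp add: algebra_simps power2_eq_square)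
        also have "0 \<le> \<dots>" using True neg by (intro add_nonneg_nonneg mult_nonneg_nonneg) simp_all
        finally show "0 \<le> 2 * ((int (n 0))\<^sup>2 + q) - (int d)\<^sup>2 + 3 * int d + 2" .
        fix i assume i: "i < r" "int d \<le> 2 * int (n i)"
        have "n i = n 0"
        proof (rule ccontr)
          assume "n i \<noteq> n 0"
          hence lt: "n i < n 0" using n_le[OF i(1)] by simp
          have "i \<noteq> 0" using lt by (intro notI) simp
          hence "n i \<le> s" unfolding s_def using i(1) by (intro member_le_sum) auto
          thus False using i(2) lt unfolding d_int by linarith
        qed
        thus "0 \<le> 3 * (int d - int (n i)) - (int d - int (n i))\<^sup>2 + ((int (n 0))\<^sup>2 + q) - (int (n i))\<^sup>2"
          using neg p2 unfolding d_int by simp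
      qed
      from rank_fill[OF r1 this] show ?thesis unfolding v_def d_def by blast
    next
      case s: False
      \<comment> \<open>No block reaches half of the degree, so the block conditions in
        \<open>fillable\<close> are vacuous and the sign of the surplus alone decides which of the
        two targets is proved.\<close>
      have lt: "2 * int (n i) < (\<Sum>i<r. int (n i))" if "i < r" for i
        unfolding sum_n d_int using n_le[OF that] s by simp
      show ?thesis
      proof (cases "0 \<le> 2 * (\<Sum>i<r. (int (n i))\<^sup>2) - (\<Sum>i<r. int (n i))\<^sup>2 + 3 * (\<Sum>i<r. int (n i)) + 2")
        case True
        have "fillable r n" unfolding fillable_def Let_def using True lt by (auto simp: not_le[symmetric])
        from rank_fill[OF r1 this] show ?thesis unfolding v_def d_def by blast
      next
        case False
        show ?thesis using rank_inject[OF r1 _ lt, where 'k = 'k] False unfolding t_def by simp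
      qed
    qed
    then obtain N where N: "rank_ge TYPE('k) UNIV r n N" "min v (2 * t) \<le> N" by (meson min.cobounded1 min.cobounded2)
    have N1: "1 \<le> N" using N(2) v_ge t1 by linarith
    have "enat (N - 1) \<le> P"
      using pdim_sigma2_ge[OF ctx, where 'k = 'k] N(1) N1 unfolding P_def d_def n r_def by blast
    moreover have "min (enat (v - 1)) (enat (2 * t - 1)) \<le> enat (N - 1)" using N(2) unfolding min_le_iff_disj by auto
    ultimately show ?thesis using False by (metis leD order_trans)
  qed
  thus ?thesis unfolding def_iff Let_def s_def p_def n_def r_def .
qed

end
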